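(* Let $\mathcal T$ be a compactly generated triangulated category. A definable subcategory $\mathcal D$ of $\mathcal T$ may be specified by any of the following means; that is, a full subcategory $\mathcal D$ of $\mathcal T$ is definable if and only if it can be written in any one of the following forms: (a) $\mathcal D=\{X\in\mathcal T:\phi(X)/\psi(X)=0\ \ \forall\,\phi/\psi\in\Phi\}$ where $\Phi$ is a set of pp-pairs in the language of $\mathcal T$; (b) $\mathcal D=\mathrm{Ann}_{\mathcal T}(\mathcal A)$ where $\mathcal A\subseteq\mathrm{Coh}(\mathcal T)$; (c) $\mathcal D=\mathrm{Ann}_{\mathcal T}\Phi$ where $\Phi$ is a set of morphisms in $\mathcal T^{\rm c}$; (d) $\mathcal D=\mathrm{Div}_{\mathcal T}\Psi$ where $\Psi$ is a set of morphisms in $\mathcal T^{\rm c}$; (e) $\mathcal D=\Xi\text{-}\mathrm{TF}$ where $\Xi$ is a set of morphisms in $\mathcal T^{\rm c}$. The subcategories of $\mathrm{Coh}(\mathcal T)$ of the form $\mathrm{Ann}_{\mathrm{Coh}(\mathcal T)}(\mathcal D)$, with $\mathcal D$ definable, are exactly the Serre subcategories, and the classes of morphisms of $\mathcal T^{\rm c}$ of the form $\mathrm{Ann}_{\mathcal T^{\rm c}}(\mathcal D)$, with $\mathcal D$ definable, are exactly the annihilator (= cohomological) ideals. Moving between the specifications (c), (d), (e) is described as follows: if $\Sigma^{-1}C\xrightarrow{\Sigma^{-1}h}A\xrightarrow{f}B\xrightarrow{g}C\xrightarrow{h}\Sigma A$ is an extended distinguished triangle in $\mathcal T^{\rm c}$,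 then for every $X\in\mathcal T$ $$Xf=0\iff g\mid X\iff \mathrm{ann}_X(\Sigma^{-1}h)=0.$$
   Context: $\mathcal T$ is a triangulated category with shift $\Sigma$ and arbitrary coproducts. An object $A$ is compact if $\mathrm{Hom}(A,-)$ commutes with coproducts; $\mathcal T^{\rm c}$ is the full subcategory of compact objects. Compactly generated means that $\mathcal T^{\rm c}$ has only a set of isomorphism classes and that $\mathrm{Hom}(A,X)=0$ for all compact $A$ implies $X=0$. We write $(X,Y)=\mathrm{Hom}_{\mathcal T}(X,Y)$. A coherent functor on $\mathcal T$ is a functor $\mathcal T\to\mathbf{Ab}$ isomorphic to $F_f=\mathrm{coker}\big((f,-):(B,-)\to(A,-)\big)$ for some $f:A\to B$ in $\mathcal T^{\rm c}$; these form the abelian category $\mathrm{Coh}(\mathcal T)$. For $\mathcal A\subseteq\mathrm{Coh}(\mathcal T)$, $\mathrm{Ann}_{\mathcal T}(\mathcal A)=\{X\in\mathcal T: FX=0\ \forall F\in\mathcal A\}$. A full subcategory of $\mathcal T$ is definable if it has this form. For $\mathcal X\subseteq\mathcal T$, $\mathrm{Ann}_{\mathrm{Coh}(\mathcal T)}(\mathcal X)=\{F\in\mathrm{Coh}(\mathcal T): FX=0\ \forall X\in\mathcal X\}$. Language: there is one sort for each object $A$ of a small version of $\mathcal T^{\rm c}$; elements of $X\in\mathcal T$ of sort $A$ are morphisms $A\to X$. The language has addition and zero on each sort and, for each $f:A\to B$ in $\mathcal T^{\rm c}$, a function symbol interpreted as $b\in(B,X)\mapsto bf\in(A,X)$. A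 pp formula is a finite system of linear equations with some variables existentially quantified; $\phi(X)$ is its solution set in $X$. A pp-pair $\phi/\psi$ consists of pp formulas in the same free variables with $\psi(X)\le\phi(X)$ for all $X\in\mathcal T$. For $f:A\to B$ in $\mathcal T^{\rm c}$ and $X\in\mathcal T$: $Xf=0$ means $bf=0$ for every $b:B\to X$. For $g:B\to C$ in $\mathcal T^{\rm c}$: $g\mid X$ means that every $b:B\to X$ has the form $b=cg$ for some $c:C\to X$. For $\ell:D\to A$ in $\mathcal T^{\rm c}$: $\mathrm{ann}_X(\ell)=\{a:A\to X: a\ell=0\}$. For sets $\Phi,\Psi,\Xi$ of morphisms of $\mathcal T^{\rm c}$: $\mathrm{Ann}_{\mathcal T}\Phi=\{X: Xf=0\ \forall f\in\Phi\}$, $\mathrm{Div}_{\mathcal T}\Psi=\{X: g\mid X\ \forall g\in\Psi\}$, $\Xi\text{-}\mathrm{TF}=\{X:\mathrm{ann}_X(\ell)=0\ \forall\ell\in\Xi\}$. For $\mathcal X\subseteq\mathcal T$, $\mathrm{Ann}_{\mathcal T^{\rm c}}(\mathcal X)=\{f\text{ in }\mathcal T^{\rm c}: Xf=0\ \forall X\in\mathcal X\}$; the classes of morphisms of the form $\mathrm{Ann}_{\mathcal T^{\rm c}}(\mathcal X)$, for $\mathcal X$ an arbitrary subcategory of $\mathcal T$, are called annihilator (or cohomological) ideals of $\mathcal T^{\rm c}$. *)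

theory Defs
  imports "HOL-Algebra.Free_Abelian_Groups"
begin

unbundle cardinal_syntax

section \<open>Additive categories\<close>

record ('o, 'm) addcat =
  Ob :: "'o set"
  Mor :: "'m set"
  Dom :: "'m \<Rightarrow> 'o"
  Cod :: "'m \<Rightarrow> 'o"
  Id :: "'o \<Rightarrow> 'm"
  Comp :: "'m \<Rightarrow> 'm \<Rightarrow> 'm" (infixl \<open>\<cdot>\<index>\<close> 70)
  AddMor :: "'m \<Rightarrow> 'm \<Rightarrow> 'm"
  ZeroMor :: "'o \<Rightarrow> 'o \<Rightarrow> 'm"

definition Hom :: "('o, 'm, 'z) addcat_scheme \<Rightarrow> 'o \<Rightarrow> 'o \<Rightarrow> 'm set" where
  "Hom C A B = {f \<in> Mor C. Dom C f = A \<and> Cod C f = B}"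

definition hom_group :: "('o, 'm, 'z) addcat_scheme \<Rightarrow> 'o \<Rightarrow> 'o \<Rightarrow> 'm monoid" where
  "hom_group C A B = \<lparr>carrier = Hom C A B, mult = AddMor C, one = ZeroMor C A B\<rparr>"

definition NegMor :: "('o, 'm, 'z) addcat_scheme \<Rightarrow> 'm \<Rightarrow> 'm" where
  "NegMor C f = inv\<^bsub>hom_group C (Dom C f) (Cod C f)\<^esub> f"

definition zero_object :: "('o, 'm, 'z) addcat_scheme \<Rightarrow> 'o \<Rightarrow> bool" where
  "zero_object C Z \<longleftrightarrow> Z \<in> Ob C \<and>
     (\<forall>A \<in> Ob C. (\<exists>!f. f \<in> Hom C Z A) \<and> (\<exists>!f. f \<in> Hom C A Z))"

definition iso_mor :: "('o, 'm, 'z) addcat_scheme \<Rightarrow> 'o \<Rightarrow> 'o \<Rightarrow> 'm \<Rightarrow> bool" where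
  "iso_mor C A B f \<longleftrightarrow> f \<in> Hom C A B \<and>
     (\<exists>g \<in> Hom C B A. g \<cdot>\<^bsub>C\<^esub> f = Id C A \<and> f \<cdot>\<^bsub>C\<^esub> g = Id C B)"

definition isomorphic :: "('o, 'm, 'z) addcat_scheme \<Rightarrow> 'o \<Rightarrow> 'o \<Rightarrow> bool" where
  "isomorphic C A B \<longleftrightarrow> (\<exists>f. iso_mor C A B f)"

locale additive_category =
  fixes C :: "('o, 'm, 'z) addcat_scheme" (structure)
  assumes Dom_Ob: "f \<in> Mor C \<Longrightarrow> Dom C f \<in> Ob C"
    and Cod_Ob: "f \<in> Mor C \<Longrightarrow> Cod C f \<in> Ob C"
    and Id_Hom: "A \<in> Ob C \<Longrightarrow> Id C A \<in> Hom C A A"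
    and Comp_Hom: "\<lbrakk>f \<in> Hom C A B; g \<in> Hom C B D\<rbrakk> \<Longrightarrow> g \<cdot> f \<in> Hom C A D"
    and Comp_Id: "f \<in> Hom C A B \<Longrightarrow> f \<cdot> Id C A = f"
    and Id_Comp: "f \<in> Hom C A B \<Longrightarrow> Id C B \<cdot> f = f"
    and Comp_assoc: "\<lbrakk>f \<in> Hom C A B; g \<in> Hom C B D; h \<in> Hom C D E\<rbrakk>
          \<Longrightarrow> (h \<cdot> g) \<cdot> f = h \<cdot> (g \<cdot> f)"
    and hom_comm_group: "\<lbrakk>A \<in> Ob C; B \<in> Ob C\<rbrakk> \<Longrightarrow> comm_group (hom_group C A B)"
    and Comp_Add_left: "\<lbrakk>f \<in> Hom C A B; g \<in> Hom C B D; g' \<in> Hom C B D\<rbrakk>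
          \<Longrightarrow> AddMor C g g' \<cdot> f = AddMor C (g \<cdot> f) (g' \<cdot> f)"
    and Comp_Add_right: "\<lbrakk>f \<in> Hom C A B; f' \<in> Hom C A B; g \<in> Hom C B D\<rbrakk>
          \<Longrightarrow> g \<cdot> AddMor C f f' = AddMor C (g \<cdot> f) (g \<cdot> f')"
    and ex_zero_object: "\<exists>Z. zero_object C Z"
    and ex_biproduct: "\<lbrakk>A \<in> Ob C; B \<in> Ob C\<rbrakk> \<Longrightarrow>
          \<exists>P \<in> Ob C. \<exists>i \<in> Hom C A P. \<exists>j \<in> Hom C B P. \<exists>p \<in> Hom C P A. \<exists>q \<in> Hom C P B.
            p \<cdot> i = Id C A \<and> q \<cdot> j = Id C B \<and>
            p \<cdot> j = ZeroMor C B A \<and> q \<cdot> i = ZeroMor C A B \<and>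
            AddMor C (i \<cdot> p) (j \<cdot> q) = Id C P"

definition is_coproduct ::
  "('o, 'm, 'z) addcat_scheme \<Rightarrow> 'i set \<Rightarrow> ('i \<Rightarrow> 'o) \<Rightarrow> 'o \<Rightarrow> ('i \<Rightarrow> 'm) \<Rightarrow> bool" where
  "is_coproduct C I X P \<iota> \<longleftrightarrow> P \<in> Ob C \<and> (\<forall>i \<in> I. \<iota> i \<in> Hom C (X i) P) \<and>
     (\<forall>Y \<in> Ob C. \<forall>\<phi>. (\<forall>i \<in> I. \<phi> i \<in> Hom C (X i) Y) \<longrightarrow>
        (\<exists>!u. u \<in> Hom C P Y \<and> (\<forall>i \<in> I. u \<cdot>\<^bsub>C\<^esub> \<iota> i = \<phi> i)))"


section \<open>Triangulated categories\<close>

record ('o, 'm) tricat = "('o, 'm) addcat" +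
  ShOb :: "'o \<Rightarrow> 'o"
  ShMor :: "'m \<Rightarrow> 'm"
  Dist :: "('m \<times> 'm \<times> 'm) set"

definition triangle ::
  "('o, 'm, 'z) tricat_scheme \<Rightarrow> 'o \<Rightarrow> 'o \<Rightarrow> 'o \<Rightarrow> 'm \<Rightarrow> 'm \<Rightarrow> 'm \<Rightarrow> bool" where
  "triangle T A B C f g h \<longleftrightarrow>
     f \<in> Hom T A B \<and> g \<in> Hom T B C \<and> h \<in> Hom T C (ShOb T A)"

definition dist_triangle ::
  "('o, 'm, 'z) tricat_scheme \<Rightarrow> 'o \<Rightarrow> 'o \<Rightarrow> 'o \<Rightarrow> 'm \<Rightarrow> 'm \<Rightarrow> 'm \<Rightarrow> bool" where
  "dist_triangle T A B C f g h \<longleftrightarrow> triangle T A B C f g h \<and> (f, g, h) \<in> Dist T"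

text \<open>As in Verdier's definition, the shift is an automorphism of the category
  (not merely an autoequivalence), so that its inverse is a functor on the nose.\<close>

locale triangulated_category = additive_category T
  for T :: "('o, 'm, 'z) tricat_scheme" (structure) +
  assumes ShOb_bij: "bij_betw (ShOb T) (Ob T) (Ob T)"
    and ShMor_bij: "bij_betw (ShMor T) (Mor T) (Mor T)"
    and ShMor_Hom: "f \<in> Hom T A B \<Longrightarrow> ShMor T f \<in> Hom T (ShOb T A) (ShOb T B)"
    and ShMor_Id: "A \<in> Ob T \<Longrightarrow> ShMor T (Id T A) = Id T (ShOb T A)"
    and ShMor_Comp: "\<lbrakk>f \<in> Hom T A B; g \<in> Hom T B C\<rbrakk>
          \<Longrightarrow> ShMor T (g \<cdot> f) = ShMor T g \<cdot> ShMor T f"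
    and ShMor_Add: "\<lbrakk>f \<in> Hom T A B; f' \<in> Hom T A B\<rbrakk>
          \<Longrightarrow> ShMor T (AddMor T f f') = AddMor T (ShMor T f) (ShMor T f')"
    and Dist_triangle: "(f, g, h) \<in> Dist T \<Longrightarrow> \<exists>A B C. triangle T A B C f g h"
    and TR1_id: "\<lbrakk>A \<in> Ob T; zero_object T Z\<rbrakk>
          \<Longrightarrow> (Id T A, ZeroMor T A Z, ZeroMor T Z (ShOb T A)) \<in> Dist T"
    and TR1_iso: "\<lbrakk>dist_triangle T A B C f g h; triangle T A' B' C' f' g' h';
            iso_mor T A A' a; iso_mor T B B' b; iso_mor T C C' c;
            b \<cdot> f = f' \<cdot> a; c \<cdot> g = g' \<cdot> b; ShMor T a \<cdot> h = h' \<cdot> c\<rbrakk>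
          \<Longrightarrow> (f', g', h') \<in> Dist T"
    and TR1_cone: "f \<in> Hom T A B \<Longrightarrow> \<exists>C g h. dist_triangle T A B C f g h"
    and TR2: "triangle T A B C f g h
          \<Longrightarrow> (f, g, h) \<in> Dist T \<longleftrightarrow> (g, h, NegMor T (ShMor T f)) \<in> Dist T"
    and TR3: "\<lbrakk>dist_triangle T A B C f g h; dist_triangle T A' B' C' f' g' h';
            a \<in> Hom T A A'; b \<in> Hom T B B'; b \<cdot> f = f' \<cdot> a\<rbrakk>
          \<Longrightarrow> \<exists>c \<in> Hom T C C'. c \<cdot> g = g' \<cdot> b \<and> ShMor T a \<cdot> h = h' \<cdot> c"
    and TR4: "\<lbrakk>dist_triangle T A B C' f p q; dist_triangle T B C A' g r s;
            dist_triangle T A C B' (g \<cdot> f) t u\<rbrakk>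
          \<Longrightarrow> \<exists>j k. dist_triangle T C' B' A' j k (ShMor T p \<cdot> s) \<and>
                j \<cdot> p = t \<cdot> g \<and> u \<cdot> j = q \<and> k \<cdot> t = r \<and> s \<cdot> k = ShMor T f \<cdot> u"

definition ShInvMor :: "('o, 'm, 'z) tricat_scheme \<Rightarrow> 'm \<Rightarrow> 'm" where
  "ShInvMor T = the_inv_into (Mor T) (ShMor T)"


section \<open>Compact generation\<close>

text \<open>The distinction between sets and classes is expressed by a regular uncountable
  cardinal \<open>\<kappa>\<close>: a collection is small (``a set'') if its cardinality is less than \<open>\<kappa>\<close>.
  The usual set-theoretic reading is the case where \<open>\<kappa>\<close> is the cardinality of a universe.
  Since \<open>\<kappa>\<close> is a cardinal order on \<open>'u\<close>, every small family can be indexed by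
  a subset of \<open>'u\<close>.\<close>

definition universe_card :: "'u rel \<Rightarrow> bool" where
  "universe_card \<kappa> \<longleftrightarrow> Card_order \<kappa> \<and> natLeq <o \<kappa> \<and> regularCard \<kappa>"

definition small :: "'u rel \<Rightarrow> 'a set \<Rightarrow> bool" where
  "small \<kappa> A \<longleftrightarrow> |A| <o \<kappa>"

definition has_coproducts :: "'u rel \<Rightarrow> ('o, 'm, 'z) addcat_scheme \<Rightarrow> bool" where
  "has_coproducts \<kappa> C \<longleftrightarrow>
     (\<forall>(I :: 'u set) X. small \<kappa> I \<and> X \<in> I \<rightarrow> Ob C \<longrightarrow> (\<exists>P \<iota>. is_coproduct C I X P \<iota>))"

text \<open>\<open>Hom(A,-)\<close> commutes with coproducts: the canonical map from the direct sum of the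
  groups \<open>Hom(A, X i)\<close> to \<open>Hom(A, P)\<close> is an isomorphism. In \<open>gfinprod\<close> only the
  finitely many nonzero terms count.\<close>

definition compact_object :: "'u rel \<Rightarrow> ('o, 'm, 'z) addcat_scheme \<Rightarrow> 'o \<Rightarrow> bool" where
  "compact_object \<kappa> C A \<longleftrightarrow> A \<in> Ob C \<and>
     (\<forall>(I :: 'u set) X P \<iota>. small \<kappa> I \<and> X \<in> I \<rightarrow> Ob C \<and> is_coproduct C I X P \<iota> \<longrightarrow>
        (\<lambda>x. gfinprod (hom_group C A P) (\<lambda>i. \<iota> i \<cdot>\<^bsub>C\<^esub> x i) I)
          \<in> iso (sum_group I (\<lambda>i. hom_group C A (X i))) (hom_group C A P))"

definition cpt :: "'u rel \<Rightarrow> ('o, 'm, 'z) addcat_scheme \<Rightarrow> 'o set" where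
  "cpt \<kappa> C = {A. compact_object \<kappa> C A}"

definition cpt_mor :: "'u rel \<Rightarrow> ('o, 'm, 'z) addcat_scheme \<Rightarrow> 'm set" where
  "cpt_mor \<kappa> C = {f \<in> Mor C. Dom C f \<in> cpt \<kappa> C \<and> Cod C f \<in> cpt \<kappa> C}"

text \<open>Local smallness is only required of \<open>Hom(A,X)\<close> with \<open>A\<close> compact. If \<open>\<kappa>\<close> is the
  cardinality of a universe this is implied by local smallness of the whole category; for a
  general \<open>\<kappa>\<close> the latter would be too restrictive, as a nonzero category with small
  coproducts and small \<open>Hom\<close>-sets forces \<open>\<kappa>\<close> to be a strong limit.\<close>

locale compactly_generated = triangulated_category T
  for \<kappa> :: "'u rel" and T :: "('o, 'm, 'z) tricat_scheme" (structure) +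
  assumes universe: "universe_card \<kappa>"
    and hom_small: "\<lbrakk>A \<in> cpt \<kappa> T; X \<in> Ob T\<rbrakk> \<Longrightarrow> small \<kappa> (Hom T A X)"
    and coproducts: "has_coproducts \<kappa> T"
    and iso_classes_small:
      "small \<kappa> (cpt \<kappa> T // {(A, B). A \<in> cpt \<kappa> T \<and> B \<in> cpt \<kappa> T \<and> isomorphic T A B})"
    and generates: "\<lbrakk>X \<in> Ob T; \<And>A. A \<in> cpt \<kappa> T \<Longrightarrow> Hom T A X = {ZeroMor T A X}\<rbrakk>
      \<Longrightarrow> zero_object T X"

definition small_version :: "'u rel \<Rightarrow> ('o, 'm, 'z) addcat_scheme \<Rightarrow> 'o set \<Rightarrow> bool" where
  "small_version \<kappa> C S \<longleftrightarrow> S \<subseteq> cpt \<kappa> C \<and> small \<kappa> S \<and>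
     (\<forall>A \<in> cpt \<kappa> C. \<exists>B \<in> S. isomorphic C A B)"


section \<open>Coherent functors\<close>

record ('o, 'm, 'g) abfun =
  FOb :: "'o \<Rightarrow> 'g monoid"
  FMor :: "'m \<Rightarrow> 'g \<Rightarrow> 'g"

definition ab_functor :: "('o, 'm, 'z) addcat_scheme \<Rightarrow> ('o, 'm, 'g) abfun \<Rightarrow> bool" where
  "ab_functor C F \<longleftrightarrow>
     (\<forall>A \<in> Ob C. comm_group (FOb F A)) \<and>
     (\<forall>A B. \<forall>f \<in> Hom C A B. FMor F f \<in> hom (FOb F A) (FOb F B)) \<and>
     (\<forall>A \<in> Ob C. \<forall>x \<in> carrier (FOb F A). FMor F (Id C A) x = x) \<and>
     (\<forall>A B D. \<forall>f \<in> Hom C A B. \<forall>g \<in> Hom C B D. \<forall>x \<in> carrier (FOb F A).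
        FMor F (g \<cdot>\<^bsub>C\<^esub> f) x = FMor F g (FMor F f x))"

text \<open>Natural transformations are taken extensional, so that equality of natural
  transformations is equality in HOL.\<close>

definition nat_trans ::
  "('o, 'm, 'z) addcat_scheme \<Rightarrow> ('o, 'm, 'g) abfun \<Rightarrow> ('o, 'm, 'h) abfun
     \<Rightarrow> ('o \<Rightarrow> 'g \<Rightarrow> 'h) \<Rightarrow> bool" where
  "nat_trans C F G \<eta> \<longleftrightarrow>
     \<eta> \<in> extensional (Ob C) \<and>
     (\<forall>A \<in> Ob C. \<eta> A \<in> hom (FOb F A) (FOb G A) \<inter> extensional (carrier (FOb F A))) \<and>
     (\<forall>A B. \<forall>f \<in> Hom C A B. \<forall>x \<in> carrier (FOb F A).
        \<eta> B (FMor F f x) = FMor G f (\<eta> A x))"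

definition nat_iso ::
  "('o, 'm, 'z) addcat_scheme \<Rightarrow> ('o, 'm, 'g) abfun \<Rightarrow> ('o, 'm, 'h) abfun
     \<Rightarrow> ('o \<Rightarrow> 'g \<Rightarrow> 'h) \<Rightarrow> bool" where
  "nat_iso C F G \<eta> \<longleftrightarrow> nat_trans C F G \<eta> \<and> (\<forall>A \<in> Ob C. \<eta> A \<in> iso (FOb F A) (FOb G A))"

definition precomp_image :: "('o, 'm, 'z) addcat_scheme \<Rightarrow> 'm \<Rightarrow> 'o \<Rightarrow> 'm set" where
  "precomp_image C f X = (\<lambda>b. b \<cdot>\<^bsub>C\<^esub> f) ` Hom C (Cod C f) X"

text \<open>The functor \<open>coker ((f,-) : (B,-) \<rightarrow> (A,-))\<close> for \<open>f : A \<rightarrow> B\<close>; its values are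
  groups of cosets in \<open>(A,X)\<close>.\<close>

definition coker_functor ::
  "('o, 'm, 'z) addcat_scheme \<Rightarrow> 'm \<Rightarrow> ('o, 'm, 'm set) abfun" where
  "coker_functor C f =
     \<lparr>FOb = (\<lambda>X. hom_group C (Dom C f) X Mod precomp_image C f X),
      FMor = (\<lambda>u K. \<Union>a \<in> K.
        precomp_image C f (Cod C u) #>\<^bsub>hom_group C (Dom C f) (Cod C u)\<^esub> (u \<cdot>\<^bsub>C\<^esub> a))\<rparr>"

text \<open>All functors here take values in groups carried by subsets of \<open>'m set\<close>, the type in
  which the values of \<open>coker_functor\<close> live. Hence up to isomorphism no coherent
  functor is lost.\<close>

definition Coh :: "'u rel \<Rightarrow> ('o, 'm, 'z) addcat_scheme \<Rightarrow> ('o, 'm, 'm set) abfun set" where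
  "Coh \<kappa> C = {F. ab_functor C F \<and> (\<exists>f \<in> cpt_mor \<kappa> C. \<exists>\<eta>. nat_iso C (coker_functor C f) F \<eta>)}"

definition Ann_Ob ::
  "('o, 'm, 'z) addcat_scheme \<Rightarrow> ('o, 'm, 'm set) abfun set \<Rightarrow> 'o set" where
  "Ann_Ob C \<A> = {X \<in> Ob C. \<forall>F \<in> \<A>. trivial_group (FOb F X)}"

definition Ann_Coh ::
  "'u rel \<Rightarrow> ('o, 'm, 'z) addcat_scheme \<Rightarrow> 'o set \<Rightarrow> ('o, 'm, 'm set) abfun set" where
  "Ann_Coh \<kappa> C \<X> = {F \<in> Coh \<kappa> C. \<forall>X \<in> \<X>. trivial_group (FOb F X)}"

definition definable :: "'u rel \<Rightarrow> ('o, 'm, 'z) addcat_scheme \<Rightarrow> 'o set \<Rightarrow> bool" where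
  "definable \<kappa> C \<D> \<longleftrightarrow> (\<exists>\<A> \<subseteq> Coh \<kappa> C. \<D> = Ann_Ob C \<A>)"

text \<open>Kernels, cokernels and exactness are those of the abelian category of coherent
  functors: the test objects of the universal properties range over coherent functors.\<close>

definition zero_comp ::
  "('o, 'm, 'z) addcat_scheme \<Rightarrow> ('o, 'm, 'f) abfun \<Rightarrow> ('o \<Rightarrow> 'f \<Rightarrow> 'g)
     \<Rightarrow> ('o, 'm, 'h) abfun \<Rightarrow> ('o \<Rightarrow> 'g \<Rightarrow> 'h) \<Rightarrow> bool" where
  "zero_comp C F \<alpha> H \<beta> \<longleftrightarrow>
     (\<forall>A \<in> Ob C. \<forall>x \<in> carrier (FOb F A). \<beta> A (\<alpha> A x) = \<one>\<^bsub>FOb H A\<^esub>)"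

definition Coh_kernel where
  "Coh_kernel \<kappa> C F \<alpha> G \<beta> H \<longleftrightarrow> nat_trans C F G \<alpha> \<and> zero_comp C F \<alpha> H \<beta> \<and>
     (\<forall>E \<in> Coh \<kappa> C. \<forall>\<gamma>. nat_trans C E G \<gamma> \<and> zero_comp C E \<gamma> H \<beta> \<longrightarrow>
        (\<exists>!\<delta>. nat_trans C E F \<delta> \<and>
           (\<forall>A \<in> Ob C. \<forall>x \<in> carrier (FOb E A). \<alpha> A (\<delta> A x) = \<gamma> A x)))"

definition Coh_cokernel where
  "Coh_cokernel \<kappa> C F \<alpha> G \<beta> H \<longleftrightarrow> nat_trans C G H \<beta> \<and> zero_comp C F \<alpha> H \<beta> \<and>
     (\<forall>E \<in> Coh \<kappa> C. \<forall>\<gamma>. nat_trans C G E \<gamma> \<and> zero_comp C F \<alpha> E \<gamma> \<longrightarrow>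
        (\<exists>!\<delta>. nat_trans C H E \<delta> \<and>
           (\<forall>A \<in> Ob C. \<forall>x \<in> carrier (FOb G A). \<delta> A (\<beta> A x) = \<gamma> A x)))"

definition Coh_short_exact where
  "Coh_short_exact \<kappa> C F \<alpha> G \<beta> H \<longleftrightarrow>
     F \<in> Coh \<kappa> C \<and> G \<in> Coh \<kappa> C \<and> H \<in> Coh \<kappa> C \<and>
     Coh_kernel \<kappa> C F \<alpha> G \<beta> H \<and> Coh_cokernel \<kappa> C F \<alpha> G \<beta> H"

definition serre_subcategory ::
  "'u rel \<Rightarrow> ('o, 'm, 'z) addcat_scheme \<Rightarrow> ('o, 'm, 'm set) abfun set \<Rightarrow> bool" where
  "serre_subcategory \<kappa> C \<S> \<longleftrightarrow> \<S> \<subseteq> Coh \<kappa> C \<and> \<S> \<noteq> {} \<and>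
     (\<forall>F \<alpha> G \<beta> H. Coh_short_exact \<kappa> C F \<alpha> G \<beta> H \<longrightarrow> (G \<in> \<S> \<longleftrightarrow> F \<in> \<S> \<and> H \<in> \<S>))"


section \<open>The language and pp formulas\<close>

text \<open>Sorts are the objects in a set \<open>S\<close> (a small version of the category of compact
  objects). Variables are de Bruijn-style positions in a context, the list of their sorts.
  The function symbol of \<open>f : A \<rightarrow> B\<close> maps sort \<open>B\<close> to sort \<open>A\<close>.\<close>

datatype ('o, 'm) tm =
    TVar nat
  | TZero 'o
  | TAdd "('o, 'm) tm" "('o, 'm) tm"
  | TApp 'm "('o, 'm) tm"

inductive has_sort ::
  "('o, 'm, 'z) addcat_scheme \<Rightarrow> 'o set \<Rightarrow> 'o list \<Rightarrow> ('o, 'm) tm \<Rightarrow> 'o \<Rightarrow> bool"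
  for C S \<Gamma> where
    "\<lbrakk>i < length \<Gamma>; \<Gamma> ! i \<in> S\<rbrakk> \<Longrightarrow> has_sort C S \<Gamma> (TVar i) (\<Gamma> ! i)"
  | "A \<in> S \<Longrightarrow> has_sort C S \<Gamma> (TZero A) A"
  | "\<lbrakk>has_sort C S \<Gamma> s A; has_sort C S \<Gamma> t A\<rbrakk> \<Longrightarrow> has_sort C S \<Gamma> (TAdd s t) A"
  | "\<lbrakk>A \<in> S; B \<in> S; f \<in> Hom C A B; has_sort C S \<Gamma> t B\<rbrakk> \<Longrightarrow> has_sort C S \<Gamma> (TApp f t) A"

primrec tm_val ::
  "('o, 'm, 'z) addcat_scheme \<Rightarrow> 'o \<Rightarrow> 'm list \<Rightarrow> ('o, 'm) tm \<Rightarrow> 'm" where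
    "tm_val C X v (TVar i) = v ! i"
  | "tm_val C X v (TZero A) = ZeroMor C A X"
  | "tm_val C X v (TAdd s t) = AddMor C (tm_val C X v s) (tm_val C X v t)"
  | "tm_val C X v (TApp f t) = tm_val C X v t \<cdot>\<^bsub>C\<^esub> f"

text \<open>A pp formula is given by the sorts of its free variables, the sorts of its
  existentially quantified variables and a finite list of equations between terms in the
  concatenated context.\<close>

datatype ('o, 'm) pp =
  PP (free_sorts: "'o list") (bound_sorts: "'o list")
     (eqns: "(('o, 'm) tm \<times> ('o, 'm) tm) list")

definition pp_formula ::
  "('o, 'm, 'z) addcat_scheme \<Rightarrow> 'o set \<Rightarrow> ('o, 'm) pp \<Rightarrow> bool" where
  "pp_formula C S \<phi> \<longleftrightarrow> set (free_sorts \<phi>) \<subseteq> S \<and> set (bound_sorts \<phi>) \<subseteq> S \<and>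
     (\<forall>(s, t) \<in> set (eqns \<phi>). \<exists>A.
        has_sort C S (free_sorts \<phi> @ bound_sorts \<phi>) s A \<and>
        has_sort C S (free_sorts \<phi> @ bound_sorts \<phi>) t A)"

definition tuples :: "('o, 'm, 'z) addcat_scheme \<Rightarrow> 'o list \<Rightarrow> 'o \<Rightarrow> 'm list set" where
  "tuples C As X = {xs. list_all2 (\<lambda>x A. x \<in> Hom C A X) xs As}"

definition pp_sol :: "('o, 'm, 'z) addcat_scheme \<Rightarrow> ('o, 'm) pp \<Rightarrow> 'o \<Rightarrow> 'm list set" where
  "pp_sol C \<phi> X = {xs \<in> tuples C (free_sorts \<phi>) X.
     \<exists>ys \<in> tuples C (bound_sorts \<phi>) X.
       \<forall>(s, t) \<in> set (eqns \<phi>). tm_val C X (xs @ ys) s = tm_val C X (xs @ ys) t}"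

definition pp_group :: "('o, 'm, 'z) addcat_scheme \<Rightarrow> ('o, 'm) pp \<Rightarrow> 'o \<Rightarrow> 'm list monoid" where
  "pp_group C \<phi> X =
     \<lparr>carrier = pp_sol C \<phi> X, mult = map2 (AddMor C),
      one = map (\<lambda>A. ZeroMor C A X) (free_sorts \<phi>)\<rparr>"

definition pp_pair ::
  "('o, 'm, 'z) addcat_scheme \<Rightarrow> 'o set \<Rightarrow> ('o, 'm) pp \<Rightarrow> ('o, 'm) pp \<Rightarrow> bool" where
  "pp_pair C S \<phi> \<psi> \<longleftrightarrow> pp_formula C S \<phi> \<and> pp_formula C S \<psi> \<and>
     free_sorts \<phi> = free_sorts \<psi> \<and> (\<forall>X \<in> Ob C. pp_sol C \<psi> X \<subseteq> pp_sol C \<phi> X)"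

definition pp_closed_class ::
  "('o, 'm, 'z) addcat_scheme \<Rightarrow> (('o, 'm) pp \<times> ('o, 'm) pp) set \<Rightarrow> 'o set" where
  "pp_closed_class C \<Phi> =
     {X \<in> Ob C. \<forall>(\<phi>, \<psi>) \<in> \<Phi>. trivial_group (pp_group C \<phi> X Mod pp_sol C \<psi> X)}"


section \<open>Annihilation, divisibility and torsionfreeness\<close>

definition kills :: "('o, 'm, 'z) addcat_scheme \<Rightarrow> 'o \<Rightarrow> 'm \<Rightarrow> bool" where
  "kills C X f \<longleftrightarrow> (\<forall>b \<in> Hom C (Cod C f) X. b \<cdot>\<^bsub>C\<^esub> f = ZeroMor C (Dom C f) X)"

definition divides :: "('o, 'm, 'z) addcat_scheme \<Rightarrow> 'm \<Rightarrow> 'o \<Rightarrow> bool" where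
  "divides C g X \<longleftrightarrow> (\<forall>b \<in> Hom C (Dom C g) X. \<exists>c \<in> Hom C (Cod C g) X. b = c \<cdot>\<^bsub>C\<^esub> g)"

definition ann :: "('o, 'm, 'z) addcat_scheme \<Rightarrow> 'o \<Rightarrow> 'm \<Rightarrow> 'm set" where
  "ann C X l = {a \<in> Hom C (Cod C l) X. a \<cdot>\<^bsub>C\<^esub> l = ZeroMor C (Dom C l) X}"

definition ann_zero :: "('o, 'm, 'z) addcat_scheme \<Rightarrow> 'o \<Rightarrow> 'm \<Rightarrow> bool" where
  "ann_zero C X l \<longleftrightarrow> ann C X l = {ZeroMor C (Cod C l) X}"

definition Ann_class :: "('o, 'm, 'z) addcat_scheme \<Rightarrow> 'm set \<Rightarrow> 'o set" where
  "Ann_class C \<Phi> = {X \<in> Ob C. \<forall>f \<in> \<Phi>. kills C X f}"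

definition Div_class :: "('o, 'm, 'z) addcat_scheme \<Rightarrow> 'm set \<Rightarrow> 'o set" where
  "Div_class C \<Psi> = {X \<in> Ob C. \<forall>g \<in> \<Psi>. divides C g X}"

definition TF_class :: "('o, 'm, 'z) addcat_scheme \<Rightarrow> 'm set \<Rightarrow> 'o set" where
  "TF_class C \<Xi> = {X \<in> Ob C. \<forall>l \<in> \<Xi>. ann_zero C X l}"

definition Ann_Mor :: "'u rel \<Rightarrow> ('o, 'm, 'z) addcat_scheme \<Rightarrow> 'o set \<Rightarrow> 'm set" where
  "Ann_Mor \<kappa> C \<X> = {f \<in> cpt_mor \<kappa> C. \<forall>X \<in> \<X>. kills C X f}"

definition annihilator_ideal :: "'u rel \<Rightarrow> ('o, 'm, 'z) addcat_scheme \<Rightarrow> 'm set \<Rightarrow> bool" where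
  "annihilator_ideal \<kappa> C J \<longleftrightarrow> (\<exists>\<X> \<subseteq> Ob C. J = Ann_Mor \<kappa> C \<X>)"

end

theory Submission
  imports Defs
begin

text \<open>
  In a triangle \<open>D \<rightarrow> A \<rightarrow> B\<close> of compact objects with maps \<open>k\<close> and \<open>f\<close>, the coherent functor
  \<open>F\<^sub>f = (A,-)/(B,-)f\<close> is isomorphic to the image functor \<open>(A,-)k\<close>, so that \<open>F\<^sub>f X = 0\<close> iff \<open>f | X\<close> iff
  \<open>Xk = 0\<close>. A Serre subcategory is therefore determined by the class \<open>J\<close> of all \<open>k\<close> whose image functor
  it contains, and it remains to find, for compact \<open>f \<notin> J\<close>, an object killed by \<open>J\<close> but not by \<open>f\<close>.
  This object is the telescope of \<open>cod f = X\<^sub>0 \<rightarrow> X\<^sub>1 \<rightarrow> \<dots>\<close>, where \<open>X\<^sub>n\<^sub>+\<^sub>1\<close> is the cone of the coproduct of all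
  maps \<open>A \<rightarrow> X\<^sub>n\<close>, \<open>A\<close> compact, that factor through \<open>J\<close>. Every map through \<open>J\<close> dies in the next step, and
  the closure of the Serre subcategory under subobjects, quotients and extensions shows that a map
  \<open>A \<rightarrow> X\<^sub>n\<close> factors through \<open>J\<close> as soon as its composite with \<open>X\<^sub>n \<rightarrow> X\<^sub>n\<^sub>+\<^sub>1\<close> does; hence \<open>f\<close> survives in the telescope.

  Conversely, annihilators of objects are Serre subcategories because exactness in the category of
  coherent functors is pointwise: elements of \<open>F X\<close> and the relations between them come from compact
  objects over \<open>X\<close>, where the Yoneda lemma turns them into maps of coherent functors. Likewise a pp
  formula is freely realised by a tuple in a compact object, which turns pp-pairs into
  divisibility conditions.
\<close>

section \<open>Additive categories\<close>

text \<open>The separating object has to be an object of the category itself; a formal colimit of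
  compact objects is not enough. Cones and telescopes have only weak universal properties, but
  \<open>J\<close> and \<open>f\<close> are tested by maps out of compact objects, and to these a
  coproduct looks like a direct sum and the telescope like a direct limit. Cones, weak coequalizers
  and weak pushouts therefore enter through the sets \<open>pim f X\<close> = (cod f, X)f: existence
  of a factorisation through them matters, its uniqueness does not. Cones are also not functorial,
  so preservation of survival is proved by replacing the large triangle that defines the next object
  by a triangle of compact objects, compared with the large one by TR3. For this, compactness is
  used in the form of finite support, which mentions no sums. In the converse direction the obstacle
  is that kernels and cokernels of coherent functors are defined by tests against coherent functors
  only, so vanishing at a non-compact object has to be extracted from their universal
  properties.\<close>

lemma Hom_iff: "f \<in> Hom C A B \<longleftrightarrow> f \<in> Mor C \<and> Dom C f = A \<and> Cod C f = B"
  by (simp add: Hom_def)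

context additive_category
begin

abbreviation add (infixl \<open>\<boxplus>\<close> 65) where "f \<boxplus> g \<equiv> AddMor C f g"
abbreviation neg (\<open>\<boxminus> _\<close> [80] 80) where "\<boxminus> f \<equiv> NegMor C f"
abbreviation diff (infixl \<open>\<boxminus>\<close> 65) where "f \<boxminus> g \<equiv> AddMor C f (NegMor C g)"
abbreviation zm where "zm \<equiv> ZeroMor C"
abbreviation hm where "hm \<equiv> Hom C"
abbreviation ID where "ID \<equiv> Id C"
abbreviation pim where "pim \<equiv> precomp_image C"

lemma Hom_Ob: "f \<in> hm A B \<Longrightarrow> A \<in> Ob C \<and> B \<in> Ob C"
  using Dom_Ob Cod_Ob by (auto simp: Hom_iff)

lemma add_Hom: assumes "f \<in> hm A B" "g \<in> hm A B" shows "f \<boxplus> g \<in> hm A B"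
proof -
  interpret G: comm_group "hom_group C A B" using Hom_Ob[OF assms(1)] hom_comm_group by blast
  show ?thesis using G.m_closed[of f g] assms by (simp add: hom_group_def)
qed

lemma zero_Hom: assumes "A \<in> Ob C" "B \<in> Ob C" shows "zm A B \<in> hm A B"
proof -
  interpret G: comm_group "hom_group C A B" using assms hom_comm_group by blast
  show ?thesis using G.one_closed by (simp add: hom_group_def)
qed

lemma neg_Hom: "f \<in> hm A B \<Longrightarrow> \<boxminus> f \<in> hm A B"
  using group.inv_closed[OF comm_group.axioms(2)[OF hom_comm_group], of A B f]
  by (auto simp: hom_group_def NegMor_def Hom_iff Dom_Ob Cod_Ob)

lemma Id_Mor [simp]: "A \<in> Ob C \<Longrightarrow> ID A \<in> Mor C" "A \<in> Ob C \<Longrightarrow> Dom C (ID A) = A"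
    "A \<in> Ob C \<Longrightarrow> Cod C (ID A) = A"
  using Id_Hom by (auto simp: Hom_iff)

lemma zero_Mor [simp]: assumes "A \<in> Ob C" "B \<in> Ob C"
  shows "zm A B \<in> Mor C" "Dom C (zm A B) = A" "Cod C (zm A B) = B"
  using zero_Hom[OF assms] by (auto simp: Hom_iff)

lemma Comp_Mor [simp]: assumes "f \<in> Mor C" "g \<in> Mor C" "Cod C f = Dom C g"
  shows "g \<cdot> f \<in> Mor C" "Dom C (g \<cdot> f) = Dom C f" "Cod C (g \<cdot> f) = Cod C g"
  using Comp_Hom[of f "Dom C f" "Cod C f" g "Cod C g"] assms by (auto simp: Hom_iff)

lemma add_Mor [simp]: assumes "f \<in> Mor C" "g \<in> Mor C" "Dom C f = Dom C g" "Cod C f = Cod C g"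
  shows "f \<boxplus> g \<in> Mor C" "Dom C (f \<boxplus> g) = Dom C g" "Cod C (f \<boxplus> g) = Cod C g"
  using add_Hom[of f "Dom C f" "Cod C f" g] assms by (auto simp: Hom_iff)

lemma neg_Mor [simp]: assumes "f \<in> Mor C"
  shows "\<boxminus> f \<in> Mor C" "Dom C (\<boxminus> f) = Dom C f" "Cod C (\<boxminus> f) = Cod C f"
  using neg_Hom[of f "Dom C f" "Cod C f"] assms by (auto simp: Hom_iff)

lemma Dom_Cod_Ob [simp]: assumes "f \<in> Mor C" shows "Dom C f \<in> Ob C" "Cod C f \<in> Ob C"
  using assms Dom_Ob Cod_Ob by auto

lemma comp_Id [simp]: "\<lbrakk>f \<in> Mor C; Dom C f = A\<rbrakk> \<Longrightarrow> f \<cdot> ID A = f"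
  and Id_comp [simp]: "\<lbrakk>f \<in> Mor C; Cod C f = B\<rbrakk> \<Longrightarrow> ID B \<cdot> f = f"
  using Comp_Id[of f A "Cod C f"] Id_Comp[of f "Dom C f" B] by (auto simp: Hom_iff)

lemma comp_assoc [simp]: "\<lbrakk>f \<in> Mor C; g \<in> Mor C; h \<in> Mor C; Cod C f = Dom C g; Cod C g = Dom C h\<rbrakk>
    \<Longrightarrow> (h \<cdot> g) \<cdot> f = h \<cdot> (g \<cdot> f)"
  using Comp_assoc[of f "Dom C f" "Cod C f" g "Cod C g" h "Cod C h"] by (auto simp: Hom_iff)

lemma comp_add_left [simp]: "\<lbrakk>f \<in> Mor C; g \<in> Mor C; h \<in> Mor C; Dom C g = Dom C h; Cod C g = Cod C h;
    Cod C f = Dom C h\<rbrakk> \<Longrightarrow> (g \<boxplus> h) \<cdot> f = g \<cdot> f \<boxplus> h \<cdot> f"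
  using Comp_Add_left[of f "Dom C f" "Cod C f" g "Cod C g" h] by (auto simp: Hom_iff)

lemma comp_add_right [simp]: "\<lbrakk>f \<in> Mor C; g \<in> Mor C; h \<in> Mor C; Dom C g = Dom C h; Cod C g = Cod C h;
    Dom C f = Cod C h\<rbrakk> \<Longrightarrow> f \<cdot> (g \<boxplus> h) = f \<cdot> g \<boxplus> f \<cdot> h"
  using Comp_Add_right[of g "Dom C g" "Cod C g" h f "Cod C f"] by (auto simp: Hom_iff)

lemma hom_group_Hom: "\<lbrakk>f \<in> Mor C\<rbrakk> \<Longrightarrow> comm_group (hom_group C (Dom C f) (Cod C f))"
  using hom_comm_group by simp

lemma add_assoc: "\<lbrakk>f \<in> Mor C; g \<in> Mor C; h \<in> Mor C; Dom C f = Dom C g; Dom C g = Dom C h;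
    Cod C f = Cod C g; Cod C g = Cod C h\<rbrakk> \<Longrightarrow> f \<boxplus> g \<boxplus> h = f \<boxplus> (g \<boxplus> h)"
  using monoid.m_assoc[OF group.is_monoid[OF comm_group.axioms(2)[OF hom_group_Hom]], of f f g h]
  by (auto simp: hom_group_def Hom_iff)

lemma add_comm: "\<lbrakk>f \<in> Mor C; g \<in> Mor C; Dom C f = Dom C g; Cod C f = Cod C g\<rbrakk> \<Longrightarrow> f \<boxplus> g = g \<boxplus> f"
  using comm_monoid.m_comm[OF comm_group.axioms(1)[OF hom_group_Hom], of f f g]
  by (auto simp: hom_group_def Hom_iff)

lemma add_left_comm: "\<lbrakk>f \<in> Mor C; g \<in> Mor C; h \<in> Mor C; Dom C f = Dom C g; Dom C g = Dom C h;
    Cod C f = Cod C g; Cod C g = Cod C h\<rbrakk> \<Longrightarrow> f \<boxplus> (g \<boxplus> h) = g \<boxplus> (f \<boxplus> h)"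
  using add_assoc[of f g h] add_assoc[of g f h] add_comm[of f g] by auto

lemma zero_add [simp]: "\<lbrakk>f \<in> Mor C; Dom C f = A; Cod C f = B\<rbrakk> \<Longrightarrow> zm A B \<boxplus> f = f"
  using monoid.l_one[OF group.is_monoid[OF comm_group.axioms(2)[OF hom_group_Hom]], of f f]
  by (auto simp: hom_group_def Hom_iff)

lemma add_zero [simp]: "\<lbrakk>f \<in> Mor C; Dom C f = A; Cod C f = B\<rbrakk> \<Longrightarrow> f \<boxplus> zm A B = f"
  using add_comm[of f "zm A B"] by auto

lemma neg_add [simp]: "f \<in> Mor C \<Longrightarrow> \<boxminus> f \<boxplus> f = zm (Dom C f) (Cod C f)"
  using group.l_inv[OF comm_group.axioms(2)[OF hom_group_Hom], of f f]
  by (auto simp: hom_group_def Hom_iff NegMor_def)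

lemma add_neg [simp]: "f \<in> Mor C \<Longrightarrow> f \<boxminus> f = zm (Dom C f) (Cod C f)"
  using add_comm[of f "\<boxminus> f"] by auto

lemma neg_add_cancel [simp]: "\<lbrakk>f \<in> Mor C; g \<in> Mor C; Dom C f = Dom C g; Cod C f = Cod C g\<rbrakk>
    \<Longrightarrow> \<boxminus> f \<boxplus> (f \<boxplus> g) = g"
  using add_assoc[of "\<boxminus> f" f g] by auto

lemma add_neg_cancel [simp]: "\<lbrakk>f \<in> Mor C; g \<in> Mor C; Dom C f = Dom C g; Cod C f = Cod C g\<rbrakk>
    \<Longrightarrow> f \<boxplus> (\<boxminus> f \<boxplus> g) = g"
  using add_assoc[of f "\<boxminus> f" g] by auto

lemma neg_unique: "\<lbrakk>f \<in> Mor C; g \<in> Mor C; Dom C f = Dom C g; Cod C f = Cod C g;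
    f \<boxplus> g = zm (Dom C g) (Cod C g)\<rbrakk> \<Longrightarrow> \<boxminus> f = g"
  using neg_add_cancel[of f g] add_zero[of "\<boxminus> f" "Dom C g" "Cod C g"] by auto

lemma neg_neg [simp]: "f \<in> Mor C \<Longrightarrow> \<boxminus> \<boxminus> f = f"
  by (rule neg_unique) auto

lemma neg_zero [simp]: "\<lbrakk>A \<in> Ob C; B \<in> Ob C\<rbrakk> \<Longrightarrow> \<boxminus> zm A B = zm A B"
  by (rule neg_unique) auto

lemma neg_add_distrib [simp]: "\<lbrakk>f \<in> Mor C; g \<in> Mor C; Dom C f = Dom C g; Cod C f = Cod C g\<rbrakk>
    \<Longrightarrow> \<boxminus> (f \<boxplus> g) = \<boxminus> f \<boxminus> g"
  by (rule neg_unique) (auto simp: add_assoc add_comm add_left_comm)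

lemma add_idem_zero: "\<lbrakk>f \<in> Mor C; f \<boxplus> f = f\<rbrakk> \<Longrightarrow> f = zm (Dom C f) (Cod C f)"
  by (metis neg_add_cancel neg_add)

lemma comp_zero [simp]: assumes "f \<in> Mor C" "Dom C f = B" "A \<in> Ob C"
  shows "f \<cdot> zm A B = zm A (Cod C f)"
proof -
  have "f \<cdot> zm A B \<boxplus> f \<cdot> zm A B = f \<cdot> (zm A B \<boxplus> zm A B)"
    using assms by (subst comp_add_right) auto
  also have "\<dots> = f \<cdot> zm A B" using assms by (subst zero_add) auto
  finally show ?thesis using add_idem_zero[of "f \<cdot> zm A B"] assms by auto
qed

lemma zero_comp [simp]: assumes "f \<in> Mor C" "Cod C f = B" "A \<in> Ob C"
  shows "zm B A \<cdot> f = zm (Dom C f) A"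
proof -
  have "zm B A \<cdot> f \<boxplus> zm B A \<cdot> f = (zm B A \<boxplus> zm B A) \<cdot> f"
    using assms by (subst comp_add_left) auto
  also have "\<dots> = zm B A \<cdot> f" using assms by (subst zero_add) auto
  finally show ?thesis using add_idem_zero[of "zm B A \<cdot> f"] assms by auto
qed

lemma comp_neg [simp]: "\<lbrakk>f \<in> Mor C; g \<in> Mor C; Cod C f = Dom C g\<rbrakk> \<Longrightarrow> g \<cdot> \<boxminus> f = \<boxminus> (g \<cdot> f)"
  by (rule neg_unique[symmetric]) (auto simp: comp_add_right[symmetric] simp del: comp_add_right)

lemma neg_comp [simp]: "\<lbrakk>f \<in> Mor C; g \<in> Mor C; Cod C f = Dom C g\<rbrakk> \<Longrightarrow> \<boxminus> g \<cdot> f = \<boxminus> (g \<cdot> f)"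
  by (rule neg_unique[symmetric]) (auto simp: comp_add_left[symmetric] simp del: comp_add_left)

lemma diff_eq_zero: assumes "f \<in> Mor C" "g \<in> Mor C" "Dom C f = Dom C g" "Cod C f = Cod C g"
  shows "f \<boxminus> g = zm (Dom C g) (Cod C g) \<longleftrightarrow> f = g"
proof
  assume "f \<boxminus> g = zm (Dom C g) (Cod C g)"
  then have "\<boxminus> f = \<boxminus> g" using assms by (intro neg_unique) auto
  then show "f = g" using assms by (metis neg_neg)
qed (use assms in auto)

lemma diff_add [simp]: "\<lbrakk>f \<in> Mor C; g \<in> Mor C; Dom C f = Dom C g; Cod C f = Cod C g\<rbrakk>
    \<Longrightarrow> f \<boxminus> g \<boxplus> g = f"
  by (subst add_assoc) simp_all

lemma add_diff [simp]: "\<lbrakk>f \<in> Mor C; g \<in> Mor C; Dom C f = Dom C g; Cod C f = Cod C g\<rbrakk>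
    \<Longrightarrow> f \<boxplus> g \<boxminus> g = f"
  by (subst add_assoc) simp_all

lemma zero_objectD: assumes "zero_object C Z" "f \<in> Mor C" "Cod C f = Z \<or> Dom C f = Z"
  shows "f = zm (Dom C f) (Cod C f)"
  using assms unfolding zero_object_def by (metis Dom_Ob Cod_Ob Hom_iff zero_Hom)

lemma obtain_biproduct:
  assumes "A \<in> Ob C" "B \<in> Ob C"
  obtains P i j p q where "P \<in> Ob C" "i \<in> hm A P" "j \<in> hm B P" "p \<in> hm P A" "q \<in> hm P B"
    "p \<cdot> i = ID A" "q \<cdot> j = ID B" "p \<cdot> j = zm B A" "q \<cdot> i = zm A B" "i \<cdot> p \<boxplus> j \<cdot> q = ID P"
  using ex_biproduct[OF assms] by blast

lemma pim_iff: "x \<in> pim f X \<longleftrightarrow> (\<exists>b \<in> hm (Cod C f) X. x = b \<cdot> f)"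
  by (auto simp: precomp_image_def)

lemma pimI: "b \<in> hm (Cod C f) X \<Longrightarrow> b \<cdot> f \<in> pim f X"
  by (auto simp: precomp_image_def)

lemma pim_Hom: "f \<in> Mor C \<Longrightarrow> x \<in> pim f X \<Longrightarrow> x \<in> hm (Dom C f) X"
  by (auto simp: precomp_image_def Hom_iff)

lemma pim_outside: "X \<notin> Ob C \<Longrightarrow> pim f X = {}"
  using Hom_Ob by (auto simp: precomp_image_def)

text \<open>Rotating a triangle back puts a sign on its first map; annihilation does not see this
  sign.\<close>

lemma comp_neg_zero_iff: assumes "x \<in> hm A X" "k \<in> hm D A" shows "x \<cdot> (\<boxminus> k) = zm D X \<longleftrightarrow> x \<cdot> k = zm D X"
proof -
  have Ob: "D \<in> Ob C" "X \<in> Ob C" using assms Hom_Ob by blast+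
  have "x \<cdot> (\<boxminus> k) = \<boxminus> (x \<cdot> k)" "\<boxminus> \<boxminus> (x \<cdot> k) = x \<cdot> k" using assms by (simp_all add: Hom_iff)
  then show ?thesis using neg_zero[OF Ob] by metis
qed

lemma pim_push: assumes "f \<in> Mor C" "x \<in> pim f X" "u \<in> hm X Y" shows "u \<cdot> x \<in> pim f Y"
proof -
  obtain b where b: "b \<in> hm (Cod C f) X" "x = b \<cdot> f" using assms(2) unfolding pim_iff by blast
  have "u \<cdot> x = u \<cdot> b \<cdot> f" using assms b by (simp add: Hom_iff)
  then show ?thesis using pimI[OF Comp_Hom[OF b(1) assms(3)]] by simp
qed

lemma divides_iff: "divides C g X \<longleftrightarrow> hm (Dom C g) X \<subseteq> pim g X"
  by (auto simp: divides_def pim_iff)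

lemma kills_iff: "kills C X f \<longleftrightarrow> pim f X \<subseteq> {zm (Dom C f) X}"
  unfolding kills_def precomp_image_def by blast

lemma iso_mor_inverse: assumes "iso_mor C A B f"
  obtains g where "f \<in> hm A B" "g \<in> hm B A" "g \<cdot> f = ID A" "f \<cdot> g = ID B" "iso_mor C B A g"
  using assms unfolding iso_mor_def by blast

end

section \<open>Coproducts and compact objects\<close>

context additive_category
begin

lemma coproduct_universal:
  "is_coproduct C I X P \<iota> \<Longrightarrow> Y \<in> Ob C \<Longrightarrow> (\<And>i. i \<in> I \<Longrightarrow> \<phi> i \<in> hm (X i) Y) \<Longrightarrow>
    \<exists>!u. u \<in> hm P Y \<and> (\<forall>i \<in> I. u \<cdot> \<iota> i = \<phi> i)"
  by (simp add: is_coproduct_def)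

lemma coproduct_ext:
  assumes "is_coproduct C I X P \<iota>" "u \<in> hm P Y" "v \<in> hm P Y" "\<And>i. i \<in> I \<Longrightarrow> u \<cdot> \<iota> i = v \<cdot> \<iota> i"
  shows "u = v"
proof -
  have Y: "Y \<in> Ob C" using assms(2) Hom_Ob by blast
  have "v \<cdot> \<iota> i \<in> hm (X i) Y" if "i \<in> I" for i
    using assms(1,3) that Comp_Hom unfolding is_coproduct_def by blast
  then have "\<exists>!w. w \<in> hm P Y \<and> (\<forall>i \<in> I. w \<cdot> \<iota> i = v \<cdot> \<iota> i)"
    using coproduct_universal[OF assms(1) Y, of "\<lambda>i. v \<cdot> \<iota> i"] by blast
  then show ?thesis using assms by blast
qed

lemma coproduct_induced:
  assumes "is_coproduct C I X P \<iota>" "Y \<in> Ob C" "\<And>i. i \<in> I \<Longrightarrow> \<phi> i \<in> hm (X i) Y"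
  obtains u where "u \<in> hm P Y" "\<And>i. i \<in> I \<Longrightarrow> u \<cdot> \<iota> i = \<phi> i"
  using coproduct_universal[OF assms] that by blast

lemma coproduct_inj: "is_coproduct C I X P \<iota> \<Longrightarrow> i \<in> I \<Longrightarrow> \<iota> i \<in> hm (X i) P"
  unfolding is_coproduct_def by blast

lemma coproduct_Ob: "is_coproduct C I X P \<iota> \<Longrightarrow> P \<in> Ob C"
  unfolding is_coproduct_def by blast

lemma coproduct_proj:
  assumes "is_coproduct C I X P \<iota>"
  obtains p where "\<And>i. i \<in> I \<Longrightarrow> p i \<in> hm P (X i)" "\<And>i. i \<in> I \<Longrightarrow> p i \<cdot> \<iota> i = ID (X i)"
    "\<And>i j. i \<in> I \<Longrightarrow> j \<in> I \<Longrightarrow> i \<noteq> j \<Longrightarrow> p i \<cdot> \<iota> j = zm (X j) (X i)"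
proof -
  have "\<exists>p. p \<in> hm P (X i) \<and> (\<forall>j\<in>I. p \<cdot> \<iota> j = (if j = i then ID (X i) else zm (X j) (X i)))" if "i \<in> I" for i
  proof -
    have X: "X j \<in> Ob C" if "j \<in> I" for j using coproduct_inj[OF assms that] Hom_Ob by blast
    show ?thesis
      by (rule coproduct_induced[OF assms, of "X i" "\<lambda>j. if j = i then ID (X i) else zm (X j) (X i)"])
        (use X \<open>i \<in> I\<close> in \<open>auto simp: Hom_iff\<close>)
  qed
  then obtain p where "\<And>i. i \<in> I \<Longrightarrow> p i \<in> hm P (X i) \<and> (\<forall>j\<in>I. p i \<cdot> \<iota> j = (if j = i then ID (X i) else zm (X j) (X i)))"
    by metis
  then show thesis using that[of p] by auto
qed

text \<open>The projection onto the summands with index in \<open>F\<close>, realised as an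
  endomorphism of the whole coproduct, so that no coproduct over \<open>F\<close> has to be
  formed.\<close>

lemma coproduct_idem:
  assumes "is_coproduct C I X P \<iota>"
  obtains e where "e \<in> hm P P" "\<And>i. i \<in> I \<Longrightarrow> i \<in> F \<Longrightarrow> e \<cdot> \<iota> i = \<iota> i"
    "\<And>i. i \<in> I \<Longrightarrow> i \<notin> F \<Longrightarrow> e \<cdot> \<iota> i = zm (X i) P"
proof -
  have X: "X j \<in> Ob C" if "j \<in> I" for j using coproduct_inj[OF assms that] Hom_Ob by blast
  show ?thesis
    by (rule coproduct_induced[OF assms coproduct_Ob[OF assms],
          of "\<lambda>j. if j \<in> F then \<iota> j else zm (X j) P"])
      (use X assms that coproduct_Ob[OF assms] in \<open>auto intro: zero_Hom coproduct_inj\<close>)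
qed

text \<open>The morphism \<open>a : A \<rightarrow> \<Coprod> X i\<close> factors through the coproduct of the \<open>X i\<close> with \<open>i \<in> F\<close>,
  expressed without sums: what vanishes on these \<open>X i\<close> vanishes on \<open>a\<close>.\<close>

definition supp_by :: "('i \<Rightarrow> 'm) \<Rightarrow> 'i set \<Rightarrow> 'm \<Rightarrow> bool" where
  "supp_by \<iota> F a \<longleftrightarrow> (\<forall>u \<in> Mor C. Dom C u = Cod C a \<and> (\<forall>i\<in>F. u \<cdot> \<iota> i = zm (Dom C (\<iota> i)) (Cod C u))
     \<longrightarrow> u \<cdot> a = zm (Dom C a) (Cod C u))"

definition fin_supp :: "'i set \<Rightarrow> ('i \<Rightarrow> 'm) \<Rightarrow> 'm \<Rightarrow> bool" where
  "fin_supp I \<iota> a \<longleftrightarrow> (\<exists>F. finite F \<and> F \<subseteq> I \<and> supp_by \<iota> F a)"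

lemma supp_byD: "supp_by \<iota> F a \<Longrightarrow> a \<in> hm A P \<Longrightarrow> u \<in> hm P Y \<Longrightarrow>
    (\<And>i. i \<in> F \<Longrightarrow> u \<cdot> \<iota> i = zm (Dom C (\<iota> i)) Y) \<Longrightarrow> u \<cdot> a = zm A Y"
  unfolding supp_by_def by (auto simp: Hom_iff)

lemma supp_byI: assumes "a \<in> hm A P"
    "\<And>u Y. u \<in> hm P Y \<Longrightarrow> (\<And>i. i \<in> F \<Longrightarrow> u \<cdot> \<iota> i = zm (Dom C (\<iota> i)) Y) \<Longrightarrow> u \<cdot> a = zm A Y"
  shows "supp_by \<iota> F a"
  unfolding supp_by_def using assms(1) assms(2)[of _ "Cod C _"] by (auto simp: Hom_iff)

text \<open>A test map \<open>u\<close> that vanishes on the summands in \<open>F\<close> is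
  corrected to u - u \<iota>_i p_i, which vanishes on the summand i as well and hence on
  \<open>a\<close>. Its value on \<open>a\<close> is the value of \<open>u\<close> on a - \<iota>_i
  p_i a.\<close>

lemma supp_by_remove:
  assumes cop: "is_coproduct C I X P \<iota>" and a: "a \<in> hm A P" and s: "supp_by \<iota> (insert i F) a" and i: "i \<in> I" and F: "F \<subseteq> I"
    and p: "\<And>i. i \<in> I \<Longrightarrow> p i \<in> hm P (X i)" "\<And>i. i \<in> I \<Longrightarrow> p i \<cdot> \<iota> i = ID (X i)"
      "\<And>i j. i \<in> I \<Longrightarrow> j \<in> I \<Longrightarrow> i \<noteq> j \<Longrightarrow> p i \<cdot> \<iota> j = zm (X j) (X i)"
  shows "supp_by \<iota> F (a \<boxminus> \<iota> i \<cdot> (p i \<cdot> a))"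
proof (rule supp_byI)
  note \<iota> = coproduct_inj[OF cop]
  show "a \<boxminus> \<iota> i \<cdot> (p i \<cdot> a) \<in> hm A P" using a p(1)[OF i] \<iota>[OF i] by (auto simp: Hom_iff)
  fix u Y assume u: "u \<in> hm P Y" "\<And>i. i \<in> F \<Longrightarrow> u \<cdot> \<iota> i = zm (Dom C (\<iota> i)) Y"
  define v where "v = u \<boxminus> (u \<cdot> \<iota> i) \<cdot> p i"
  have v: "v \<in> hm P Y" unfolding v_def using u p(1)[OF i] \<iota>[OF i] by (auto simp: Hom_iff)
  have "v \<cdot> a = zm A Y"
  proof (rule supp_byD[OF s a v])
    fix j assume j: "j \<in> insert i F"
    then have jI: "j \<in> I" using i F by auto
    show "v \<cdot> \<iota> j = zm (Dom C (\<iota> j)) Y"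
    proof (cases "j = i")
      case True
      then show ?thesis unfolding v_def using u p(1,2)[OF i] \<iota>[OF i] by (auto simp: Hom_iff)
    next
      case False
      then have "u \<cdot> \<iota> j = zm (Dom C (\<iota> j)) Y" using j u by auto
      moreover have "X i \<in> Ob C" "X j \<in> Ob C" using \<iota> i jI Hom_Ob by blast+
      ultimately show ?thesis unfolding v_def using u p(1)[OF i] p(3)[OF i jI] False \<iota>[OF i] \<iota>[OF jI]
        by (auto simp: Hom_iff)
    qed
  qed
  then show "u \<cdot> (a \<boxminus> \<iota> i \<cdot> (p i \<cdot> a)) = zm A Y"
    unfolding v_def using u p(1)[OF i] \<iota>[OF i] a by (auto simp: Hom_iff)
qed

lemma supp_by_empty: assumes "a \<in> hm A P" "supp_by \<iota> {} a" shows "a = zm A P"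
proof -
  have "ID P \<cdot> a = zm A P" by (rule supp_byD[OF assms(2,1)]) (use assms Hom_Ob in \<open>auto simp: Hom_iff\<close>)
  then show ?thesis using assms by (auto simp: Hom_iff)
qed

text \<open>Peeling off one component p_i a at a time presents \<open>a\<close> as a finite sum of
  morphisms \<iota>_i x. This induction is how finite sums are handled from here on.\<close>

lemma supp_by_induct:
  assumes "finite F" "is_coproduct C I X P \<iota>" "a \<in> hm A P" "supp_by \<iota> F a" "F \<subseteq> I"
    and Q0: "Q (zm A P)"
    and Qadd: "\<And>b i x. i \<in> I \<Longrightarrow> b \<in> hm A P \<Longrightarrow> x \<in> hm A (X i) \<Longrightarrow> Q b \<Longrightarrow> Q (b \<boxplus> \<iota> i \<cdot> x)"
  shows "Q a"
  using assms(1,3-5)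
proof (induction F arbitrary: a)
  case empty
  then show ?case using Q0 supp_by_empty by metis
next
  case (insert i F)
  obtain p where p: "\<And>i. i \<in> I \<Longrightarrow> p i \<in> hm P (X i)" "\<And>i. i \<in> I \<Longrightarrow> p i \<cdot> \<iota> i = ID (X i)"
    "\<And>i j. i \<in> I \<Longrightarrow> j \<in> I \<Longrightarrow> i \<noteq> j \<Longrightarrow> p i \<cdot> \<iota> j = zm (X j) (X i)"
    using coproduct_proj[OF assms(2)] by blast
  have i: "i \<in> I" and F: "F \<subseteq> I" using insert by auto
  note \<iota> = coproduct_inj[OF assms(2) i] and a = insert.prems(1)
  let ?b = "a \<boxminus> \<iota> i \<cdot> (p i \<cdot> a)"
  have b: "?b \<in> hm A P" using a p(1)[OF i] \<iota> by (auto simp: Hom_iff)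
  have "Q ?b" using insert.IH[OF b _ F] supp_by_remove[OF assms(2) a insert.prems(2) i F p] by blast
  moreover have "a = ?b \<boxplus> \<iota> i \<cdot> (p i \<cdot> a)" using a p(1)[OF i] \<iota> by (auto simp: Hom_iff)
  moreover have "p i \<cdot> a \<in> hm A (X i)" using a p(1)[OF i] Comp_Hom by blast
  ultimately show ?case using Qadd[OF i b] by metis
qed

lemma fin_supp_induct [consumes 3, case_names zero add]:
  assumes "is_coproduct C I X P \<iota>" "a \<in> hm A P" "fin_supp I \<iota> a"
    and "Q (zm A P)"
    and "\<And>b i x. i \<in> I \<Longrightarrow> b \<in> hm A P \<Longrightarrow> x \<in> hm A (X i) \<Longrightarrow> Q b \<Longrightarrow> Q (b \<boxplus> \<iota> i \<cdot> x)"
  shows "Q a"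
  using assms(3) supp_by_induct[OF _ assms(1,2)] assms(4,5) unfolding fin_supp_def by metis

text \<open>If p_i a = 0, then removing the index i from the support leaves \<open>a\<close>
  unchanged, so the support shrinks to the empty set.\<close>

lemma fin_supp_zero:
  assumes cop: "is_coproduct C I X P \<iota>" and a: "a \<in> hm A P" and fs: "fin_supp I \<iota> a"
    and p: "\<And>i. i \<in> I \<Longrightarrow> p i \<in> hm P (X i)" "\<And>i. i \<in> I \<Longrightarrow> p i \<cdot> \<iota> i = ID (X i)"
      "\<And>i j. i \<in> I \<Longrightarrow> j \<in> I \<Longrightarrow> i \<noteq> j \<Longrightarrow> p i \<cdot> \<iota> j = zm (X j) (X i)"
    and 0: "\<And>i. i \<in> I \<Longrightarrow> p i \<cdot> a = zm A (X i)"
  shows "a = zm A P"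
proof -
  obtain F where F: "finite F" "F \<subseteq> I" "supp_by \<iota> F a" using fs unfolding fin_supp_def by blast
  show ?thesis using F
  proof (induction F)
    case empty
    then show ?case using supp_by_empty[OF a] by blast
  next
    case (insert i F)
    have i: "i \<in> I" and FI: "F \<subseteq> I" using insert by auto
    have Ob: "A \<in> Ob C" "P \<in> Ob C" using a Hom_Ob by blast+
    have "a \<boxminus> \<iota> i \<cdot> (p i \<cdot> a) = a" using a 0[OF i] coproduct_inj[OF cop i] Ob by (simp add: Hom_iff)
    then have "supp_by \<iota> F a" using supp_by_remove[OF cop a insert.prems(2) i FI p] by simp
    then show ?case using insert.IH FI by blast
  qed
qed

lemma comp_finprod:
  assumes "finite F" "f \<in> F \<rightarrow> hm A P" "u \<in> hm P Y" "A \<in> Ob C"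
  shows "u \<cdot> finprod (hom_group C A P) f F = finprod (hom_group C A Y) (\<lambda>i. u \<cdot> f i) F"
proof -
  have Ob: "P \<in> Ob C" "Y \<in> Ob C" using assms(3) Hom_Ob by blast+
  interpret G: comm_group "hom_group C A P" using assms Ob hom_comm_group by blast
  interpret H: comm_group "hom_group C A Y" using assms Ob hom_comm_group by blast
  show ?thesis using assms(1,2)
  proof (induction F)
    case empty
    then show ?case unfolding G.finprod_empty H.finprod_empty using assms Ob by (simp add: hom_group_def Hom_iff)
  next
    case (insert i F)
    have f: "f \<in> F \<rightarrow> carrier (hom_group C A P)" "f i \<in> carrier (hom_group C A P)"
      using insert by (auto simp: hom_group_def)
    have uf: "(\<lambda>i. u \<cdot> f i) \<in> F \<rightarrow> carrier (hom_group C A Y)" "u \<cdot> f i \<in> carrier (hom_group C A Y)"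
      using insert Comp_Hom[OF _ assms(3)] by (auto simp: hom_group_def)
    have "finprod (hom_group C A P) f F \<in> hm A P"
      using G.finprod_closed[OF f(1)] by (simp add: hom_group_def)
    moreover have "u \<cdot> finprod (hom_group C A P) f F = finprod (hom_group C A Y) (\<lambda>i. u \<cdot> f i) F"
      using insert by blast
    ultimately show ?case
      unfolding G.finprod_insert[OF insert(1,2) f] H.finprod_insert[OF insert(1,2) uf]
      using f assms(3) by (simp add: hom_group_def Hom_iff)
  qed
qed

section \<open>Compactness as finite support of all morphisms into small coproducts\<close>

lemma compact_objectD:
  fixes I :: "'u set" and \<kappa> :: "'u rel"
  assumes "compact_object \<kappa> C A" "small \<kappa> I" "is_coproduct C I X P \<iota>" "a \<in> hm A P"
  shows "fin_supp I \<iota> a"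
proof -
  let ?G = "hom_group C A P"
  note \<iota> = coproduct_inj[OF assms(3)]
  have X: "X i \<in> Ob C" if "i \<in> I" for i using \<iota>[OF that] Hom_Ob by blast
  have A: "A \<in> Ob C" "P \<in> Ob C" using assms(4) Hom_Ob by blast+
  interpret G: comm_group ?G using A hom_comm_group by blast
  have "(\<lambda>x. gfinprod ?G (\<lambda>i. \<iota> i \<cdot> x i) I) \<in> iso (sum_group I (\<lambda>i. hom_group C A (X i))) ?G"
    using assms(1)[unfolded compact_object_def, THEN conjunct2, rule_format, of I X P \<iota>] assms(2,3) X by auto
  then have "a \<in> (\<lambda>x. gfinprod ?G (\<lambda>i. \<iota> i \<cdot> x i) I) ` carrier (sum_group I (\<lambda>i. hom_group C A (X i)))"
    using assms(4) unfolding iso_def bij_betw_def by (auto simp: hom_group_def)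
  then obtain x where x: "x \<in> carrier (sum_group I (\<lambda>i. hom_group C A (X i)))"
    and a: "a = gfinprod ?G (\<lambda>i. \<iota> i \<cdot> x i) I" by blast
  have xi: "x i \<in> hm A (X i)" if "i \<in> I" for i
    using x that by (subst (asm) carrier_sum_group)
      (auto simp: hom_group_def PiE_iff intro!: comm_group.axioms(2) hom_comm_group[unfolded hom_group_def] A X)
  let ?F = "{i \<in> I. \<iota> i \<cdot> x i \<noteq> zm A P}"
  show ?thesis
  proof (cases "finite ?F")
    case True
    have "supp_by \<iota> ?F a"
    proof (rule supp_byI[OF assms(4)])
      fix u Y assume u: "u \<in> hm P Y" "\<And>i. i \<in> ?F \<Longrightarrow> u \<cdot> \<iota> i = zm (Dom C (\<iota> i)) Y"
      have Y: "Y \<in> Ob C" using u Hom_Ob by blast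
      interpret H: comm_group "hom_group C A Y" using A Y hom_comm_group by blast
      have "a = finprod ?G (\<lambda>i. \<iota> i \<cdot> x i) ?F"
        unfolding a gfinprod_def using True by (simp add: hom_group_def)
      also have "u \<cdot> \<dots> = finprod (hom_group C A Y) (\<lambda>i. u \<cdot> (\<iota> i \<cdot> x i)) ?F"
        by (rule comp_finprod) (use True xi \<iota> u A Comp_Hom in blast)+
      also have "\<dots> = \<one>\<^bsub>hom_group C A Y\<^esub>"
      proof (rule H.finprod_one_eqI)
        fix i assume i: "i \<in> ?F"
        then have "u \<cdot> (\<iota> i \<cdot> x i) = (u \<cdot> \<iota> i) \<cdot> x i" using u(1) xi[of i] \<iota>[of i] by (auto simp: Hom_iff)
        also have "u \<cdot> \<iota> i = zm (X i) Y" using u(2)[OF i] \<iota>[of i] i by (simp add: Hom_iff)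
        also have "zm (X i) Y \<cdot> x i = zm A Y" using xi[of i] i Y by (auto simp: Hom_iff)
        finally show "u \<cdot> (\<iota> i \<cdot> x i) = \<one>\<^bsub>hom_group C A Y\<^esub>" by (simp add: hom_group_def)
      qed
      finally show "u \<cdot> a = zm A Y" by (simp add: hom_group_def)
    qed
    then show ?thesis unfolding fin_supp_def using True by blast
  next
    \<comment> \<open>\<open>gfinprod\<close> is the unit by convention when infinitely many terms
      are nontrivial, so here \<open>a\<close> is zero and has empty support.\<close>
    case False
    then have "a = zm A P" unfolding a gfinprod_def by (simp add: hom_group_def)
    then have "supp_by \<iota> {} a" by (intro supp_byI[OF assms(4)]) (use A Hom_Ob in \<open>auto simp: Hom_iff\<close>)
    then show ?thesis unfolding fin_supp_def by blast
  qed
qed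

text \<open>Finite support yields the full isomorphism of the definition: the canonical map is
  injective because p_k recovers the k-th component of a sum, and surjective because
  \<open>a\<close> and the sum of the \<iota>_i p_i a have the same components, while a finitely
  supported morphism with zero components is zero.\<close>

lemma compact_objectI:
  fixes \<kappa> :: "'u rel"
  assumes A: "A \<in> Ob C"
    and fs: "\<And>(I :: 'u set) X P \<iota> a. \<lbrakk>small \<kappa> I; is_coproduct C I X P \<iota>; a \<in> hm A P\<rbrakk> \<Longrightarrow> fin_supp I \<iota> a"
  shows "compact_object \<kappa> C A"
  unfolding compact_object_def
proof (intro conjI allI impI)
  fix I :: "'u set" and X P \<iota>
  assume "small \<kappa> I \<and> X \<in> I \<rightarrow> Ob C \<and> is_coproduct C I X P \<iota>"
  then have sm: "small \<kappa> I" and cop: "is_coproduct C I X P \<iota>" by auto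
  note \<iota> = coproduct_inj[OF cop]
  have X: "X i \<in> Ob C" if "i \<in> I" for i using \<iota>[OF that] Hom_Ob by blast
  have P: "P \<in> Ob C" using coproduct_Ob[OF cop] .
  obtain p where p: "\<And>i. i \<in> I \<Longrightarrow> p i \<in> hm P (X i)" "\<And>i. i \<in> I \<Longrightarrow> p i \<cdot> \<iota> i = ID (X i)"
    "\<And>i j. i \<in> I \<Longrightarrow> j \<in> I \<Longrightarrow> i \<noteq> j \<Longrightarrow> p i \<cdot> \<iota> j = zm (X j) (X i)"
    using coproduct_proj[OF cop] by blast
  let ?G = "hom_group C A P" and ?S = "sum_group I (\<lambda>i. hom_group C A (X i))"
  let ?h = "\<lambda>x. gfinprod ?G (\<lambda>i. \<iota> i \<cdot> x i) I"
  interpret G: comm_group ?G using A P hom_comm_group by blast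
  have gX: "group (hom_group C A (X i))" if "i \<in> I" for i
    using comm_group.axioms(2) hom_comm_group A X that by blast
  have car: "carrier ?S = {x \<in> \<Pi>\<^sub>E i\<in>I. hm A (X i). finite {i \<in> I. x i \<noteq> zm A (X i)}}"
    using carrier_sum_group[OF gX] by (simp add: hom_group_def)
  have hom: "?h \<in> hom ?S ?G"
    using \<iota> X A P by (intro G.hom_group_sum) (auto simp: hom_def hom_group_def Hom_iff intro!: gX[unfolded hom_group_def])
  have ph: "p k \<cdot> ?h x = x k" if x: "x \<in> carrier ?S" and k: "k \<in> I" for x k
  proof -
    let ?F = "{i \<in> I. \<iota> i \<cdot> x i \<noteq> zm A P}"
    have xi: "x i \<in> hm A (X i)" if "i \<in> I" for i using x that unfolding car by auto
    have "?F \<subseteq> {i \<in> I. x i \<noteq> zm A (X i)}" using \<iota> A by (auto simp: Hom_iff)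
    then have fin: "finite ?F" using x finite_subset unfolding car by blast
    interpret H: comm_group "hom_group C A (X k)" using A X k hom_comm_group by blast
    have "p k \<cdot> ?h x = p k \<cdot> finprod ?G (\<lambda>i. \<iota> i \<cdot> x i) ?F"
      unfolding gfinprod_def using fin by (simp add: hom_group_def)
    also have "\<dots> = finprod (hom_group C A (X k)) (\<lambda>i. p k \<cdot> (\<iota> i \<cdot> x i)) ?F"
      by (rule comp_finprod) (use fin xi \<iota> p k A Comp_Hom in blast)+
    also have "\<dots> = finprod (hom_group C A (X k)) (\<lambda>i. if k = i then x k else \<one>\<^bsub>hom_group C A (X k)\<^esub>) ?F"
    proof (rule H.finprod_cong')
      fix i assume i: "i \<in> ?F"
      have "p k \<cdot> (\<iota> i \<cdot> x i) = (p k \<cdot> \<iota> i) \<cdot> x i" using p(1)[OF k] xi[of i] \<iota>[of i] i by (auto simp: Hom_iff)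
      then show "p k \<cdot> (\<iota> i \<cdot> x i) = (if k = i then x k else \<one>\<^bsub>hom_group C A (X k)\<^esub>)"
        using p(2,3)[OF k] xi[of i] X[OF k] i by (auto simp: hom_group_def Hom_iff)
    qed (use xi A X[OF k] in \<open>auto simp: hom_group_def intro: zero_Hom\<close>)
    also have "\<dots> = x k"
    proof (cases "k \<in> ?F")
      case True
      have "(\<lambda>_. x k) \<in> ?F \<rightarrow> carrier (hom_group C A (X k))"
        using xi[OF k] by (auto simp: hom_group_def)
      then show ?thesis using H.finprod_singleton[OF True fin] by simp
    next
      case False
      then have z: "\<iota> k \<cdot> x k = zm A P" using k by auto
      have "x k = (p k \<cdot> \<iota> k) \<cdot> x k" using p(2)[OF k] xi[OF k] by (auto simp: Hom_iff)
      also have "\<dots> = p k \<cdot> zm A P" using z p(1)[OF k] \<iota>[OF k] xi[OF k] by (auto simp: Hom_iff)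
      finally have "x k = zm A (X k)" using p(1)[OF k] A by (auto simp: Hom_iff)
      then show ?thesis using False
        by (subst H.finprod_one_eqI) (auto simp: hom_group_def)
    qed
    finally show ?thesis .
  qed
  have hclosed: "?h x \<in> hm A P" if "x \<in> carrier ?S" for x
    using hom that by (auto simp: hom_def hom_group_def)
  have "inj_on ?h (carrier ?S)"
  proof (rule inj_onI)
    fix x y assume xy: "x \<in> carrier ?S" "y \<in> carrier ?S" "?h x = ?h y"
    show "x = y" by (rule PiE_ext[of _ I "\<lambda>i. hm A (X i)"]) (use xy ph[OF xy(1)] ph[OF xy(2)] car in auto)
  qed
  moreover have "\<exists>x\<in>carrier ?S. ?h x = a" if a: "a \<in> hm A P" for a
  proof -
    obtain F where F: "finite F" "F \<subseteq> I" "supp_by \<iota> F a" using fs[OF sm cop a] unfolding fin_supp_def by blast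
    \<comment> \<open>The candidate preimage consists of the components of \<open>a\<close>. They
      vanish outside \<open>F\<close> because p_i kills every \<iota>_j with j in
      \<open>F\<close>.\<close>
    define x where "x = (\<lambda>i\<in>I. p i \<cdot> a)"
    have p0: "p i \<cdot> a = zm A (X i)" if "i \<in> I" "i \<notin> F" for i
    proof (rule supp_byD[OF F(3) a p(1)[OF that(1)]])
      fix j assume "j \<in> F"
      then have "j \<in> I" "i \<noteq> j" using F(2) that by auto
      then show "p i \<cdot> \<iota> j = zm (Dom C (\<iota> j)) (X i)" using p(3)[OF that(1)] \<iota>[of j] by (auto simp: Hom_iff)
    qed
    have "{i \<in> I. x i \<noteq> zm A (X i)} \<subseteq> F" using p0 unfolding x_def by auto
    then have "finite {i \<in> I. x i \<noteq> zm A (X i)}" using F(1) finite_subset by blast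
    moreover have "x \<in> (\<Pi>\<^sub>E i\<in>I. hm A (X i))" using p(1) a by (auto simp: x_def intro: Comp_Hom)
    ultimately have xS: "x \<in> carrier ?S" unfolding car by simp
    define b where "b = a \<boxminus> ?h x"
    have b: "b \<in> hm A P" unfolding b_def using a hclosed[OF xS] by (auto simp: Hom_iff)
    have "b = zm A P"
    proof (rule fin_supp_zero[OF cop b fs[OF sm cop b] p])
      fix i assume i: "i \<in> I"
      have "x i = p i \<cdot> a" using i by (simp add: x_def)
      then show "p i \<cdot> b = zm A (X i)"
        unfolding b_def using a hclosed[OF xS] ph[OF xS i] p(1)[OF i] by (auto simp: Hom_iff)
    qed
    then have "a = ?h x" unfolding b_def using a hclosed[OF xS] diff_eq_zero[of a "?h x"] by (auto simp: Hom_iff)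
    then show ?thesis using xS by blast
  qed
  ultimately have "bij_betw ?h (carrier ?S) (hm A P)"
    unfolding bij_betw_def using hclosed by (auto simp: image_iff)
  then show "?h \<in> iso ?S ?G" using hom unfolding iso_def by (simp add: hom_group_def)
qed (rule A)

text \<open>Since a = (a i)p + (a j)q, supports of the two restrictions a i and a j together support
  \<open>a\<close>.\<close>

lemma compact_biproduct:
  assumes "compact_object \<kappa> C A" "compact_object \<kappa> C B"
    "i \<in> hm A P" "j \<in> hm B P" "p \<in> hm P A" "q \<in> hm P B" "i \<cdot> p \<boxplus> j \<cdot> q = ID P"
  shows "compact_object \<kappa> C P"
proof (rule compact_objectI)
  show P: "P \<in> Ob C" using assms Hom_Ob by blast
  fix I :: "'a set" and X Q \<iota> a
  assume 1: "small \<kappa> I" "is_coproduct C I X Q \<iota>" "a \<in> hm P Q"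
  have ai: "a \<cdot> i \<in> hm A Q" "a \<cdot> j \<in> hm B Q" using assms 1 Comp_Hom by blast+
  obtain F where F: "finite F" "F \<subseteq> I" "supp_by \<iota> F (a \<cdot> i)"
    using compact_objectD[OF assms(1) 1(1,2) ai(1)] unfolding fin_supp_def by blast
  obtain F' where F': "finite F'" "F' \<subseteq> I" "supp_by \<iota> F' (a \<cdot> j)"
    using compact_objectD[OF assms(2) 1(1,2) ai(2)] unfolding fin_supp_def by blast
  have "supp_by \<iota> (F \<union> F') a"
  proof (rule supp_byI[OF 1(3)])
    fix u Y assume u: "u \<in> hm Q Y" "\<And>i. i \<in> F \<union> F' \<Longrightarrow> u \<cdot> \<iota> i = zm (Dom C (\<iota> i)) Y"
    have 2: "u \<cdot> (a \<cdot> i) = zm A Y" "u \<cdot> (a \<cdot> j) = zm B Y"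
      using supp_byD[OF F(3) ai(1) u(1)] supp_byD[OF F'(3) ai(2) u(1)] u(2) by auto
    have Y: "Y \<in> Ob C" using u Hom_Ob by blast
    have "u \<cdot> a = u \<cdot> a \<cdot> (i \<cdot> p \<boxplus> j \<cdot> q)" using assms u 1(3) by (auto simp: Hom_iff)
    also have "\<dots> = u \<cdot> (a \<cdot> i) \<cdot> p \<boxplus> u \<cdot> (a \<cdot> j) \<cdot> q"
      using assms(3-6) u(1) 1(3) by (simp add: Hom_iff)
    also have "\<dots> = zm P Y" unfolding 2 using assms P Y by (simp add: Hom_iff)
    finally show "u \<cdot> a = zm P Y" .
  qed
  then show "fin_supp I \<iota> a" using F F' unfolding fin_supp_def by blast
qed

end

section \<open>Triangulated categories\<close>

context triangulated_category
begin

notation add (infixl \<open>\<boxplus>\<close> 65)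
notation neg (\<open>\<boxminus> _\<close> [80] 80)
notation diff (infixl \<open>\<boxminus>\<close> 65)

abbreviation tri where "tri \<equiv> dist_triangle T"

lemma Sh_Ob [simp]: "A \<in> Ob T \<Longrightarrow> ShOb T A \<in> Ob T"
  using ShOb_bij bij_betwE by blast

lemma Sh_Mor [simp]: assumes "f \<in> Mor T"
  shows "ShMor T f \<in> Mor T" "Dom T (ShMor T f) = ShOb T (Dom T f)" "Cod T (ShMor T f) = ShOb T (Cod T f)"
  using ShMor_Hom[of f "Dom T f" "Cod T f"] assms by (auto simp: Hom_iff)

lemma Sh_Id [simp]: "A \<in> Ob T \<Longrightarrow> ShMor T (ID A) = ID (ShOb T A)"
  by (rule ShMor_Id)

lemma Sh_comp [simp]: "\<lbrakk>f \<in> Mor T; g \<in> Mor T; Cod T f = Dom T g\<rbrakk> \<Longrightarrow> ShMor T (g \<cdot> f) = ShMor T g \<cdot> ShMor T f"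
  by (rule ShMor_Comp[of f "Dom T f" "Cod T f" g "Cod T g"]) (simp_all add: Hom_iff)

lemma Sh_add [simp]: "\<lbrakk>f \<in> Mor T; g \<in> Mor T; Dom T f = Dom T g; Cod T f = Cod T g\<rbrakk>
    \<Longrightarrow> ShMor T (f \<boxplus> g) = ShMor T f \<boxplus> ShMor T g"
  by (rule ShMor_Add[of f "Dom T f" "Cod T f" g]) (simp_all add: Hom_iff)

lemma Sh_zero [simp]: assumes "A \<in> Ob T" "B \<in> Ob T" shows "ShMor T (zm A B) = zm (ShOb T A) (ShOb T B)"
proof -
  have "ShMor T (zm A B) \<boxplus> ShMor T (zm A B) = ShMor T (zm A B \<boxplus> zm A B)"
    using assms by (subst Sh_add) auto
  also have "\<dots> = ShMor T (zm A B)" using assms by simp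
  finally show ?thesis using add_idem_zero[of "ShMor T (zm A B)"] assms by auto
qed

lemma Sh_neg [simp]: assumes "f \<in> Mor T" shows "ShMor T (\<boxminus> f) = \<boxminus> ShMor T f"
proof -
  have "ShMor T (f \<boxminus> f) = zm (ShOb T (Dom T f)) (ShOb T (Cod T f))" using assms by (subst add_neg) auto
  then show ?thesis using assms by (intro neg_unique[symmetric]) (auto simp: Sh_add[symmetric] simp del: Sh_add)
qed

lemma Sh_inj: "f \<in> Mor T \<Longrightarrow> g \<in> Mor T \<Longrightarrow> ShMor T f = ShMor T g \<longleftrightarrow> f = g"
  using ShMor_bij unfolding bij_betw_def inj_on_def by blast

lemma ShOb_inj: "A \<in> Ob T \<Longrightarrow> B \<in> Ob T \<Longrightarrow> ShOb T A = ShOb T B \<longleftrightarrow> A = B"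
  using ShOb_bij unfolding bij_betw_def inj_on_def by blast

lemma ShOb_surj: "A \<in> Ob T \<Longrightarrow> \<exists>B \<in> Ob T. A = ShOb T B"
  using ShOb_bij unfolding bij_betw_def by blast

lemma ShMor_surj: assumes "f \<in> hm (ShOb T A) (ShOb T B)" "A \<in> Ob T" "B \<in> Ob T"
  obtains g where "g \<in> hm A B" "f = ShMor T g"
proof -
  obtain g where g: "g \<in> Mor T" "f = ShMor T g" using ShMor_bij assms unfolding bij_betw_def Hom_iff by blast
  then have "ShOb T (Dom T g) = ShOb T A" "ShOb T (Cod T g) = ShOb T B" using assms by (auto simp: Hom_iff)
  then have "g \<in> hm A B" using g assms ShOb_inj by (auto simp: Hom_iff)
  then show thesis using that g by blast
qed

lemma tri_Hom: "tri A B D f g h \<Longrightarrow> f \<in> hm A B \<and> g \<in> hm B D \<and> h \<in> hm D (ShOb T A) \<and> A \<in> Ob T \<and> B \<in> Ob T \<and> D \<in> Ob T"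
  unfolding dist_triangle_def triangle_def using Hom_Ob by blast

lemma tri_rotate: "tri A B D f g h \<Longrightarrow> tri B D (ShOb T A) g h (\<boxminus> ShMor T f)"
  using tri_Hom[of A B D f g h] TR2[of A B D f g h] ShMor_Hom[of f A B]
  unfolding dist_triangle_def triangle_def by (auto simp: Hom_iff)

text \<open>The sign on \<open>h\<close> is forced: the axiom TR2 for a triangle with first map -h
  produces the third map -\<Sigma>(-h) = \<Sigma>h.\<close>

lemma tri_rotate_back: assumes "tri A B (ShOb T D) f g (ShMor T h)" "h \<in> hm D A"
  shows "tri D A B (\<boxminus> h) f g"
proof -
  note t = tri_Hom[OF assms(1)]
  have tr: "triangle T D A B (\<boxminus> h) f g" using t assms(2) unfolding triangle_def by (auto simp: Hom_iff)
  have "\<boxminus> ShMor T (\<boxminus> h) = ShMor T h" using assms(2) by (auto simp: Hom_iff)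
  then show ?thesis using TR2[OF tr] tr assms(1) unfolding dist_triangle_def by metis
qed

text \<open>This is where the shift being an automorphism pays off: the third object and the third
  map of a triangle are shifts on the nose.\<close>

lemma tri_unrotate: assumes "tri A B D f g h"
  obtains D' k where "D = ShOb T D'" "h = ShMor T k" "k \<in> hm D' A" "tri D' A B (\<boxminus> k) f g"
proof -
  note t = tri_Hom[OF assms]
  obtain D' where D: "D' \<in> Ob T" "D = ShOb T D'" using ShOb_surj t by metis
  obtain k where "k \<in> hm D' A" "h = ShMor T k" using ShMor_surj[of h D' A] t D by blast
  then show thesis using that D assms tri_rotate_back by blast
qed

lemma obtain_cone: assumes "f \<in> hm A B" obtains D g h where "tri A B D f g h"
  using TR1_cone[OF assms] by blast

text \<open>The maps id and \<open>f\<close> start a morphism from the triangle A = A -> 0 to the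
  given one; its third component shows that g f factors through a zero object.\<close>

lemma tri_comp: assumes "tri A B D f g h" shows "g \<cdot> f = zm A D"
proof -
  note t = tri_Hom[OF assms]
  obtain Z where Z: "zero_object T Z" using ex_zero_object by blast
  have ZO: "Z \<in> Ob T" using Z unfolding zero_object_def by blast
  have i: "tri A A Z (ID A) (zm A Z) (zm Z (ShOb T A))"
    unfolding dist_triangle_def triangle_def using TR1_id[OF _ Z] t ZO by (auto simp: Hom_iff)
  have "\<exists>c\<in>hm Z D. c \<cdot> zm A Z = g \<cdot> f \<and> ShMor T (ID A) \<cdot> zm Z (ShOb T A) = h \<cdot> c"
    by (rule TR3[OF i assms, of "ID A" f]) (use t in \<open>auto simp: Hom_iff\<close>)
  then obtain c where c: "c \<in> hm Z D" "c \<cdot> zm A Z = g \<cdot> f" by blast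
  have "c \<cdot> zm A Z = zm A D" using c(1) t by (auto simp: Hom_iff)
  then show ?thesis using c(2) by simp
qed

lemma tri_comp': assumes "tri A B D f g h" shows "h \<cdot> g = zm B (ShOb T A)"
  using tri_comp[OF tri_rotate[OF assms]] .

text \<open>The condition x f = 0 makes the zero map and \<open>x\<close> the start of a morphism to
  the triangle D' -> X = X, where D' is the desuspension of a zero object. The third component
  supplied by TR3 is the extension.\<close>

lemma tri_extend: assumes "tri A B D f g h" "x \<in> hm B X" "x \<cdot> f = zm A X"
  obtains y where "y \<in> hm D X" "x = y \<cdot> g"
proof -
  note t = tri_Hom[OF assms(1)]
  have X: "X \<in> Ob T" using assms Hom_Ob by blast
  obtain Z where Z: "zero_object T Z" using ex_zero_object by blast
  have ZO: "Z \<in> Ob T" using Z unfolding zero_object_def by blast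
  have i: "tri X X Z (ID X) (zm X Z) (zm Z (ShOb T X))"
    unfolding dist_triangle_def triangle_def using TR1_id[OF _ Z] X ZO by (auto simp: Hom_iff)
  obtain D' k where k: "Z = ShOb T D'" "k \<in> hm D' X" "tri D' X X (\<boxminus> k) (ID X) (zm X Z)"
    using tri_unrotate[OF i] by metis
  have D': "D' \<in> Ob T" using k(2) Hom_Ob by blast
  have zA: "zm A D' \<in> hm A D'" using t D' zero_Hom by blast
  have eq: "x \<cdot> f = (\<boxminus> k) \<cdot> zm A D'" using assms(3) k(2) t D' X by (simp add: Hom_iff)
  obtain c where c: "c \<in> hm D X" "c \<cdot> g = ID X \<cdot> x"
    using TR3[OF assms(1) k(3) zA assms(2) eq] by blast
  have "x = c \<cdot> g" using c(2) assms(2) by (simp add: Hom_iff)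
  then show thesis using that c(1) by blast
qed

text \<open>TR3 fills only the third position, so both the given triangle and X = X -> 0 are rotated
  once. The filler is then a map \<Sigma>X -> \<Sigma>A, and its desuspension is the lift; the signs
  of the two rotations cancel.\<close>

lemma tri_lift: assumes "tri A B D f g h" "x \<in> hm X B" "g \<cdot> x = zm X D"
  obtains y where "y \<in> hm X A" "x = f \<cdot> y"
proof -
  note t = tri_Hom[OF assms(1)]
  have X: "X \<in> Ob T" using assms Hom_Ob by blast
  obtain Z where Z: "zero_object T Z" using ex_zero_object by blast
  have ZO: "Z \<in> Ob T" using Z unfolding zero_object_def by blast
  have i: "tri X X Z (ID X) (zm X Z) (zm Z (ShOb T X))"
    unfolding dist_triangle_def triangle_def using TR1_id[OF _ Z] X ZO by (auto simp: Hom_iff)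
  have "zm Z D \<cdot> zm X Z = g \<cdot> x" using assms t ZO X by (auto simp: Hom_iff)
  then obtain c where c: "c \<in> hm (ShOb T X) (ShOb T A)" "ShMor T x \<cdot> (\<boxminus> ShMor T (ID X)) = (\<boxminus> ShMor T f) \<cdot> c"
    using TR3[OF tri_rotate[OF i] tri_rotate[OF assms(1)], of x "zm Z D"] t assms ZO by (auto simp: Hom_iff)
  obtain y where y: "y \<in> hm X A" "c = ShMor T y" using ShMor_surj[OF c(1)] X t by blast
  have "\<boxminus> ShMor T x = \<boxminus> ShMor T (f \<cdot> y)" using c(2) y assms(2) t X by (simp add: Hom_iff)
  then have "ShMor T x = ShMor T (f \<cdot> y)" using neg_neg y assms(2) t
    by (metis Hom_iff Sh_Mor(1) Comp_Mor(1))
  then have "x = f \<cdot> y" using Sh_inj[of x "f \<cdot> y"] y assms(2) t by (auto simp: Hom_iff)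
  then show thesis using that y by blast
qed

text \<open>Exactness of (D,X) -> (B,X) -> (A,X). All translations between annihilation,
  divisibility and torsionfreeness rest on this equality.\<close>

lemma tri_pim: assumes "tri A B D f g h" shows "pim g X = {x \<in> hm B X. x \<cdot> f = zm A X}"
proof -
  note t = tri_Hom[OF assms]
  have "x \<cdot> f = zm A X" if x: "x \<in> pim g X" for x
  proof -
    obtain b where b: "b \<in> hm D X" "x = b \<cdot> g" using x t unfolding pim_iff by (auto simp: Hom_iff)
    then show ?thesis using tri_comp[OF assms] t by (auto simp: Hom_iff)
  qed
  moreover have "x \<in> hm B X" if "x \<in> pim g X" for x using pim_Hom[of g] that t by (auto simp: Hom_iff)
  moreover have "x \<in> pim g X" if x: "x \<in> hm B X" "x \<cdot> f = zm A X" for x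
    using tri_extend[OF assms x] t by (metis Hom_iff pimI)
  ultimately show ?thesis by blast
qed

lemma tri_pim_neg: assumes "tri D A B (\<boxminus> k) f g" "k \<in> hm D A" shows "pim f X = {x \<in> hm A X. x \<cdot> k = zm D X}"
  unfolding tri_pim[OF assms(1)] using comp_neg_zero_iff[OF _ assms(2)] by blast

section \<open>Compact objects under shift and cones\<close>

lemma coproduct_Sh: "is_coproduct T I X P \<iota> \<longleftrightarrow>
    is_coproduct T I (\<lambda>i. ShOb T (X i)) (ShOb T P) (\<lambda>i. ShMor T (\<iota> i))"
  if PX: "P \<in> Ob T" "\<And>i. i \<in> I \<Longrightarrow> \<iota> i \<in> hm (X i) P"
proof
  assume c: "is_coproduct T I X P \<iota>"
  show "is_coproduct T I (\<lambda>i. ShOb T (X i)) (ShOb T P) (\<lambda>i. ShMor T (\<iota> i))"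
    unfolding is_coproduct_def
  proof (intro conjI ballI allI impI)
    fix Y \<phi> assume Y: "Y \<in> Ob T" and \<phi>: "\<forall>i\<in>I. \<phi> i \<in> hm (ShOb T (X i)) Y"
    obtain Y' where Y': "Y' \<in> Ob T" "Y = ShOb T Y'" using ShOb_surj Y by blast
    have "\<exists>\<psi>. \<psi> \<in> hm (X i) Y' \<and> \<phi> i = ShMor T \<psi>" if "i \<in> I" for i
      using ShMor_surj[of "\<phi> i" "X i" Y'] \<phi> Y' that PX(2)[OF that] Hom_Ob by metis
    then obtain \<psi> where \<psi>: "\<And>i. i \<in> I \<Longrightarrow> \<psi> i \<in> hm (X i) Y' \<and> \<phi> i = ShMor T (\<psi> i)" by metis
    obtain u where u: "u \<in> hm P Y'" "\<And>i. i \<in> I \<Longrightarrow> u \<cdot> \<iota> i = \<psi> i"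
      using coproduct_induced[OF c Y'(1), of \<psi>] \<psi> by blast
    show "\<exists>!u. u \<in> hm (ShOb T P) Y \<and> (\<forall>i\<in>I. u \<cdot> ShMor T (\<iota> i) = \<phi> i)"
    proof (intro ex1I[of _ "ShMor T u"] conjI ballI)
      show "ShMor T u \<in> hm (ShOb T P) Y" using u Y' ShMor_Hom by blast
      show "ShMor T u \<cdot> ShMor T (\<iota> i) = \<phi> i" if "i \<in> I" for i
        using u(2)[OF that] \<psi>[OF that] ShMor_Comp[OF PX(2)[OF that] u(1)] by simp
      fix w assume w: "w \<in> hm (ShOb T P) Y \<and> (\<forall>i\<in>I. w \<cdot> ShMor T (\<iota> i) = \<phi> i)"
      then obtain v where v: "v \<in> hm P Y'" "w = ShMor T v" using ShMor_surj[of w P Y'] Y' PX by auto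
      have "v = u"
      proof (rule coproduct_ext[OF c v(1) u(1)])
        fix i assume i: "i \<in> I"
        have "ShMor T (v \<cdot> \<iota> i) = ShMor T (u \<cdot> \<iota> i)"
          using w v \<psi>[OF i] u(2)[OF i] ShMor_Comp[OF PX(2)[OF i] v(1)] i by simp
        then show "v \<cdot> \<iota> i = u \<cdot> \<iota> i"
          using Sh_inj[of "v \<cdot> \<iota> i" "u \<cdot> \<iota> i"] PX(2)[OF i] v(1) u(1) by (auto simp: Hom_iff)
      qed
      then show "w = ShMor T u" using v by simp
    qed
  qed (use PX ShMor_Hom in auto)
next
  assume c: "is_coproduct T I (\<lambda>i. ShOb T (X i)) (ShOb T P) (\<lambda>i. ShMor T (\<iota> i))"
  show "is_coproduct T I X P \<iota>"
    unfolding is_coproduct_def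
  proof (intro conjI ballI allI impI)
    fix Y \<phi> assume Y: "Y \<in> Ob T" and \<phi>: "\<forall>i\<in>I. \<phi> i \<in> hm (X i) Y"
    obtain u' where u': "u' \<in> hm (ShOb T P) (ShOb T Y)" "\<And>i. i \<in> I \<Longrightarrow> u' \<cdot> ShMor T (\<iota> i) = ShMor T (\<phi> i)"
      using coproduct_induced[OF c Sh_Ob[OF Y], of "\<lambda>i. ShMor T (\<phi> i)"] \<phi> ShMor_Hom by blast
    obtain u where u: "u \<in> hm P Y" "u' = ShMor T u" using ShMor_surj[OF u'(1) PX(1) Y] by blast
    show "\<exists>!u. u \<in> hm P Y \<and> (\<forall>i\<in>I. u \<cdot> \<iota> i = \<phi> i)"
    proof (intro ex1I[of _ u] conjI ballI)
      show "u \<in> hm P Y" by fact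
      show "u \<cdot> \<iota> i = \<phi> i" if i: "i \<in> I" for i
        using u'(2)[OF i] ShMor_Comp[OF PX(2)[OF i] u(1)] u(2) Sh_inj[of "u \<cdot> \<iota> i" "\<phi> i"]
          \<phi> i PX(2)[OF i] u(1) by (auto simp: Hom_iff)
      fix w assume w: "w \<in> hm P Y \<and> (\<forall>i\<in>I. w \<cdot> \<iota> i = \<phi> i)"
      have "ShMor T w = ShMor T u"
      proof (rule coproduct_ext[OF c])
        show "ShMor T w \<in> hm (ShOb T P) (ShOb T Y)" "ShMor T u \<in> hm (ShOb T P) (ShOb T Y)"
          using w u ShMor_Hom by blast+
        fix i assume i: "i \<in> I"
        show "ShMor T w \<cdot> ShMor T (\<iota> i) = ShMor T u \<cdot> ShMor T (\<iota> i)"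
          using ShMor_Comp[OF PX(2)[OF i], of w Y] w i u'(2)[OF i] u(2) by simp
      qed
      then show "w = u" using Sh_inj w u(1) by (auto simp: Hom_iff)
    qed
  qed (use PX in auto)
qed

lemma supp_by_Sh: assumes "a \<in> hm A P" "\<And>i. i \<in> F \<Longrightarrow> \<iota> i \<in> hm (X i) P"
  shows "supp_by (\<lambda>i. ShMor T (\<iota> i)) F (ShMor T a) \<longleftrightarrow> supp_by \<iota> F a"
proof
  assume s: "supp_by (\<lambda>i. ShMor T (\<iota> i)) F (ShMor T a)"
  show "supp_by \<iota> F a"
  proof (rule supp_byI[OF assms(1)])
    fix u Y assume u: "u \<in> hm P Y" "\<And>i. i \<in> F \<Longrightarrow> u \<cdot> \<iota> i = zm (Dom T (\<iota> i)) Y"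
    have Ob: "Y \<in> Ob T" "A \<in> Ob T" using u assms(1) Hom_Ob by blast+
    have "ShMor T u \<cdot> ShMor T a = zm (ShOb T A) (ShOb T Y)"
    proof (rule supp_byD[OF s ShMor_Hom[OF assms(1)] ShMor_Hom[OF u(1)]])
      fix i assume i: "i \<in> F"
      have "ShMor T u \<cdot> ShMor T (\<iota> i) = ShMor T (u \<cdot> \<iota> i)" using ShMor_Comp[OF assms(2)[OF i] u(1)] by simp
      then show "ShMor T u \<cdot> ShMor T (\<iota> i) = zm (Dom T (ShMor T (\<iota> i))) (ShOb T Y)"
        using u(2)[OF i] assms(2)[OF i] Hom_Ob[OF assms(2)[OF i]] Ob by (auto simp: Hom_iff)
    qed
    then have "ShMor T (u \<cdot> a) = ShMor T (zm A Y)" using ShMor_Comp[OF assms(1) u(1)] Ob by simp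
    then show "u \<cdot> a = zm A Y" using Sh_inj[of "u \<cdot> a" "zm A Y"] Ob u(1) assms(1) by (auto simp: Hom_iff)
  qed
next
  assume s: "supp_by \<iota> F a"
  show "supp_by (\<lambda>i. ShMor T (\<iota> i)) F (ShMor T a)"
  proof (rule supp_byI[OF ShMor_Hom[OF assms(1)]])
    fix u' Y' assume u': "u' \<in> hm (ShOb T P) Y'" "\<And>i. i \<in> F \<Longrightarrow> u' \<cdot> ShMor T (\<iota> i) = zm (Dom T (ShMor T (\<iota> i))) Y'"
    have "Y' \<in> Ob T" "P \<in> Ob T" using u'(1) assms(1) Hom_Ob by blast+
    then obtain Y where Y: "Y \<in> Ob T" "Y' = ShOb T Y" using ShOb_surj by blast
    obtain u where u: "u \<in> hm P Y" "u' = ShMor T u" using ShMor_surj[of u' P Y] u'(1) Y \<open>P \<in> Ob T\<close> by blast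
    have "u \<cdot> a = zm A Y"
    proof (rule supp_byD[OF s assms(1) u(1)])
      fix i assume i: "i \<in> F"
      have "ShMor T (u \<cdot> \<iota> i) = ShMor T (zm (Dom T (\<iota> i)) Y)"
        using ShMor_Comp[OF assms(2)[OF i] u(1)] u'(2)[OF i] u(2) assms(2)[OF i] Y
          Hom_Ob[OF assms(2)[OF i]] by (auto simp: Hom_iff)
      then show "u \<cdot> \<iota> i = zm (Dom T (\<iota> i)) Y"
        using Sh_inj[of "u \<cdot> \<iota> i" "zm (Dom T (\<iota> i)) Y"] assms(2)[OF i] u(1) Y
          Hom_Ob[OF assms(2)[OF i]] by (auto simp: Hom_iff)
    qed
    then show "u' \<cdot> ShMor T a = zm (ShOb T A) Y'"
      using ShMor_Comp[OF assms(1) u(1)] u(2) Y assms(1) Hom_Ob by (metis Sh_zero)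
  qed
qed

lemma compact_Sh: "compact_object \<kappa> T (ShOb T A)" if c: "compact_object \<kappa> T A"
proof (rule compact_objectI)
  have A: "A \<in> Ob T" using c unfolding compact_object_def by blast
  then show "ShOb T A \<in> Ob T" by simp
  fix I :: "'a set" and X' P' \<iota>' a'
  assume sm: "small \<kappa> I" and cop: "is_coproduct T I X' P' \<iota>'" and a': "a' \<in> hm (ShOb T A) P'"
  obtain P where P: "P \<in> Ob T" "P' = ShOb T P" using ShOb_surj coproduct_Ob[OF cop] by blast
  have "\<exists>X \<iota>. X' i = ShOb T X \<and> \<iota> \<in> hm X P \<and> \<iota>' i = ShMor T \<iota>" if i: "i \<in> I" for i
  proof -
    obtain X where "X \<in> Ob T" "X' i = ShOb T X" using coproduct_inj[OF cop i] Hom_Ob ShOb_surj by metis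
    then show ?thesis using ShMor_surj[of "\<iota>' i" X P] coproduct_inj[OF cop i] P by metis
  qed
  then obtain X \<iota> where X: "\<And>i. i \<in> I \<Longrightarrow> X' i = ShOb T (X i)" "\<And>i. i \<in> I \<Longrightarrow> \<iota> i \<in> hm (X i) P"
    "\<And>i. i \<in> I \<Longrightarrow> \<iota>' i = ShMor T (\<iota> i)" by metis
  have "is_coproduct T I (\<lambda>i. ShOb T (X i)) (ShOb T P) (\<lambda>i. ShMor T (\<iota> i))"
    using cop X P unfolding is_coproduct_def by simp
  then have cop': "is_coproduct T I X P \<iota>" using coproduct_Sh[of P I \<iota> X] P X by blast
  obtain a where a: "a \<in> hm A P" "a' = ShMor T a" using ShMor_surj[of a' A P] a' P A by blast
  obtain F where F: "finite F" "F \<subseteq> I" "supp_by \<iota> F a"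
    using compact_objectD[OF c sm cop' a(1)] unfolding fin_supp_def by blast
  then have "supp_by (\<lambda>i. ShMor T (\<iota> i)) F a'" using supp_by_Sh[OF a(1), of F \<iota> X] X a by blast
  then have "supp_by \<iota>' F a'" using X(3) F(2) unfolding supp_by_def by (simp add: subset_iff)
  then show "fin_supp I \<iota>' a'" using F unfolding fin_supp_def by blast
qed

lemma compact_unSh: "compact_object \<kappa> T A" if c: "compact_object \<kappa> T (ShOb T A)" and A: "A \<in> Ob T"
proof (rule compact_objectI)
  show "A \<in> Ob T" by fact
  fix I :: "'a set" and X P \<iota> a
  assume sm: "small \<kappa> I" and cop: "is_coproduct T I X P \<iota>" and a: "a \<in> hm A P"
  note \<iota> = coproduct_inj[OF cop]
  have cop': "is_coproduct T I (\<lambda>i. ShOb T (X i)) (ShOb T P) (\<lambda>i. ShMor T (\<iota> i))"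
    using coproduct_Sh[of P I \<iota> X] cop \<iota> coproduct_Ob[OF cop] by blast
  obtain F where F: "finite F" "F \<subseteq> I" "supp_by (\<lambda>i. ShMor T (\<iota> i)) F (ShMor T a)"
    using compact_objectD[OF c sm cop' ShMor_Hom[OF a]] unfolding fin_supp_def by blast
  then have "supp_by \<iota> F a" using supp_by_Sh[OF a, of F \<iota> X] \<iota> by blast
  then show "fin_supp I \<iota> a" using F unfolding fin_supp_def by blast
qed

text \<open>For c : D -> P the composite c g is supported on a finite set F. With u the projection
  away from F, u c g = 0, so u c = c' h for some c' out of \<Sigma>A, which has a finite support F'.
  A map v that vanishes on the summands in F and F' satisfies v = v u, hence v c = v c' h =
  0.\<close>

lemma compact_cone:
  assumes t: "tri A B D f g h" and A: "compact_object \<kappa> T A" and B: "compact_object \<kappa> T B"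
  shows "compact_object \<kappa> T D"
proof (rule compact_objectI)
  note th = tri_Hom[OF t]
  show "D \<in> Ob T" using th by blast
  fix I :: "'a set" and X P \<iota> c
  assume sm: "small \<kappa> I" and cop: "is_coproduct T I X P \<iota>" and c: "c \<in> hm D P"
  note \<iota> = coproduct_inj[OF cop]
  have P: "P \<in> Ob T" using coproduct_Ob[OF cop] .
  have cg: "c \<cdot> g \<in> hm B P" using th c Comp_Hom by blast
  obtain F where F: "finite F" "F \<subseteq> I" "supp_by \<iota> F (c \<cdot> g)"
    using compact_objectD[OF B sm cop cg] unfolding fin_supp_def by blast
  obtain e where e: "e \<in> hm P P" "\<And>i. i \<in> I \<Longrightarrow> i \<in> F \<Longrightarrow> e \<cdot> \<iota> i = \<iota> i"
    "\<And>i. i \<in> I \<Longrightarrow> i \<notin> F \<Longrightarrow> e \<cdot> \<iota> i = zm (X i) P" using coproduct_idem[OF cop] by metis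
  define u where "u = ID P \<boxminus> e"
  have u: "u \<in> hm P P" unfolding u_def using e P by (auto simp: Hom_iff)
  have "u \<cdot> (c \<cdot> g) = zm B P"
  proof (rule supp_byD[OF F(3) cg u])
    fix i assume "i \<in> F"
    then show "u \<cdot> \<iota> i = zm (Dom T (\<iota> i)) P"
      unfolding u_def using e(1) e(2)[of i] \<iota>[of i] F(2) P by (auto simp: Hom_iff subset_iff)
  qed
  then have "u \<cdot> c \<cdot> g = zm B P" using u c th by (auto simp: Hom_iff)
  then obtain c' where c': "c' \<in> hm (ShOb T A) P" "u \<cdot> c = c' \<cdot> h"
    using tri_extend[OF tri_rotate[OF t] Comp_Hom[OF c u]] by blast
  obtain F' where F': "finite F'" "F' \<subseteq> I" "supp_by \<iota> F' c'"
    using compact_objectD[OF compact_Sh[OF A] sm cop c'(1)] unfolding fin_supp_def by blast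
  have "supp_by \<iota> (F \<union> F') c"
  proof (rule supp_byI[OF c])
    fix v Y assume v: "v \<in> hm P Y" "\<And>i. i \<in> F \<union> F' \<Longrightarrow> v \<cdot> \<iota> i = zm (Dom T (\<iota> i)) Y"
    have Y: "Y \<in> Ob T" using v Hom_Ob by blast
    have "v \<cdot> e = zm P Y"
    proof (rule coproduct_ext[OF cop Comp_Hom[OF e(1) v(1)] zero_Hom[OF P Y]])
      fix i assume i: "i \<in> I"
      have Xi: "X i \<in> Ob T" using \<iota>[OF i] Hom_Ob by blast
      have "(v \<cdot> e) \<cdot> \<iota> i = v \<cdot> (e \<cdot> \<iota> i)" using v(1) e(1) \<iota>[OF i] by (auto simp: Hom_iff)
      also have "\<dots> = zm (X i) Y"
      proof (cases "i \<in> F")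
        case True
        then show ?thesis using e(2)[OF i] v(2)[of i] \<iota>[OF i] by (auto simp: Hom_iff)
      next
        case False
        then show ?thesis using e(3)[OF i] v(1) Xi by (auto simp: Hom_iff)
      qed
      finally show "v \<cdot> e \<cdot> \<iota> i = zm P Y \<cdot> \<iota> i" using \<iota>[OF i] Y by (auto simp: Hom_iff)
    qed
    moreover have "v = v \<cdot> u \<boxplus> v \<cdot> e" unfolding u_def using v(1) e(1) P by (auto simp: Hom_iff)
    ultimately have vu: "v = v \<cdot> u" using v(1) u P Y by (auto simp: Hom_iff)
    have vc': "v \<cdot> c' = zm (ShOb T A) Y" using supp_byD[OF F'(3) c'(1) v(1)] v(2) by blast
    have "v \<cdot> c = v \<cdot> u \<cdot> c" using vu by simp
    also have "\<dots> = v \<cdot> (u \<cdot> c)" using v(1) u c by (auto simp: Hom_iff)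
    also have "\<dots> = v \<cdot> c' \<cdot> h" using c' v(1) th by (auto simp: Hom_iff)
    also have "\<dots> = zm D Y" unfolding vc' using th Y by (auto simp: Hom_iff)
    finally show "v \<cdot> c = zm D Y" .
  qed
  then show "fin_supp I \<iota> c" using F F' unfolding fin_supp_def by blast
qed

end

section \<open>Weak colimits of compact objects\<close>

context compactly_generated
begin

notation add (infixl \<open>\<boxplus>\<close> 65)
notation neg (\<open>\<boxminus> _\<close> [80] 80)
notation diff (infixl \<open>\<boxminus>\<close> 65)

abbreviation cob where "cob \<equiv> cpt \<kappa> T"
abbreviation cmor where "cmor \<equiv> cpt_mor \<kappa> T"

lemma cob_Ob: "A \<in> cob \<Longrightarrow> A \<in> Ob T"
  unfolding cpt_def compact_object_def by blast

lemma cmor_iff: "f \<in> hm A B \<Longrightarrow> f \<in> cmor \<longleftrightarrow> A \<in> cob \<and> B \<in> cob"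
  unfolding cpt_mor_def by (auto simp: Hom_iff)

lemma cmorE: assumes "f \<in> cmor" obtains "f \<in> hm (Dom T f) (Cod T f)" "f \<in> Mor T" "Dom T f \<in> cob" "Cod T f \<in> cob"
    "Dom T f \<in> Ob T" "Cod T f \<in> Ob T"
  using assms unfolding cpt_mor_def by (auto simp: Hom_iff)

lemma cob_Sh: "A \<in> Ob T \<Longrightarrow> ShOb T A \<in> cob \<longleftrightarrow> A \<in> cob"
  unfolding cpt_def using compact_Sh compact_unSh by blast

lemma cob_cone: "tri A B D f g h \<Longrightarrow> A \<in> cob \<Longrightarrow> B \<in> cob \<Longrightarrow> D \<in> cob"
  unfolding cpt_def using compact_cone by blast

lemma cob_biproduct: "A \<in> cob \<Longrightarrow> B \<in> cob \<Longrightarrow>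
    i \<in> hm A P \<Longrightarrow> j \<in> hm B P \<Longrightarrow> p \<in> hm P A \<Longrightarrow> q \<in> hm P B \<Longrightarrow> i \<cdot> p \<boxplus> j \<cdot> q = ID P \<Longrightarrow> P \<in> cob"
  unfolding cpt_def using compact_biproduct by blast

lemma zero_object_cob: "zero_object T Z \<Longrightarrow> Z \<in> cob"
proof -
  assume Z: "zero_object T Z"
  have ZO: "Z \<in> Ob T" using Z unfolding zero_object_def by blast
  have "compact_object \<kappa> T Z"
  proof (rule compact_objectI[OF ZO])
    fix I :: "'u set" and X P and \<iota> :: "'u \<Rightarrow> 'm" and a assume a: "a \<in> hm Z P"
    have "supp_by \<iota> {} a"
    proof (rule supp_byI[OF a])
      fix u Y assume "u \<in> hm P Y"
      then show "u \<cdot> a = zm Z Y" using zero_objectD[OF Z, of "u \<cdot> a"] a by (auto simp: Hom_iff)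
    qed
    then show "fin_supp I \<iota> a" unfolding fin_supp_def by blast
  qed
  then show ?thesis unfolding cpt_def by blast
qed

text \<open>A weak coequalizer of finitely many pairs into a compact \<open>L\<close>, again with
  compact target. It is described only through \<open>pim\<close>, since factorisations through
  \<open>k\<close> exist but need not be unique.\<close>

lemma weak_coequalizer:
  assumes "L \<in> cob" "\<And>\<sigma> \<tau>. (\<sigma>, \<tau>) \<in> set ps \<Longrightarrow> \<exists>A \<in> cob. \<sigma> \<in> hm A L \<and> \<tau> \<in> hm A L"
  obtains k where "k \<in> cmor" "Dom T k = L"
    "\<And>X. pim k X = {z \<in> hm L X. \<forall>(\<sigma>, \<tau>) \<in> set ps. z \<cdot> \<sigma> = z \<cdot> \<tau>}"
proof -
  have "\<exists>k \<in> cmor. Dom T k = L \<and> (\<forall>X. pim k X = {z \<in> hm L X. \<forall>(\<sigma>, \<tau>) \<in> set ps. z \<cdot> \<sigma> = z \<cdot> \<tau>})"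
    using assms(2)
  proof (induction ps)
    case Nil
    have L: "L \<in> Ob T" using assms(1) cob_Ob by blast
    have "pim (ID L) X = hm L X" for X
      unfolding precomp_image_def using L by (force simp: Hom_iff)
    moreover have "ID L \<in> cmor" using L assms(1) by (simp add: cpt_mor_def)
    ultimately show ?case using L by (intro bexI[of _ "ID L"]) auto
  next
    case (Cons p ps)
    obtain \<sigma> \<tau> where p: "p = (\<sigma>, \<tau>)" by (cases p)
    obtain A where A: "A \<in> cob" "\<sigma> \<in> hm A L" "\<tau> \<in> hm A L" using Cons.prems[of \<sigma> \<tau>] p by auto
    have "\<exists>k \<in> cmor. Dom T k = L \<and> (\<forall>X. pim k X = {z \<in> hm L X. \<forall>(\<sigma>, \<tau>) \<in> set ps. z \<cdot> \<sigma> = z \<cdot> \<tau>})"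
      by (rule Cons.IH) (use Cons.prems in simp)
    then obtain k where k0: "k \<in> cmor"
        "Dom T k = L \<and> (\<forall>X. pim k X = {z \<in> hm L X. \<forall>(\<sigma>, \<tau>) \<in> set ps. z \<cdot> \<sigma> = z \<cdot> \<tau>})" by (rule bexE)
    then have k: "k \<in> cmor" "Dom T k = L" "\<And>X. pim k X = {z \<in> hm L X. \<forall>(\<sigma>, \<tau>) \<in> set ps. z \<cdot> \<sigma> = z \<cdot> \<tau>}"
      by simp_all
    obtain K where K: "K \<in> cob" "k \<in> hm L K" using k unfolding cpt_mor_def by (auto simp: Hom_iff)
    have "k \<cdot> (\<sigma> \<boxminus> \<tau>) \<in> hm A K" using A K by (auto simp: Hom_iff)
    then obtain N g h where t: "tri A K N (k \<cdot> (\<sigma> \<boxminus> \<tau>)) g h" using obtain_cone by blast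
    have g: "g \<in> hm K N" using tri_Hom[OF t] by blast
    have N: "N \<in> cob" using cob_cone[OF t] A K by blast
    have gk: "g \<cdot> k \<in> hm L N" using g K Comp_Hom by blast
    have Ob: "A \<in> Ob T" "L \<in> Ob T" "K \<in> Ob T" using A K g Hom_Ob by blast+
    have sig: "w \<cdot> k \<cdot> \<sigma> = w \<cdot> k \<cdot> \<tau> \<longleftrightarrow> w \<cdot> (k \<cdot> (\<sigma> \<boxminus> \<tau>)) = zm A X" if w: "w \<in> hm K X" for w X
    proof -
      have "w \<cdot> (k \<cdot> (\<sigma> \<boxminus> \<tau>)) = w \<cdot> k \<cdot> \<sigma> \<boxminus> w \<cdot> k \<cdot> \<tau>" using w K A by (auto simp: Hom_iff)
      then show ?thesis using diff_eq_zero[of "w \<cdot> k \<cdot> \<sigma>" "w \<cdot> k \<cdot> \<tau>"] w K A by (auto simp: Hom_iff)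
    qed
    have "pim (g \<cdot> k) X = {z \<in> hm L X. \<forall>(\<sigma>, \<tau>) \<in> set (p # ps). z \<cdot> \<sigma> = z \<cdot> \<tau>}" for X
    proof -
      have "z \<in> pim (g \<cdot> k) X \<longleftrightarrow> z \<in> pim k X \<and> z \<cdot> \<sigma> = z \<cdot> \<tau>" for z
      proof -
        have "z \<in> pim (g \<cdot> k) X \<longleftrightarrow> (\<exists>w \<in> pim g X. z = w \<cdot> k)"
        proof -
          have "b \<cdot> (g \<cdot> k) = b \<cdot> g \<cdot> k" if "b \<in> hm N X" for b using that g K by (auto simp: Hom_iff)
          then show ?thesis using gk g unfolding precomp_image_def by (auto simp: Hom_iff image_image)
        qed
        also have "\<dots> \<longleftrightarrow> (\<exists>w \<in> hm K X. z = w \<cdot> k \<and> w \<cdot> k \<cdot> \<sigma> = w \<cdot> k \<cdot> \<tau>)"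
          unfolding tri_pim[OF t] using sig by blast
        also have "\<dots> \<longleftrightarrow> z \<in> pim k X \<and> z \<cdot> \<sigma> = z \<cdot> \<tau>" using K unfolding precomp_image_def by (auto simp: Hom_iff)
        finally show ?thesis .
      qed
      then show ?thesis unfolding k p by auto
    qed
    moreover have "g \<cdot> k \<in> cmor" "Dom T (g \<cdot> k) = L" using gk N assms(1) cmor_iff[OF gk] by (auto simp: Hom_iff)
    ultimately show ?case by blast
  qed
  then show thesis using that by blast
qed

text \<open>Weak coequalizer of the two maps from \<open>A\<close> into the biproduct of
  \<open>K\<close> and \<open>L\<close>.\<close>

lemma weak_pushout:
  assumes "a \<in> hm A K" "b \<in> hm A L" "A \<in> cob" "K \<in> cob" "L \<in> cob"
  obtains N e d where "N \<in> cob" "e \<in> hm K N" "d \<in> hm L N" "e \<cdot> a = d \<cdot> b"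
    "\<And>X x y. x \<in> hm K X \<Longrightarrow> y \<in> hm L X \<Longrightarrow> x \<cdot> a = y \<cdot> b \<Longrightarrow> \<exists>z \<in> hm N X. x = z \<cdot> e \<and> y = z \<cdot> d"
proof -
  have Ob: "A \<in> Ob T" "K \<in> Ob T" "L \<in> Ob T" using assms cob_Ob by blast+
  obtain P i j p q where P: "P \<in> Ob T" "i \<in> hm K P" "j \<in> hm L P" "p \<in> hm P K" "q \<in> hm P L"
    "p \<cdot> i = ID K" "q \<cdot> j = ID L" "p \<cdot> j = zm L K" "q \<cdot> i = zm K L" "i \<cdot> p \<boxplus> j \<cdot> q = ID P"
    using obtain_biproduct[OF Ob(2,3)] by blast
  have Pc: "P \<in> cob" using cob_biproduct[OF assms(4,5) P(2-5,10)] .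
  have "\<exists>A'\<in>cob. \<sigma> \<in> hm A' P \<and> \<tau> \<in> hm A' P" if "(\<sigma>, \<tau>) \<in> set [(i \<cdot> a, j \<cdot> b)]" for \<sigma> \<tau>
    using that assms P(2,3) by (auto intro!: bexI[of _ A] Comp_Hom)
  then obtain k where k: "k \<in> cmor" "Dom T k = P" "\<And>X. pim k X = {z \<in> hm P X. \<forall>(\<sigma>, \<tau>) \<in> set [(i \<cdot> a, j \<cdot> b)]. z \<cdot> \<sigma> = z \<cdot> \<tau>}"
    using weak_coequalizer[OF Pc, of "[(i \<cdot> a, j \<cdot> b)]"] by blast
  obtain N where N: "N \<in> cob" "k \<in> hm P N" using k unfolding cpt_mor_def by (auto simp: Hom_iff)
  have NO: "N \<in> Ob T" using N cob_Ob by blast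
  show thesis
  proof
    show "N \<in> cob" "k \<cdot> i \<in> hm K N" "k \<cdot> j \<in> hm L N" using N P Comp_Hom by blast+
    have "k \<in> pim k N" using pimI[of "ID N" k N] N NO by (auto simp: Hom_iff)
    then have "k \<cdot> (i \<cdot> a) = k \<cdot> (j \<cdot> b)" unfolding k(3) by auto
    then show "k \<cdot> i \<cdot> a = k \<cdot> j \<cdot> b" using N P(2,3) assms by (auto simp: Hom_iff)
    fix X x y assume x: "x \<in> hm K X" and y: "y \<in> hm L X" and e: "x \<cdot> a = y \<cdot> b"
    have X: "X \<in> Ob T" using x Hom_Ob by blast
    define z where "z = x \<cdot> p \<boxplus> y \<cdot> q"
    have z: "z \<in> hm P X" unfolding z_def using x y P(4,5) by (auto simp: Hom_iff)
    have zi: "z \<cdot> i = x" "z \<cdot> j = y" unfolding z_def using x y P(2-9) X Ob by (auto simp: Hom_iff)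
    have "z \<cdot> (i \<cdot> a) = z \<cdot> i \<cdot> a" "z \<cdot> (j \<cdot> b) = z \<cdot> j \<cdot> b" using z P(2,3) assms by (auto simp: Hom_iff)
    then have "z \<in> pim k X" unfolding k(3) using e z zi by auto
    then obtain w where w: "w \<in> hm N X" "z = w \<cdot> k" unfolding pim_iff using N by (auto simp: Hom_iff)
    have "x = w \<cdot> (k \<cdot> i)" "y = w \<cdot> (k \<cdot> j)" using zi w N P(2,3) by (auto simp: Hom_iff)
    then show "\<exists>z\<in>hm N X. x = z \<cdot> (k \<cdot> i) \<and> y = z \<cdot> (k \<cdot> j)" using w by blast
  qed
qed

end

section \<open>Small sets\<close>

lemma small_image: "small \<kappa> A \<Longrightarrow> small \<kappa> (f ` A)"
  unfolding small_def using card_of_image ordLeq_ordLess_trans by blast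

lemma small_subset: "small \<kappa> B \<Longrightarrow> A \<subseteq> B \<Longrightarrow> small \<kappa> A"
  unfolding small_def using card_of_mono1 ordLeq_ordLess_trans by blast

text \<open>Coproducts are only provided for families indexed by subsets of \<open>'u\<close>; other
  small families are reindexed along \<open>e\<close>.\<close>

lemma small_inj:
  fixes \<kappa> :: "'u rel"
  assumes "Card_order \<kappa>" "small \<kappa> A"
  obtains e :: "'a \<Rightarrow> 'u" where "inj_on e A"
proof -
  have "|A| \<le>o \<kappa>" using assms ordLess_imp_ordLeq unfolding small_def by blast
  then have "|A| \<le>o |Field \<kappa>|" using assms(1) card_of_Field_ordIso ordIso_symmetric ordLeq_ordIso_trans by blast
  then show thesis using that unfolding card_of_ordLeq[symmetric] by blast
qed

context compactly_generated
begin

lemma small_UN: assumes "small \<kappa> I" "\<And>i. i \<in> I \<Longrightarrow> small \<kappa> (A i)" shows "small \<kappa> (\<Union>i\<in>I. A i)"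
proof -
  have "Card_order \<kappa>" "regularCard \<kappa>" "natLeq \<le>o \<kappa>"
    using universe ordLess_imp_ordLeq unfolding universe_card_def by blast+
  then have "Cinfinite \<kappa>" using cinfinite_mono natLeq_cinfinite by blast
  then show ?thesis using \<open>regularCard \<kappa>\<close> regularCard_UNION_bound assms unfolding small_def by blast
qed

lemma small_nat: "small \<kappa> (UNIV :: nat set)"
  using universe card_of_nat ordIso_ordLess_trans unfolding universe_card_def small_def by blast

lemma Card_universe: "Card_order \<kappa>"
  using universe unfolding universe_card_def by blast

lemma isomorphic_refl: "A \<in> Ob T \<Longrightarrow> isomorphic T A A"
  unfolding isomorphic_def iso_mor_def by (intro exI[of _ "ID A"] conjI bexI[of _ "ID A"]) (auto simp: Hom_iff)

lemma ex_small_version: obtains S where "small_version \<kappa> T S"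
proof -
  let ?r = "{(A, B). A \<in> cob \<and> B \<in> cob \<and> isomorphic T A B}"
  define S where "S = (\<lambda>c. SOME a. a \<in> c) ` (cob // ?r)"
  have "(SOME a. a \<in> ?r `` {A}) \<in> ?r `` {A}" if "A \<in> cob" for A
    by (rule someI[of _ A]) (use that isomorphic_refl cob_Ob in auto)
  then have 1: "(SOME a. a \<in> ?r `` {A}) \<in> cob \<and> isomorphic T A (SOME a. a \<in> ?r `` {A})" if "A \<in> cob" for A
    using that by auto
  have "small_version \<kappa> T S" unfolding small_version_def
  proof (intro conjI ballI)
    show "S \<subseteq> cob" unfolding S_def quotient_def using 1 by auto
    show "small \<kappa> S" unfolding S_def using iso_classes_small by (rule small_image)
    fix A assume A: "A \<in> cob"
    then have "(SOME a. a \<in> ?r `` {A}) \<in> S" unfolding S_def by (intro imageI) (rule quotientI)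
    then show "\<exists>B\<in>S. isomorphic T A B" using 1[OF A] by blast
  qed
  then show thesis using that by blast
qed

section \<open>Saturated classes of morphisms\<close>

text \<open>The classes of morphisms \<open>f\<close> such that the functor \<open>X \<mapsto> (cod f, X)f\<close> lies in a given
  Serre subcategory are saturated; the exactness properties of such functors only enter
  through the last clause.\<close>

definition saturated :: "'m set \<Rightarrow> bool" where
  "saturated J \<longleftrightarrow> J \<subseteq> cmor \<and> (\<forall>A \<in> cob. \<forall>B \<in> cob. zm A B \<in> J) \<and>
     (\<forall>A B E D K q p r m g. A \<in> cob \<and> B \<in> cob \<and> E \<in> cob \<and> D \<in> cob \<and> K \<in> cob \<and>
        tri B E D q p r \<and> m \<in> hm E K \<and> g \<in> hm A E \<and> m \<cdot> q \<in> J \<and> p \<cdot> g \<in> J \<longrightarrow> m \<cdot> g \<in> J)"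

definition through :: "'m set \<Rightarrow> 'o \<Rightarrow> 'm set" where
  "through J X = (\<Union>j\<in>J. pim j X)"

text \<open>A degenerate triangle at which the last clause of \<open>saturated\<close>, with q an
  identity, becomes closure under precomposition. The counterpart \<open>id_triangle'\<close>, with
  q zero, gives closure under postcomposition.\<close>

lemma id_triangle: assumes "X \<in> cob"
  obtains Z r where "tri X X Z (ID X) (zm X Z) r" "Z \<in> cob"
proof -
  obtain Z where Z: "zero_object T Z" using ex_zero_object by blast
  have ZO: "Z \<in> Ob T" using Z unfolding zero_object_def by blast
  have "tri X X Z (ID X) (zm X Z) (zm Z (ShOb T X))"
    unfolding dist_triangle_def triangle_def using TR1_id[OF _ Z] cob_Ob[OF assms] ZO by (auto simp: Hom_iff)
  then show thesis using that zero_object_cob[OF Z] by blast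
qed

lemma id_triangle': assumes "X \<in> cob"
  obtains Z r where "tri Z X X (zm Z X) (ID X) r" "Z \<in> cob"
proof -
  obtain Z r where Z: "tri X X Z (ID X) (zm X Z) r" "Z \<in> cob" using id_triangle[OF assms] .
  obtain Z' k where k: "Z = ShOb T Z'" "k \<in> hm Z' X" "tri Z' X X (\<boxminus> k) (ID X) (zm X Z)"
    using tri_unrotate[OF Z(1)] by metis
  have Z': "Z' \<in> cob" using Z k(1) cob_Sh Hom_Ob[OF k(2)] by simp
  have "ID X \<cdot> (\<boxminus> k) = zm Z' X" using tri_comp[OF k(3)] .
  then have "\<boxminus> k = zm Z' X" using k(2) by (auto simp: Hom_iff)
  then show thesis using that[of Z'] k(3) Z' by simp
qed

section \<open>A saturated class is an ideal\<close>

lemma saturated_cmor: "saturated J \<Longrightarrow> j \<in> J \<Longrightarrow> j \<in> cmor"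
  unfolding saturated_def by blast

lemma saturated_zero: "saturated J \<Longrightarrow> A \<in> cob \<Longrightarrow> B \<in> cob \<Longrightarrow> zm A B \<in> J"
  unfolding saturated_def by blast

lemma saturatedD: "saturated J \<Longrightarrow> tri B E D q p r \<Longrightarrow> A \<in> cob \<Longrightarrow> B \<in> cob \<Longrightarrow> E \<in> cob \<Longrightarrow> D \<in> cob \<Longrightarrow> K \<in> cob \<Longrightarrow>
   m \<in> hm E K \<Longrightarrow> g \<in> hm A E \<Longrightarrow> m \<cdot> q \<in> J \<Longrightarrow> p \<cdot> g \<in> J \<Longrightarrow> m \<cdot> g \<in> J"
  unfolding saturated_def by blast

lemma saturated_post: assumes "saturated J" "f \<in> J" "f \<in> hm A B" "m \<in> hm B K" "K \<in> cob" shows "m \<cdot> f \<in> J"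
proof -
  have c: "A \<in> cob" "B \<in> cob" using saturated_cmor[OF assms(1,2)] assms(3) cmor_iff by blast+
  obtain Z r where Z: "tri Z B B (zm Z B) (ID B) r" "Z \<in> cob" using id_triangle'[OF c(2)] .
  have "m \<cdot> zm Z B \<in> J" using saturated_zero[OF assms(1) Z(2) assms(5)] assms(4) cob_Ob[OF Z(2)] by (auto simp: Hom_iff)
  moreover have "ID B \<cdot> f \<in> J" using assms(2,3) by (auto simp: Hom_iff)
  ultimately show ?thesis using saturatedD[OF assms(1) Z(1) c(1) Z(2) c(2) c(2) assms(5,4,3)] by blast
qed

lemma saturated_pre: assumes "saturated J" "m \<in> J" "m \<in> hm E K" "g \<in> hm A E" "A \<in> cob" shows "m \<cdot> g \<in> J"
proof -
  have c: "E \<in> cob" "K \<in> cob" using saturated_cmor[OF assms(1,2)] assms(3) cmor_iff by blast+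
  obtain Z r where Z: "tri E E Z (ID E) (zm E Z) r" "Z \<in> cob" using id_triangle[OF c(1)] .
  have "zm E Z \<cdot> g \<in> J" using saturated_zero[OF assms(1) assms(5) Z(2)] assms(4) cob_Ob[OF Z(2)] by (auto simp: Hom_iff)
  moreover have "m \<cdot> ID E \<in> J" using assms(2,3) by (auto simp: Hom_iff)
  ultimately show ?thesis using saturatedD[OF assms(1) Z(1) assms(5) c(1) c(1) Z(2) c(2) assms(3,4)] by blast
qed

text \<open>The sum is a composite through the biproduct: m + m' is the row (m, 1) after the column
  (1, m'). The triangle on the inclusion i of the first summand fits the clause of
  \<open>saturated\<close>: the row restricted along i is m, and the second map \<open>v\<close> of
  the triangle sends the column to (v j)m', because v i = 0.\<close>

lemma saturated_add: assumes "saturated J" "m \<in> J" "m' \<in> J" "m \<in> hm A K" "m' \<in> hm A K" shows "m \<boxplus> m' \<in> J"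
proof -
  have c: "A \<in> cob" "K \<in> cob" using saturated_cmor[OF assms(1,2)] assms(4) cmor_iff by blast+
  have Ob: "A \<in> Ob T" "K \<in> Ob T" using c cob_Ob by blast+
  obtain P i j p q where P: "P \<in> Ob T" "i \<in> hm A P" "j \<in> hm K P" "p \<in> hm P A" "q \<in> hm P K"
    "p \<cdot> i = ID A" "q \<cdot> j = ID K" "p \<cdot> j = zm K A" "q \<cdot> i = zm A K" "i \<cdot> p \<boxplus> j \<cdot> q = ID P"
    using obtain_biproduct[OF Ob] by blast
  have Pc: "P \<in> cob" using cob_biproduct[OF c P(2-5,10)] .
  obtain D v r where t: "tri A P D i v r" using obtain_cone[OF P(2)] .
  have D: "D \<in> cob" "v \<in> hm P D" "D \<in> Ob T" using cob_cone[OF t] c Pc tri_Hom[OF t] by blast+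
  define n where "n = m \<cdot> p \<boxplus> q"
  define g where "g = i \<boxplus> j \<cdot> m'"
  have n: "n \<in> hm P K" unfolding n_def using assms(4) P(4,5) by (auto simp: Hom_iff)
  have g: "g \<in> hm A P" unfolding g_def using assms(5) P(2,3) by (auto simp: Hom_iff)
  have "n \<cdot> i = m" unfolding n_def using assms(4) P(2,4,5,6,9) by (auto simp: Hom_iff)
  moreover have "v \<cdot> g = (v \<cdot> j) \<cdot> m'"
    unfolding g_def using tri_comp[OF t] D assms(5) P(2,3) by (auto simp: Hom_iff)
  moreover have "(v \<cdot> j) \<cdot> m' \<in> J" by (rule saturated_post[OF assms(1,3,5) _ D(1)]) (use D P(3) Comp_Hom in blast)
  ultimately have "n \<cdot> g \<in> J" using saturatedD[OF assms(1) t c(1) c(1) Pc D(1) c(2) n g] assms(2) by simp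
  moreover have "n \<cdot> g = m \<boxplus> m'"
  proof -
    have "p \<cdot> (j \<cdot> m') = p \<cdot> j \<cdot> m'" "q \<cdot> (j \<cdot> m') = q \<cdot> j \<cdot> m'" using P(3,4,5) assms(5) by (auto simp: Hom_iff)
    then have pm: "p \<cdot> (j \<cdot> m') = zm A A" "q \<cdot> (j \<cdot> m') = m'"
      using P(7,8) assms(5) Ob by (auto simp: Hom_iff)
    show ?thesis unfolding n_def g_def using assms(4,5) P(2-5) P(6,9) pm Ob by (auto simp: Hom_iff)
  qed
  ultimately show ?thesis by simp
qed

section \<open>Morphisms from compact to arbitrary objects that factor through a saturated
  class\<close>

lemma throughE: assumes "saturated J" "x \<in> through J X"
  obtains j b A K where "j \<in> J" "j \<in> hm A K" "A \<in> cob" "K \<in> cob" "b \<in> hm K X" "x = b \<cdot> j" "x \<in> hm A X"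
proof -
  obtain j where j: "j \<in> J" "x \<in> pim j X" using assms(2) unfolding through_def by blast
  have jc: "j \<in> cmor" using saturated_cmor[OF assms(1) j(1)] .
  obtain b where b: "b \<in> hm (Cod T j) X" "x = b \<cdot> j" using j(2) unfolding pim_iff by blast
  show thesis
  proof (rule cmorE[OF jc])
    assume 1: "j \<in> hm (Dom T j) (Cod T j)" "Dom T j \<in> cob" "Cod T j \<in> cob"
    show thesis using that[OF j(1) 1 b] Comp_Hom[OF 1(1) b(1)] b(2) by blast
  qed
qed

lemma throughI: "j \<in> J \<Longrightarrow> j \<in> hm A K \<Longrightarrow> b \<in> hm K X \<Longrightarrow> b \<cdot> j \<in> through J X"
  unfolding through_def using pimI by (auto simp: Hom_iff)

lemma through_zero: "saturated J \<Longrightarrow> A \<in> cob \<Longrightarrow> X \<in> Ob T \<Longrightarrow> zm A X \<in> through J X"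
  using throughI[OF saturated_zero[of J A A], of A A "zm A X" X] cob_Ob[of A] by (auto simp: Hom_iff)

lemma through_pre: assumes "saturated J" "x \<in> through J X" "x \<in> hm A X" "v \<in> hm A' A" "A' \<in> cob"
  shows "x \<cdot> v \<in> through J X"
proof -
  obtain j b B K where j: "j \<in> J" "j \<in> hm B K" "B \<in> cob" "K \<in> cob" "b \<in> hm K X" "x = b \<cdot> j" "x \<in> hm B X"
    using throughE[OF assms(1,2)] .
  have B: "B = A" using j(7) assms(3) by (auto simp: Hom_iff)
  have jv: "j \<cdot> v \<in> J" using saturated_pre[OF assms(1) j(1,2)] assms(4,5) B by blast
  have "x \<cdot> v = b \<cdot> (j \<cdot> v)" using j assms(4) B by (auto simp: Hom_iff)
  then show ?thesis using throughI[OF jv _ j(5), of A'] Comp_Hom[of v A' A j K] j(2) B assms(4) by simp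
qed

text \<open>The two factorisations may have different intermediate objects. Pushed into the
  biproduct of these, their parts in \<open>J\<close> can be added inside \<open>J\<close>.\<close>

lemma through_add: assumes "saturated J" "x \<in> through J X" "y \<in> through J X" "x \<in> hm A X" "y \<in> hm A X"
  shows "x \<boxplus> y \<in> through J X"
proof -
  obtain j b A1 K where j: "j \<in> J" "j \<in> hm A1 K" "A1 \<in> cob" "K \<in> cob" "b \<in> hm K X" "x = b \<cdot> j" "x \<in> hm A1 X"
    using throughE[OF assms(1,2)] .
  obtain j' b' A2 K' where j': "j' \<in> J" "j' \<in> hm A2 K'" "A2 \<in> cob" "K' \<in> cob" "b' \<in> hm K' X" "y = b' \<cdot> j'" "y \<in> hm A2 X"
    using throughE[OF assms(1,3)] .
  have A: "A1 = A" "A2 = A" using j j' assms by (auto simp: Hom_iff)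
  have Ob: "K \<in> Ob T" "K' \<in> Ob T" using j j' cob_Ob by blast+
  obtain P i i' p q where P: "P \<in> Ob T" "i \<in> hm K P" "i' \<in> hm K' P" "p \<in> hm P K" "q \<in> hm P K'"
    "p \<cdot> i = ID K" "q \<cdot> i' = ID K'" "p \<cdot> i' = zm K' K" "q \<cdot> i = zm K K'" "i \<cdot> p \<boxplus> i' \<cdot> q = ID P"
    using obtain_biproduct[OF Ob] by blast
  have Pc: "P \<in> cob" using cob_biproduct[OF j(4) j'(4) P(2-5,10)] .
  have X: "X \<in> Ob T" using assms(4) Hom_Ob by blast
  have 1: "i \<cdot> j \<in> J" "i' \<cdot> j' \<in> J"
    using saturated_post[OF assms(1) j(1,2) P(2) Pc] saturated_post[OF assms(1) j'(1,2) P(3) Pc] by blast+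
  have 2: "i \<cdot> j \<in> hm A P" "i' \<cdot> j' \<in> hm A P" using j(2) j'(2) P(2,3) A Comp_Hom by blast+
  have 3: "(i \<cdot> j) \<boxplus> (i' \<cdot> j') \<in> J" using saturated_add[OF assms(1) 1 2] .
  define w where "w = b \<cdot> p \<boxplus> b' \<cdot> q"
  have w: "w \<in> hm P X" unfolding w_def using j(5) j'(5) P(4,5) by (auto simp: Hom_iff)
  have wi: "w \<cdot> i = b" "w \<cdot> i' = b'" unfolding w_def using j(5) j'(5) P(2-9) Ob X by (auto simp: Hom_iff)
  have "w \<cdot> ((i \<cdot> j) \<boxplus> (i' \<cdot> j')) = w \<cdot> i \<cdot> j \<boxplus> w \<cdot> i' \<cdot> j'"
    using w j(2) j'(2) P(2,3) A by (auto simp: Hom_iff)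
  then have "w \<cdot> ((i \<cdot> j) \<boxplus> (i' \<cdot> j')) = x \<boxplus> y" using wi j j' by simp
  then show ?thesis using throughI[OF 3 add_Hom[OF 2] w] by simp
qed

text \<open>The triangle clause of \<open>saturated\<close> for an arbitrary target X. Given m q = b
  j, the weak pushout of q and j factors m as z e with compact target of e and e q in
  \<open>J\<close>. The original clause then applies to e.\<close>

lemma through_triangle: assumes "saturated J" "tri B E D q p r" "A \<in> cob" "B \<in> cob" "E \<in> cob" "D \<in> cob"
    "m \<in> hm E X" "g \<in> hm A E" "m \<cdot> q \<in> through J X" "p \<cdot> g \<in> J"
  shows "m \<cdot> g \<in> through J X"
proof -
  note t = tri_Hom[OF assms(2)]
  obtain j b B' K where j: "j \<in> J" "j \<in> hm B' K" "B' \<in> cob" "K \<in> cob" "b \<in> hm K X" "m \<cdot> q = b \<cdot> j" "m \<cdot> q \<in> hm B' X"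
    using throughE[OF assms(1,9)] .
  have B: "B' = B" using j(7) assms(7) t by (auto simp: Hom_iff)
  obtain N e d where N: "N \<in> cob" "e \<in> hm E N" "d \<in> hm K N" "e \<cdot> q = d \<cdot> j"
    "\<And>X x y. x \<in> hm E X \<Longrightarrow> y \<in> hm K X \<Longrightarrow> x \<cdot> q = y \<cdot> j \<Longrightarrow> \<exists>z \<in> hm N X. x = z \<cdot> e \<and> y = z \<cdot> d"
    using weak_pushout[of q B E j K] t j(2) B assms(4,5) j(4) by metis
  obtain z where z: "z \<in> hm N X" "m = z \<cdot> e" using N(5)[OF assms(7) j(5,6)] by blast
  have "e \<cdot> q \<in> J" using N(4) saturated_post[OF assms(1) j(1,2) N(3,1)] by simp
  then have "e \<cdot> g \<in> J" using saturatedD[OF assms(1-6) N(1,2) assms(8) _ assms(10)] by blast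
  moreover have "m \<cdot> g = z \<cdot> (e \<cdot> g)" using z N(2) assms(8) by (auto simp: Hom_iff)
  ultimately show ?thesis using throughI[OF _ Comp_Hom[OF assms(8) N(2)] z(1)] by simp
qed

lemma through_compact: assumes "saturated J" "x \<in> through J B" "B \<in> cob" shows "x \<in> J"
proof -
  obtain j b A K where j: "j \<in> J" "j \<in> hm A K" "A \<in> cob" "K \<in> cob" "b \<in> hm K B" "x = b \<cdot> j"
    using throughE[OF assms(1,2)] .
  then show ?thesis using saturated_post[OF assms(1) j(1,2) j(5) assms(3)] by simp
qed

end

section \<open>Separating a morphism from a saturated class\<close>

context compactly_generated
begin

lemma obtain_coproduct:
  fixes X :: "'b \<Rightarrow> 'o"
  assumes "small \<kappa> I" "\<And>i. i \<in> I \<Longrightarrow> X i \<in> Ob T"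
  obtains e :: "'b \<Rightarrow> 'u" and P \<iota> where "inj_on e I" "small \<kappa> (e ` I)"
    "is_coproduct T (e ` I) (\<lambda>k. X (the_inv_into I e k)) P \<iota>" "\<And>i. i \<in> I \<Longrightarrow> \<iota> (e i) \<in> hm (X i) P"
proof -
  obtain e :: "'b \<Rightarrow> 'u" where e: "inj_on e I" using small_inj[OF Card_universe assms(1)] .
  have sm: "small \<kappa> (e ` I)" using assms(1) small_image by blast
  have inv: "the_inv_into I e (e i) = i" if "i \<in> I" for i using the_inv_into_f_f[OF e that] .
  have "(\<lambda>k. X (the_inv_into I e k)) \<in> e ` I \<rightarrow> Ob T" using inv assms(2) by auto
  then obtain P \<iota> where P: "is_coproduct T (e ` I) (\<lambda>k. X (the_inv_into I e k)) P \<iota>"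
    using coproducts sm unfolding has_coproducts_def by blast
  show thesis using that[OF e sm P] coproduct_inj[OF P] inv by fastforce
qed

lemma compact_finite_coproduct:
  assumes "finite F" "is_coproduct T F X P \<iota>" "\<And>i. i \<in> F \<Longrightarrow> X i \<in> cob"
  shows "P \<in> cob"
proof -
  note \<iota> = coproduct_inj[OF assms(2)]
  have "compact_object \<kappa> T P"
  proof (rule compact_objectI[OF coproduct_Ob[OF assms(2)]])
    fix I :: "'u set" and Y Q and \<eta> :: "'u \<Rightarrow> 'm" and a
    assume 1: "small \<kappa> I" "is_coproduct T I Y Q \<eta>" "a \<in> hm P Q"
    have "\<exists>G. finite G \<and> G \<subseteq> I \<and> supp_by \<eta> G (a \<cdot> \<iota> i)" if "i \<in> F" for i
      using compact_objectD[OF _ 1(1,2) Comp_Hom[OF \<iota>[OF that] 1(3)]] assms(3)[OF that]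
      unfolding fin_supp_def cpt_def by blast
    then obtain G where G: "\<And>i. i \<in> F \<Longrightarrow> finite (G i) \<and> G i \<subseteq> I \<and> supp_by \<eta> (G i) (a \<cdot> \<iota> i)" by metis
    have "supp_by \<eta> (\<Union>i\<in>F. G i) a"
    proof (rule supp_byI[OF 1(3)])
      fix u Y assume u: "u \<in> hm Q Y" "\<And>i. i \<in> (\<Union>i\<in>F. G i) \<Longrightarrow> u \<cdot> \<eta> i = zm (Dom T (\<eta> i)) Y"
      have Ob: "P \<in> Ob T" "Y \<in> Ob T" using u 1(3) Hom_Ob by blast+
      show "u \<cdot> a = zm P Y"
      proof (rule coproduct_ext[OF assms(2) Comp_Hom[OF 1(3) u(1)] zero_Hom[OF Ob]])
        fix i assume i: "i \<in> F"
        have "u \<cdot> (a \<cdot> \<iota> i) = zm (X i) Y"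
          using supp_byD[of \<eta> "G i" "a \<cdot> \<iota> i" "X i" Q u Y] G[OF i] Comp_Hom[OF \<iota>[OF i] 1(3)] u i by blast
        then show "u \<cdot> a \<cdot> \<iota> i = zm P Y \<cdot> \<iota> i" using u(1) 1(3) \<iota>[OF i] Ob by (auto simp: Hom_iff)
      qed
    qed
    then show "fin_supp I \<eta> a" unfolding fin_supp_def using G assms(1) by (intro exI[of _ "\<Union>i\<in>F. G i"]) auto
  qed
  then show ?thesis unfolding cpt_def by blast
qed

text \<open>By finite support \<open>v\<close> is a finite sum of morphisms \<iota>_i x, so s v is a
  finite sum of morphisms through \<open>J\<close>.\<close>

lemma through_fin_supp:
  assumes J: "saturated J" and cop: "is_coproduct T I Y Q \<iota>" and s: "s \<in> hm Q X"
    and si: "\<And>i. i \<in> I \<Longrightarrow> s \<cdot> \<iota> i \<in> through J X"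
    and v: "v \<in> hm A Q" "A \<in> cob" "fin_supp I \<iota> v"
  shows "s \<cdot> v \<in> through J X"
  using cop v(1,3)
proof (induction rule: fin_supp_induct)
  case zero
  have "s \<cdot> zm A Q = zm A X" using s cob_Ob[OF v(2)] by (auto simp: Hom_iff)
  then show ?case using through_zero[OF J v(2)] Hom_Ob[OF s] by simp
next
  case (add b i x)
  note \<iota> = coproduct_inj[OF cop add(1)]
  have "s \<cdot> (b \<boxplus> \<iota> i \<cdot> x) = s \<cdot> b \<boxplus> s \<cdot> \<iota> i \<cdot> x" using s add(2,3) \<iota> by (auto simp: Hom_iff)
  moreover have "s \<cdot> \<iota> i \<cdot> x \<in> through J X"
    using through_pre[OF J si[OF add(1)] Comp_Hom[OF \<iota> s] add(3) v(2)] .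
  moreover have "s \<cdot> b \<in> hm A X" "s \<cdot> \<iota> i \<cdot> x \<in> hm A X" using s add(2,3) \<iota> Comp_Hom by blast+
  ultimately show ?case using through_add[OF J add(4)] by simp
qed

text \<open>The object \<open>X'\<close> is the cone of the coproduct of all morphisms \<open>A \<rightarrow> X\<close> that factor through \<open>J\<close>,
  with \<open>A\<close> in a small skeleton of the compact objects.\<close>

lemma saturated_step:
  assumes J: "saturated J" and X: "X \<in> Ob T"
  obtains X' u where "u \<in> hm X X'" "\<And>x. x \<in> through J X \<Longrightarrow> u \<cdot> x = zm (Dom T x) X'"
    "\<And>A y. A \<in> cob \<Longrightarrow> y \<in> hm A X \<Longrightarrow> u \<cdot> y \<in> through J X' \<Longrightarrow> y \<in> through J X"
proof -
  obtain S where S: "S \<subseteq> cob" "small \<kappa> S" "\<And>A. A \<in> cob \<Longrightarrow> \<exists>B\<in>S. isomorphic T A B"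
    using ex_small_version unfolding small_version_def by metis
  define \<Lambda> where "\<Lambda> = {x \<in> through J X. Dom T x \<in> S}"
  have \<Lambda>H: "x \<in> hm (Dom T x) X" if "x \<in> \<Lambda>" for x
  proof -
    have "x \<in> through J X" using that unfolding \<Lambda>_def by blast
    then obtain A where "x \<in> hm A X" using throughE[OF J] by metis
    then show ?thesis by (auto simp: Hom_iff)
  qed
  have "\<Lambda> \<subseteq> (\<Union>A\<in>S. hm A X)" using \<Lambda>H unfolding \<Lambda>_def by blast
  moreover have "small \<kappa> (\<Union>A\<in>S. hm A X)" by (rule small_UN[OF S(2)]) (use hom_small S(1) X in blast)
  ultimately have sm: "small \<kappa> \<Lambda>" using small_subset by blast
  obtain e :: "'m \<Rightarrow> 'u" and Q \<iota> where e: "inj_on e \<Lambda>" "small \<kappa> (e ` \<Lambda>)"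
    "is_coproduct T (e ` \<Lambda>) (\<lambda>k. Dom T (the_inv_into \<Lambda> e k)) Q \<iota>" "\<And>x. x \<in> \<Lambda> \<Longrightarrow> \<iota> (e x) \<in> hm (Dom T x) Q"
  proof (rule obtain_coproduct[OF sm, of "Dom T"], goal_cases)
    case (1 x)
    then show ?case using \<Lambda>H Hom_Ob by blast
  next
    case (2 e P \<iota>)
    show ?case by (rule 2(1)[OF 2(2-5)])
  qed
  let ?I = "e ` \<Lambda>" and ?Y = "\<lambda>k. Dom T (the_inv_into \<Lambda> e k)"
  note \<iota> = coproduct_inj[OF e(3)]
  have inv: "the_inv_into \<Lambda> e (e x) = x" if "x \<in> \<Lambda>" for x using the_inv_into_f_f[OF e(1) that] .
  have invin: "the_inv_into \<Lambda> e i \<in> \<Lambda>" if "i \<in> ?I" for i using inv that by auto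
  have Yc: "?Y i \<in> cob" if "i \<in> ?I" for i using invin[OF that] S(1) unfolding \<Lambda>_def by blast
  obtain s where s: "s \<in> hm Q X" "\<And>i. i \<in> ?I \<Longrightarrow> s \<cdot> \<iota> i = the_inv_into \<Lambda> e i"
    using coproduct_induced[OF e(3) X, of "the_inv_into \<Lambda> e"] \<Lambda>H invin by metis
  have si: "s \<cdot> \<iota> i \<in> through J X" if "i \<in> ?I" for i
    using s(2)[OF that] invin[OF that] unfolding \<Lambda>_def by simp
  obtain X' u r where t: "tri Q X X' s u r" using obtain_cone[OF s(1)] .
  note tH = tri_Hom[OF t]
  have u: "u \<in> hm X X'" "X' \<in> Ob T" using tH by blast+
  have u\<Lambda>: "u \<cdot> x = zm (Dom T x) X'" if x: "x \<in> \<Lambda>" for x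
  proof -
    have "u \<cdot> x = u \<cdot> (s \<cdot> \<iota> (e x))" using s(2)[of "e x"] inv[OF x] x by simp
    also have "\<dots> = u \<cdot> s \<cdot> \<iota> (e x)" using u s(1) e(4)[OF x] by (auto simp: Hom_iff)
    also have "\<dots> = zm (Dom T x) X'" using tri_comp[OF t] e(4)[OF x] u by (auto simp: Hom_iff)
    finally show ?thesis .
  qed
  show thesis
  proof
    show "u \<in> hm X X'" by fact
    fix x assume x: "x \<in> through J X"
    obtain A where A: "A \<in> cob" "x \<in> hm A X" using throughE[OF J x] by metis
    obtain B where B: "B \<in> S" "isomorphic T A B" using S(3)[OF A(1)] by blast
    then obtain a b where ab: "a \<in> hm A B" "b \<in> hm B A" "b \<cdot> a = ID A" unfolding isomorphic_def iso_mor_def by blast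
    have "x \<cdot> b \<in> through J X" using through_pre[OF J x A(2) ab(2)] B(1) S(1) by blast
    then have "x \<cdot> b \<in> \<Lambda>" unfolding \<Lambda>_def using A(2) ab(2) B(1) by (auto simp: Hom_iff)
    then have xb: "u \<cdot> (x \<cdot> b) = zm B X'" using u\<Lambda> A(2) ab(2) by (auto simp: Hom_iff)
    have "u \<cdot> x = u \<cdot> (x \<cdot> (b \<cdot> a))" using ab(3) A(2) by (auto simp: Hom_iff)
    also have "\<dots> = u \<cdot> (x \<cdot> b) \<cdot> a" using u A(2) ab(1,2) by (simp add: Hom_iff)
    also have "\<dots> = zm A X'" unfolding xb using ab(1) u by (auto simp: Hom_iff)
    finally show "u \<cdot> x = zm (Dom T x) X'" using A(2) by (simp add: Hom_iff)
  next
    fix A y assume A: "A \<in> cob" and y: "y \<in> hm A X" and uy: "u \<cdot> y \<in> through J X'"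
    have AO: "A \<in> Ob T" using A cob_Ob by blast
    \<comment> \<open>The factorisation u y = b g has compact middle object B, but b ends in the
      cone X'. The aim is a compact E with maps p : E -> B and m : E -> X over u, and a lift g' of g
      along p. Then m g' factors through \<open>J\<close> by \<open>through_triangle\<close>, while
      y - m g' is killed by u and comes from Q, where finite support applies. E arises from
      desuspending b to \<open>b0\<close>, composing into Q to get \<open>a0\<close>, and cutting
      \<open>a0\<close> down to the finite coproduct \<open>E0\<close> of the summands that it
      meets.\<close>
    obtain g b A' B where g: "g \<in> J" "g \<in> hm A' B" "A' \<in> cob" "B \<in> cob" "b \<in> hm B X'" "u \<cdot> y = b \<cdot> g"
      "u \<cdot> y \<in> hm A' X'" using throughE[OF J uy] .
    have "A' = A" using g(7) u(1) y by (auto simp: Hom_iff)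
    note g = g(1) g(2)[unfolded this] g(4-6)
    obtain V k where k: "X' = ShOb T V" "r = ShMor T k" "k \<in> hm V Q" "tri V Q X (\<boxminus> k) s u" using tri_unrotate[OF t] .
    have VO: "V \<in> Ob T" using k(3) Hom_Ob by blast
    obtain B0 where B0: "B0 \<in> Ob T" "B = ShOb T B0" using ShOb_surj cob_Ob[OF g(3)] by blast
    have B0c: "B0 \<in> cob" using cob_Sh[OF B0(1)] g(3) B0(2) by blast
    obtain b0 where b0: "b0 \<in> hm B0 V" "b = ShMor T b0" using ShMor_surj[of b B0 V] g(4) B0 k(1) VO by blast
    define a0 where "a0 = (\<boxminus> k) \<cdot> b0"
    have a0: "a0 \<in> hm B0 Q" unfolding a0_def using k(3) b0 by (auto simp: Hom_iff)
    obtain F where F: "finite F" "F \<subseteq> ?I" "supp_by \<iota> F a0"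
      using compact_objectD[OF _ e(2,3) a0] B0c unfolding fin_supp_def cpt_def by blast
    have smF: "small \<kappa> F" using small_subset e(2) F(2) by blast
    have "?Y \<in> F \<rightarrow> Ob T" using Yc F(2) cob_Ob by blast
    then obtain E0 \<eta> where E0: "is_coproduct T F ?Y E0 \<eta>"
      using coproducts smF unfolding has_coproducts_def by blast
    note \<eta> = coproduct_inj[OF E0]
    have E0c: "E0 \<in> cob" using compact_finite_coproduct[OF F(1) E0] Yc F(2) by blast
    have E0O: "E0 \<in> Ob T" using E0c cob_Ob by blast
    have QO: "Q \<in> Ob T" using coproduct_Ob[OF e(3)] .
    have \<iota>F: "\<iota> i \<in> hm (?Y i) Q" if "i \<in> F" for i using \<iota> that F(2) by blast
    obtain c where c: "c \<in> hm E0 Q" "\<And>i. i \<in> F \<Longrightarrow> c \<cdot> \<eta> i = \<iota> i"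
      using coproduct_induced[OF E0 QO, of \<iota>] \<iota>F by metis
    have "(if i \<in> F then \<eta> i else zm (?Y i) E0) \<in> hm (?Y i) E0" if "i \<in> ?I" for i
      using \<eta> zero_Hom E0O Yc[OF that] cob_Ob by auto
    \<comment> \<open>A retraction of c : E0 -> Q, zero on the summands outside
      \<open>F\<close>.\<close>
    then obtain d where d: "d \<in> hm Q E0" "\<And>i. i \<in> ?I \<Longrightarrow> d \<cdot> \<iota> i = (if i \<in> F then \<eta> i else zm (?Y i) E0)"
      using coproduct_induced[OF e(3) E0O, of "\<lambda>i. if i \<in> F then \<eta> i else zm (?Y i) E0"] by metis
    have dc: "d \<cdot> c = ID E0"
    proof (rule coproduct_ext[OF E0 Comp_Hom[OF c(1) d(1)] Id_Hom[OF E0O]])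
      fix i assume i: "i \<in> F"
      have "d \<cdot> c \<cdot> \<eta> i = d \<cdot> \<iota> i" using c(1) d(1) \<eta>[OF i] c(2)[OF i] by (simp add: Hom_iff)
      also have "\<dots> = ID E0 \<cdot> \<eta> i" using d(2)[of i] i F(2) \<eta>[OF i] by (auto simp: Hom_iff)
      finally show "d \<cdot> c \<cdot> \<eta> i = ID E0 \<cdot> \<eta> i" .
    qed
    \<comment> \<open>1 - c d vanishes on the summands that support \<open>a0\<close>, hence on
      \<open>a0\<close> itself.\<close>
    have cda: "a0 = c \<cdot> (d \<cdot> a0)"
    proof -
      have w: "ID Q \<boxminus> c \<cdot> d \<in> hm Q Q" using c(1) d(1) QO by (auto simp: Hom_iff)
      have "(ID Q \<boxminus> c \<cdot> d) \<cdot> a0 = zm B0 Q"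
      proof (rule supp_byD[OF F(3) a0 w])
        fix i assume i: "i \<in> F"
        have "c \<cdot> (d \<cdot> \<iota> i) = \<iota> i" using d(2)[of i] i F(2) c(2)[OF i] by auto
        then show "(ID Q \<boxminus> c \<cdot> d) \<cdot> \<iota> i = zm (Dom T (\<iota> i)) Q"
          using c(1) d(1) \<iota>F[OF i] QO by (simp add: Hom_iff)
      qed
      then have "a0 \<boxminus> c \<cdot> (d \<cdot> a0) = zm B0 Q" using c(1) d(1) a0 QO by (simp add: Hom_iff)
      then show ?thesis using diff_eq_zero[of a0 "c \<cdot> (d \<cdot> a0)"] a0 c(1) d(1) by (auto simp: Hom_iff)
    qed
    define a' where "a' = d \<cdot> a0"
    have a': "a' \<in> hm B0 E0" unfolding a'_def using a0 d Comp_Hom by blast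
    obtain E q p where tE: "tri B0 E0 E a' q p" using obtain_cone[OF a'] .
    note tEH = tri_Hom[OF tE]
    have Ec: "E \<in> cob" using cob_cone[OF tE B0c E0c] .
    have q: "q \<in> hm E0 E" and p: "p \<in> hm E B" using tEH B0 by auto
    have "c \<cdot> a' = (\<boxminus> k) \<cdot> b0" using cda unfolding a'_def a0_def by simp
    \<comment> \<open>TR3 compares the compact triangle on \<open>a'\<close> with the large one,
      which is rotated back so that its first map carries the sign present in
      \<open>a0\<close>.\<close>
    then obtain m where m: "m \<in> hm E X" "m \<cdot> q = s \<cdot> c" "b \<cdot> p = u \<cdot> m"
      using TR3[OF tE k(4) b0(1) c(1)] b0(2) by blast
    have sc: "s \<cdot> c \<in> through J X"
    proof (rule through_fin_supp[OF J e(3) s(1) si c(1) E0c])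
      have "supp_by \<iota> F c"
      proof (rule supp_byI[OF c(1)])
        fix v Y assume v: "v \<in> hm Q Y" "\<And>i. i \<in> F \<Longrightarrow> v \<cdot> \<iota> i = zm (Dom T (\<iota> i)) Y"
        have YO: "Y \<in> Ob T" using v Hom_Ob by blast
        show "v \<cdot> c = zm E0 Y"
        proof (rule coproduct_ext[OF E0 Comp_Hom[OF c(1) v(1)] zero_Hom[OF E0O YO]])
          fix i assume i: "i \<in> F"
          have "v \<cdot> c \<cdot> \<eta> i = v \<cdot> \<iota> i" using c v(1) \<eta>[OF i] i by (simp add: Hom_iff)
          then show "v \<cdot> c \<cdot> \<eta> i = zm E0 Y \<cdot> \<eta> i" using v(2)[OF i] \<iota>F[OF i] \<eta>[OF i] YO by (simp add: Hom_iff)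
        qed
      qed
      then show "fin_supp ?I \<iota> c" unfolding fin_supp_def using F by blast
    qed
    \<comment> \<open>\<Sigma>c is split by \<Sigma>d, so it suffices to check after \<Sigma>c.
      There \<Sigma>(c a') = \<Sigma>a0 = -(r b), and r b g = r u y = 0 because r u = 0.\<close>
    have lift: "(\<boxminus> ShMor T a') \<cdot> g = zm A (ShOb T E0)"
    proof -
      have Sc: "ShMor T c \<cdot> ShMor T a' = ShMor T a0" using cda c(1) a' unfolding a'_def[symmetric] by (metis Sh_comp Hom_iff)
      have Sa0: "ShMor T a0 = \<boxminus> (r \<cdot> b)" unfolding a0_def using k(2,3) b0 by (simp add: Hom_iff)
      have "r \<cdot> b \<cdot> g = r \<cdot> (u \<cdot> y)" using g tH by (auto simp: Hom_iff)
      also have "\<dots> = r \<cdot> u \<cdot> y" using tH y by (auto simp: Hom_iff)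
      also have "\<dots> = zm A (ShOb T Q)" using tri_comp'[OF t] y QO by (auto simp: Hom_iff)
      finally have rbg: "r \<cdot> b \<cdot> g = zm A (ShOb T Q)" .
      have rb: "r \<cdot> b \<in> hm B (ShOb T Q)" using tH g(4) Comp_Hom by blast
      have SH: "ShMor T c \<in> hm (ShOb T E0) (ShOb T Q)" "ShMor T d \<in> hm (ShOb T Q) (ShOb T E0)" "ShMor T a' \<in> hm B (ShOb T E0)"
        using c(1) d(1) a' B0 ShMor_Hom by auto
      have "ShMor T d \<cdot> (ShMor T c \<cdot> ShMor T a' \<cdot> g) = ShMor T d \<cdot> ((\<boxminus> (r \<cdot> b)) \<cdot> g)" using Sc Sa0 by simp
      also have "(\<boxminus> (r \<cdot> b)) \<cdot> g = \<boxminus> (r \<cdot> b \<cdot> g)" by (rule neg_comp) (use rb g(2) in \<open>auto simp: Hom_iff\<close>)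
      also have "ShMor T d \<cdot> (\<boxminus> (r \<cdot> b \<cdot> g)) = zm A (ShOb T E0)" unfolding rbg using SH AO QO by (auto simp: Hom_iff)
      also have "ShMor T d \<cdot> (ShMor T c \<cdot> ShMor T a' \<cdot> g) = (ShMor T d \<cdot> ShMor T c) \<cdot> (ShMor T a' \<cdot> g)"
        using SH g(2) by (auto simp: Hom_iff)
      also have "ShMor T d \<cdot> ShMor T c = ID (ShOb T E0)" using dc c(1) d(1) E0O by (metis Sh_comp Hom_iff Sh_Id)
      finally have "ShMor T a' \<cdot> g = zm A (ShOb T E0)" using SH g(2) by (auto simp: Hom_iff)
      then show ?thesis using SH g(2) E0O AO by (auto simp: Hom_iff)
    qed
    have trot: "tri E0 E B q p (\<boxminus> ShMor T a')" using tri_rotate[OF tE] B0 by simp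
    obtain g' where g': "g' \<in> hm A E" "g = p \<cdot> g'" using tri_lift[OF tri_rotate[OF trot] g(2) lift] .
    have mg: "m \<cdot> g' \<in> through J X"
      using through_triangle[OF J trot A E0c Ec g(3) m(1) g'(1)] sc m(2) g(1) g'(2) by simp
    \<comment> \<open>Since u(m g') = b p g' = b g = u y, the difference z is killed by u.\<close>
    define z where "z = y \<boxminus> m \<cdot> g'"
    have mgH: "m \<cdot> g' \<in> hm A X" using m(1) g'(1) Comp_Hom by blast
    have z: "z \<in> hm A X" unfolding z_def using y mgH by (auto simp: Hom_iff)
    have "u \<cdot> (m \<cdot> g') = u \<cdot> m \<cdot> g'" using u m(1) g'(1) by (auto simp: Hom_iff)
    also have "\<dots> = b \<cdot> g" using m(3)[symmetric] g'(2) g(4) p g'(1) by (simp add: Hom_iff)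
    finally have um: "u \<cdot> (m \<cdot> g') = u \<cdot> y" using g(5) by simp
    have "u \<cdot> z = u \<cdot> y \<boxminus> u \<cdot> (m \<cdot> g')" unfolding z_def using y mgH u by (auto simp: Hom_iff)
    then have "u \<cdot> z = zm A X'" unfolding um using y u by (auto simp: Hom_iff)
    then obtain v where v: "v \<in> hm A Q" "z = s \<cdot> v" using tri_lift[OF t z] by blast
    have "fin_supp ?I \<iota> v" using compact_objectD[OF _ e(2,3) v(1)] A unfolding cpt_def by blast
    then have "z \<in> through J X" using through_fin_supp[OF J e(3) s(1) si v(1) A] v(2) by simp
    moreover have "y = z \<boxplus> m \<cdot> g'" unfolding z_def using y mgH by (auto simp: Hom_iff)
    ultimately show "y \<in> through J X" using through_add[OF J _ mg z mgH] by simp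
  qed
qed

text \<open>The object \<open>Y\<close> is the cone of \<open>1 - shift\<close> on the coproduct of the \<open>X n\<close>.\<close>

lemma telescope:
  fixes X :: "nat \<Rightarrow> 'o"
  assumes u: "\<And>n. u n \<in> hm (X n) (X (Suc n))"
  obtains Y c where "\<And>n. c n \<in> hm (X n) Y" "\<And>n. c (Suc n) \<cdot> u n = c n"
    "\<And>A b. A \<in> cob \<Longrightarrow> b \<in> hm A Y \<Longrightarrow> \<exists>n. \<exists>a \<in> hm A (X n). b = c n \<cdot> a"
    "\<And>A a. A \<in> cob \<Longrightarrow> a 0 \<in> hm A (X 0) \<Longrightarrow> (\<And>n. a (Suc n) = u n \<cdot> a n) \<Longrightarrow> c 0 \<cdot> a 0 = zm A Y \<Longrightarrow>
        \<exists>n. a n = zm A (X n)"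
proof -
  have XO: "X n \<in> Ob T" for n using u Hom_Ob by blast
  obtain e :: "nat \<Rightarrow> 'u" and P \<iota>' where e: "inj_on e UNIV" "small \<kappa> (range e)"
    "is_coproduct T (range e) (\<lambda>k. X (the_inv_into UNIV e k)) P \<iota>'" "\<And>n. \<iota>' (e n) \<in> hm (X n) P"
    using obtain_coproduct[OF small_nat, of X] XO by (metis UNIV_I)
  let ?X = "\<lambda>k. X (the_inv_into UNIV e k)"
  have inv [simp]: "the_inv_into UNIV e (e n) = n" for n using the_inv_into_f_f[OF e(1)] by simp
  note cop = e(3)
  have PO: "P \<in> Ob T" using coproduct_Ob[OF cop] .
  define \<iota> where "\<iota> n = \<iota>' (e n)" for n
  have \<iota>: "\<iota> n \<in> hm (X n) P" for n using e(4) unfolding \<iota>_def .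
  obtain p' where p': "\<And>i. i \<in> range e \<Longrightarrow> p' i \<in> hm P (?X i)" "\<And>i. i \<in> range e \<Longrightarrow> p' i \<cdot> \<iota>' i = ID (?X i)"
    "\<And>i j. i \<in> range e \<Longrightarrow> j \<in> range e \<Longrightarrow> i \<noteq> j \<Longrightarrow> p' i \<cdot> \<iota>' j = zm (?X j) (?X i)"
    using coproduct_proj[OF cop] by blast
  define p where "p n = p' (e n)" for n
  have p: "p n \<in> hm P (X n)" "p n \<cdot> \<iota> n = ID (X n)" for n
    using p'(1,2)[of "e n"] unfolding p_def \<iota>_def by auto
  have pn: "p n \<cdot> \<iota> k = zm (X k) (X n)" if "n \<noteq> k" for n k
    using p'(3)[of "e n" "e k"] that e(1) unfolding p_def \<iota>_def by (auto simp: inj_on_def)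
  have "\<iota>' i \<boxminus> \<iota> (Suc (the_inv_into UNIV e i)) \<cdot> u (the_inv_into UNIV e i) \<in> hm (?X i) P" if "i \<in> range e" for i
    using that \<iota>[of "Suc (the_inv_into UNIV e i)"] u[of "the_inv_into UNIV e i"] e(4) by (auto simp: Hom_iff)
  then obtain s where s: "s \<in> hm P P" "\<And>i. i \<in> range e \<Longrightarrow>
      s \<cdot> \<iota>' i = \<iota>' i \<boxminus> \<iota> (Suc (the_inv_into UNIV e i)) \<cdot> u (the_inv_into UNIV e i)"
    using coproduct_induced[OF cop PO, of "\<lambda>i. \<iota>' i \<boxminus> \<iota> (Suc (the_inv_into UNIV e i)) \<cdot> u (the_inv_into UNIV e i)"] by metis
  have sn: "s \<cdot> \<iota> n = \<iota> n \<boxminus> \<iota> (Suc n) \<cdot> u n" for n using s(2)[of "e n"] unfolding \<iota>_def by simp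
  have ext: "v = w" if "v \<in> hm P Y" "w \<in> hm P Y" "\<And>n. v \<cdot> \<iota> n = w \<cdot> \<iota> n" for v w Y
    by (rule coproduct_ext[OF cop that(1,2)]) (use that(3) in \<open>auto simp: \<iota>_def\<close>)
  \<comment> \<open>With s = 1 - shift, the components satisfy p_0 s = p_0 and p_(k+1) s = p_(k+1) -
    u_k p_k. Hence the components of w are determined recursively by those of s w; this is used once
    for s a = 0 and once for s w = \<iota>_0 a_0.\<close>
  have ps0: "p 0 \<cdot> s = p 0"
  proof (rule ext[OF Comp_Hom[OF s(1) p(1)] p(1)])
    fix n
    have "p 0 \<cdot> s \<cdot> \<iota> n = p 0 \<cdot> \<iota> n \<boxminus> (p 0 \<cdot> \<iota> (Suc n)) \<cdot> u n"
      using p(1)[of 0] s(1) \<iota>[of n] \<iota>[of "Suc n"] u[of n] sn[of n] by (auto simp: Hom_iff)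
    then show "p 0 \<cdot> s \<cdot> \<iota> n = p 0 \<cdot> \<iota> n"
      using pn[of 0 "Suc n"] p(1)[of 0] \<iota>[of n] u[of n] XO by (auto simp: Hom_iff)
  qed
  have psS: "p (Suc k) \<cdot> s = p (Suc k) \<boxminus> u k \<cdot> p k" for k
  proof (rule ext[OF Comp_Hom[OF s(1) p(1)]])
    show "p (Suc k) \<boxminus> u k \<cdot> p k \<in> hm P (X (Suc k))" using p(1)[of "Suc k"] p(1)[of k] u[of k] by (auto simp: Hom_iff)
    fix n
    have l: "p (Suc k) \<cdot> s \<cdot> \<iota> n = p (Suc k) \<cdot> \<iota> n \<boxminus> (p (Suc k) \<cdot> \<iota> (Suc n)) \<cdot> u n"
      using p(1)[of "Suc k"] s(1) \<iota>[of n] \<iota>[of "Suc n"] u[of n] sn[of n] by (auto simp: Hom_iff)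
    have r: "(p (Suc k) \<boxminus> u k \<cdot> p k) \<cdot> \<iota> n = p (Suc k) \<cdot> \<iota> n \<boxminus> u k \<cdot> (p k \<cdot> \<iota> n)"
      using p(1)[of "Suc k"] p(1)[of k] \<iota>[of n] u[of k] by (auto simp: Hom_iff)
    have "(p (Suc k) \<cdot> \<iota> (Suc n)) \<cdot> u n = u k \<cdot> (p k \<cdot> \<iota> n)"
    proof (cases "n = k")
      case True
      then show ?thesis using p(2)[of "Suc k"] p(2)[of k] u[of k] by (auto simp: Hom_iff)
    next
      case False
      then show ?thesis using pn[of "Suc k" "Suc n"] pn[of k n] u[of k] u[of n] XO by (auto simp: Hom_iff)
    qed
    then show "p (Suc k) \<cdot> s \<cdot> \<iota> n = (p (Suc k) \<boxminus> u k \<cdot> p k) \<cdot> \<iota> n" unfolding l r by simp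
  qed
  have fs: "fin_supp (range e) \<iota>' a" if "A \<in> cob" "a \<in> hm A P" for A a
    using compact_objectD[OF _ e(2) cop that(2)] that(1) unfolding cpt_def by blast
  have zero: "a = zm A P" if a: "A \<in> cob" "a \<in> hm A P" "\<And>n. p n \<cdot> a = zm A (X n)" for A a
  proof (rule fin_supp_zero[OF cop a(2) fs[OF a(1,2)] p'])
    fix i assume "i \<in> range e"
    then show "p' i \<cdot> a = zm A (?X i)" using a(3) unfolding p_def by auto
  qed
  obtain Y \<pi> r where t: "tri P P Y s \<pi> r" using obtain_cone[OF s(1)] .
  note tH = tri_Hom[OF t]
  have \<pi>: "\<pi> \<in> hm P Y" using tH by blast
  define c where "c n = \<pi> \<cdot> \<iota> n" for n
  have c: "c n \<in> hm (X n) Y" for n unfolding c_def using \<pi> \<iota>[of n] Comp_Hom by blast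
  have cu: "c (Suc n) \<cdot> u n = c n" for n
  proof -
    have "\<pi> \<cdot> (s \<cdot> \<iota> n) = \<pi> \<cdot> s \<cdot> \<iota> n" using \<pi> s(1) \<iota>[of n] by (auto simp: Hom_iff)
    also have "\<dots> = zm (X n) Y" using tri_comp[OF t] \<iota>[of n] tH by (auto simp: Hom_iff)
    finally have "c n \<boxminus> c (Suc n) \<cdot> u n = zm (X n) Y"
      unfolding sn c_def using \<pi> \<iota>[of n] \<iota>[of "Suc n"] u[of n] by (auto simp: Hom_iff)
    then show ?thesis using diff_eq_zero[of "c n" "c (Suc n) \<cdot> u n"] c[of n] c[of "Suc n"] u[of n] by (auto simp: Hom_iff)
  qed
  \<comment> \<open>A morphism from stage n can be rewritten at any later stage; this allows two of
    them to be added at a common stage n + k.\<close>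
  have cd: "\<exists>a' \<in> hm A (X (n + d)). c n \<cdot> a = c (n + d) \<cdot> a'" if a: "a \<in> hm A (X n)" for A n d a
  proof (induction d)
    case 0
    then show ?case using a by auto
  next
    case (Suc d)
    then obtain a' where a': "a' \<in> hm A (X (n + d))" "c n \<cdot> a = c (n + d) \<cdot> a'" by blast
    have "c (n + d) \<cdot> a' = c (Suc (n + d)) \<cdot> (u (n + d) \<cdot> a')"
      using cu[of "n + d"] c[of "Suc (n + d)"] u[of "n + d"] a'(1) by (metis Hom_iff comp_assoc)
    then show ?case using a' Comp_Hom[OF a'(1) u] by auto
  qed
  show thesis
  proof
    show "c n \<in> hm (X n) Y" "c (Suc n) \<cdot> u n = c n" for n using c cu by blast+
  next
    fix A b assume A: "A \<in> cob" and b: "b \<in> hm A Y"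
    have AO: "A \<in> Ob T" using cob_Ob[OF A] .
    \<comment> \<open>The map s is injective on morphisms out of compact objects: r b desuspends to
      some a with s a = 0, the recursion forces all components of a to vanish, and finite support
      gives a = 0. Therefore b lifts along \<pi>.\<close>
    have rb: "r \<cdot> b = zm A (ShOb T P)"
    proof -
      obtain A' where A': "A' \<in> Ob T" "A = ShOb T A'" using ShOb_surj AO by blast
      have A'c: "A' \<in> cob" using cob_Sh A A' by blast
      have rbH: "r \<cdot> b \<in> hm A (ShOb T P)" using tH b Comp_Hom by blast
      then obtain a where a: "a \<in> hm A' P" "r \<cdot> b = ShMor T a" using ShMor_surj[of "r \<cdot> b" A' P] A' PO by blast
      have "ShMor T s \<cdot> (r \<cdot> b) = ShMor T s \<cdot> r \<cdot> b" using s(1) tH b by (auto simp: Hom_iff)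
      also have "ShMor T s \<cdot> r = zm Y (ShOb T P)"
      proof -
        have "(\<boxminus> ShMor T s) \<cdot> r = zm Y (ShOb T P)" using tri_comp'[OF tri_rotate[OF t]] .
        then have "\<boxminus> (\<boxminus> (ShMor T s \<cdot> r)) = zm Y (ShOb T P)" using s(1) tH PO by (auto simp: Hom_iff)
        then show ?thesis using s(1) tH by (auto simp: Hom_iff)
      qed
      also have "zm Y (ShOb T P) \<cdot> b = zm A (ShOb T P)" using b PO by (auto simp: Hom_iff)
      finally have "ShMor T (s \<cdot> a) = ShMor T (zm A' P)" using a s(1) A' PO by (auto simp: Hom_iff)
      then have sa: "s \<cdot> a = zm A' P" using Sh_inj[of "s \<cdot> a" "zm A' P"] s(1) a(1) A' PO by (auto simp: Hom_iff)
      have "p n \<cdot> a = zm A' (X n)" for n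
      proof (induction n)
        case 0
        have "p 0 \<cdot> a = p 0 \<cdot> (s \<cdot> a)" using ps0 p(1)[of 0] s(1) a(1) by (metis Hom_iff comp_assoc)
        then show ?case unfolding sa using p(1)[of 0] A' by (auto simp: Hom_iff)
      next
        case (Suc k)
        have "p (Suc k) \<cdot> (s \<cdot> a) = p (Suc k) \<cdot> s \<cdot> a" using p(1)[of "Suc k"] s(1) a(1) by (auto simp: Hom_iff)
        also have "\<dots> = p (Suc k) \<cdot> a \<boxminus> u k \<cdot> (p k \<cdot> a)"
          unfolding psS using p(1)[of "Suc k"] p(1)[of k] u[of k] a(1) by (auto simp: Hom_iff)
        finally show ?case unfolding sa Suc using p(1)[of "Suc k"] a(1) u[of k] A' XO by (auto simp: Hom_iff)
      qed
      then have "a = zm A' P" using zero A'c a(1) by blast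
      then show ?thesis using a(2) A' PO by simp
    qed
    obtain a where a: "a \<in> hm A P" "b = \<pi> \<cdot> a" using tri_lift[OF tri_rotate[OF t] b rb] .
    have "\<exists>n. \<exists>a' \<in> hm A (X n). \<pi> \<cdot> a = c n \<cdot> a'"
      using cop a(1) fs[OF A a(1)]
    proof (induction rule: fin_supp_induct)
      case zero
      have "\<pi> \<cdot> zm A P = c 0 \<cdot> zm A (X 0)" using \<pi> c[of 0] AO by (auto simp: Hom_iff)
      then show ?case using zero_Hom[OF AO XO] by blast
    next
      case (add b i x)
      then obtain n a' where a': "a' \<in> hm A (X n)" "\<pi> \<cdot> b = c n \<cdot> a'" by blast
      obtain k where k: "i = e k" using add(1) by blast
      have x: "x \<in> hm A (X k)" using add(3) k by simp
      have eq: "\<pi> \<cdot> (b \<boxplus> \<iota>' i \<cdot> x) = c n \<cdot> a' \<boxplus> c k \<cdot> x"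
        unfolding a'(2)[symmetric] unfolding c_def k \<iota>_def using \<pi> add(2) x \<iota>[of k, unfolded \<iota>_def] by (auto simp: Hom_iff)
      obtain y where y: "y \<in> hm A (X (n + k))" "c n \<cdot> a' = c (n + k) \<cdot> y" using cd[OF a'(1)] by blast
      obtain z where z: "z \<in> hm A (X (n + k))" "c k \<cdot> x = c (n + k) \<cdot> z" using cd[OF x, of n] by (metis add.commute)
      have "\<pi> \<cdot> (b \<boxplus> \<iota>' i \<cdot> x) = c (n + k) \<cdot> (y \<boxplus> z)"
        unfolding eq y(2) z(2) using y(1) z(1) c[of "n + k"] by (auto simp: Hom_iff)
      then show ?case using add_Hom[OF y(1) z(1)] by blast
    qed
    then show "\<exists>n. \<exists>a \<in> hm A (X n). b = c n \<cdot> a" using a(2) by simp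
  next
    fix A a assume A: "A \<in> cob" and a0: "a 0 \<in> hm A (X 0)" and aS: "\<And>n. a (Suc n) = u n \<cdot> a n"
      and c0: "c 0 \<cdot> a 0 = zm A Y"
    have AO: "A \<in> Ob T" using cob_Ob[OF A] .
    have aH: "a n \<in> hm A (X n)" for n by (induction n) (use a0 aS u Comp_Hom in auto)
    have "\<pi> \<cdot> (\<iota> 0 \<cdot> a 0) = zm A Y" using c0 unfolding c_def using \<pi> \<iota>[of 0] a0 by (auto simp: Hom_iff)
    then obtain w where w: "w \<in> hm A P" "\<iota> 0 \<cdot> a 0 = s \<cdot> w" using tri_lift[OF t Comp_Hom[OF a0 \<iota>]] by blast
    \<comment> \<open>If \<iota>_0 a_0 = s w, the recursion identifies the components of w with the
      iterates a_n. As w has finite support, some a_n is zero.\<close>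
    have pw: "p n \<cdot> w = a n" for n
    proof (induction n)
      case 0
      have "p 0 \<cdot> w = p 0 \<cdot> (s \<cdot> w)" using ps0 p(1)[of 0] s(1) w(1) by (metis Hom_iff comp_assoc)
      also have "\<dots> = p 0 \<cdot> \<iota> 0 \<cdot> a 0" using w(2)[symmetric] p(1)[of 0] \<iota>[of 0] a0 by (auto simp: Hom_iff)
      finally show ?case using p(2)[of 0] a0 by (auto simp: Hom_iff)
    next
      case (Suc k)
      have "p (Suc k) \<cdot> (s \<cdot> w) = p (Suc k) \<cdot> s \<cdot> w" using p(1)[of "Suc k"] s(1) w(1) by (auto simp: Hom_iff)
      also have "\<dots> = p (Suc k) \<cdot> w \<boxminus> u k \<cdot> (p k \<cdot> w)"
        unfolding psS using p(1)[of "Suc k"] p(1)[of k] u[of k] w(1) by (auto simp: Hom_iff)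
      also have "p (Suc k) \<cdot> (s \<cdot> w) = p (Suc k) \<cdot> \<iota> 0 \<cdot> a 0"
        using w(2)[symmetric] p(1)[of "Suc k"] \<iota>[of 0] a0 by (auto simp: Hom_iff)
      also have "\<dots> = zm A (X (Suc k))" using pn[of "Suc k" 0] a0 XO by (auto simp: Hom_iff)
      finally have "p (Suc k) \<cdot> w \<boxminus> u k \<cdot> (p k \<cdot> w) = zm A (X (Suc k))" by simp
      then have "p (Suc k) \<cdot> w = u k \<cdot> (p k \<cdot> w)"
        using diff_eq_zero[of "p (Suc k) \<cdot> w" "u k \<cdot> (p k \<cdot> w)"] p(1)[of "Suc k"] p(1)[of k] u[of k] w(1) by (auto simp: Hom_iff)
      then show ?case using Suc aS by simp
    qed
    obtain F where F: "finite F" "F \<subseteq> range e" "supp_by \<iota>' F w" using fs[OF A w(1)] unfolding fin_supp_def by blast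
    have "finite {n. e n \<in> F}" using finite_vimageI[OF F(1), of e] e(1) by (simp add: vimage_def)
    then obtain n where n: "e n \<notin> F" using infinite_UNIV_nat by (metis (no_types, lifting) UNIV_eq_I mem_Collect_eq)
    have "p n \<cdot> w = zm A (X n)"
    proof (rule supp_byD[OF F(3) w(1) p(1)])
      fix i assume i: "i \<in> F"
      then obtain k where k: "i = e k" using F(2) by blast
      then have "n \<noteq> k" using n i by auto
      then show "p n \<cdot> \<iota>' i = zm (Dom T (\<iota>' i)) (X n)" using pn[of n k] \<iota>[of k] k unfolding \<iota>_def by (auto simp: Hom_iff)
    qed
    then show "\<exists>n. a n = zm A (X n)" using pw[of n] by auto
  qed
qed

lemma saturated_separation:
  assumes J: "saturated J" and f: "f \<in> cmor" "f \<notin> J"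
  obtains X where "X \<in> Ob T" "\<And>j. j \<in> J \<Longrightarrow> kills T X j" "\<not> kills T X f"
proof -
  obtain A B where fH: "f \<in> hm A B" and c: "A \<in> cob" "B \<in> cob" using f(1) cmor_iff cmorE by metis
  define P where "P X X' u \<longleftrightarrow> u \<in> hm X X' \<and> (\<forall>x \<in> through J X. u \<cdot> x = zm (Dom T x) X') \<and>
    (\<forall>A \<in> cob. \<forall>y \<in> hm A X. u \<cdot> y \<in> through J X' \<longrightarrow> y \<in> through J X)" for X X' u
  have ex: "\<exists>X'. X' \<in> Ob T \<and> (\<exists>u. P X X' u)" if X: "X \<in> Ob T" for X
  proof -
    obtain X' u where "u \<in> hm X X'" "\<And>x. x \<in> through J X \<Longrightarrow> u \<cdot> x = zm (Dom T x) X'"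
      "\<And>A y. A \<in> cob \<Longrightarrow> y \<in> hm A X \<Longrightarrow> u \<cdot> y \<in> through J X' \<Longrightarrow> y \<in> through J X"
    proof (rule saturated_step[OF J X], goal_cases)
      case (1 u X')
      show ?case by (rule 1(1)[OF 1(2-4)])
    qed
    then show ?thesis using Hom_Ob unfolding P_def by (intro exI[of _ X']) blast
  qed
  have "\<exists>X. \<forall>n. (X n \<in> Ob T \<and> (n = 0 \<longrightarrow> X n = B)) \<and> (\<exists>u. P (X n) (X (Suc n)) u)"
    by (rule dependent_nat_choice) (use ex cob_Ob[OF c(2)] in auto)
  then obtain X where X: "\<And>n. X n \<in> Ob T" "X 0 = B" "\<And>n. \<exists>u. P (X n) (X (Suc n)) u" by blast
  then obtain u where P: "\<And>n. P (X n) (X (Suc n)) (u n)" by metis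
  have u: "u n \<in> hm (X n) (X (Suc n))" "\<And>x. x \<in> through J (X n) \<Longrightarrow> u n \<cdot> x = zm (Dom T x) (X (Suc n))"
    "\<And>A y. A \<in> cob \<Longrightarrow> y \<in> hm A (X n) \<Longrightarrow> u n \<cdot> y \<in> through J (X (Suc n)) \<Longrightarrow> y \<in> through J (X n)" for n
    using P[of n] unfolding P_def by blast+
  obtain Y d where Y: "\<And>n. d n \<in> hm (X n) Y" "\<And>n. d (Suc n) \<cdot> u n = d n"
    "\<And>A b. A \<in> cob \<Longrightarrow> b \<in> hm A Y \<Longrightarrow> \<exists>n. \<exists>a \<in> hm A (X n). b = d n \<cdot> a"
    "\<And>A a. A \<in> cob \<Longrightarrow> a 0 \<in> hm A (X 0) \<Longrightarrow> (\<And>n. a (Suc n) = u n \<cdot> a n) \<Longrightarrow> d 0 \<cdot> a 0 = zm A Y \<Longrightarrow>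
        \<exists>n. a n = zm A (X n)"
  proof (rule telescope[of u X, OF u(1)], goal_cases)
    case (1 c Y)
    show ?case by (rule 1(1)[OF 1(2-5)])
  qed
  have YO: "Y \<in> Ob T" using Y(1) Hom_Ob by blast
  show thesis
  proof
    show "Y \<in> Ob T" by fact
    fix j assume j: "j \<in> J"
    show "kills T Y j" unfolding kills_def
    proof
      fix b assume b: "b \<in> hm (Cod T j) Y"
      have jc: "j \<in> cmor" using saturated_cmor[OF J j] .
      have jH: "j \<in> hm (Dom T j) (Cod T j)" "Cod T j \<in> cob" using cmorE[OF jc] by metis+
      obtain n a where a: "a \<in> hm (Cod T j) (X n)" "b = d n \<cdot> a" using Y(3)[OF jH(2) b] by blast
      have "a \<cdot> j \<in> through J (X n)" using throughI[OF j jH(1) a(1)] .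
      then have "u n \<cdot> (a \<cdot> j) = zm (Dom T j) (X (Suc n))" using u(2) a(1) jH(1) by (simp add: Hom_iff)
      moreover have "b \<cdot> j = d (Suc n) \<cdot> (u n \<cdot> (a \<cdot> j))"
      proof -
        have "d (Suc n) \<cdot> (u n \<cdot> (a \<cdot> j)) = d (Suc n) \<cdot> u n \<cdot> (a \<cdot> j)"
          using Y(1)[of "Suc n"] u(1)[of n] a(1) jH(1) by (auto simp: Hom_iff)
        then show ?thesis using Y(1)[of n] a jH(1) unfolding Y(2) by (auto simp: Hom_iff)
      qed
      ultimately show "b \<cdot> j = zm (Dom T j) Y" using Y(1)[of "Suc n"] jH(1) by (auto simp: Hom_iff)
    qed
  next
    show "\<not> kills T Y f"
    proof
      assume "kills T Y f"
      then have d0: "d 0 \<cdot> f = zm A Y" unfolding kills_def using Y(1)[of 0] X(2) fH by (auto simp: Hom_iff)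
      define a where "a = rec_nat f (\<lambda>n x. u n \<cdot> x)"
      have a: "a 0 = f" "\<And>n. a (Suc n) = u n \<cdot> a n" unfolding a_def by simp_all
      have aH: "a n \<in> hm A (X n)" for n by (induction n) (use a fH X(2) u(1) Comp_Hom in auto)
      obtain n where n: "a n = zm A (X n)" using Y(4)[OF c(1), of a] a d0 aH by metis
      \<comment> \<open>If \<open>f\<close> died in the telescope, some iterate a_n would be zero
        and thus factor through \<open>J\<close>. By the third property of the maps u this descends
        to stage 0, where the target is compact and factoring through \<open>J\<close> means lying
        in \<open>J\<close>.\<close>
      have thr: "a k \<in> through J (X k) \<Longrightarrow> a 0 \<in> through J (X 0)" for k
      proof (induction k)
        case (Suc k)
        then show ?case using u(3)[OF c(1) aH] a(2) by simp
      qed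
      have "a n \<in> through J (X n)" unfolding n using through_zero[OF J c(1) X(1)] .
      then have "f \<in> through J B" using thr a(1) X(2) by metis
      then show False using through_compact[OF J _ c(2)] f(2) by blast
    qed
  qed
qed

end

section \<open>Subquotients of representable functors\<close>

context additive_category
begin

definition coset :: "'m set \<Rightarrow> 'm \<Rightarrow> 'm set" where
  "coset N x = (\<lambda>n. n \<boxplus> x) ` N"

text \<open>The value at X is the group (M X + N X)/N X of cosets in (K,X), which is M X/N X when N
  X lies in M X. Elements are sets of morphisms, so these functors have the same type as
  \<open>coker_functor\<close>.\<close>

definition subquot :: "'o \<Rightarrow> ('o \<Rightarrow> 'm set) \<Rightarrow> ('o \<Rightarrow> 'm set) \<Rightarrow> ('o, 'm, 'm set) abfun" where
  "subquot K M N =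
     \<lparr>FOb = (\<lambda>X. \<lparr>carrier = coset (N X) ` M X, mult = set_mult (hom_group C K X), one = N X\<rparr>),
      FMor = (\<lambda>u S. \<Union>a\<in>S. coset (N (Cod C u)) (u \<cdot> a))\<rparr>"

definition subfunctor :: "'o \<Rightarrow> ('o \<Rightarrow> 'm set) \<Rightarrow> bool" where
  "subfunctor K M \<longleftrightarrow> K \<in> Ob C \<and> (\<forall>X \<in> Ob C. M X \<subseteq> hm K X \<and> zm K X \<in> M X \<and>
      (\<forall>x \<in> M X. \<boxminus> x \<in> M X \<and> (\<forall>y \<in> M X. x \<boxplus> y \<in> M X))) \<and>
     (\<forall>X Y. \<forall>u \<in> hm X Y. \<forall>x \<in> M X. u \<cdot> x \<in> M Y)"

text \<open>Precomposition with t on cosets, where \<open>N\<close> is the denominator of the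
  target. The union over all representatives avoids a choice: when the map is well defined all of
  them contribute the same coset.\<close>

definition induced_map ::
  "('o, 'm, 'm set) abfun \<Rightarrow> ('o \<Rightarrow> 'm set) \<Rightarrow> 'm \<Rightarrow> 'o \<Rightarrow> 'm set \<Rightarrow> 'm set" where
  "induced_map F N t = (\<lambda>X\<in>Ob C. \<lambda>S\<in>carrier (FOb F X). \<Union>a\<in>S. coset (N X) (a \<cdot> t))"

lemma subfunctor_pim: assumes "f \<in> hm A B" shows "subfunctor A (pim f)"
  unfolding subfunctor_def
proof (intro conjI ballI allI)
  show A: "A \<in> Ob C" using assms Hom_Ob by blast
  have B: "B \<in> Ob C" using assms Hom_Ob by blast
  fix X assume X: "X \<in> Ob C"
  show "pim f X \<subseteq> hm A X" using pim_Hom[of f _ X] assms by (auto simp: Hom_iff)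
  show "zm A X \<in> pim f X" using pimI[of "zm B X" f X] assms X B by (auto simp: Hom_iff)
  fix x assume "x \<in> pim f X"
  then obtain b where b: "b \<in> hm B X" "x = b \<cdot> f" unfolding pim_iff using assms by (auto simp: Hom_iff)
  show "\<boxminus> x \<in> pim f X" using pimI[of "\<boxminus> b" f X] b assms by (auto simp: Hom_iff)
  fix y assume "y \<in> pim f X"
  then obtain c where c: "c \<in> hm B X" "y = c \<cdot> f" unfolding pim_iff using assms by (auto simp: Hom_iff)
  show "x \<boxplus> y \<in> pim f X" using pimI[of "b \<boxplus> c" f X] b c assms by (auto simp: Hom_iff)
next
  fix X Y u x assume "u \<in> hm X Y" "x \<in> pim f X"
  then show "u \<cdot> x \<in> pim f Y" using pim_push[of f x X u Y] assms by (auto simp: Hom_iff)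
qed

lemma pim_Id: "K \<in> Ob C \<Longrightarrow> pim (ID K) = hm K"
  unfolding precomp_image_def fun_eq_iff by (force simp: Hom_iff)

lemma subfunctor_hm: "K \<in> Ob C \<Longrightarrow> subfunctor K (hm K)"
  using subfunctor_pim[OF Id_Hom] pim_Id by metis

lemma subfunctorD:
  assumes "subfunctor K M" "X \<in> Ob C"
  shows "K \<in> Ob C" "x \<in> M X \<Longrightarrow> x \<in> hm K X" "zm K X \<in> M X" "x \<in> M X \<Longrightarrow> \<boxminus> x \<in> M X"
    "x \<in> M X \<Longrightarrow> y \<in> M X \<Longrightarrow> x \<boxplus> y \<in> M X"
  using assms unfolding subfunctor_def by blast+

lemma subfunctor_push: "subfunctor K M \<Longrightarrow> u \<in> hm X Y \<Longrightarrow> x \<in> M X \<Longrightarrow> u \<cdot> x \<in> M Y"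
  unfolding subfunctor_def by blast

lemma subfunctor_diff: "subfunctor K M \<Longrightarrow> X \<in> Ob C \<Longrightarrow> x \<in> M X \<Longrightarrow> y \<in> M X \<Longrightarrow> x \<boxminus> y \<in> M X"
  using subfunctorD by meson

lemma mem_coset: assumes "subfunctor K N" "x \<in> hm K X" "y \<in> hm K X"
  shows "y \<in> coset (N X) x \<longleftrightarrow> y \<boxminus> x \<in> N X"
proof
  have X: "X \<in> Ob C" using assms Hom_Ob by blast
  assume "y \<in> coset (N X) x"
  then obtain n where n: "n \<in> N X" "y = n \<boxplus> x" unfolding coset_def by blast
  have "n \<in> hm K X" using subfunctorD(2)[OF assms(1) X n(1)] .
  then have "y \<boxminus> x = n" using n(2) assms(2) by (auto simp: Hom_iff)
  then show "y \<boxminus> x \<in> N X" using n by simp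
next
  assume "y \<boxminus> x \<in> N X"
  moreover have "y = y \<boxminus> x \<boxplus> x" using assms by (auto simp: Hom_iff)
  ultimately show "y \<in> coset (N X) x" unfolding coset_def by blast
qed

lemma coset_Hom: assumes "subfunctor K N" "x \<in> hm K X" "y \<in> coset (N X) x" shows "y \<in> hm K X"
proof -
  have X: "X \<in> Ob C" using assms Hom_Ob by blast
  obtain n where n: "n \<in> N X" "y = n \<boxplus> x" using assms(3) unfolding coset_def by blast
  then show ?thesis using add_Hom subfunctorD(2)[OF assms(1) X n(1)] assms(2) by blast
qed

lemma coset_self: assumes "subfunctor K N" "x \<in> hm K X" shows "x \<in> coset (N X) x"
proof -
  have X: "X \<in> Ob C" using assms Hom_Ob by blast
  show ?thesis using mem_coset[OF assms assms(2)] subfunctorD(3)[OF assms(1) X] assms(2) by (auto simp: Hom_iff)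
qed

lemma coset_eq: assumes "subfunctor K N" "x \<in> hm K X" "y \<in> hm K X"
  shows "coset (N X) x = coset (N X) y \<longleftrightarrow> x \<boxminus> y \<in> N X"
proof
  assume "coset (N X) x = coset (N X) y"
  then have "x \<in> coset (N X) y" using coset_self[OF assms(1,2)] by simp
  then show "x \<boxminus> y \<in> N X" using mem_coset assms by blast
next
  have X: "X \<in> Ob C" using assms Hom_Ob by blast
  have sub: "coset (N X) x \<subseteq> coset (N X) y" if x: "x \<in> hm K X" and y: "y \<in> hm K X" and d: "x \<boxminus> y \<in> N X" for x y
  proof
    fix z assume z: "z \<in> coset (N X) x"
    have zH: "z \<in> hm K X" using coset_Hom[OF assms(1) x z] .
    have "(z \<boxminus> x) \<boxplus> (x \<boxminus> y) \<in> N X" using subfunctorD(5)[OF assms(1) X _ d] z mem_coset[OF assms(1) x zH] by blast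
    moreover have "(z \<boxminus> x) \<boxplus> (x \<boxminus> y) = z \<boxminus> y" using x y zH by (auto simp: Hom_iff add_assoc)
    ultimately show "z \<in> coset (N X) y" using mem_coset[OF assms(1) y zH] by simp
  qed
  assume d: "x \<boxminus> y \<in> N X"
  have "\<boxminus> (x \<boxminus> y) = y \<boxminus> x" using assms(2,3) add_comm[of "\<boxminus> x" y] by (auto simp: Hom_iff)
  then have d': "y \<boxminus> x \<in> N X" using subfunctorD(4)[OF assms(1) X d] by simp
  show "coset (N X) x = coset (N X) y" using sub[OF assms(2,3) d] sub[OF assms(3,2) d'] by blast
qed

lemma coset_zero: assumes "subfunctor K N" "X \<in> Ob C" shows "coset (N X) (zm K X) = N X"
proof -
  have "n \<boxplus> zm K X = n" if "n \<in> N X" for n using subfunctorD(2)[OF assms that] by (auto simp: Hom_iff)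
  then show ?thesis unfolding coset_def by (simp cong: image_cong)
qed

lemma coset_mult: assumes "subfunctor K N" "x \<in> hm K X" "y \<in> hm K X"
  shows "set_mult (hom_group C K X) (coset (N X) x) (coset (N X) y) = coset (N X) (x \<boxplus> y)"
proof -
  have X: "X \<in> Ob C" using assms Hom_Ob by blast
  have xy: "x \<boxplus> y \<in> hm K X" using assms add_Hom by blast
  have "z \<boxplus> w \<in> coset (N X) (x \<boxplus> y)" if z: "z \<in> coset (N X) x" and w: "w \<in> coset (N X) y" for z w
  proof -
    have zw: "z \<in> hm K X" "w \<in> hm K X" using coset_Hom assms z w by blast+
    have "(z \<boxminus> x) \<boxplus> (w \<boxminus> y) \<in> N X"
      using subfunctorD(5)[OF assms(1) X] z w mem_coset[OF assms(1,2) zw(1)] mem_coset[OF assms(1,3) zw(2)] by blast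
    moreover have "(z \<boxminus> x) \<boxplus> (w \<boxminus> y) = z \<boxplus> w \<boxminus> (x \<boxplus> y)"
      using zw assms(2,3) by (simp add: Hom_iff add_assoc add_left_comm)
    ultimately show ?thesis using mem_coset[OF assms(1) xy add_Hom[OF zw]] by simp
  qed
  moreover have "\<exists>z\<in>coset (N X) x. \<exists>w\<in>coset (N X) y. v = z \<boxplus> w" if v: "v \<in> coset (N X) (x \<boxplus> y)" for v
  proof -
    obtain n where n: "n \<in> N X" "v = n \<boxplus> (x \<boxplus> y)" using v unfolding coset_def by blast
    have nH: "n \<in> hm K X" using subfunctorD(2)[OF assms(1) X n(1)] .
    have "n \<boxplus> x \<in> coset (N X) x" using n(1) unfolding coset_def by blast
    moreover have "v = n \<boxplus> x \<boxplus> y" using n(2) nH assms(2,3) by (simp add: Hom_iff add_assoc)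
    ultimately show ?thesis using coset_self[OF assms(1,3)] by blast
  qed
  ultimately show ?thesis unfolding set_mult_def by (auto simp: hom_group_def)
qed

text \<open>Evaluates the unions in \<open>subquot\<close> and \<open>induced_map\<close>: a
  function that is constant on a coset has a union equal to its value at one representative.\<close>

lemma Union_coset:
  assumes "subfunctor K N" "x \<in> hm K X"
    and "\<And>a. a \<in> hm K X \<Longrightarrow> a \<boxminus> x \<in> N X \<Longrightarrow> g a = g x"
  shows "(\<Union>a\<in>coset (N X) x. g a) = g x"
proof -
  have "g a = g x" if a: "a \<in> coset (N X) x" for a
    using assms(3) a coset_Hom[OF assms(1,2) a] mem_coset[OF assms(1,2)] by blast
  then show ?thesis using coset_self[OF assms(1,2)] by blast
qed

lemma subquot_simps [simp]:
  "carrier (FOb (subquot K M N) X) = coset (N X) ` M X"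
  "mult (FOb (subquot K M N) X) = set_mult (hom_group C K X)"
  "one (FOb (subquot K M N) X) = N X"
  "FMor (subquot K M N) u S = (\<Union>a\<in>S. coset (N (Cod C u)) (u \<cdot> a))"
  unfolding subquot_def by auto

lemma subquot_FMor: assumes "subfunctor K N" "x \<in> hm K X" "u \<in> hm X Y"
  shows "FMor (subquot K M N) u (coset (N X) x) = coset (N Y) (u \<cdot> x)"
proof -
  have "coset (N Y) (u \<cdot> a) = coset (N Y) (u \<cdot> x)" if a: "a \<in> hm K X" "a \<boxminus> x \<in> N X" for a
  proof -
    have "u \<cdot> (a \<boxminus> x) \<in> N Y" using subfunctor_push[OF assms(1,3) a(2)] .
    moreover have "u \<cdot> (a \<boxminus> x) = u \<cdot> a \<boxminus> u \<cdot> x" using a assms(2,3) by (auto simp: Hom_iff)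
    ultimately show ?thesis using coset_eq[OF assms(1) Comp_Hom[OF a(1) assms(3)] Comp_Hom[OF assms(2,3)]] by simp
  qed
  then have "(\<Union>a\<in>coset (N X) x. coset (N Y) (u \<cdot> a)) = coset (N Y) (u \<cdot> x)"
    by (rule Union_coset[OF assms(1,2)])
  then show ?thesis using assms(3) by (simp add: Hom_iff)
qed

lemma subquot_comm_group:
  assumes M: "subfunctor K M" and N: "subfunctor K N" and X: "X \<in> Ob C"
  shows "comm_group (FOb (subquot K M N) X)"
proof (rule comm_groupI)
  note MD = subfunctorD[OF M X] note cm = coset_mult[OF N]
  let ?G = "FOb (subquot K M N) X"
  have rep: "\<exists>x \<in> M X. x \<in> hm K X \<and> S = coset (N X) x" if "S \<in> carrier ?G" for S using that MD(2) by auto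
  have one: "one ?G = coset (N X) (zm K X)" using coset_zero[OF N X] by simp
  show "S \<otimes>\<^bsub>?G\<^esub> S' \<in> carrier ?G" if "S \<in> carrier ?G" "S' \<in> carrier ?G" for S S'
    using rep[OF that(1)] rep[OF that(2)] cm MD(5) by auto
  show "one ?G \<in> carrier ?G" unfolding one using MD(3) by simp
  show "S \<otimes>\<^bsub>?G\<^esub> S' \<otimes>\<^bsub>?G\<^esub> S'' = S \<otimes>\<^bsub>?G\<^esub> (S' \<otimes>\<^bsub>?G\<^esub> S'')"
    if TT: "S \<in> carrier ?G" "S' \<in> carrier ?G" "S'' \<in> carrier ?G" for S S' S''
  proof -
    obtain x where x: "x \<in> hm K X" "S = coset (N X) x" using rep[OF TT(1)] by blast
    obtain y where y: "y \<in> hm K X" "S' = coset (N X) y" using rep[OF TT(2)] by blast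
    obtain z where z: "z \<in> hm K X" "S'' = coset (N X) z" using rep[OF TT(3)] by blast
    from x y z show ?thesis by (simp add: cm add_Hom) (simp add: add_assoc Hom_iff)
  qed
  show "S \<otimes>\<^bsub>?G\<^esub> S' = S' \<otimes>\<^bsub>?G\<^esub> S" if TT: "S \<in> carrier ?G" "S' \<in> carrier ?G" for S S'
  proof -
    obtain x where x: "x \<in> hm K X" "S = coset (N X) x" using rep[OF TT(1)] by blast
    obtain y where y: "y \<in> hm K X" "S' = coset (N X) y" using rep[OF TT(2)] by blast
    from x y show ?thesis by (simp add: cm add_Hom) (simp add: add_comm Hom_iff)
  qed
  show "one ?G \<otimes>\<^bsub>?G\<^esub> S = S" if TT: "S \<in> carrier ?G" for S
  proof -
    obtain x where "x \<in> hm K X" "S = coset (N X) x" using rep[OF TT] by blast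
    then show ?thesis using cm[of "zm K X" X x] zero_Hom[OF MD(1) X] coset_zero[OF N X] by (simp add: Hom_iff)
  qed
  show "\<exists>S'\<in>carrier ?G. S' \<otimes>\<^bsub>?G\<^esub> S = one ?G" if S: "S \<in> carrier ?G" for S
  proof -
    obtain x where x: "x \<in> M X" "x \<in> hm K X" "S = coset (N X) x" using rep[OF S] by blast
    then have "coset (N X) (\<boxminus> x) \<otimes>\<^bsub>?G\<^esub> S = one ?G"
      unfolding one using cm[OF neg_Hom[OF x(2)] x(2)] by (simp add: Hom_iff)
    moreover have "coset (N X) (\<boxminus> x) \<in> carrier ?G" using MD(4) x(1) by simp
    ultimately show ?thesis by blast
  qed
qed

lemma subquot_functor:
  assumes M: "subfunctor K M" and N: "subfunctor K N"
  shows "ab_functor C (subquot K M N)"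
  unfolding ab_functor_def
proof (intro conjI ballI allI)
  let ?F = "subquot K M N"
  show "comm_group (FOb ?F X)" if "X \<in> Ob C" for X using subquot_comm_group[OF M N that] .
  have rep: "\<exists>x. x \<in> M X \<and> x \<in> hm K X \<and> S = coset (N X) x" if "S \<in> carrier (FOb ?F X)" "X \<in> Ob C" for S X
    using that subfunctorD(2)[OF M] by auto
  note FM = subquot_FMor[OF N] note cm = coset_mult[OF N]
  show "FMor ?F u \<in> hom (FOb ?F X) (FOb ?F Y)" if u: "u \<in> hm X Y" for X Y u
  proof (rule homI)
    have XO: "X \<in> Ob C" using u Hom_Ob by blast
    fix S assume S: "S \<in> carrier (FOb ?F X)"
    obtain x where x: "x \<in> M X" "x \<in> hm K X" "S = coset (N X) x" using rep[OF S XO] by blast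
    show "FMor ?F u S \<in> carrier (FOb ?F Y)"
      unfolding x(3) FM[OF x(2) u] using subfunctor_push[OF M u x(1)] by simp
    fix S' assume S': "S' \<in> carrier (FOb ?F X)"
    obtain y where y: "y \<in> hm K X" "S' = coset (N X) y" using rep[OF S' XO] by blast
    have "u \<cdot> (x \<boxplus> y) = u \<cdot> x \<boxplus> u \<cdot> y" using x y u by (simp add: Hom_iff)
    then show "FMor ?F u (S \<otimes>\<^bsub>FOb ?F X\<^esub> S') = FMor ?F u S \<otimes>\<^bsub>FOb ?F Y\<^esub> FMor ?F u S'"
      unfolding x(3) y(2) subquot_simps(2) cm[OF x(2) y(1)] FM[OF x(2) u] FM[OF y(1) u] FM[OF add_Hom[OF x(2) y(1)] u]
      using cm[OF Comp_Hom[OF x(2) u] Comp_Hom[OF y(1) u]] by simp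
  qed
  show "FMor ?F (ID X) S = S" if X: "X \<in> Ob C" and S: "S \<in> carrier (FOb ?F X)" for X S
  proof -
    obtain x where x: "x \<in> hm K X" "S = coset (N X) x" using rep[OF S X] by blast
    show ?thesis unfolding x(2) FM[OF x(1) Id_Hom[OF X]] using x(1) by (simp add: Hom_iff)
  qed
  show "FMor ?F (v \<cdot> u) S = FMor ?F v (FMor ?F u S)"
    if u: "u \<in> hm X Y" and v: "v \<in> hm Y Z" and S: "S \<in> carrier (FOb ?F X)" for X Y Z u v S
  proof -
    have XO: "X \<in> Ob C" using u Hom_Ob by blast
    obtain x where x: "x \<in> hm K X" "S = coset (N X) x" using rep[OF S XO] by blast
    show ?thesis unfolding x(2) FM[OF x(1) u] FM[OF x(1) Comp_Hom[OF u v]] FM[OF Comp_Hom[OF x(1) u] v]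
      using x(1) u v by (simp add: Hom_iff)
  qed
qed

lemma coker_functor_eq: assumes "f \<in> hm A B" shows "coker_functor C f = subquot A (hm A) (pim f)"
proof -
  have [simp]: "Dom C f = A" using assms by (simp add: Hom_iff)
  have rc: "r_coset (hom_group C A X) N x = coset N x" for X N x
    unfolding r_coset_def coset_def by (auto simp: hom_group_def)
  have "RCOSETS (hom_group C A X) (pim f X) = coset (pim f X) ` hm A X" for X
    unfolding RCOSETS_def rc by (auto simp: hom_group_def)
  then show ?thesis unfolding coker_functor_def subquot_def FactGroup_def by (simp add: rc)
qed

lemma subquot_trivial:
  assumes M: "subfunctor K M" and N: "subfunctor K N" and X: "X \<in> Ob C"
  shows "trivial_group (FOb (subquot K M N) X) \<longleftrightarrow> M X \<subseteq> N X"
proof -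
  have "coset (N X) x = N X \<longleftrightarrow> x \<in> N X" if "x \<in> M X" for x
  proof -
    have x: "x \<in> hm K X" using subfunctorD(2)[OF M X that] .
    show ?thesis using coset_eq[OF N x zero_Hom[OF subfunctorD(1)[OF M X] X]] coset_zero[OF N X]
        x X subfunctorD(1)[OF M X] by (simp add: Hom_iff)
  qed
  moreover have "M X \<noteq> {}" using subfunctorD(3)[OF M X] by blast
  ultimately show ?thesis
    unfolding trivial_group_def using comm_group.axioms(2)[OF subquot_comm_group[OF M N X]] by auto
qed

section \<open>Natural transformations between subquotients given by precomposition\<close>

lemma induced_map_coset:
  assumes M: "subfunctor K M" and N: "subfunctor K N" and N': "subfunctor K' N'" and t: "t \<in> hm K' K"
    and NN: "\<And>x. x \<in> N X \<Longrightarrow> x \<cdot> t \<in> N' X" and x: "x \<in> M X" and X: "X \<in> Ob C"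
  shows "induced_map (subquot K M N) N' t X (coset (N X) x) = coset (N' X) (x \<cdot> t)"
proof -
  have xH: "x \<in> hm K X" using subfunctorD(2)[OF M X x] .
  have "coset (N' X) (a \<cdot> t) = coset (N' X) (x \<cdot> t)" if a: "a \<in> hm K X" "a \<boxminus> x \<in> N X" for a
  proof -
    have "(a \<boxminus> x) \<cdot> t = a \<cdot> t \<boxminus> x \<cdot> t" using a xH t by (auto simp: Hom_iff)
    then show ?thesis using NN[OF a(2)] coset_eq[OF N' Comp_Hom[OF t a(1)] Comp_Hom[OF t xH]] by simp
  qed
  then have "(\<Union>a\<in>coset (N X) x. coset (N' X) (a \<cdot> t)) = coset (N' X) (x \<cdot> t)"
    by (rule Union_coset[OF N xH])
  then show ?thesis unfolding induced_map_def using X x by simp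
qed

lemma induced_map_nat:
  assumes M: "subfunctor K M" and N: "subfunctor K N" and M': "subfunctor K' M'" and N': "subfunctor K' N'"
    and t: "t \<in> hm K' K"
    and MM: "\<And>X x. X \<in> Ob C \<Longrightarrow> x \<in> M X \<Longrightarrow> x \<cdot> t \<in> M' X"
    and NN: "\<And>X x. X \<in> Ob C \<Longrightarrow> x \<in> N X \<Longrightarrow> x \<cdot> t \<in> N' X"
  shows "nat_trans C (subquot K M N) (subquot K' M' N') (induced_map (subquot K M N) N' t)"
  unfolding nat_trans_def
proof (intro conjI ballI allI)
  let ?F = "subquot K M N" and ?G = "subquot K' M' N'" and ?\<eta> = "induced_map (subquot K M N) N' t"
  note ic = induced_map_coset[OF M N N' t NN]
  show "?\<eta> \<in> extensional (Ob C)" unfolding induced_map_def by simp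
  have rep: "\<exists>x. x \<in> M X \<and> x \<in> hm K X \<and> S = coset (N X) x" if "S \<in> carrier (FOb ?F X)" "X \<in> Ob C" for S X
    using that subfunctorD(2)[OF M] by auto
  show "?\<eta> X \<in> hom (FOb ?F X) (FOb ?G X) \<inter> extensional (carrier (FOb ?F X))" if X: "X \<in> Ob C" for X
  proof (intro IntI homI)
    show "?\<eta> X \<in> extensional (carrier (FOb ?F X))" unfolding induced_map_def using X by simp
    fix S assume S: "S \<in> carrier (FOb ?F X)"
    obtain x where x: "x \<in> M X" "x \<in> hm K X" "S = coset (N X) x" using rep[OF S X] by blast
    show "?\<eta> X S \<in> carrier (FOb ?G X)" unfolding x(3) ic[OF X _ x(1) X, simplified] using MM[OF X x(1)] by simp
    fix S' assume S': "S' \<in> carrier (FOb ?F X)"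
    obtain y where y: "y \<in> M X" "y \<in> hm K X" "S' = coset (N X) y" using rep[OF S' X] by blast
    have "(x \<boxplus> y) \<cdot> t = x \<cdot> t \<boxplus> y \<cdot> t" using x(2) y(2) t by (simp add: Hom_iff)
    then show "?\<eta> X (S \<otimes>\<^bsub>FOb ?F X\<^esub> S') = ?\<eta> X S \<otimes>\<^bsub>FOb ?G X\<^esub> ?\<eta> X S'"
      unfolding x(3) y(3) subquot_simps(2) coset_mult[OF N x(2) y(2)]
      using ic[OF X _ x(1) X] ic[OF X _ y(1) X] ic[OF X _ subfunctorD(5)[OF M X x(1) y(1)] X]
        coset_mult[OF N' Comp_Hom[OF t x(2)] Comp_Hom[OF t y(2)]] by simp
  qed
  show "?\<eta> Y (FMor ?F u S) = FMor ?G u (?\<eta> X S)" if u: "u \<in> hm X Y" and S: "S \<in> carrier (FOb ?F X)" for X Y u S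
  proof -
    have X: "X \<in> Ob C" "Y \<in> Ob C" using u Hom_Ob by blast+
    obtain x where x: "x \<in> M X" "x \<in> hm K X" "S = coset (N X) x" using rep[OF S X(1)] by blast
    show ?thesis unfolding x(3) subquot_FMor[OF N x(2) u]
      using ic[OF X(1) _ x(1) X(1)] ic[OF X(2) _ subfunctor_push[OF M u x(1)] X(2)]
        subquot_FMor[OF N' Comp_Hom[OF t x(2)] u] x(2) t u by (simp add: Hom_iff del: subquot_simps(4))
  qed
qed

lemma induced_map_inj:
  assumes M: "subfunctor K M" and N: "subfunctor K N" and N': "subfunctor K' N'" and t: "t \<in> hm K' K" and X: "X \<in> Ob C"
    and NN: "\<And>x. x \<in> N X \<Longrightarrow> x \<cdot> t \<in> N' X" and inj: "\<And>x. x \<in> M X \<Longrightarrow> x \<cdot> t \<in> N' X \<Longrightarrow> x \<in> N X"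
  shows "inj_on (induced_map (subquot K M N) N' t X) (carrier (FOb (subquot K M N) X))"
proof (rule inj_onI)
  let ?\<alpha> = "induced_map (subquot K M N) N' t"
  fix S S' assume "S \<in> carrier (FOb (subquot K M N) X)" "S' \<in> carrier (FOb (subquot K M N) X)" and e: "?\<alpha> X S = ?\<alpha> X S'"
  then obtain x x' where x: "x \<in> M X" "S = coset (N X) x" "x' \<in> M X" "S' = coset (N X) x'" by auto
  note xH = subfunctorD(2)[OF M X x(1)] subfunctorD(2)[OF M X x(3)]
  have "coset (N' X) (x \<cdot> t) = coset (N' X) (x' \<cdot> t)"
    using e induced_map_coset[OF M N N' t NN x(1) X] induced_map_coset[OF M N N' t NN x(3) X] x by simp
  then have "x \<cdot> t \<boxminus> x' \<cdot> t \<in> N' X" using coset_eq[OF N' Comp_Hom[OF t xH(1)] Comp_Hom[OF t xH(2)]] by simp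
  moreover have "x \<cdot> t \<boxminus> x' \<cdot> t = (x \<boxminus> x') \<cdot> t" using xH t by (simp add: Hom_iff)
  ultimately have "x \<boxminus> x' \<in> N X" using inj[OF subfunctor_diff[OF M X x(1,3)]] by simp
  then show "S = S'" using coset_eq[OF N xH] x by simp
qed

end

section \<open>Exact sequences of coherent functors\<close>

lemma ab_functor_group: "ab_functor C F \<Longrightarrow> X \<in> Ob C \<Longrightarrow> comm_group (FOb F X)"
  unfolding ab_functor_def by blast

lemma ab_functor_hom: "ab_functor C F \<Longrightarrow> u \<in> Hom C X Y \<Longrightarrow> FMor F u \<in> hom (FOb F X) (FOb F Y)"
  unfolding ab_functor_def by blast

lemma Coh_functor: "F \<in> Coh \<kappa> C \<Longrightarrow> ab_functor C F"
  unfolding Coh_def by blast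

lemma nat_trans_hom: "nat_trans C F G \<eta> \<Longrightarrow> X \<in> Ob C \<Longrightarrow> \<eta> X \<in> hom (FOb F X) (FOb G X)"
  unfolding nat_trans_def by blast

lemma nat_trans_closed: "nat_trans C F G \<eta> \<Longrightarrow> X \<in> Ob C \<Longrightarrow> x \<in> carrier (FOb F X) \<Longrightarrow> \<eta> X x \<in> carrier (FOb G X)"
  using nat_trans_hom by (fastforce simp: hom_def)

lemma nat_trans_mult: "nat_trans C F G \<eta> \<Longrightarrow> X \<in> Ob C \<Longrightarrow> x \<in> carrier (FOb F X) \<Longrightarrow> y \<in> carrier (FOb F X) \<Longrightarrow>
    \<eta> X (x \<otimes>\<^bsub>FOb F X\<^esub> y) = \<eta> X x \<otimes>\<^bsub>FOb G X\<^esub> \<eta> X y"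
  using nat_trans_hom by (fastforce simp: hom_def)

lemma nat_trans_natural: "nat_trans C F G \<eta> \<Longrightarrow> u \<in> Hom C X Y \<Longrightarrow> x \<in> carrier (FOb F X) \<Longrightarrow>
    \<eta> Y (FMor F u x) = FMor G u (\<eta> X x)"
  unfolding nat_trans_def by blast

lemma nat_trans_eqI:
  assumes "nat_trans C F G \<eta>" "nat_trans C F G \<theta>"
    "\<And>X x. X \<in> Ob C \<Longrightarrow> x \<in> carrier (FOb F X) \<Longrightarrow> \<eta> X x = \<theta> X x"
  shows "\<eta> = \<theta>"
proof (rule extensionalityI[of _ "Ob C"])
  show "\<eta> \<in> extensional (Ob C)" "\<theta> \<in> extensional (Ob C)" using assms unfolding nat_trans_def by blast+
  fix X assume X: "X \<in> Ob C"
  show "\<eta> X = \<theta> X"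
    by (rule extensionalityI[of _ "carrier (FOb F X)"]) (use assms X in \<open>auto simp: nat_trans_def\<close>)
qed

lemma nat_trans_one:
  assumes "ab_functor C F" "ab_functor C G" "nat_trans C F G \<eta>" "X \<in> Ob C"
  shows "\<eta> X \<one>\<^bsub>FOb F X\<^esub> = \<one>\<^bsub>FOb G X\<^esub>"
  using hom_one[OF nat_trans_hom[OF assms(3,4)]] ab_functor_group[OF assms(1,4)] ab_functor_group[OF assms(2,4)]
  by (simp add: comm_group.axioms(2))

context additive_category
begin

text \<open>The mediating transformations are built object by object: for the kernel by inverting
  \<alpha> on its image, for the cokernel by choosing preimages under \<beta>. Naturality and
  uniqueness follow because \<alpha> is injective and \<beta> surjective at each object.\<close>

lemma pointwise_short_exact:
  assumes F: "F \<in> Coh \<kappa> C" and G: "G \<in> Coh \<kappa> C" and H: "H \<in> Coh \<kappa> C"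
    and \<alpha>: "nat_trans C F G \<alpha>" and \<beta>: "nat_trans C G H \<beta>"
    and inj: "\<And>X. X \<in> Ob C \<Longrightarrow> inj_on (\<alpha> X) (carrier (FOb F X))"
    and ex: "\<And>X. X \<in> Ob C \<Longrightarrow> \<alpha> X ` carrier (FOb F X) = {y \<in> carrier (FOb G X). \<beta> X y = \<one>\<^bsub>FOb H X\<^esub>}"
    and sur: "\<And>X. X \<in> Ob C \<Longrightarrow> \<beta> X ` carrier (FOb G X) = carrier (FOb H X)"
  shows "Coh_short_exact \<kappa> C F \<alpha> G \<beta> H"
proof -
  have zc: "zero_comp C F \<alpha> H \<beta>" unfolding zero_comp_def using ex by blast
  note Ff = Coh_functor[OF F] and Gf = Coh_functor[OF G] and Hf = Coh_functor[OF H]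
  have "Coh_kernel \<kappa> C F \<alpha> G \<beta> H" unfolding Coh_kernel_def
  proof (intro conjI ballI allI impI)
    fix E :: "('o, 'm, 'm set) abfun" and \<gamma>
    assume E: "E \<in> Coh \<kappa> C" and "nat_trans C E G \<gamma> \<and> zero_comp C E \<gamma> H \<beta>"
    then have \<gamma>: "nat_trans C E G \<gamma>" and \<gamma>0: "zero_comp C E \<gamma> H \<beta>" by auto
    note Ef = Coh_functor[OF E]
    define \<delta> where "\<delta> = (\<lambda>X\<in>Ob C. \<lambda>x\<in>carrier (FOb E X). the_inv_into (carrier (FOb F X)) (\<alpha> X) (\<gamma> X x))"
    have \<delta>: "\<delta> X x \<in> carrier (FOb F X)" "\<alpha> X (\<delta> X x) = \<gamma> X x" if X: "X \<in> Ob C" and x: "x \<in> carrier (FOb E X)" for X x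
    proof -
      have "\<gamma> X x \<in> {y \<in> carrier (FOb G X). \<beta> X y = \<one>\<^bsub>FOb H X\<^esub>}"
        using nat_trans_closed[OF \<gamma> X x] \<gamma>0 X x unfolding zero_comp_def by blast
      then have im: "\<gamma> X x \<in> \<alpha> X ` carrier (FOb F X)" unfolding ex[OF X] .
      have d: "\<delta> X x = the_inv_into (carrier (FOb F X)) (\<alpha> X) (\<gamma> X x)" unfolding \<delta>_def using X x by simp
      show "\<delta> X x \<in> carrier (FOb F X)" unfolding d by (rule the_inv_into_into[OF inj[OF X] im order_refl])
      show "\<alpha> X (\<delta> X x) = \<gamma> X x" unfolding d by (rule f_the_inv_into_f[OF inj[OF X] im])
    qed
    have nat: "nat_trans C E F \<delta>" unfolding nat_trans_def
    proof (intro conjI ballI allI)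
      show "\<delta> \<in> extensional (Ob C)" unfolding \<delta>_def by simp
      show "\<delta> X \<in> hom (FOb E X) (FOb F X) \<inter> extensional (carrier (FOb E X))" if X: "X \<in> Ob C" for X
      proof (intro IntI homI)
        show "\<delta> X \<in> extensional (carrier (FOb E X))" unfolding \<delta>_def using X by simp
        fix x assume x: "x \<in> carrier (FOb E X)"
        show "\<delta> X x \<in> carrier (FOb F X)" using \<delta> X x by blast
        fix y assume y: "y \<in> carrier (FOb E X)"
        have xy: "x \<otimes>\<^bsub>FOb E X\<^esub> y \<in> carrier (FOb E X)"
          using ab_functor_group[OF Ef X] x y by (simp add: comm_group_def group.is_monoid monoid.m_closed)
        have dd: "\<delta> X x \<otimes>\<^bsub>FOb F X\<^esub> \<delta> X y \<in> carrier (FOb F X)"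
          using ab_functor_group[OF Ff X] \<delta>(1)[OF X x] \<delta>(1)[OF X y] by (simp add: comm_group_def group.is_monoid monoid.m_closed)
        have "\<alpha> X (\<delta> X (x \<otimes>\<^bsub>FOb E X\<^esub> y)) = \<alpha> X (\<delta> X x \<otimes>\<^bsub>FOb F X\<^esub> \<delta> X y)"
          using \<delta>(2)[OF X xy] nat_trans_mult[OF \<gamma> X x y] nat_trans_mult[OF \<alpha> X \<delta>(1)[OF X x] \<delta>(1)[OF X y]]
            \<delta>(2)[OF X x] \<delta>(2)[OF X y] by simp
        then show "\<delta> X (x \<otimes>\<^bsub>FOb E X\<^esub> y) = \<delta> X x \<otimes>\<^bsub>FOb F X\<^esub> \<delta> X y"
          using inj[OF X] \<delta>(1)[OF X xy] dd by (simp add: inj_on_eq_iff)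
      qed
      show "\<delta> Y (FMor E u x) = FMor F u (\<delta> X x)" if u: "u \<in> hm X Y" and x: "x \<in> carrier (FOb E X)" for X Y u x
      proof -
        have X: "X \<in> Ob C" "Y \<in> Ob C" using u Hom_Ob by blast+
        have ux: "FMor E u x \<in> carrier (FOb E Y)" using ab_functor_hom[OF Ef u] x by (auto simp: hom_def)
        have ud: "FMor F u (\<delta> X x) \<in> carrier (FOb F Y)" using ab_functor_hom[OF Ff u] \<delta>(1)[OF X(1) x] by (auto simp: hom_def)
        have "\<alpha> Y (\<delta> Y (FMor E u x)) = \<alpha> Y (FMor F u (\<delta> X x))"
          using \<delta>(2)[OF X(2) ux] nat_trans_natural[OF \<gamma> u x] nat_trans_natural[OF \<alpha> u \<delta>(1)[OF X(1) x]] \<delta>(2)[OF X(1) x] by simp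
        then show ?thesis using inj[OF X(2)] \<delta>(1)[OF X(2) ux] ud by (simp add: inj_on_eq_iff)
      qed
    qed
    show "\<exists>!\<delta>. nat_trans C E F \<delta> \<and> (\<forall>A\<in>Ob C. \<forall>x\<in>carrier (FOb E A). \<alpha> A (\<delta> A x) = \<gamma> A x)"
    proof (rule ex1I[of _ \<delta>])
      show "nat_trans C E F \<delta> \<and> (\<forall>A\<in>Ob C. \<forall>x\<in>carrier (FOb E A). \<alpha> A (\<delta> A x) = \<gamma> A x)" using nat \<delta>(2) by blast
      fix \<delta>' assume d': "nat_trans C E F \<delta>' \<and> (\<forall>A\<in>Ob C. \<forall>x\<in>carrier (FOb E A). \<alpha> A (\<delta>' A x) = \<gamma> A x)"
      show "\<delta>' = \<delta>"
      proof (rule nat_trans_eqI[OF _ nat])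
        show "nat_trans C E F \<delta>'" using d' by blast
        fix X x assume X: "X \<in> Ob C" and x: "x \<in> carrier (FOb E X)"
        have "\<delta>' X x \<in> carrier (FOb F X)" using nat_trans_closed[of C E F \<delta>'] d' X x by blast
        moreover have "\<alpha> X (\<delta>' X x) = \<alpha> X (\<delta> X x)" using d' X x \<delta>(2) by simp
        ultimately show "\<delta>' X x = \<delta> X x" using inj[OF X] \<delta>(1)[OF X x] by (simp add: inj_on_eq_iff)
      qed
    qed
  qed (use \<alpha> zc in auto)
  moreover have "Coh_cokernel \<kappa> C F \<alpha> G \<beta> H" unfolding Coh_cokernel_def
  proof (intro conjI ballI allI impI)
    fix E :: "('o, 'm, 'm set) abfun" and \<gamma>
    assume E: "E \<in> Coh \<kappa> C" and "nat_trans C G E \<gamma> \<and> zero_comp C F \<alpha> E \<gamma>"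
    then have \<gamma>: "nat_trans C G E \<gamma>" and \<gamma>0: "zero_comp C F \<alpha> E \<gamma>" by auto
    note Ef = Coh_functor[OF E]
    \<comment> \<open>Two preimages of the same element differ by something in the kernel of
      \<beta>, which is the image of \<alpha>, and \<gamma> kills that image.\<close>
    have wd: "\<gamma> X y = \<gamma> X y'" if X: "X \<in> Ob C" and y: "y \<in> carrier (FOb G X)" "y' \<in> carrier (FOb G X)"
        and e: "\<beta> X y = \<beta> X y'" for X y y'
    proof -
      interpret G: comm_group "FOb G X" using ab_functor_group[OF Gf X] .
      interpret H: comm_group "FOb H X" using ab_functor_group[OF Hf X] .
      interpret E: comm_group "FOb E X" using ab_functor_group[OF Ef X] .
      interpret b: group_hom "FOb G X" "FOb H X" "\<beta> X"
        by unfold_locales (rule nat_trans_hom[OF \<beta> X])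
      interpret c: group_hom "FOb G X" "FOb E X" "\<gamma> X"
        by unfold_locales (rule nat_trans_hom[OF \<gamma> X])
      let ?d = "y \<otimes>\<^bsub>FOb G X\<^esub> inv\<^bsub>FOb G X\<^esub> y'"
      have "\<beta> X ?d = \<one>\<^bsub>FOb H X\<^esub>" using y e by simp
      then have "?d \<in> \<alpha> X ` carrier (FOb F X)" unfolding ex[OF X] using y by simp
      then have "\<gamma> X ?d = \<one>\<^bsub>FOb E X\<^esub>" using \<gamma>0 X unfolding zero_comp_def by auto
      then have "\<gamma> X y \<otimes>\<^bsub>FOb E X\<^esub> inv\<^bsub>FOb E X\<^esub> \<gamma> X y' = \<one>\<^bsub>FOb E X\<^esub>" using y by simp
      then show ?thesis using y by (metis E.inv_equality E.inv_inv c.hom_closed E.inv_closed)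
    qed
    define \<delta> where "\<delta> = (\<lambda>X\<in>Ob C. \<lambda>z\<in>carrier (FOb H X). \<gamma> X (SOME y. y \<in> carrier (FOb G X) \<and> \<beta> X y = z))"
    have \<delta>: "\<delta> X (\<beta> X y) = \<gamma> X y" if X: "X \<in> Ob C" and y: "y \<in> carrier (FOb G X)" for X y
    proof -
      let ?y = "SOME y'. y' \<in> carrier (FOb G X) \<and> \<beta> X y' = \<beta> X y"
      have "?y \<in> carrier (FOb G X) \<and> \<beta> X ?y = \<beta> X y" by (rule someI[of _ y]) (use y in simp)
      then have "\<gamma> X ?y = \<gamma> X y" using wd[OF X] y by blast
      then show ?thesis unfolding \<delta>_def using X nat_trans_closed[OF \<beta> X y] by simp
    qed
    have rep: "\<exists>y \<in> carrier (FOb G X). z = \<beta> X y" if "X \<in> Ob C" "z \<in> carrier (FOb H X)" for X z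
      using sur[OF that(1)] that(2) by blast
    have nat: "nat_trans C H E \<delta>" unfolding nat_trans_def
    proof (intro conjI ballI allI)
      show "\<delta> \<in> extensional (Ob C)" unfolding \<delta>_def by simp
      show "\<delta> X \<in> hom (FOb H X) (FOb E X) \<inter> extensional (carrier (FOb H X))" if X: "X \<in> Ob C" for X
      proof (intro IntI homI)
        show "\<delta> X \<in> extensional (carrier (FOb H X))" unfolding \<delta>_def using X by simp
        fix z assume z: "z \<in> carrier (FOb H X)"
        obtain y where y: "y \<in> carrier (FOb G X)" "z = \<beta> X y" using rep[OF X z] by blast
        show "\<delta> X z \<in> carrier (FOb E X)" using \<delta>[OF X y(1)] y(2) nat_trans_closed[OF \<gamma> X y(1)] by simp
        fix z' assume z': "z' \<in> carrier (FOb H X)"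
        obtain y' where y': "y' \<in> carrier (FOb G X)" "z' = \<beta> X y'" using rep[OF X z'] by blast
        have yy: "y \<otimes>\<^bsub>FOb G X\<^esub> y' \<in> carrier (FOb G X)"
          using ab_functor_group[OF Gf X] y y' by (simp add: comm_group_def group.is_monoid monoid.m_closed)
        show "\<delta> X (z \<otimes>\<^bsub>FOb H X\<^esub> z') = \<delta> X z \<otimes>\<^bsub>FOb E X\<^esub> \<delta> X z'"
          using \<delta>[OF X yy] \<delta>[OF X y(1)] \<delta>[OF X y'(1)] nat_trans_mult[OF \<beta> X y(1) y'(1)]
            nat_trans_mult[OF \<gamma> X y(1) y'(1)] y(2) y'(2) by simp
      qed
      show "\<delta> Y (FMor H u z) = FMor E u (\<delta> X z)" if u: "u \<in> hm X Y" and z: "z \<in> carrier (FOb H X)" for X Y u z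
      proof -
        have X: "X \<in> Ob C" "Y \<in> Ob C" using u Hom_Ob by blast+
        obtain y where y: "y \<in> carrier (FOb G X)" "z = \<beta> X y" using rep[OF X(1) z] by blast
        have uy: "FMor G u y \<in> carrier (FOb G Y)" using ab_functor_hom[OF Gf u] y(1) by (auto simp: hom_def)
        show ?thesis using nat_trans_natural[OF \<beta> u y(1)] nat_trans_natural[OF \<gamma> u y(1)] \<delta>[OF X(1) y(1)] \<delta>[OF X(2) uy] y(2) by simp
      qed
    qed
    show "\<exists>!\<delta>. nat_trans C H E \<delta> \<and> (\<forall>A\<in>Ob C. \<forall>x\<in>carrier (FOb G A). \<delta> A (\<beta> A x) = \<gamma> A x)"
    proof (rule ex1I[of _ \<delta>])
      show "nat_trans C H E \<delta> \<and> (\<forall>A\<in>Ob C. \<forall>x\<in>carrier (FOb G A). \<delta> A (\<beta> A x) = \<gamma> A x)" using nat \<delta> by blast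
      fix \<delta>' assume d': "nat_trans C H E \<delta>' \<and> (\<forall>A\<in>Ob C. \<forall>x\<in>carrier (FOb G A). \<delta>' A (\<beta> A x) = \<gamma> A x)"
      show "\<delta>' = \<delta>"
      proof (rule nat_trans_eqI[OF _ nat])
        show "nat_trans C H E \<delta>'" using d' by blast
        fix X z assume X: "X \<in> Ob C" and z: "z \<in> carrier (FOb H X)"
        obtain y where y: "y \<in> carrier (FOb G X)" "z = \<beta> X y" using rep[OF X z] by blast
        then show "\<delta>' X z = \<delta> X z" using d' \<delta> X by simp
      qed
    qed
  qed (use \<beta> zc in auto)
  ultimately show ?thesis unfolding Coh_short_exact_def using F G H by blast
qed

text \<open>Pointwise exactness of M/N -> M'/N' -> M''/N'' expressed on representatives, so that
  later exact sequences are verified by computations with morphisms alone.\<close>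

lemma subquot_short_exact:
  assumes M: "subfunctor K M" "subfunctor K N" and M': "subfunctor K' M'" "subfunctor K' N'"
    and M'': "subfunctor K'' M''" "subfunctor K'' N''" and t: "t \<in> hm K' K" and s: "s \<in> hm K'' K'"
    and Coh: "subquot K M N \<in> Coh \<kappa> C" "subquot K' M' N' \<in> Coh \<kappa> C" "subquot K'' M'' N'' \<in> Coh \<kappa> C"
    and tm: "\<And>X x. X \<in> Ob C \<Longrightarrow> x \<in> M X \<Longrightarrow> x \<cdot> t \<in> M' X" "\<And>X x. X \<in> Ob C \<Longrightarrow> x \<in> N X \<Longrightarrow> x \<cdot> t \<in> N' X"
    and sm: "\<And>X x. X \<in> Ob C \<Longrightarrow> x \<in> M' X \<Longrightarrow> x \<cdot> s \<in> M'' X" "\<And>X x. X \<in> Ob C \<Longrightarrow> x \<in> N' X \<Longrightarrow> x \<cdot> s \<in> N'' X"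
    and inj: "\<And>X x. X \<in> Ob C \<Longrightarrow> x \<in> M X \<Longrightarrow> x \<cdot> t \<in> N' X \<Longrightarrow> x \<in> N X"
    and ex1: "\<And>X x. X \<in> Ob C \<Longrightarrow> x \<in> M X \<Longrightarrow> x \<cdot> t \<cdot> s \<in> N'' X"
    and ex2: "\<And>X y. X \<in> Ob C \<Longrightarrow> y \<in> M' X \<Longrightarrow> y \<cdot> s \<in> N'' X \<Longrightarrow> \<exists>x\<in>M X. y \<boxminus> x \<cdot> t \<in> N' X"
    and sur: "\<And>X z. X \<in> Ob C \<Longrightarrow> z \<in> M'' X \<Longrightarrow> \<exists>y\<in>M' X. z \<boxminus> y \<cdot> s \<in> N'' X"
  shows "Coh_short_exact \<kappa> C (subquot K M N) (induced_map (subquot K M N) N' t) (subquot K' M' N')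
    (induced_map (subquot K' M' N') N'' s) (subquot K'' M'' N'')"
proof -
  let ?\<alpha> = "induced_map (subquot K M N) N' t" and ?\<beta> = "induced_map (subquot K' M' N') N'' s"
  have H: "x \<in> M X \<Longrightarrow> x \<in> hm K X" "x \<in> M' X \<Longrightarrow> x \<in> hm K' X" "x \<in> M'' X \<Longrightarrow> x \<in> hm K'' X" if "X \<in> Ob C" for x X
    using subfunctorD(2) M M' M'' that by blast+
  have a: "?\<alpha> X (coset (N X) x) = coset (N' X) (x \<cdot> t)" if "X \<in> Ob C" "x \<in> M X" for X x
    using induced_map_coset[OF M M'(2) t tm(2)] that by blast
  have b: "?\<beta> X (coset (N' X) x) = coset (N'' X) (x \<cdot> s)" if "X \<in> Ob C" "x \<in> M' X" for X x
    using induced_map_coset[OF M' M''(2) s sm(2)] that by blast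
  have zero: "coset (N'' X) z = N'' X \<longleftrightarrow> z \<in> N'' X" if X: "X \<in> Ob C" and z: "z \<in> hm K'' X" for X z
  proof -
    have K: "K'' \<in> Ob C" using z Hom_Ob by blast
    have "z \<boxminus> zm K'' X = z" using z K X by (simp add: Hom_iff)
    then show ?thesis using coset_eq[OF M''(2) z zero_Hom[OF K X]] coset_zero[OF M''(2) X] by simp
  qed
  show ?thesis
  proof (rule pointwise_short_exact[OF Coh])
    show "nat_trans C (subquot K M N) (subquot K' M' N') ?\<alpha>" by (rule induced_map_nat[OF M M' t tm])
    show "nat_trans C (subquot K' M' N') (subquot K'' M'' N'') ?\<beta>" by (rule induced_map_nat[OF M' M'' s sm])
    fix X assume X: "X \<in> Ob C"
    show "inj_on (?\<alpha> X) (carrier (FOb (subquot K M N) X))"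
      by (rule induced_map_inj[OF M M'(2) t X tm(2)[OF X] inj[OF X]])
    show "?\<alpha> X ` carrier (FOb (subquot K M N) X) =
      {y \<in> carrier (FOb (subquot K' M' N') X). ?\<beta> X y = \<one>\<^bsub>FOb (subquot K'' M'' N'') X\<^esub>}"
    proof (intro equalityI subsetI)
      fix S assume "S \<in> ?\<alpha> X ` carrier (FOb (subquot K M N) X)"
      then obtain x where x: "x \<in> M X" "S = coset (N' X) (x \<cdot> t)" using a[OF X] by auto
      have m: "x \<cdot> t \<in> M' X" using tm(1)[OF X x(1)] .
      have "?\<beta> X S = N'' X" unfolding x(2) b[OF X m] using zero[OF X Comp_Hom[OF s H(2)[OF X m]]] ex1[OF X x(1)] by simp
      then show "S \<in> {y \<in> carrier (FOb (subquot K' M' N') X). ?\<beta> X y = \<one>\<^bsub>FOb (subquot K'' M'' N'') X\<^esub>}"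
        using m x(2) by simp
    next
      fix S assume "S \<in> {y \<in> carrier (FOb (subquot K' M' N') X). ?\<beta> X y = \<one>\<^bsub>FOb (subquot K'' M'' N'') X\<^esub>}"
      then obtain y where y: "y \<in> M' X" "S = coset (N' X) y" "?\<beta> X S = N'' X" by auto
      have "coset (N'' X) (y \<cdot> s) = N'' X" using y(3) b[OF X y(1)] y(2) by simp
      then have "y \<cdot> s \<in> N'' X" using zero[OF X Comp_Hom[OF s H(2)[OF X y(1)]]] by simp
      then obtain x where x: "x \<in> M X" "y \<boxminus> x \<cdot> t \<in> N' X" using ex2[OF X y(1)] by blast
      then have "S = ?\<alpha> X (coset (N X) x)"
        unfolding a[OF X x(1)] y(2) using coset_eq[OF M'(2) H(2)[OF X y(1)] Comp_Hom[OF t H(1)[OF X x(1)]]] by simp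
      then show "S \<in> ?\<alpha> X ` carrier (FOb (subquot K M N) X)" using x(1) by simp
    qed
    show "?\<beta> X ` carrier (FOb (subquot K' M' N') X) = carrier (FOb (subquot K'' M'' N'') X)"
    proof (intro equalityI subsetI)
      fix S assume "S \<in> ?\<beta> X ` carrier (FOb (subquot K' M' N') X)"
      then show "S \<in> carrier (FOb (subquot K'' M'' N'') X)" using b[OF X] sm(1)[OF X] by auto
    next
      fix S assume "S \<in> carrier (FOb (subquot K'' M'' N'') X)"
      then obtain z where z: "z \<in> M'' X" "S = coset (N'' X) z" by auto
      obtain y where y: "y \<in> M' X" "z \<boxminus> y \<cdot> s \<in> N'' X" using sur[OF X z(1)] by blast
      then have "S = ?\<beta> X (coset (N' X) y)"
        unfolding b[OF X y(1)] z(2) using coset_eq[OF M''(2) H(3)[OF X z(1)] Comp_Hom[OF s H(2)[OF X y(1)]]] by simp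
      then show "S \<in> ?\<beta> X ` carrier (FOb (subquot K' M' N') X)" using y(1) by simp
    qed
  qed
qed

lemma induced_map_iso:
  assumes M: "subfunctor K M" "subfunctor K N" and M': "subfunctor K' M'" "subfunctor K' N'" and t: "t \<in> hm K' K"
    and tm: "\<And>X x. X \<in> Ob C \<Longrightarrow> x \<in> M X \<Longrightarrow> x \<cdot> t \<in> M' X" "\<And>X x. X \<in> Ob C \<Longrightarrow> x \<in> N X \<Longrightarrow> x \<cdot> t \<in> N' X"
    and inj: "\<And>X x. X \<in> Ob C \<Longrightarrow> x \<in> M X \<Longrightarrow> x \<cdot> t \<in> N' X \<Longrightarrow> x \<in> N X"
    and sur: "\<And>X z. X \<in> Ob C \<Longrightarrow> z \<in> M' X \<Longrightarrow> \<exists>y\<in>M X. z = y \<cdot> t"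
  shows "nat_iso C (subquot K M N) (subquot K' M' N') (induced_map (subquot K M N) N' t)"
  unfolding nat_iso_def
proof (intro conjI ballI)
  let ?\<alpha> = "induced_map (subquot K M N) N' t"
  show n: "nat_trans C (subquot K M N) (subquot K' M' N') ?\<alpha>" by (rule induced_map_nat[OF M M' t tm])
  fix X assume X: "X \<in> Ob C"
  have H: "x \<in> M X \<Longrightarrow> x \<in> hm K X" "x \<in> M' X \<Longrightarrow> x \<in> hm K' X" for x
    using subfunctorD(2) M M' X by blast+
  have a: "?\<alpha> X (coset (N X) x) = coset (N' X) (x \<cdot> t)" if "x \<in> M X" for x
    using induced_map_coset[OF M M'(2) t tm(2)] that X by blast
  have "inj_on (?\<alpha> X) (carrier (FOb (subquot K M N) X))"
    by (rule induced_map_inj[OF M M'(2) t X tm(2)[OF X] inj[OF X]])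
  moreover have "?\<alpha> X ` carrier (FOb (subquot K M N) X) = carrier (FOb (subquot K' M' N') X)"
  proof -
    have "M' X = (\<lambda>x. x \<cdot> t) ` M X" using tm(1)[OF X] sur[OF X] by auto
    then show ?thesis using a by (auto simp: image_image)
  qed
  ultimately show "?\<alpha> X \<in> iso (FOb (subquot K M N) X) (FOb (subquot K' M' N') X)"
    using nat_trans_hom[OF n X] unfolding iso_def bij_betw_def by blast
qed

end

context compactly_generated
begin

lemma coker_functor_Coh: assumes "f \<in> cmor" shows "coker_functor T f \<in> Coh \<kappa> T"
proof -
  have fH: "f \<in> hm (Dom T f) (Cod T f)" "Dom T f \<in> Ob T" using cmorE[OF assms] by metis+
  let ?K = "Dom T f"
  have M: "subfunctor ?K (hm ?K)" using subfunctor_hm[OF fH(2)] .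
  have N: "subfunctor ?K (pim f)" by (rule subfunctor_pim[OF fH(1)])
  have "nat_iso T (coker_functor T f) (coker_functor T f) (induced_map (subquot ?K (hm ?K) (pim f)) (pim f) (ID ?K))"
    unfolding coker_functor_eq[OF fH(1)]
    by (rule induced_map_iso[OF M N M N Id_Hom[OF fH(2)]])
      (use pim_Hom[of f] fH(1) in \<open>auto simp: Hom_iff intro!: bexI[of _ z for z]\<close>)
  moreover have "ab_functor T (coker_functor T f)"
    unfolding coker_functor_eq[OF fH(1)] by (rule subquot_functor[OF M N])
  ultimately show ?thesis unfolding Coh_def using assms by blast
qed

text \<open>The functor (cod a,-)a / (cod b,-)b. It covers both kinds of functors in play: F_f is
  \<open>quot (ID A) f\<close>, and the image functor of f is its quotient by a zero map.\<close>

definition quot :: "'m \<Rightarrow> 'm \<Rightarrow> ('o, 'm, 'm set) abfun" where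
  "quot a b = subquot (Dom T a) (pim a) (pim b)"

lemma quot_Id: "f \<in> hm A B \<Longrightarrow> quot (ID A) f = coker_functor T f"
  unfolding quot_def using coker_functor_eq[of f A B] pim_Id[of A] Hom_Ob[of f A B] by simp

text \<open>The map x |-> x a from (K,-) onto (K,-)a sends x into (L,-)b exactly when x factors
  through the leg e of the weak pushout of a and b. Hence F_e is isomorphic to the quotient.\<close>

lemma quot_Coh:
  assumes a: "a \<in> hm A K" and b: "b \<in> hm A L" and c: "A \<in> cob" "K \<in> cob" "L \<in> cob"
    and sub: "\<And>X. pim b X \<subseteq> pim a X"
  shows "quot a b \<in> Coh \<kappa> T"
proof -
  obtain N e d where N: "N \<in> cob" "e \<in> hm K N" "d \<in> hm L N" "e \<cdot> a = d \<cdot> b"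
    "\<And>X x y. x \<in> hm K X \<Longrightarrow> y \<in> hm L X \<Longrightarrow> x \<cdot> a = y \<cdot> b \<Longrightarrow> \<exists>z \<in> hm N X. x = z \<cdot> e \<and> y = z \<cdot> d"
    using weak_pushout[OF a b c] by metis
  have ec: "e \<in> cmor" using cmor_iff[OF N(2)] c N by blast
  have K: "K \<in> Ob T" using c cob_Ob by blast
  have M: "subfunctor K (hm K)" using subfunctor_hm[OF K] .
  have q: "quot a b = subquot A (pim a) (pim b)" unfolding quot_def using a by (simp add: Hom_iff)
  have iso: "nat_iso T (coker_functor T e) (quot a b) (induced_map (subquot K (hm K) (pim e)) (pim b) a)"
    unfolding coker_functor_eq[OF N(2)] q
  proof (rule induced_map_iso[OF M subfunctor_pim[OF N(2)] subfunctor_pim[OF a] subfunctor_pim[OF b] a])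
    fix X x assume X: "X \<in> Ob T"
    show "x \<cdot> a \<in> pim a X" if "x \<in> hm K X" using pimI[of x a X] that a by (simp add: Hom_iff)
    show "x \<cdot> a \<in> pim b X" if xe: "x \<in> pim e X"
    proof -
      obtain z where z: "z \<in> hm N X" "x = z \<cdot> e" using xe N(2) unfolding pim_iff by (auto simp: Hom_iff)
      have "x \<cdot> a = z \<cdot> d \<cdot> b" using z N(2,3,4) a b by (simp add: Hom_iff)
      then show ?thesis using pimI[of "z \<cdot> d" b X] z N(3) b by (simp add: Hom_iff)
    qed
    show "x \<in> pim e X" if x: "x \<in> hm K X" "x \<cdot> a \<in> pim b X"
    proof -
      obtain y where "y \<in> hm L X" "x \<cdot> a = y \<cdot> b" using x(2) b unfolding pim_iff by (auto simp: Hom_iff)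
      then obtain z where "z \<in> hm N X" "x = z \<cdot> e" using N(5)[OF x(1)] by blast
      then show ?thesis using pimI[of z e X] N(2) by (simp add: Hom_iff)
    qed
    show "\<exists>y\<in>hm K X. x = y \<cdot> a" if "x \<in> pim a X" using that a unfolding pim_iff by (simp add: Hom_iff)
  qed
  have "ab_functor T (quot a b)" unfolding q by (rule subquot_functor[OF subfunctor_pim[OF a] subfunctor_pim[OF b]])
  then show ?thesis unfolding Coh_def using iso ec by blast
qed

end

section \<open>From Serre subcategories to saturated classes\<close>

context compactly_generated
begin

lemma nat_iso_trivial:
  assumes "nat_iso T F G \<eta>" "ab_functor T F" "ab_functor T G" "X \<in> Ob T"
  shows "trivial_group (FOb F X) \<longleftrightarrow> trivial_group (FOb G X)"
proof -
  have n: "nat_trans T F G \<eta>" and i: "\<eta> X \<in> iso (FOb F X) (FOb G X)" using assms(1,4) unfolding nat_iso_def by blast+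
  have one: "\<eta> X \<one>\<^bsub>FOb F X\<^esub> = \<one>\<^bsub>FOb G X\<^esub>" using nat_trans_one[OF assms(2,3) n assms(4)] .
  have g: "group (FOb F X)" "group (FOb G X)"
    using comm_group.axioms(2)[OF ab_functor_group[OF assms(2,4)]] comm_group.axioms(2)[OF ab_functor_group[OF assms(3,4)]] .
  have b: "bij_betw (\<eta> X) (carrier (FOb F X)) (carrier (FOb G X))" using i unfolding iso_def by blast
  have 1: "\<one>\<^bsub>FOb F X\<^esub> \<in> carrier (FOb F X)" using g(1) by (simp add: group.is_monoid monoid.one_closed)
  have "carrier (FOb F X) = {\<one>\<^bsub>FOb F X\<^esub>} \<longleftrightarrow> carrier (FOb G X) = {\<one>\<^bsub>FOb G X\<^esub>}"
  proof
    assume "carrier (FOb F X) = {\<one>\<^bsub>FOb F X\<^esub>}"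
    then show "carrier (FOb G X) = {\<one>\<^bsub>FOb G X\<^esub>}" using b one unfolding bij_betw_def by auto
  next
    assume G: "carrier (FOb G X) = {\<one>\<^bsub>FOb G X\<^esub>}"
    have "x = \<one>\<^bsub>FOb F X\<^esub>" if x: "x \<in> carrier (FOb F X)" for x
    proof -
      have "\<eta> X x \<in> carrier (FOb G X)" using b x unfolding bij_betw_def by blast
      then have "\<eta> X x = \<eta> X \<one>\<^bsub>FOb F X\<^esub>" using G one by simp
      then show ?thesis using b x 1 unfolding bij_betw_def inj_on_def by blast
    qed
    then show "carrier (FOb F X) = {\<one>\<^bsub>FOb F X\<^esub>}" using 1 by blast
  qed
  then show ?thesis unfolding trivial_group_def using g by blast
qed

lemma nat_trans_zero:
  assumes "ab_functor T F" "ab_functor T G"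
  shows "nat_trans T F G (\<lambda>X\<in>Ob T. \<lambda>x\<in>carrier (FOb F X). \<one>\<^bsub>FOb G X\<^esub>)"
  unfolding nat_trans_def
proof (intro conjI ballI allI)
  fix X assume X: "X \<in> Ob T"
  interpret F: comm_group "FOb F X" using ab_functor_group[OF assms(1) X] .
  interpret G: comm_group "FOb G X" using ab_functor_group[OF assms(2) X] .
  show "(\<lambda>X\<in>Ob T. \<lambda>x\<in>carrier (FOb F X). \<one>\<^bsub>FOb G X\<^esub>) X \<in> hom (FOb F X) (FOb G X) \<inter> extensional (carrier (FOb F X))"
    using X by (auto simp: hom_def)
next
  fix X Y u x assume u: "u \<in> hm X Y" and x: "x \<in> carrier (FOb F X)"
  have X: "X \<in> Ob T" "Y \<in> Ob T" using u Hom_Ob by blast+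
  have ux: "FMor F u x \<in> carrier (FOb F Y)" using ab_functor_hom[OF assms(1) u] x by (auto simp: hom_def)
  have "FMor G u \<one>\<^bsub>FOb G X\<^esub> = \<one>\<^bsub>FOb G Y\<^esub>"
    using hom_one[OF ab_functor_hom[OF assms(2) u]] ab_functor_group[OF assms(2)] X by (simp add: comm_group.axioms(2))
  then show "(\<lambda>X\<in>Ob T. \<lambda>x\<in>carrier (FOb F X). \<one>\<^bsub>FOb G X\<^esub>) Y (FMor F u x) =
    FMor G u ((\<lambda>X\<in>Ob T. \<lambda>x\<in>carrier (FOb F X). \<one>\<^bsub>FOb G X\<^esub>) X x)" using X x ux by simp
qed simp

lemma nat_trans_id:
  assumes "ab_functor T F" shows "nat_trans T F F (\<lambda>X\<in>Ob T. \<lambda>x\<in>carrier (FOb F X). x)"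
  unfolding nat_trans_def
proof (intro conjI ballI allI)
  fix X assume X: "X \<in> Ob T"
  interpret F: comm_group "FOb F X" using ab_functor_group[OF assms(1) X] .
  show "(\<lambda>X\<in>Ob T. \<lambda>x\<in>carrier (FOb F X). x) X \<in> hom (FOb F X) (FOb F X) \<inter> extensional (carrier (FOb F X))"
    using X by (auto simp: hom_def)
next
  fix X Y u x assume u: "u \<in> hm X Y" and x: "x \<in> carrier (FOb F X)"
  have X: "X \<in> Ob T" "Y \<in> Ob T" using u Hom_Ob by blast+
  have ux: "FMor F u x \<in> carrier (FOb F Y)" using ab_functor_hom[OF assms(1) u] x by (auto simp: hom_def)
  show "(\<lambda>X\<in>Ob T. \<lambda>x\<in>carrier (FOb F X). x) Y (FMor F u x) =
    FMor F u ((\<lambda>X\<in>Ob T. \<lambda>x\<in>carrier (FOb F X). x) X x)" using X x ux by simp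
qed simp

lemma zero_functor:
  obtains Z where "Z \<in> Coh \<kappa> T" "\<And>X. X \<in> Ob T \<Longrightarrow> trivial_group (FOb Z X)"
proof -
  obtain A where A: "zero_object T A" using ex_zero_object by blast
  have Ac: "A \<in> cob" "A \<in> Ob T" using zero_object_cob[OF A] cob_Ob by blast+
  have "ID A \<in> cmor" using cmor_iff[OF Id_Hom[OF Ac(2)]] Ac(1) by blast
  then have "coker_functor T (ID A) \<in> Coh \<kappa> T" by (rule coker_functor_Coh)
  moreover have "trivial_group (FOb (coker_functor T (ID A)) X)" if "X \<in> Ob T" for X
    unfolding coker_functor_eq[OF Id_Hom[OF Ac(2)]] pim_Id[OF Ac(2)]
    using subquot_trivial[OF subfunctor_hm[OF Ac(2)] subfunctor_hm[OF Ac(2)] that] by blast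
  ultimately show thesis using that by blast
qed

text \<open>An isomorphism F -> G continued by G -> 0. It yields closure of Serre subcategories
  under isomorphism, which their definition does not list.\<close>

lemma iso_short_exact:
  assumes "F \<in> Coh \<kappa> T" "G \<in> Coh \<kappa> T" "nat_iso T F G \<eta>" "Z \<in> Coh \<kappa> T" "\<And>X. X \<in> Ob T \<Longrightarrow> trivial_group (FOb Z X)"
  shows "Coh_short_exact \<kappa> T F \<eta> G (\<lambda>X\<in>Ob T. \<lambda>x\<in>carrier (FOb G X). \<one>\<^bsub>FOb Z X\<^esub>) Z"
proof (rule pointwise_short_exact[OF assms(1,2,4)])
  show "nat_trans T F G \<eta>" using assms(3) unfolding nat_iso_def by blast
  show "nat_trans T G Z (\<lambda>X\<in>Ob T. \<lambda>x\<in>carrier (FOb G X). \<one>\<^bsub>FOb Z X\<^esub>)"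
    using nat_trans_zero Coh_functor assms(2,4) by blast
  fix X assume X: "X \<in> Ob T"
  have b: "bij_betw (\<eta> X) (carrier (FOb F X)) (carrier (FOb G X))" using assms(3) X unfolding nat_iso_def iso_def by blast
  show "inj_on (\<eta> X) (carrier (FOb F X))" using b unfolding bij_betw_def by blast
  show "\<eta> X ` carrier (FOb F X) = {y \<in> carrier (FOb G X). (\<lambda>X\<in>Ob T. \<lambda>x\<in>carrier (FOb G X). \<one>\<^bsub>FOb Z X\<^esub>) X y = \<one>\<^bsub>FOb Z X\<^esub>}"
    using b X unfolding bij_betw_def by auto
  interpret G: comm_group "FOb G X" using ab_functor_group[OF Coh_functor[OF assms(2)] X] .
  show "(\<lambda>X\<in>Ob T. \<lambda>x\<in>carrier (FOb G X). \<one>\<^bsub>FOb Z X\<^esub>) X ` carrier (FOb G X) = carrier (FOb Z X)"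
    using X assms(5)[OF X] G.one_closed unfolding trivial_group_def by auto
qed

text \<open>The definition only asks for a nonempty class; a zero functor enters through the exact
  sequence 0 -> G = G for any member G.\<close>

lemma serre_zero:
  assumes S: "serre_subcategory \<kappa> T \<S>" and F: "F \<in> Coh \<kappa> T" "\<And>X. X \<in> Ob T \<Longrightarrow> trivial_group (FOb F X)"
  shows "F \<in> \<S>"
proof -
  obtain G where G: "G \<in> \<S>" "G \<in> Coh \<kappa> T" using S unfolding serre_subcategory_def by blast
  note Ff = Coh_functor[OF F(1)] and Gf = Coh_functor[OF G(2)]
  have "Coh_short_exact \<kappa> T F (\<lambda>X\<in>Ob T. \<lambda>x\<in>carrier (FOb F X). \<one>\<^bsub>FOb G X\<^esub>) G (\<lambda>X\<in>Ob T. \<lambda>x\<in>carrier (FOb G X). x) G"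
  proof (rule pointwise_short_exact[OF F(1) G(2,2) nat_trans_zero[OF Ff Gf] nat_trans_id[OF Gf]])
    fix X assume X: "X \<in> Ob T"
    interpret G: comm_group "FOb G X" using ab_functor_group[OF Gf X] .
    have c: "carrier (FOb F X) = {\<one>\<^bsub>FOb F X\<^esub>}" using F(2)[OF X] unfolding trivial_group_def by blast
    show "inj_on ((\<lambda>X\<in>Ob T. \<lambda>x\<in>carrier (FOb F X). \<one>\<^bsub>FOb G X\<^esub>) X) (carrier (FOb F X))" unfolding c by simp
    show "(\<lambda>X\<in>Ob T. \<lambda>x\<in>carrier (FOb F X). \<one>\<^bsub>FOb G X\<^esub>) X ` carrier (FOb F X) =
      {y \<in> carrier (FOb G X). (\<lambda>X\<in>Ob T. \<lambda>x\<in>carrier (FOb G X). x) X y = \<one>\<^bsub>FOb G X\<^esub>}"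
      using X c by auto
    show "(\<lambda>X\<in>Ob T. \<lambda>x\<in>carrier (FOb G X). x) X ` carrier (FOb G X) = carrier (FOb G X)" using X by auto
  qed
  then show ?thesis using S G(1) unfolding serre_subcategory_def by blast
qed

lemma serre_iso:
  assumes S: "serre_subcategory \<kappa> T \<S>" and FG: "F \<in> Coh \<kappa> T" "G \<in> Coh \<kappa> T" "nat_iso T F G \<eta>"
  shows "F \<in> \<S> \<longleftrightarrow> G \<in> \<S>"
proof -
  obtain Z where Z: "Z \<in> Coh \<kappa> T" "\<And>X. X \<in> Ob T \<Longrightarrow> trivial_group (FOb Z X)" using zero_functor by blast
  have "Z \<in> \<S>" using serre_zero[OF S Z] .
  then show ?thesis using S iso_short_exact[OF FG Z] unfolding serre_subcategory_def by blast
qed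

text \<open>For subfunctors c \<le> b \<le> a of (A,-) this is the exact sequence 0 -> b/c -> a/c ->
  a/b -> 0.\<close>

lemma serre_chain:
  assumes S: "serre_subcategory \<kappa> T \<S>" and abc: "a \<in> hm A K" "b \<in> hm A L" "c \<in> hm A N"
    and cpt: "A \<in> cob" "K \<in> cob" "L \<in> cob" "N \<in> cob"
    and sub: "\<And>X. pim c X \<subseteq> pim b X" "\<And>X. pim b X \<subseteq> pim a X"
  shows "quot a c \<in> \<S> \<longleftrightarrow> quot b c \<in> \<S> \<and> quot a b \<in> \<S>"
proof -
  have D: "Dom T a = A" "Dom T b = A" "Dom T c = A" using abc by (auto simp: Hom_iff)
  have A: "A \<in> Ob T" using cpt cob_Ob by blast
  have sub': "pim c X \<subseteq> pim a X" for X using sub by blast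
  note s = subfunctor_pim[OF abc(1)] subfunctor_pim[OF abc(2)] subfunctor_pim[OF abc(3)]
  note Coh = quot_Coh[OF abc(2,3) cpt(1,3,4) sub(1)] quot_Coh[OF abc(1,3) cpt(1,2,4) sub'] quot_Coh[OF abc(1,2) cpt(1,2,3) sub(2)]
  have H: "x \<cdot> ID A = x" "x \<in> hm A X" if x: "x \<in> pim a X" for x X
  proof -
    have "X \<in> Ob T" using x pim_outside by blast
    then show "x \<in> hm A X" using subfunctorD(2)[OF s(1) _ x] by blast
    then show "x \<cdot> ID A = x" by (simp add: Hom_iff)
  qed
  have Hb: "x \<cdot> ID A = x" if "x \<in> pim b X" for x X using H sub that by blast
  have Hc: "x \<cdot> ID A = x" if "x \<in> pim c X" for x X using Hb sub that by blast
  have "Coh_short_exact \<kappa> T (quot b c) (induced_map (quot b c) (pim c) (ID A)) (quot a c)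
    (induced_map (quot a c) (pim b) (ID A)) (quot a b)"
    unfolding quot_def D
  proof (rule subquot_short_exact[OF s(2,3,1,3,1,2) Id_Hom[OF A] Id_Hom[OF A] Coh[unfolded quot_def D]])
    fix X assume X: "X \<in> Ob T"
    note z = subfunctorD(3)[OF s(1) X] subfunctorD(3)[OF s(2) X] subfunctorD(3)[OF s(3) X]
    show "\<exists>x\<in>pim b X. y \<boxminus> x \<cdot> ID A \<in> pim c X" if "y \<in> pim a X" "y \<cdot> ID A \<in> pim b X" for y
      using that H[of y X] z(3) A X by (intro bexI[of _ y]) (auto simp: Hom_iff)
    show "\<exists>y\<in>pim a X. w \<boxminus> y \<cdot> ID A \<in> pim b X" if "w \<in> pim a X" for w
      using that H[of w X] z(2) A X by (intro bexI[of _ w]) (auto simp: Hom_iff)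
  qed (use H(1) Hb Hc sub in \<open>auto simp: subset_iff\<close>)
  then show ?thesis using S unfolding serre_subcategory_def by blast
qed

text \<open>Composition with \<open>t\<close> maps the functor \<open>(K,-)/(N,-)b\<close> onto \<open>(K,-)t/(N,-)bt\<close>, with kernel \<open>(L,-)e/(N,-)b\<close>.\<close>

lemma serre_precomp:
  assumes S: "serre_subcategory \<kappa> T \<S>" and h: "t \<in> hm A K" "b \<in> hm K N" "e \<in> hm K L"
    and cpt: "A \<in> cob" "K \<in> cob" "L \<in> cob" "N \<in> cob"
    and e: "\<And>X. pim e X = {x \<in> hm K X. x \<cdot> t \<in> pim (b \<cdot> t) X}"
  shows "quot (ID K) b \<in> \<S> \<longleftrightarrow> quot e b \<in> \<S> \<and> quot t (b \<cdot> t) \<in> \<S>"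
proof -
  have K: "K \<in> Ob T" using cpt cob_Ob by blast
  have bt: "b \<cdot> t \<in> hm A N" using h Comp_Hom by blast
  have D: "Dom T t = A" "Dom T b = K" "Dom T e = K" "Dom T (ID K) = K" using h K by (auto simp: Hom_iff)
  note s = subfunctor_pim[OF h(3)] subfunctor_pim[OF h(2)] subfunctor_pim[OF Id_Hom[OF K]] subfunctor_pim[OF h(1)] subfunctor_pim[OF bt]
  have pb: "x \<cdot> t \<in> pim (b \<cdot> t) X" "x \<in> hm K X" if x: "x \<in> pim b X" for x X
  proof -
    obtain y where y: "y \<in> hm N X" "x = y \<cdot> b" using x h(2) unfolding pim_iff by (auto simp: Hom_iff)
    then have "x \<cdot> t = y \<cdot> (b \<cdot> t)" using h by (auto simp: Hom_iff)
    then show "x \<cdot> t \<in> pim (b \<cdot> t) X" using pimI[of y "b \<cdot> t" X] y bt by (simp add: Hom_iff)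
    show "x \<in> hm K X" using y h(2) Comp_Hom by blast
  qed
  have sub: "pim b X \<subseteq> pim e X" "pim b X \<subseteq> pim (ID K) X" "pim (b \<cdot> t) X \<subseteq> pim t X" for X
  proof -
    show "pim b X \<subseteq> pim e X" "pim b X \<subseteq> pim (ID K) X" unfolding e pim_Id[OF K] using pb by blast+
    show "pim (b \<cdot> t) X \<subseteq> pim t X"
    proof
      fix x assume "x \<in> pim (b \<cdot> t) X"
      then obtain y where y: "y \<in> hm N X" "x = y \<cdot> (b \<cdot> t)" using bt unfolding pim_iff by (auto simp: Hom_iff)
      then have "x = y \<cdot> b \<cdot> t" using h by (auto simp: Hom_iff)
      then show "x \<in> pim t X" using pimI[of "y \<cdot> b" t X] y h Comp_Hom[OF h(2) y(1)] by (simp add: Hom_iff)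
    qed
  qed
  note Coh = quot_Coh[OF h(3,2) cpt(2,3,4) sub(1)] quot_Coh[OF Id_Hom[OF K] h(2) cpt(2,2,4) sub(2)] quot_Coh[OF h(1) bt cpt(1,2,4) sub(3)]
  have "Coh_short_exact \<kappa> T (quot e b) (induced_map (quot e b) (pim b) (ID K)) (quot (ID K) b)
    (induced_map (quot (ID K) b) (pim (b \<cdot> t)) t) (quot t (b \<cdot> t))"
    unfolding quot_def D
  proof (rule subquot_short_exact[OF s(1,2,3,2,4,5) Id_Hom[OF K] h(1) Coh[unfolded quot_def D]])
    fix X assume X: "X \<in> Ob T"
    have z: "zm K X \<in> pim b X" "zm A X \<in> pim (b \<cdot> t) X" using subfunctorD(3)[OF s(2) X] subfunctorD(3)[OF s(5) X] .
    have A: "A \<in> Ob T" using cpt cob_Ob by blast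
    show "\<exists>x\<in>pim e X. y \<boxminus> x \<cdot> ID K \<in> pim b X" if "y \<in> pim (ID K) X" "y \<cdot> t \<in> pim (b \<cdot> t) X" for y
      using that z(1) unfolding e pim_Id[OF K] by (intro bexI[of _ y]) (auto simp: Hom_iff)
    show "\<exists>y\<in>pim (ID K) X. w \<boxminus> y \<cdot> t \<in> pim (b \<cdot> t) X" if w: "w \<in> pim t X" for w
    proof -
      obtain y where y: "y \<in> hm K X" "w = y \<cdot> t" using w h(1) unfolding pim_iff by (auto simp: Hom_iff)
      have "w \<boxminus> y \<cdot> t = zm A X" using y h(1) by (auto simp: Hom_iff)
      then show ?thesis using z(2) y(1) unfolding pim_Id[OF K] by (intro bexI[of _ y]) simp_all
    qed
    show "x \<cdot> t \<in> pim t X" if "x \<in> pim (ID K) X" for x using that pimI[of x t X] h(1) unfolding pim_Id[OF K] by (simp add: Hom_iff)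
  qed (use pb sub in \<open>auto simp: e pim_Id[OF K] Hom_iff\<close>)
  then show ?thesis using S unfolding serre_subcategory_def by blast
qed

text \<open>The class \<open>J\<close> of the overview; dividing by a zero map turns
  \<open>quot\<close> into the image functor of f.\<close>

definition serre_morphisms :: "('o, 'm, 'm set) abfun set \<Rightarrow> 'm set" where
  "serre_morphisms \<S> = {f \<in> cmor. quot f (zm (Dom T f) (Cod T f)) \<in> \<S>}"

lemma pim_zero: assumes "A \<in> Ob T" "B \<in> Ob T"
  shows "pim (zm A B) = (\<lambda>X. if X \<in> Ob T then {zm A X} else {})"
proof
  fix X show "pim (zm A B) X = (if X \<in> Ob T then {zm A X} else {})"
  proof (cases "X \<in> Ob T")
    case True
    have 1: "zm A X \<in> pim (zm A B) X" using subfunctorD(3)[OF subfunctor_pim[OF zero_Hom[OF assms]] True] .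
    have 2: "x = zm A X" if x: "x \<in> pim (zm A B) X" for x
    proof -
      obtain b where "b \<in> hm B X" "x = b \<cdot> zm A B" using x unfolding pim_iff zero_Mor(3)[OF assms] by blast
      then show ?thesis using assms by (simp add: Hom_iff)
    qed
    have "pim (zm A B) X = {zm A X}" using 1 2 by blast
    then show ?thesis using True by simp
  qed (simp add: pim_outside)
qed

lemma quot_zero: "A \<in> Ob T \<Longrightarrow> B \<in> Ob T \<Longrightarrow> B' \<in> Ob T \<Longrightarrow> quot f (zm A B) = quot f (zm A B')"
  unfolding quot_def by (simp add: pim_zero)

lemma pim_zero_subset: assumes "a \<in> hm A K" "B \<in> Ob T" shows "pim (zm A B) X \<subseteq> pim a X"
  using subfunctorD(3)[OF subfunctor_pim[OF assms(1)]] Hom_Ob[OF assms(1)] assms(2) by (auto simp: pim_zero)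

lemma quot_self:
  assumes S: "serre_subcategory \<kappa> T \<S>" and f: "f \<in> hm A B" and c: "A \<in> cob" "B \<in> cob"
  shows "quot f f \<in> \<S>"
proof (rule serre_zero[OF S])
  show "quot f f \<in> Coh \<kappa> T" by (rule quot_Coh[OF f f c c(2)]) simp
  show "trivial_group (FOb (quot f f) X)" if "X \<in> Ob T" for X
    unfolding quot_def using subquot_trivial[OF subfunctor_pim[OF f] subfunctor_pim[OF f] that] f by (simp add: Hom_iff)
qed

text \<open>A degenerate case of \<open>serre_precomp\<close>: since (B,-)f is the annihilator of k
  and f k = 0, the map F_f -> (A,-)k has the zero functor \<open>quot f f\<close> as kernel.\<close>

lemma serre_triangle:
  assumes S: "serre_subcategory \<kappa> T \<S>" and t: "tri D A B (\<boxminus> k) f g" and k: "k \<in> hm D A" and c: "D \<in> cob" "A \<in> cob" "B \<in> cob"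
  shows "quot (ID A) f \<in> \<S> \<longleftrightarrow> k \<in> serre_morphisms \<S>"
proof -
  have f: "f \<in> hm A B" using tri_Hom[OF t] by blast
  have Ob: "A \<in> Ob T" "B \<in> Ob T" "D \<in> Ob T" using c cob_Ob by blast+
  have fk: "f \<cdot> k = zm D B"
  proof -
    have "f \<cdot> (\<boxminus> k) = zm D B" using tri_comp[OF t] .
    then have "\<boxminus> \<boxminus> (f \<cdot> k) = zm D B" using f k Ob by (simp add: Hom_iff)
    then show ?thesis using f k by (simp add: Hom_iff)
  qed
  have pf: "pim f X = {x \<in> hm A X. x \<cdot> k \<in> pim (f \<cdot> k) X}" for X
    unfolding tri_pim_neg[OF t k] fk pim_zero[OF Ob(3,2)] using Hom_Ob by auto
  have "quot f f \<in> \<S>" using quot_self[OF S f c(2,3)] .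
  then have "quot (ID A) f \<in> \<S> \<longleftrightarrow> quot k (zm D B) \<in> \<S>"
    using serre_precomp[OF S k f f c(1,2,3,3) pf] unfolding fk by blast
  also have "\<dots> \<longleftrightarrow> k \<in> serre_morphisms \<S>"
    unfolding serre_morphisms_def using k c cmor_iff[OF k] quot_zero[OF Ob(3,2,1), of k] by (auto simp: Hom_iff)
  finally show ?thesis .
qed

lemma serre_morphisms_iff: assumes "f \<in> hm A B" "A \<in> cob" "B \<in> cob" "N \<in> Ob T"
  shows "f \<in> serre_morphisms \<S> \<longleftrightarrow> quot f (zm A N) \<in> \<S>"
  using assms cmor_iff[OF assms(1)] quot_zero[of A B N f] cob_Ob unfolding serre_morphisms_def by (auto simp: Hom_iff)

text \<open>For the triangle clause, let g1 : K -> N be the second map of a triangle on m q and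
  filter (K,-)mg by (N,-)g1 mg. The quotient is a quotient of F_g1, which is isomorphic to the image
  functor of m q. The subobject lies inside (D,-)pg, because g1 m q = 0 makes g1 m factor as n p.
  Both layers belong to the Serre subcategory, hence so does the extension.\<close>

lemma serre_saturated: assumes S: "serre_subcategory \<kappa> T \<S>" shows "saturated (serre_morphisms \<S>)"
  unfolding saturated_def
proof (intro conjI ballI allI impI)
  let ?J = "serre_morphisms \<S>"
  show "?J \<subseteq> cmor" unfolding serre_morphisms_def by blast
  show "zm A B \<in> ?J" if c: "A \<in> cob" "B \<in> cob" for A B
  proof -
    have Ob: "A \<in> Ob T" "B \<in> Ob T" using c cob_Ob by blast+
    note z = zero_Hom[OF Ob]
    have "quot (zm A B) (zm A B) \<in> \<S>" using quot_self[OF S z c] .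
    then show ?thesis using serre_morphisms_iff[OF z c Ob(2)] by blast
  qed
  fix A B E D K q p r m g
  assume as: "A \<in> cob \<and> B \<in> cob \<and> E \<in> cob \<and> D \<in> cob \<and> K \<in> cob \<and> tri B E D q p r \<and>
    m \<in> hm E K \<and> g \<in> hm A E \<and> m \<cdot> q \<in> ?J \<and> p \<cdot> g \<in> ?J"
  then have c: "A \<in> cob" "B \<in> cob" "E \<in> cob" "D \<in> cob" "K \<in> cob" and t: "tri B E D q p r"
    and m: "m \<in> hm E K" and g: "g \<in> hm A E" and J: "m \<cdot> q \<in> ?J" "p \<cdot> g \<in> ?J" by blast+
  have q: "q \<in> hm B E" and p: "p \<in> hm E D" using tri_Hom[OF t] by blast+
  have mq: "m \<cdot> q \<in> hm B K" and mg: "m \<cdot> g \<in> hm A K" and pg: "p \<cdot> g \<in> hm A D" using m q p g Comp_Hom by blast+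
  obtain N g1 h where t1: "tri B K N (m \<cdot> q) g1 h" using obtain_cone[OF mq] .
  have N: "N \<in> cob" using cob_cone[OF t1 c(2,5)] .
  have Ob: "A \<in> Ob T" "B \<in> Ob T" "K \<in> Ob T" "N \<in> Ob T" "D \<in> Ob T" using c N cob_Ob by blast+
  have g1: "g1 \<in> hm K N" using tri_Hom[OF t1] by blast
  have g1mq: "g1 \<cdot> (m \<cdot> q) = zm B N" using tri_comp[OF t1] .
  have p1: "pim g1 X = {x \<in> hm K X. x \<cdot> (m \<cdot> q) \<in> pim (g1 \<cdot> (m \<cdot> q)) X}" for X
    unfolding tri_pim[OF t1] g1mq pim_zero[OF Ob(2,4)] using Hom_Ob by auto
  have "quot g1 g1 \<in> \<S>" using quot_self[OF S g1 c(5) N] .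
  then have Idg1: "quot (ID K) g1 \<in> \<S>"
    using serre_precomp[OF S mq g1 g1 c(2,5) N N p1] J(1) serre_morphisms_iff[OF mq c(2,5) Ob(4)] unfolding g1mq by blast
  have g1mg: "g1 \<cdot> (m \<cdot> g) \<in> hm A N" using mg g1 Comp_Hom by blast
  \<comment> \<open>The leg e presents the kernel of (K,-) -> (K,-)mg / (N,-)g1 mg, so that this
    kernel is coherent and \<open>serre_precomp\<close> applies.\<close>
  obtain L e d where L: "L \<in> cob" "e \<in> hm K L" "d \<in> hm N L" "e \<cdot> (m \<cdot> g) = d \<cdot> (g1 \<cdot> (m \<cdot> g))"
    "\<And>X x y. x \<in> hm K X \<Longrightarrow> y \<in> hm N X \<Longrightarrow> x \<cdot> (m \<cdot> g) = y \<cdot> (g1 \<cdot> (m \<cdot> g)) \<Longrightarrow> \<exists>z \<in> hm L X. x = z \<cdot> e \<and> y = z \<cdot> d"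
    using weak_pushout[OF mg g1mg c(1,5) N] by metis
  have pe: "pim e X = {x \<in> hm K X. x \<cdot> (m \<cdot> g) \<in> pim (g1 \<cdot> (m \<cdot> g)) X}" for X
  proof (intro equalityI subsetI)
    fix x assume "x \<in> pim e X"
    then obtain z where z: "z \<in> hm L X" "x = z \<cdot> e" using L(2) unfolding pim_iff by (auto simp: Hom_iff)
    have "x \<cdot> (m \<cdot> g) = z \<cdot> (e \<cdot> (m \<cdot> g))" using z L(2) mg by (simp add: Hom_iff)
    also have "\<dots> = z \<cdot> d \<cdot> (g1 \<cdot> (m \<cdot> g))" unfolding L(4) using z(1) L(3) g1mg by (simp add: Hom_iff)
    finally have "x \<cdot> (m \<cdot> g) \<in> pim (g1 \<cdot> (m \<cdot> g)) X"
      using pimI[of "z \<cdot> d" "g1 \<cdot> (m \<cdot> g)" X] Comp_Hom[OF L(3) z(1)] g1mg by (simp add: Hom_iff)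
    then show "x \<in> {x \<in> hm K X. x \<cdot> (m \<cdot> g) \<in> pim (g1 \<cdot> (m \<cdot> g)) X}" using z L(2) Comp_Hom by blast
  next
    fix x assume "x \<in> {x \<in> hm K X. x \<cdot> (m \<cdot> g) \<in> pim (g1 \<cdot> (m \<cdot> g)) X}"
    then have x: "x \<in> hm K X" "x \<cdot> (m \<cdot> g) \<in> pim (g1 \<cdot> (m \<cdot> g)) X" by auto
    obtain y where "y \<in> hm N X" "x \<cdot> (m \<cdot> g) = y \<cdot> (g1 \<cdot> (m \<cdot> g))" using x(2) g1mg unfolding pim_iff by (auto simp: Hom_iff)
    then obtain z where "z \<in> hm L X" "x = z \<cdot> e" using L(5)[OF x(1)] by blast
    then show "x \<in> pim e X" using pimI[of z e X] L(2) by (simp add: Hom_iff)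
  qed
  have 1: "quot (m \<cdot> g) (g1 \<cdot> (m \<cdot> g)) \<in> \<S>"
    using serre_precomp[OF S mg g1 L(2) c(1,5) L(1) N pe] Idg1 by blast
  have "(g1 \<cdot> m) \<cdot> q = zm B N" using g1mq g1 m q by (simp add: Hom_iff)
  then obtain n where n: "n \<in> hm D N" "g1 \<cdot> m = n \<cdot> p" using tri_extend[OF t Comp_Hom[OF m g1]] by blast
  have npg: "g1 \<cdot> (m \<cdot> g) = n \<cdot> (p \<cdot> g)"
  proof -
    have "g1 \<cdot> (m \<cdot> g) = g1 \<cdot> m \<cdot> g" using g1 m g by (simp add: Hom_iff)
    also have "\<dots> = n \<cdot> (p \<cdot> g)" unfolding n(2) using n(1) p g by (simp add: Hom_iff)
    finally show ?thesis .
  qed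
  have sub: "pim (v \<cdot> w) X \<subseteq> pim w X" if v: "v \<in> hm B' C'" and w: "w \<in> hm A' B'" for v w A' B' C' X
  proof
    fix x assume "x \<in> pim (v \<cdot> w) X"
    then obtain y where y: "y \<in> hm C' X" "x = y \<cdot> (v \<cdot> w)" using v w unfolding pim_iff by (auto simp: Hom_iff)
    then have "x = y \<cdot> v \<cdot> w" using v w by (simp add: Hom_iff)
    then show "x \<in> pim w X" using pimI[of "y \<cdot> v" w X] Comp_Hom[OF v y(1)] w by (simp add: Hom_iff)
  qed
  have npgH: "n \<cdot> (p \<cdot> g) \<in> hm A N" using n(1) pg Comp_Hom by blast
  note z = zero_Hom[OF Ob(1) Ob(4)]
  have "quot (p \<cdot> g) (zm A N) \<in> \<S>" using J(2) serre_morphisms_iff[OF pg c(1,4) Ob(4)] by blast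
  then have "quot (n \<cdot> (p \<cdot> g)) (zm A N) \<in> \<S>"
    using serre_chain[OF S pg npgH z c(1,4) N N pim_zero_subset[OF npgH Ob(4)] sub[OF n(1) pg]] by blast
  then have "quot (m \<cdot> g) (zm A N) \<in> \<S>"
    using serre_chain[OF S mg g1mg z c(1,5) N N pim_zero_subset[OF g1mg Ob(4)] sub[OF g1 mg]] 1 npg by simp
  then show "m \<cdot> g \<in> ?J" using serre_morphisms_iff[OF mg c(1,5) Ob(4)] by blast
qed

section \<open>Annihilators of morphisms and of functors\<close>

lemma tri_kills:
  assumes t: "tri D A B (\<boxminus> k) f g" and k: "k \<in> hm D A"
  shows "divides T f X \<longleftrightarrow> kills T X k"
proof -
  have f: "f \<in> hm A B" using tri_Hom[OF t] by blast
  show ?thesis unfolding divides_iff tri_pim_neg[OF assms] kills_def using f k by (auto simp: Hom_iff)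
qed

lemma coker_trivial: assumes "f \<in> cmor" "X \<in> Ob T"
  shows "trivial_group (FOb (coker_functor T f) X) \<longleftrightarrow> divides T f X"
proof -
  have fH: "f \<in> hm (Dom T f) (Cod T f)" "Dom T f \<in> Ob T" using cmorE[OF assms(1)] by metis+
  show ?thesis unfolding coker_functor_eq[OF fH(1)] divides_iff
    using subquot_trivial[OF subfunctor_hm[OF fH(2)] subfunctor_pim[OF fH(1)] assms(2)] .
qed

lemma Coh_divides: assumes "F \<in> Coh \<kappa> T" "f \<in> cmor" "nat_iso T (coker_functor T f) F \<eta>" "X \<in> Ob T"
  shows "trivial_group (FOb F X) \<longleftrightarrow> divides T f X"
  using nat_iso_trivial[OF assms(3) Coh_functor[OF coker_functor_Coh[OF assms(2)]] Coh_functor[OF assms(1)] assms(4)]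
    coker_trivial[OF assms(2,4)] by blast

lemma obtain_fibre: assumes "f \<in> cmor"
  obtains D k g where "tri D (Dom T f) (Cod T f) (\<boxminus> k) f g" "k \<in> hm D (Dom T f)" "k \<in> cmor" "D \<in> cob"
proof -
  have fH: "f \<in> hm (Dom T f) (Cod T f)" "Dom T f \<in> cob" "Cod T f \<in> cob" using cmorE[OF assms] by metis+
  obtain C g h where t: "tri (Dom T f) (Cod T f) C f g h" using obtain_cone[OF fH(1)] .
  obtain D k where k: "C = ShOb T D" "h = ShMor T k" "k \<in> hm D (Dom T f)" "tri D (Dom T f) (Cod T f) (\<boxminus> k) f g"
    using tri_unrotate[OF t] .
  have D: "D \<in> cob" using cob_cone[OF t fH(2,3)] k(1) cob_Sh Hom_Ob[OF k(3)] by blast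
  then show thesis using that[OF k(4,3)] cmor_iff[OF k(3)] fH(2) by blast
qed

lemma serre_closed:
  assumes S: "serre_subcategory \<kappa> T \<S>" shows "Ann_Coh \<kappa> T (Ann_Ob T \<S>) = \<S>"
proof
  have SC: "\<S> \<subseteq> Coh \<kappa> T" using S unfolding serre_subcategory_def by blast
  then show "\<S> \<subseteq> Ann_Coh \<kappa> T (Ann_Ob T \<S>)" unfolding Ann_Coh_def Ann_Ob_def by blast
  \<comment> \<open>Every coherent functor is isomorphic to the image functor of some compact k, so
    membership in \<S> and vanishing at X both become conditions on k. Separating k from the
    saturated class then separates F from \<S>.\<close>
  have rep: "\<exists>k. k \<in> cmor \<and> (F \<in> \<S> \<longleftrightarrow> k \<in> serre_morphisms \<S>) \<and> (\<forall>X\<in>Ob T. trivial_group (FOb F X) \<longleftrightarrow> kills T X k)"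
    if F: "F \<in> Coh \<kappa> T" for F
  proof -
    obtain f \<eta> where f: "f \<in> cmor" "nat_iso T (coker_functor T f) F \<eta>" using F unfolding Coh_def by blast
    have fH: "f \<in> hm (Dom T f) (Cod T f)" "Dom T f \<in> cob" "Cod T f \<in> cob" using cmorE[OF f(1)] by metis+
    obtain D k g where k: "tri D (Dom T f) (Cod T f) (\<boxminus> k) f g" "k \<in> hm D (Dom T f)" "k \<in> cmor" "D \<in> cob"
      using obtain_fibre[OF f(1)] .
    have "F \<in> \<S> \<longleftrightarrow> k \<in> serre_morphisms \<S>"
      using serre_iso[OF S coker_functor_Coh[OF f(1)] F f(2)] serre_triangle[OF S k(1,2,4) fH(2,3)] quot_Id[OF fH(1)] by simp
    then show ?thesis using Coh_divides[OF F f] tri_kills[OF k(1,2)] k(3) by blast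
  qed
  show "Ann_Coh \<kappa> T (Ann_Ob T \<S>) \<subseteq> \<S>"
  proof
    fix F assume F: "F \<in> Ann_Coh \<kappa> T (Ann_Ob T \<S>)"
    then have FC: "F \<in> Coh \<kappa> T" unfolding Ann_Coh_def by blast
    obtain k where k: "k \<in> cmor" "F \<in> \<S> \<longleftrightarrow> k \<in> serre_morphisms \<S>" "\<forall>X\<in>Ob T. trivial_group (FOb F X) \<longleftrightarrow> kills T X k"
      using rep[OF FC] by blast
    show "F \<in> \<S>"
    proof (rule ccontr)
      assume "F \<notin> \<S>"
      then have "k \<notin> serre_morphisms \<S>" using k(2) by blast
      then obtain X where X: "X \<in> Ob T" "\<And>j. j \<in> serre_morphisms \<S> \<Longrightarrow> kills T X j" "\<not> kills T X k"
        using saturated_separation[OF serre_saturated[OF S] k(1)] by metis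
      have "X \<in> Ann_Ob T \<S>" unfolding Ann_Ob_def using rep SC X(1,2) by blast
      then have "trivial_group (FOb F X)" using F unfolding Ann_Coh_def by blast
      then show False using k(3) X(1,3) by blast
    qed
  qed
qed

end

section \<open>Annihilators are Serre subcategories\<close>

context compactly_generated
begin

section \<open>Elements of coherent functors and their origin over compact objects\<close>

lemma Coh_one_map: "F \<in> Coh \<kappa> T \<Longrightarrow> u \<in> hm X Y \<Longrightarrow> FMor F u \<one>\<^bsub>FOb F X\<^esub> = \<one>\<^bsub>FOb F Y\<^esub>"
  using hom_one[OF ab_functor_hom[OF Coh_functor]] ab_functor_group[OF Coh_functor] comm_group.axioms(2) Hom_Ob by metis

lemma Coh_map_closed: "F \<in> Coh \<kappa> T \<Longrightarrow> u \<in> hm X Y \<Longrightarrow> x \<in> carrier (FOb F X) \<Longrightarrow> FMor F u x \<in> carrier (FOb F Y)"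
  using ab_functor_hom[OF Coh_functor, of F \<kappa> T u X Y] by (auto simp: hom_def)

lemma Coh_map_comp: assumes "F \<in> Coh \<kappa> T" "u \<in> hm X Y" "v \<in> hm Y Z" "x \<in> carrier (FOb F X)"
  shows "FMor F (v \<cdot> u) x = FMor F v (FMor F u x)"
proof -
  have "\<forall>A B D. \<forall>f \<in> hm A B. \<forall>g \<in> hm B D. \<forall>x \<in> carrier (FOb F A). FMor F (g \<cdot> f) x = FMor F g (FMor F f x)"
    using Coh_functor[OF assms(1)] unfolding ab_functor_def by (elim conjE)
  then show ?thesis using assms(2-4) by blast
qed

lemma Coh_map_id: "F \<in> Coh \<kappa> T \<Longrightarrow> X \<in> Ob T \<Longrightarrow> x \<in> carrier (FOb F X) \<Longrightarrow> FMor F (ID X) x = x"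
  using Coh_functor[of F \<kappa> T] unfolding ab_functor_def by simp

text \<open>The element \<open>i\<close> is the class of the identity of A under a presentation by f
  : A -> B. It generates F, and its relations at X are exactly (B,X)f.\<close>

lemma Coh_generator:
  assumes F: "F \<in> Coh \<kappa> T"
  obtains f A B i where "f \<in> cmor" "f \<in> hm A B" "A \<in> cob" "B \<in> cob" "i \<in> carrier (FOb F A)"
    "\<And>X v. X \<in> Ob T \<Longrightarrow> v \<in> carrier (FOb F X) \<Longrightarrow> \<exists>a \<in> hm A X. v = FMor F a i"
    "\<And>X a. a \<in> hm A X \<Longrightarrow> FMor F a i = \<one>\<^bsub>FOb F X\<^esub> \<longleftrightarrow> a \<in> pim f X"
    "\<And>X a b. a \<in> hm A X \<Longrightarrow> b \<in> hm A X \<Longrightarrow> FMor F (a \<boxplus> b) i = FMor F a i \<otimes>\<^bsub>FOb F X\<^esub> FMor F b i"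
proof -
  obtain f \<eta> where f: "f \<in> cmor" "nat_iso T (coker_functor T f) F \<eta>" using F unfolding Coh_def by blast
  define A where "A = Dom T f"
  have fH: "f \<in> hm A (Cod T f)" "A \<in> cob" "Cod T f \<in> cob" "A \<in> Ob T" unfolding A_def using cmorE[OF f(1)] by metis+
  let ?G = "subquot A (hm A) (pim f)"
  have G: "coker_functor T f = ?G" using coker_functor_eq[OF fH(1)] .
  note s = subfunctor_hm[OF fH(4)] subfunctor_pim[OF fH(1)]
  have n: "nat_trans T ?G F \<eta>" and iso: "\<And>X. X \<in> Ob T \<Longrightarrow> \<eta> X \<in> iso (FOb ?G X) (FOb F X)"
    using f(2) unfolding G nat_iso_def by blast+
  define i where "i = \<eta> A (coset (pim f A) (ID A))"
  have cA: "coset (pim f A) (ID A) \<in> carrier (FOb ?G A)" using Id_Hom[OF fH(4)] by simp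
  have Fi: "FMor F a i = \<eta> X (coset (pim f X) a)" if a: "a \<in> hm A X" for a X
  proof -
    have "FMor F a i = \<eta> X (FMor ?G a (coset (pim f A) (ID A)))"
      unfolding i_def using nat_trans_natural[OF n a cA] by simp
    also have "FMor ?G a (coset (pim f A) (ID A)) = coset (pim f X) (a \<cdot> ID A)"
      by (rule subquot_FMor[OF s(2) Id_Hom[OF fH(4)] a])
    finally show ?thesis using a by (simp add: Hom_iff)
  qed
  show thesis
  proof (rule that[OF f(1) fH(1-3)])
    show "i \<in> carrier (FOb F A)" unfolding i_def by (rule nat_trans_closed[OF n fH(4) cA])
    show "\<exists>a \<in> hm A X. v = FMor F a i" if X: "X \<in> Ob T" and v: "v \<in> carrier (FOb F X)" for X v
    proof -
      have "v \<in> \<eta> X ` carrier (FOb ?G X)" using iso[OF X] v unfolding iso_def bij_betw_def by blast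
      then obtain a where "a \<in> hm A X" "v = \<eta> X (coset (pim f X) a)" by auto
      then show ?thesis using Fi by blast
    qed
    show "FMor F a i = \<one>\<^bsub>FOb F X\<^esub> \<longleftrightarrow> a \<in> pim f X" if a: "a \<in> hm A X" for X a
    proof -
      have X: "X \<in> Ob T" using a Hom_Ob by blast
      have inj: "inj_on (\<eta> X) (carrier (FOb ?G X))" using iso[OF X] unfolding iso_def bij_betw_def by blast
      have one: "\<eta> X \<one>\<^bsub>FOb ?G X\<^esub> = \<one>\<^bsub>FOb F X\<^esub>"
        using nat_trans_one[OF subquot_functor[OF s] Coh_functor[OF F] n X] .
      have z: "\<one>\<^bsub>FOb ?G X\<^esub> = coset (pim f X) (zm A X)" using coset_zero[OF s(2) X] by simp
      have "FMor F a i = \<one>\<^bsub>FOb F X\<^esub> \<longleftrightarrow> \<eta> X (coset (pim f X) a) = \<eta> X (coset (pim f X) (zm A X))"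
        unfolding Fi[OF a] one[symmetric] z ..
      also have "\<dots> \<longleftrightarrow> coset (pim f X) a = coset (pim f X) (zm A X)"
        using inj_on_eq_iff[OF inj] a zero_Hom[OF fH(4) X] by simp
      also have "\<dots> \<longleftrightarrow> a \<in> pim f X"
        using coset_eq[OF s(2) a zero_Hom[OF fH(4) X]] a fH(4) X by (simp add: Hom_iff)
      finally show ?thesis .
    qed
    show "FMor F (a \<boxplus> b) i = FMor F a i \<otimes>\<^bsub>FOb F X\<^esub> FMor F b i" if a: "a \<in> hm A X" and b: "b \<in> hm A X" for X a b
    proof -
      have X: "X \<in> Ob T" using a Hom_Ob by blast
      show ?thesis unfolding Fi[OF a] Fi[OF b] Fi[OF add_Hom[OF a b]]
        using nat_trans_mult[OF n X, of "coset (pim f X) a" "coset (pim f X) b"] coset_mult[OF s(2) a b] a b by simp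
    qed
  qed
qed

lemma Coh_lift:
  assumes F: "F \<in> Coh \<kappa> T" and X: "X \<in> Ob T" and v: "v \<in> carrier (FOb F X)"
  obtains A a w where "A \<in> cob" "a \<in> hm A X" "w \<in> carrier (FOb F A)" "v = FMor F a w"
proof -
  obtain f A B i where f: "f \<in> cmor" "f \<in> hm A B" "A \<in> cob" "B \<in> cob" "i \<in> carrier (FOb F A)"
    "\<And>X v. X \<in> Ob T \<Longrightarrow> v \<in> carrier (FOb F X) \<Longrightarrow> \<exists>a \<in> hm A X. v = FMor F a i"
    "\<And>X a. a \<in> hm A X \<Longrightarrow> FMor F a i = \<one>\<^bsub>FOb F X\<^esub> \<longleftrightarrow> a \<in> pim f X"
    by (rule Coh_generator[OF F]) blast
  then show thesis using that X v by blast
qed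

text \<open>A relation that holds over X already holds over a compact N on the way to X. Writing w =
  F(y)i, its vanishing over X means a y = z f with f the presenting map; N is the weak pushout of y
  and f.\<close>

lemma Coh_vanish:
  assumes F: "F \<in> Coh \<kappa> T" and A: "A \<in> cob" and w: "w \<in> carrier (FOb F A)" and a: "a \<in> hm A X"
    and 0: "FMor F a w = \<one>\<^bsub>FOb F X\<^esub>"
  obtains N e n where "N \<in> cob" "e \<in> hm A N" "n \<in> hm N X" "a = n \<cdot> e" "FMor F e w = \<one>\<^bsub>FOb F N\<^esub>"
proof -
  obtain f P Q i where f: "f \<in> cmor" "f \<in> hm P Q" "P \<in> cob" "Q \<in> cob" "i \<in> carrier (FOb F P)"
    "\<And>X v. X \<in> Ob T \<Longrightarrow> v \<in> carrier (FOb F X) \<Longrightarrow> \<exists>a \<in> hm P X. v = FMor F a i"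
    "\<And>X a. a \<in> hm P X \<Longrightarrow> FMor F a i = \<one>\<^bsub>FOb F X\<^esub> \<longleftrightarrow> a \<in> pim f X"
    by (rule Coh_generator[OF F]) blast
  obtain y where y: "y \<in> hm P A" "w = FMor F y i" using f(6)[OF cob_Ob[OF A] w] by blast
  have "FMor F (a \<cdot> y) i = \<one>\<^bsub>FOb F X\<^esub>" using Coh_map_comp[OF F y(1) a f(5)] y(2) 0 by simp
  then have "a \<cdot> y \<in> pim f X" using f(7)[OF Comp_Hom[OF y(1) a]] by blast
  then obtain z where z: "z \<in> hm Q X" "a \<cdot> y = z \<cdot> f" using f(2) unfolding pim_iff by (auto simp: Hom_iff)
  obtain N e d where N: "N \<in> cob" "e \<in> hm A N" "d \<in> hm Q N" "e \<cdot> y = d \<cdot> f"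
    "\<And>X x x'. x \<in> hm A X \<Longrightarrow> x' \<in> hm Q X \<Longrightarrow> x \<cdot> y = x' \<cdot> f \<Longrightarrow> \<exists>z \<in> hm N X. x = z \<cdot> e \<and> x' = z \<cdot> d"
    using weak_pushout[OF y(1) f(2,3) A f(4)] by metis
  obtain n where n: "n \<in> hm N X" "a = n \<cdot> e" using N(5)[OF a z] by blast
  have "e \<cdot> y \<in> pim f N" unfolding N(4) using pimI[of d f N] N(3) f(2) by (simp add: Hom_iff)
  then have "FMor F (e \<cdot> y) i = \<one>\<^bsub>FOb F N\<^esub>" using f(7)[OF Comp_Hom[OF y(1) N(2)]] by blast
  then have "FMor F e w = \<one>\<^bsub>FOb F N\<^esub>" using Coh_map_comp[OF F y(1) N(2) f(5)] y(2) by simp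
  then show thesis using that N(1,2) n by blast
qed

text \<open>The functor (P,-) is made coherent as the cokernel functor of a zero map; its cosets are
  singletons. Elements of F P become transformations between coherent functors, which the universal
  properties can test.\<close>

lemma yoneda:
  assumes F: "F \<in> Coh \<kappa> T" and P: "P \<in> cob" and w: "w \<in> carrier (FOb F P)"
  obtains E \<gamma> i where "E \<in> Coh \<kappa> T" "nat_trans T E F \<gamma>" "i \<in> carrier (FOb E P)" "\<gamma> P i = w"
    "\<And>X S. X \<in> Ob T \<Longrightarrow> S \<in> carrier (FOb E X) \<Longrightarrow> \<exists>x \<in> hm P X. \<gamma> X S = FMor F x w"
proof -
  have PO: "P \<in> Ob T" using P cob_Ob by blast
  note zH = zero_Hom[OF PO PO]
  let ?E = "subquot P (hm P) (pim (zm P P))"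
  note s = subfunctor_hm[OF PO] subfunctor_pim[OF zH]
  have E: "?E \<in> Coh \<kappa> T" using coker_functor_Coh[of "zm P P"] cmor_iff[OF zH] P coker_functor_eq[OF zH] by simp
  have cs: "coset (pim (zm P P) X) x = {x}" if x: "x \<in> hm P X" for x X
  proof -
    have "X \<in> Ob T" using x Hom_Ob by blast
    then show ?thesis unfolding pim_zero[OF PO PO] coset_def using x by (simp add: Hom_iff)
  qed
  have car: "carrier (FOb ?E X) = (\<lambda>x. {x}) ` hm P X" for X using cs by (auto simp: image_iff)
  define \<gamma> where "\<gamma> = (\<lambda>X\<in>Ob T. \<lambda>S\<in>carrier (FOb ?E X). FMor F (the_elem S) w)"
  have g: "\<gamma> X {x} = FMor F x w" if x: "x \<in> hm P X" for x X
  proof -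
    have "X \<in> Ob T" using x Hom_Ob by blast
    then show ?thesis unfolding \<gamma>_def using x car by simp
  qed
  \<comment> \<open>\<open>ab_functor\<close> makes each F(u) additive but says nothing about F(u +
    v). Additivity in x comes from the presentation, after writing w = F(a)i.\<close>
  have Fa: "FMor F (x \<boxplus> y) w = FMor F x w \<otimes>\<^bsub>FOb F X\<^esub> FMor F y w" if x: "x \<in> hm P X" and y: "y \<in> hm P X" for x y X
  proof -
    obtain f A B i where f: "f \<in> cmor" "f \<in> hm A B" "A \<in> cob" "B \<in> cob" "i \<in> carrier (FOb F A)"
      "\<And>X v. X \<in> Ob T \<Longrightarrow> v \<in> carrier (FOb F X) \<Longrightarrow> \<exists>a \<in> hm A X. v = FMor F a i"
      "\<And>X a b. a \<in> hm A X \<Longrightarrow> b \<in> hm A X \<Longrightarrow> FMor F (a \<boxplus> b) i = FMor F a i \<otimes>\<^bsub>FOb F X\<^esub> FMor F b i"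
      by (rule Coh_generator[OF F]) blast
    obtain a where a: "a \<in> hm A P" "w = FMor F a i" using f(6)[OF PO w] by blast
    have "FMor F (x \<boxplus> y) w = FMor F ((x \<boxplus> y) \<cdot> a) i" unfolding a(2) using Coh_map_comp[OF F a(1) add_Hom[OF x y] f(5)] by simp
    also have "(x \<boxplus> y) \<cdot> a = x \<cdot> a \<boxplus> y \<cdot> a" using x y a(1) by (simp add: Hom_iff)
    also have "FMor F (x \<cdot> a \<boxplus> y \<cdot> a) i = FMor F (x \<cdot> a) i \<otimes>\<^bsub>FOb F X\<^esub> FMor F (y \<cdot> a) i"
      by (rule f(7)[OF Comp_Hom[OF a(1) x] Comp_Hom[OF a(1) y]])
    finally show ?thesis unfolding a(2) using Coh_map_comp[OF F a(1) x f(5)] Coh_map_comp[OF F a(1) y f(5)] by simp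
  qed
  have nat: "nat_trans T ?E F \<gamma>" unfolding nat_trans_def
  proof (intro conjI ballI allI)
    show "\<gamma> \<in> extensional (Ob T)" unfolding \<gamma>_def by simp
    show "\<gamma> X \<in> hom (FOb ?E X) (FOb F X) \<inter> extensional (carrier (FOb ?E X))" if X: "X \<in> Ob T" for X
    proof (intro IntI homI)
      show "\<gamma> X \<in> extensional (carrier (FOb ?E X))" unfolding \<gamma>_def using X by simp
      fix S assume "S \<in> carrier (FOb ?E X)"
      then obtain x where x: "x \<in> hm P X" "S = {x}" unfolding car by blast
      show "\<gamma> X S \<in> carrier (FOb F X)" unfolding x(2) g[OF x(1)] using Coh_map_closed[OF F x(1) w] .
      fix S' assume "S' \<in> carrier (FOb ?E X)"
      then obtain y where y: "y \<in> hm P X" "S' = {y}" unfolding car by blast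
      have "S \<otimes>\<^bsub>FOb ?E X\<^esub> S' = {x \<boxplus> y}"
        using coset_mult[OF s(2) x(1) y(1)] x y cs add_Hom[OF x(1) y(1)] by simp
      then show "\<gamma> X (S \<otimes>\<^bsub>FOb ?E X\<^esub> S') = \<gamma> X S \<otimes>\<^bsub>FOb F X\<^esub> \<gamma> X S'"
        using g[OF x(1)] g[OF y(1)] g[OF add_Hom[OF x(1) y(1)]] Fa[OF x(1) y(1)] x(2) y(2) by simp
    qed
    show "\<gamma> Y (FMor ?E u S) = FMor F u (\<gamma> X S)" if u: "u \<in> hm X Y" and S: "S \<in> carrier (FOb ?E X)" for X Y u S
    proof -
      obtain x where x: "x \<in> hm P X" "S = {x}" using S unfolding car by blast
      have "FMor ?E u S = {u \<cdot> x}"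
        using subquot_FMor[OF s(2) x(1) u, of "hm P"] cs[OF x(1)] cs[OF Comp_Hom[OF x(1) u]] x(2) by simp
      then show ?thesis using g[OF x(1)] g[OF Comp_Hom[OF x(1) u]] Coh_map_comp[OF F x(1) u w] x(2) by simp
    qed
  qed
  show thesis
  proof (rule that[OF E nat])
    show "{ID P} \<in> carrier (FOb ?E P)" unfolding car using Id_Hom[OF PO] by blast
    show "\<gamma> P {ID P} = w" using g[OF Id_Hom[OF PO]] Coh_map_id[OF F PO w] by simp
    show "\<exists>x \<in> hm P X. \<gamma> X S = FMor F x w" if "X \<in> Ob T" "S \<in> carrier (FOb ?E X)" for X S
      using that g unfolding car by blast
  qed
qed

text \<open>The element v and the relation \<alpha> v = 0 are moved to a compact N, giving w' in F
  N. The transformation (N,-) -> F belonging to w' and the zero transformation both solve the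
  lifting problem for zero, so uniqueness forces w' and hence v to be trivial.\<close>

lemma Coh_kernel_inj:
  assumes F: "F \<in> Coh \<kappa> T" and G: "G \<in> Coh \<kappa> T" and H: "H \<in> Coh \<kappa> T" and \<beta>: "nat_trans T G H \<beta>"
    and k: "Coh_kernel \<kappa> T F \<alpha> G \<beta> H"
    and X: "X \<in> Ob T" and v: "v \<in> carrier (FOb F X)" and v0: "\<alpha> X v = \<one>\<^bsub>FOb G X\<^esub>"
  shows "v = \<one>\<^bsub>FOb F X\<^esub>"
proof -
  have \<alpha>: "nat_trans T F G \<alpha>" using k unfolding Coh_kernel_def by blast
  note Gf = Coh_functor[OF G] and Ff = Coh_functor[OF F] and Hf = Coh_functor[OF H]
  obtain A a w where A: "A \<in> cob" "a \<in> hm A X" "w \<in> carrier (FOb F A)" "v = FMor F a w" using Coh_lift[OF F X v] .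
  have AO: "A \<in> Ob T" using A(1) cob_Ob by blast
  have "FMor G a (\<alpha> A w) = \<one>\<^bsub>FOb G X\<^esub>" using nat_trans_natural[OF \<alpha> A(2,3)] v0 A(4) by simp
  then obtain N e n where N: "N \<in> cob" "e \<in> hm A N" "n \<in> hm N X" "a = n \<cdot> e" "FMor G e (\<alpha> A w) = \<one>\<^bsub>FOb G N\<^esub>"
    using Coh_vanish[OF G A(1) nat_trans_closed[OF \<alpha> AO A(3)] A(2)] by metis
  have NO: "N \<in> Ob T" using N(1) cob_Ob by blast
  define w' where "w' = FMor F e w"
  have w': "w' \<in> carrier (FOb F N)" unfolding w'_def using Coh_map_closed[OF F N(2) A(3)] .
  have aw': "\<alpha> N w' = \<one>\<^bsub>FOb G N\<^esub>" unfolding w'_def using nat_trans_natural[OF \<alpha> N(2) A(3)] N(5) by simp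
  have vw: "v = FMor F n w'" unfolding A(4) N(4) w'_def using Coh_map_comp[OF F N(2,3) A(3)] .
  obtain E \<gamma> i where E: "E \<in> Coh \<kappa> T" "nat_trans T E F \<gamma>" "i \<in> carrier (FOb E N)" "\<gamma> N i = w'"
    "\<And>X S. X \<in> Ob T \<Longrightarrow> S \<in> carrier (FOb E X) \<Longrightarrow> \<exists>x \<in> hm N X. \<gamma> X S = FMor F x w'"
    using yoneda[OF F N(1) w'] by metis
  note Ef = Coh_functor[OF E(1)]
  let ?o = "\<lambda>G. \<lambda>X\<in>Ob T. \<lambda>x\<in>carrier (FOb E X). \<one>\<^bsub>FOb G X\<^esub>"
  have zc: "zero_comp T E (?o G) H \<beta>"
    unfolding zero_comp_def using nat_trans_one[OF Gf Hf \<beta>] by simp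
  have "\<exists>!\<delta>. nat_trans T E F \<delta> \<and> (\<forall>A\<in>Ob T. \<forall>x\<in>carrier (FOb E A). \<alpha> A (\<delta> A x) = ?o G A x)"
    using k E(1) nat_trans_zero[OF Ef Gf] zc unfolding Coh_kernel_def by blast
  moreover have "\<alpha> A (\<gamma> A x) = ?o G A x" if AX: "A \<in> Ob T" "x \<in> carrier (FOb E A)" for A x
  proof -
    obtain y where y: "y \<in> hm N A" "\<gamma> A x = FMor F y w'" using E(5)[OF AX] by blast
    have "\<alpha> A (\<gamma> A x) = \<one>\<^bsub>FOb G A\<^esub>"
      unfolding y(2) using nat_trans_natural[OF \<alpha> y(1) w'] aw' Coh_one_map[OF G y(1)] by simp
    then show ?thesis using AX by simp
  qed
  moreover have "\<alpha> A (?o F A x) = ?o G A x" if "A \<in> Ob T" "x \<in> carrier (FOb E A)" for A x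
    using nat_trans_one[OF Ff Gf \<alpha>] that by simp
  ultimately have "\<gamma> = ?o F" using E(2) nat_trans_zero[OF Ef Ff] by blast
  then have "\<gamma> N i = \<one>\<^bsub>FOb F N\<^esub>" using NO E(3) by simp
  then show ?thesis unfolding vw E(4)[symmetric] using Coh_one_map[OF F N(3)] by simp
qed

text \<open>The existence part of the same argument: over a compact N the element gives a
  transformation (N,-) -> G killed by \<beta>, and its lift to F, evaluated at the generator, is the
  required preimage.\<close>

lemma Coh_kernel_exact:
  assumes F: "F \<in> Coh \<kappa> T" and G: "G \<in> Coh \<kappa> T" and H: "H \<in> Coh \<kappa> T" and \<beta>: "nat_trans T G H \<beta>"
    and k: "Coh_kernel \<kappa> T F \<alpha> G \<beta> H"
    and X: "X \<in> Ob T" and v: "v \<in> carrier (FOb G X)" and v0: "\<beta> X v = \<one>\<^bsub>FOb H X\<^esub>"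
  shows "\<exists>u \<in> carrier (FOb F X). v = \<alpha> X u"
proof -
  have \<alpha>: "nat_trans T F G \<alpha>" using k unfolding Coh_kernel_def by blast
  obtain A a w where A: "A \<in> cob" "a \<in> hm A X" "w \<in> carrier (FOb G A)" "v = FMor G a w" using Coh_lift[OF G X v] .
  have AO: "A \<in> Ob T" using A(1) cob_Ob by blast
  have "FMor H a (\<beta> A w) = \<one>\<^bsub>FOb H X\<^esub>" using nat_trans_natural[OF \<beta> A(2,3)] v0 A(4) by simp
  then obtain N e n where N: "N \<in> cob" "e \<in> hm A N" "n \<in> hm N X" "a = n \<cdot> e" "FMor H e (\<beta> A w) = \<one>\<^bsub>FOb H N\<^esub>"
    using Coh_vanish[OF H A(1) nat_trans_closed[OF \<beta> AO A(3)] A(2)] by metis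
  have NO: "N \<in> Ob T" using N(1) cob_Ob by blast
  define w' where "w' = FMor G e w"
  have w': "w' \<in> carrier (FOb G N)" unfolding w'_def using Coh_map_closed[OF G N(2) A(3)] .
  have bw': "\<beta> N w' = \<one>\<^bsub>FOb H N\<^esub>" unfolding w'_def using nat_trans_natural[OF \<beta> N(2) A(3)] N(5) by simp
  have vw: "v = FMor G n w'" unfolding A(4) N(4) w'_def using Coh_map_comp[OF G N(2,3) A(3)] .
  obtain E \<gamma> i where E: "E \<in> Coh \<kappa> T" "nat_trans T E G \<gamma>" "i \<in> carrier (FOb E N)" "\<gamma> N i = w'"
    "\<And>X S. X \<in> Ob T \<Longrightarrow> S \<in> carrier (FOb E X) \<Longrightarrow> \<exists>x \<in> hm N X. \<gamma> X S = FMor G x w'"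
    using yoneda[OF G N(1) w'] by metis
  have "zero_comp T E \<gamma> H \<beta>" unfolding zero_comp_def
  proof (intro ballI)
    fix A x assume AX: "A \<in> Ob T" "x \<in> carrier (FOb E A)"
    obtain y where y: "y \<in> hm N A" "\<gamma> A x = FMor G y w'" using E(5)[OF AX] by blast
    show "\<beta> A (\<gamma> A x) = \<one>\<^bsub>FOb H A\<^esub>"
      unfolding y(2) using nat_trans_natural[OF \<beta> y(1) w'] bw' Coh_one_map[OF H y(1)] by simp
  qed
  then obtain \<delta> where d: "nat_trans T E F \<delta>" "\<forall>A\<in>Ob T. \<forall>x\<in>carrier (FOb E A). \<alpha> A (\<delta> A x) = \<gamma> A x"
    using k E(1,2) unfolding Coh_kernel_def by blast
  have di: "\<delta> N i \<in> carrier (FOb F N)" using nat_trans_closed[OF d(1) NO E(3)] .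
  have "v = FMor G n (\<alpha> N (\<delta> N i))" unfolding vw using d(2) NO E(3,4) by simp
  also have "\<dots> = \<alpha> X (FMor F n (\<delta> N i))" using nat_trans_natural[OF \<alpha> N(3) di] by simp
  finally show ?thesis using Coh_map_closed[OF F N(3) di] by blast
qed

text \<open>F is the kernel of G -> 0, so the identity of G lifts along \<eta>; the lift is the
  inverse.\<close>

lemma nat_iso_inverse:
  assumes F: "F \<in> Coh \<kappa> T" and G: "G \<in> Coh \<kappa> T" and \<eta>: "nat_iso T F G \<eta>"
  obtains \<theta> where "nat_trans T G F \<theta>" "\<And>X x. X \<in> Ob T \<Longrightarrow> x \<in> carrier (FOb F X) \<Longrightarrow> \<theta> X (\<eta> X x) = x"
proof -
  obtain Z where Z: "Z \<in> Coh \<kappa> T" "\<And>X. X \<in> Ob T \<Longrightarrow> trivial_group (FOb Z X)" using zero_functor by blast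
  let ?\<beta> = "\<lambda>X\<in>Ob T. \<lambda>x\<in>carrier (FOb G X). \<one>\<^bsub>FOb Z X\<^esub>" and ?i = "\<lambda>X\<in>Ob T. \<lambda>x\<in>carrier (FOb G X). x"
  have n: "nat_trans T F G \<eta>" using \<eta> unfolding nat_iso_def by blast
  have k: "Coh_kernel \<kappa> T F \<eta> G ?\<beta> Z" using iso_short_exact[OF F G \<eta> Z] unfolding Coh_short_exact_def by blast
  have "zero_comp T G ?i Z ?\<beta>" unfolding zero_comp_def by simp
  then obtain \<theta> where \<theta>: "nat_trans T G F \<theta>" "\<forall>X\<in>Ob T. \<forall>x\<in>carrier (FOb G X). \<eta> X (\<theta> X x) = ?i X x"
    using k G nat_trans_id[OF Coh_functor[OF G]] unfolding Coh_kernel_def by blast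
  have "\<theta> X (\<eta> X x) = x" if X: "X \<in> Ob T" and x: "x \<in> carrier (FOb F X)" for X x
  proof -
    have ex: "\<eta> X x \<in> carrier (FOb G X)" using nat_trans_closed[OF n X x] .
    have "\<eta> X (\<theta> X (\<eta> X x)) = \<eta> X x" using \<theta>(2) X ex by simp
    moreover have "inj_on (\<eta> X) (carrier (FOb F X))" using \<eta> X unfolding nat_iso_def iso_def bij_betw_def by blast
    ultimately show ?thesis using nat_trans_closed[OF \<theta>(1) X ex] x by (simp add: inj_on_eq_iff)
  qed
  then show thesis using that \<theta>(1) by blast
qed

lemma nat_trans_comp:
  assumes F: "F \<in> Coh \<kappa> T" and \<alpha>: "nat_trans T F G \<alpha>" and \<beta>: "nat_trans T G H \<beta>"
  shows "nat_trans T F H (\<lambda>X\<in>Ob T. \<lambda>x\<in>carrier (FOb F X). \<beta> X (\<alpha> X x))"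
  unfolding nat_trans_def
proof (intro conjI ballI allI)
  fix X assume X: "X \<in> Ob T"
  interpret F: comm_group "FOb F X" using ab_functor_group[OF Coh_functor[OF F] X] .
  show "(\<lambda>X\<in>Ob T. \<lambda>x\<in>carrier (FOb F X). \<beta> X (\<alpha> X x)) X \<in> hom (FOb F X) (FOb H X) \<inter> extensional (carrier (FOb F X))"
  proof (intro IntI homI)
    fix x y assume x: "x \<in> carrier (FOb F X)" and y: "y \<in> carrier (FOb F X)"
    show "(\<lambda>X\<in>Ob T. \<lambda>x\<in>carrier (FOb F X). \<beta> X (\<alpha> X x)) X (x \<otimes>\<^bsub>FOb F X\<^esub> y) =
      (\<lambda>X\<in>Ob T. \<lambda>x\<in>carrier (FOb F X). \<beta> X (\<alpha> X x)) X x \<otimes>\<^bsub>FOb H X\<^esub> (\<lambda>X\<in>Ob T. \<lambda>x\<in>carrier (FOb F X). \<beta> X (\<alpha> X x)) X y"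
      using X x y nat_trans_mult[OF \<alpha> X x y] nat_trans_mult[OF \<beta> X nat_trans_closed[OF \<alpha> X x] nat_trans_closed[OF \<alpha> X y]] by simp
  qed (use X nat_trans_closed[OF \<beta> X nat_trans_closed[OF \<alpha> X]] in auto)
next
  fix X Y u x assume u: "u \<in> hm X Y" and x: "x \<in> carrier (FOb F X)"
  have X: "X \<in> Ob T" "Y \<in> Ob T" using u Hom_Ob by blast+
  show "(\<lambda>X\<in>Ob T. \<lambda>x\<in>carrier (FOb F X). \<beta> X (\<alpha> X x)) Y (FMor F u x) =
    FMor H u ((\<lambda>X\<in>Ob T. \<lambda>x\<in>carrier (FOb F X). \<beta> X (\<alpha> X x)) X x)"
    using X x Coh_map_closed[OF F u x] nat_trans_natural[OF \<alpha> u x] nat_trans_natural[OF \<beta> u nat_trans_closed[OF \<alpha> X(1) x]] by simp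
qed simp

text \<open>The universal property of \<open>H\<close> is tested on the pointwise cokernel of \<open>\<beta>\<close>, which is coherent: if
  \<open>H\<close> is presented by \<open>h\<close> and \<open>\<beta>\<close> maps the generator of \<open>G\<close> to the class of \<open>x\<close>, it is presented by \<open>(x, h)\<close>.\<close>

lemma Coh_cokernel_trivial:
  assumes G: "G \<in> Coh \<kappa> T" and H: "H \<in> Coh \<kappa> T" and \<alpha>: "nat_trans T F G \<alpha>" and k: "Coh_cokernel \<kappa> T F \<alpha> G \<beta> H"
    and X: "X \<in> Ob T" and GX: "trivial_group (FOb G X)"
  shows "trivial_group (FOb H X)"
proof -
  have \<beta>: "nat_trans T G H \<beta>" using k unfolding Coh_cokernel_def by blast
  note Gf = Coh_functor[OF G] and Hf = Coh_functor[OF H]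
  obtain h \<eta> where h: "h \<in> cmor" "nat_iso T (coker_functor T h) H \<eta>" using H unfolding Coh_def by blast
  define C0 D0 where "C0 = Dom T h" and "D0 = Cod T h"
  have hH: "h \<in> hm C0 D0" "C0 \<in> cob" "D0 \<in> cob" unfolding C0_def D0_def using cmorE[OF h(1)] by metis+
  obtain f A B i where f: "f \<in> cmor" "f \<in> hm A B" "A \<in> cob" "B \<in> cob" "i \<in> carrier (FOb G A)"
    "\<And>X v. X \<in> Ob T \<Longrightarrow> v \<in> carrier (FOb G X) \<Longrightarrow> \<exists>a \<in> hm A X. v = FMor G a i"
    by (rule Coh_generator[OF G]) blast
  have Ob: "A \<in> Ob T" "C0 \<in> Ob T" "D0 \<in> Ob T" using f hH cob_Ob by blast+
  let ?H = "subquot C0 (hm C0) (pim h)"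
  have Heq: "coker_functor T h = ?H" using coker_functor_eq[OF hH(1)] .
  have HC: "?H \<in> Coh \<kappa> T" using coker_functor_Coh[OF h(1)] Heq by simp
  note s = subfunctor_hm[OF Ob(2)] subfunctor_pim[OF hH(1)]
  have \<eta>: "nat_iso T ?H H \<eta>" using h(2) Heq by simp
  have n: "nat_trans T ?H H \<eta>" using \<eta> unfolding nat_iso_def by blast
  obtain \<theta> where \<theta>: "nat_trans T H ?H \<theta>" "\<And>X x. X \<in> Ob T \<Longrightarrow> x \<in> carrier (FOb ?H X) \<Longrightarrow> \<theta> X (\<eta> X x) = x"
    using nat_iso_inverse[OF HC H \<eta>] by blast
  have "\<beta> A i \<in> \<eta> A ` carrier (FOb ?H A)"
    using \<eta> Ob(1) nat_trans_closed[OF \<beta> Ob(1) f(5)] unfolding nat_iso_def iso_def bij_betw_def by blast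
  then obtain x where x: "x \<in> hm C0 A" "\<beta> A i = \<eta> A (coset (pim h A) x)" by auto
  have \<beta>a: "\<beta> Y (FMor G a i) = \<eta> Y (coset (pim h Y) (a \<cdot> x))" if a: "a \<in> hm A Y" for a Y
  proof -
    have cx: "coset (pim h A) x \<in> carrier (FOb ?H A)" using x(1) by simp
    have "\<beta> Y (FMor G a i) = FMor H a (\<eta> A (coset (pim h A) x))" using nat_trans_natural[OF \<beta> a f(5)] x(2) by simp
    also have "\<dots> = \<eta> Y (FMor ?H a (coset (pim h A) x))" using nat_trans_natural[OF n a cx] by simp
    also have "FMor ?H a (coset (pim h A) x) = coset (pim h Y) (a \<cdot> x)" by (rule subquot_FMor[OF s(2) x(1) a])
    finally show ?thesis .
  qed
  obtain P u w p q where P: "P \<in> Ob T" "u \<in> hm A P" "w \<in> hm D0 P" "p \<in> hm P A" "q \<in> hm P D0"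
    "p \<cdot> u = ID A" "q \<cdot> w = ID D0" "p \<cdot> w = zm D0 A" "q \<cdot> u = zm A D0" "u \<cdot> p \<boxplus> w \<cdot> q = ID P"
    using obtain_biproduct[OF Ob(1,3)] by blast
  have Pc: "P \<in> cob" using cob_biproduct[OF f(3) hH(3) P(2-5,10)] .
  define k where "k = u \<cdot> x \<boxplus> w \<cdot> h"
  have kH: "k \<in> hm C0 P" unfolding k_def using P(2,3) x(1) hH(1) by (auto simp: Hom_iff)
  have kc: "k \<in> cmor" using cmor_iff[OF kH] hH(2) Pc by blast
  let ?E = "subquot C0 (hm C0) (pim k)"
  have EC: "?E \<in> Coh \<kappa> T" using coker_functor_Coh[OF kc] coker_functor_eq[OF kH] by simp
  note sk = subfunctor_pim[OF kH]
  have qk: "q \<cdot> k = h" and pk: "p \<cdot> k = x"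
  proof -
    have "q \<cdot> k = q \<cdot> u \<cdot> x \<boxplus> q \<cdot> w \<cdot> h" "p \<cdot> k = p \<cdot> u \<cdot> x \<boxplus> p \<cdot> w \<cdot> h"
      unfolding k_def using P(2-5) x(1) hH(1) by (simp_all add: Hom_iff)
    then show "q \<cdot> k = h" "p \<cdot> k = x" using P(6-9) x(1) hH(1) Ob by (simp_all add: Hom_iff)
  qed
  have hk: "c \<in> pim k Y" if "c \<in> pim h Y" for c Y
  proof -
    obtain d where d: "d \<in> hm D0 Y" "c = d \<cdot> h" using \<open>c \<in> pim h Y\<close> hH(1) unfolding pim_iff by (auto simp: Hom_iff)
    then have "c = d \<cdot> q \<cdot> k" using qk P(5) kH by (simp add: Hom_iff)
    then show ?thesis using pimI[of "d \<cdot> q" k Y] Comp_Hom[OF P(5) d(1)] kH by (simp add: Hom_iff)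
  qed
  let ?\<pi> = "induced_map ?H (pim k) (ID C0)"
  have \<pi>c: "?\<pi> Y (coset (pim h Y) c) = coset (pim k Y) c" if c: "c \<in> hm C0 Y" for c Y
  proof -
    have Y: "Y \<in> Ob T" using c Hom_Ob by blast
    have "?\<pi> Y (coset (pim h Y) c) = coset (pim k Y) (c \<cdot> ID C0)"
      by (rule induced_map_coset[OF s sk Id_Hom[OF Ob(2)] _ c Y]) (use hk pim_Hom[of h] hH(1) in \<open>auto simp: Hom_iff\<close>)
    then show ?thesis using c by (simp add: Hom_iff)
  qed
  have \<pi>: "nat_trans T ?H ?E ?\<pi>"
    by (rule induced_map_nat[OF s s(1) sk Id_Hom[OF Ob(2)]]) (use hk pim_Hom[of h] hH(1) in \<open>auto simp: Hom_iff\<close>)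
  let ?\<gamma> = "\<lambda>X\<in>Ob T. \<lambda>x\<in>carrier (FOb H X). ?\<pi> X (\<theta> X x)"
  let ?o = "\<lambda>X\<in>Ob T. \<lambda>x\<in>carrier (FOb H X). \<one>\<^bsub>FOb ?E X\<^esub>"
  have \<gamma>: "nat_trans T H ?E ?\<gamma>" by (rule nat_trans_comp[OF H \<theta>(1) \<pi>])
  have Ef: "ab_functor T ?E" using Coh_functor[OF EC] .
  have \<gamma>\<beta>: "?\<gamma> Y (\<beta> Y v) = \<one>\<^bsub>FOb ?E Y\<^esub>" if Y: "Y \<in> Ob T" and v: "v \<in> carrier (FOb G Y)" for Y v
  proof -
    obtain a where a: "a \<in> hm A Y" "v = FMor G a i" using f(6)[OF Y v] by blast
    have ax: "a \<cdot> x \<in> hm C0 Y" using Comp_Hom[OF x(1) a(1)] .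
    have "?\<gamma> Y (\<beta> Y v) = ?\<pi> Y (\<theta> Y (\<eta> Y (coset (pim h Y) (a \<cdot> x))))"
      using Y nat_trans_closed[OF \<beta> Y v] \<beta>a[OF a(1)] a(2) by simp
    also have "\<dots> = coset (pim k Y) (a \<cdot> x)" using \<theta>(2)[OF Y] ax \<pi>c[OF ax] by simp
    also have "\<dots> = coset (pim k Y) (zm C0 Y)"
    proof -
      have "a \<cdot> x = a \<cdot> p \<cdot> k" using pk a(1) P(4) kH by (simp add: Hom_iff)
      then have "a \<cdot> x \<in> pim k Y" using pimI[of "a \<cdot> p" k Y] Comp_Hom[OF P(4) a(1)] kH by (simp add: Hom_iff)
      then show ?thesis using coset_eq[OF sk ax zero_Hom[OF Ob(2) Y]] ax Ob(2) Y by (simp add: Hom_iff)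
    qed
    finally show ?thesis using coset_zero[OF sk Y] by simp
  qed
  let ?z = "\<lambda>X\<in>Ob T. \<lambda>x\<in>carrier (FOb G X). \<one>\<^bsub>FOb ?E X\<^esub>"
  have zc: "zero_comp T F \<alpha> ?E ?z"
    unfolding zero_comp_def using nat_trans_closed[OF \<alpha>] by simp
  have z: "nat_trans T G ?E ?z" by (rule nat_trans_zero[OF Gf Ef])
  have "\<exists>!\<delta>. nat_trans T H ?E \<delta> \<and> (\<forall>A\<in>Ob T. \<forall>x\<in>carrier (FOb G A). \<delta> A (\<beta> A x) = ?z A x)"
    using k EC z zc unfolding Coh_cokernel_def by blast
  moreover have "\<forall>A\<in>Ob T. \<forall>x\<in>carrier (FOb G A). ?\<gamma> A (\<beta> A x) = ?z A x" using \<gamma>\<beta> by simp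
  moreover have "\<forall>A\<in>Ob T. \<forall>x\<in>carrier (FOb G A). ?o A (\<beta> A x) = ?z A x" using nat_trans_closed[OF \<beta>] by simp
  \<comment> \<open>The projection from H to the pointwise cokernel and the zero transformation
    agree after \<beta>; uniqueness in the universal property makes the projection zero.\<close>
  ultimately have \<gamma>o: "?\<gamma> = ?o" using \<gamma> nat_trans_zero[OF Hf Ef] by blast
  \<comment> \<open>The projection being zero, c = z k = (z u)x + (z w)h for some z. The class of (z
    u)x is the image under \<beta> of the element G(z u)i of G X, which is trivial by assumption,
    and the second summand is already a relation of H.\<close>
  have "hm C0 X \<subseteq> pim h X"
  proof
    fix c assume c: "c \<in> hm C0 X"
    let ?c = "coset (pim h X) c"
    have cc: "?c \<in> carrier (FOb ?H X)" using c by simp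
    have ec: "\<eta> X ?c \<in> carrier (FOb H X)" using nat_trans_closed[OF n X cc] .
    have "?\<gamma> X (\<eta> X ?c) = ?o X (\<eta> X ?c)" unfolding \<gamma>o ..
    then have "?\<pi> X ?c = pim k X" using X ec \<theta>(2)[OF X cc] by simp
    then have "coset (pim k X) c = coset (pim k X) (zm C0 X)" using \<pi>c[OF c] coset_zero[OF sk X] by simp
    then have "c \<in> pim k X" using coset_eq[OF sk c zero_Hom[OF Ob(2) X]] c Ob(2) X by (simp add: Hom_iff)
    then obtain z where z: "z \<in> hm P X" "c = z \<cdot> k" using kH unfolding pim_iff by (auto simp: Hom_iff)
    have zu: "z \<cdot> u \<in> hm A X" "z \<cdot> w \<in> hm D0 X" using z(1) P(2,3) Comp_Hom by blast+
    have ceq: "c = z \<cdot> u \<cdot> x \<boxplus> z \<cdot> w \<cdot> h" unfolding z(2) k_def using z(1) P(2,3) x(1) hH(1) by (simp add: Hom_iff)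
    have ux: "z \<cdot> u \<cdot> x \<in> hm C0 X" using Comp_Hom[OF x(1) zu(1)] .
    have "FMor G (z \<cdot> u) i = \<one>\<^bsub>FOb G X\<^esub>"
      using GX Coh_map_closed[OF G zu(1) f(5)] unfolding trivial_group_def by auto
    then have "\<eta> X (coset (pim h X) (z \<cdot> u \<cdot> x)) = \<one>\<^bsub>FOb H X\<^esub>"
      using \<beta>a[OF zu(1)] nat_trans_one[OF Gf Hf \<beta> X] by simp
    then have "coset (pim h X) (z \<cdot> u \<cdot> x) = \<theta> X \<one>\<^bsub>FOb H X\<^esub>" using \<theta>(2)[OF X, of "coset (pim h X) (z \<cdot> u \<cdot> x)"] ux by simp
    also have "\<dots> = coset (pim h X) (zm C0 X)"
      using nat_trans_one[OF Hf Coh_functor[OF HC] \<theta>(1) X] coset_zero[OF s(2) X] by simp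
    finally have "z \<cdot> u \<cdot> x \<in> pim h X" using coset_eq[OF s(2) ux zero_Hom[OF Ob(2) X]] ux Ob(2) X by (simp add: Hom_iff)
    moreover have "z \<cdot> w \<cdot> h \<in> pim h X" using pimI[of "z \<cdot> w" h X] zu(2) hH(1) by (simp add: Hom_iff)
    ultimately show "c \<in> pim h X" unfolding ceq using subfunctorD(5)[OF s(2) X] by blast
  qed
  then have "trivial_group (FOb ?H X)" using subquot_trivial[OF s X] by blast
  then show ?thesis using nat_iso_trivial[OF \<eta> Coh_functor[OF HC] Hf X] by blast
qed

lemma short_exact_trivial:
  assumes e: "Coh_short_exact \<kappa> T F \<alpha> G \<beta> H" and X: "X \<in> Ob T"
  shows "trivial_group (FOb G X) \<longleftrightarrow> trivial_group (FOb F X) \<and> trivial_group (FOb H X)"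
proof -
  have C: "F \<in> Coh \<kappa> T" "G \<in> Coh \<kappa> T" "H \<in> Coh \<kappa> T" and k: "Coh_kernel \<kappa> T F \<alpha> G \<beta> H" and c: "Coh_cokernel \<kappa> T F \<alpha> G \<beta> H"
    using e unfolding Coh_short_exact_def by blast+
  have \<alpha>: "nat_trans T F G \<alpha>" and \<beta>: "nat_trans T G H \<beta>" using k c unfolding Coh_kernel_def Coh_cokernel_def by blast+
  note f = Coh_functor[OF C(1)] Coh_functor[OF C(2)] Coh_functor[OF C(3)]
  have triv: "trivial_group (FOb K X) \<longleftrightarrow> carrier (FOb K X) \<subseteq> {\<one>\<^bsub>FOb K X\<^esub>}" if "ab_functor T K" for K :: "('o, 'm, 'm set) abfun"
  proof -
    interpret K: comm_group "FOb K X" using ab_functor_group[OF that X] .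
    show ?thesis unfolding trivial_group_def using K.group_axioms K.one_closed by auto
  qed
  show ?thesis
  proof
    assume G: "trivial_group (FOb G X)"
    have "trivial_group (FOb H X)" using Coh_cokernel_trivial[OF C(2,3) \<alpha> c X G] .
    moreover have "v = \<one>\<^bsub>FOb F X\<^esub>" if v: "v \<in> carrier (FOb F X)" for v
      using Coh_kernel_inj[OF C \<beta> k X v] nat_trans_closed[OF \<alpha> X v] G unfolding triv[OF f(2)] by blast
    ultimately show "trivial_group (FOb F X) \<and> trivial_group (FOb H X)" unfolding triv[OF f(1)] by blast
  next
    assume FH: "trivial_group (FOb F X) \<and> trivial_group (FOb H X)"
    have "v = \<one>\<^bsub>FOb G X\<^esub>" if v: "v \<in> carrier (FOb G X)" for v
    proof -
      have "\<beta> X v = \<one>\<^bsub>FOb H X\<^esub>" using nat_trans_closed[OF \<beta> X v] FH unfolding triv[OF f(3)] by blast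
      then obtain u where u: "u \<in> carrier (FOb F X)" "v = \<alpha> X u" using Coh_kernel_exact[OF C \<beta> k X v] by blast
      then have "u = \<one>\<^bsub>FOb F X\<^esub>" using FH unfolding triv[OF f(1)] by blast
      then show ?thesis using u(2) nat_trans_one[OF f(1,2) \<alpha> X] by simp
    qed
    then show "trivial_group (FOb G X)" unfolding triv[OF f(2)] by blast
  qed
qed

lemma Ann_Coh_serre: assumes "\<X> \<subseteq> Ob T" shows "serre_subcategory \<kappa> T (Ann_Coh \<kappa> T \<X>)"
  unfolding serre_subcategory_def
proof (intro conjI allI impI)
  show "Ann_Coh \<kappa> T \<X> \<subseteq> Coh \<kappa> T" unfolding Ann_Coh_def by blast
  obtain Z where "Z \<in> Coh \<kappa> T" "\<And>X. X \<in> Ob T \<Longrightarrow> trivial_group (FOb Z X)" using zero_functor by blast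
  then show "Ann_Coh \<kappa> T \<X> \<noteq> {}" unfolding Ann_Coh_def using assms by blast
  fix F \<alpha> G \<beta> H assume e: "Coh_short_exact \<kappa> T F \<alpha> G \<beta> H"
  have C: "F \<in> Coh \<kappa> T" "G \<in> Coh \<kappa> T" "H \<in> Coh \<kappa> T" using e unfolding Coh_short_exact_def by blast+
  show "G \<in> Ann_Coh \<kappa> T \<X> \<longleftrightarrow> F \<in> Ann_Coh \<kappa> T \<X> \<and> H \<in> Ann_Coh \<kappa> T \<X>"
    unfolding Ann_Coh_def using C short_exact_trivial[OF e] assms by blast
qed

end

section \<open>pp formulas\<close>

context compactly_generated
begin

section \<open>Tuples, terms and free realisations of pp formulas\<close>

lemma tuples_Nil [simp]: "xs \<in> tuples T [] X \<longleftrightarrow> xs = []"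
  by (simp add: tuples_def)

lemma tuples_Cons: "xs \<in> tuples T (A # \<Gamma>) X \<longleftrightarrow> (\<exists>y ys. xs = y # ys \<and> y \<in> hm A X \<and> ys \<in> tuples T \<Gamma> X)"
  unfolding tuples_def by (cases xs) auto

lemma tuples_length: "xs \<in> tuples T \<Gamma> X \<Longrightarrow> length xs = length \<Gamma>"
  unfolding tuples_def using list_all2_lengthD by blast

lemma tuples_nth: "xs \<in> tuples T \<Gamma> X \<Longrightarrow> i < length \<Gamma> \<Longrightarrow> xs ! i \<in> hm (\<Gamma> ! i) X"
  unfolding tuples_def by (simp add: list_all2_conv_all_nth)

lemma tuples_mem: assumes "xs \<in> tuples T \<Gamma> X" "x \<in> set xs" shows "\<exists>A \<in> set \<Gamma>. x \<in> hm A X"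
  using assms tuples_nth[OF assms(1)] tuples_length[OF assms(1)] by (metis in_set_conv_nth)

lemma tuples_append: "xs @ ys \<in> tuples T (\<Gamma> @ \<Delta>) X \<longleftrightarrow> xs \<in> tuples T \<Gamma> X \<and> ys \<in> tuples T \<Delta> X"
  if "length xs = length \<Gamma>"
  using that unfolding tuples_def by (simp add: list_all2_append)

lemma tuples_push: "xs \<in> tuples T \<Gamma> X \<Longrightarrow> u \<in> hm X Y \<Longrightarrow> map (\<lambda>x. u \<cdot> x) xs \<in> tuples T \<Gamma> Y"
  unfolding tuples_def using Comp_Hom by (auto simp: list_all2_conv_all_nth)

lemma map_comp_tuple: assumes "xs \<in> tuples T \<Gamma> X" "u \<in> hm X Y" "v \<in> hm Y Z"
  shows "map (\<lambda>x. v \<cdot> x) (map (\<lambda>x. u \<cdot> x) xs) = map (\<lambda>x. v \<cdot> u \<cdot> x) xs"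
proof -
  have "v \<cdot> (u \<cdot> x) = v \<cdot> u \<cdot> x" if "x \<in> set xs" for x
    using tuples_mem[OF assms(1) that] assms(2,3) by (auto simp: Hom_iff)
  then show ?thesis by simp
qed

text \<open>P is the biproduct of the sorts and v its tuple of injections, built by recursion from a
  zero object; maps out of P are the same as tuples.\<close>

lemma generic_tuple:
  assumes "set \<Gamma> \<subseteq> cob"
  shows "\<exists>P \<in> cob. \<exists>v \<in> tuples T \<Gamma> P. \<forall>X \<in> Ob T. \<forall>x \<in> tuples T \<Gamma> X. \<exists>u \<in> hm P X. x = map (\<lambda>c. u \<cdot> c) v"
  using assms
proof (induction \<Gamma>)
  case Nil
  obtain Z where Z: "zero_object T Z" using ex_zero_object by blast
  show ?case using zero_object_cob[OF Z] cob_Ob zero_Hom by (intro bexI[of _ Z] bexI[of _ "[]"]) auto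
next
  case (Cons A \<Gamma>)
  have "\<exists>P \<in> cob. \<exists>v \<in> tuples T \<Gamma> P. \<forall>X \<in> Ob T. \<forall>x \<in> tuples T \<Gamma> X. \<exists>u \<in> hm P X. x = map (\<lambda>c. u \<cdot> c) v"
    by (rule Cons.IH) (use Cons.prems in simp)
  then obtain P v where P: "P \<in> cob" "v \<in> tuples T \<Gamma> P" "\<forall>X \<in> Ob T. \<forall>x \<in> tuples T \<Gamma> X. \<exists>u \<in> hm P X. x = map (\<lambda>c. u \<cdot> c) v"
    by (elim bexE) blast
  have A: "A \<in> cob" using Cons by simp
  have Ob: "A \<in> Ob T" "P \<in> Ob T" using A P(1) cob_Ob by blast+
  obtain Q i j p q where Q: "Q \<in> Ob T" "i \<in> hm A Q" "j \<in> hm P Q" "p \<in> hm Q A" "q \<in> hm Q P"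
    "p \<cdot> i = ID A" "q \<cdot> j = ID P" "p \<cdot> j = zm P A" "q \<cdot> i = zm A P" "i \<cdot> p \<boxplus> j \<cdot> q = ID Q"
    using obtain_biproduct[OF Ob] by blast
  have Qc: "Q \<in> cob" using cob_biproduct[OF A P(1) Q(2-5,10)] .
  let ?v = "i # map (\<lambda>c. j \<cdot> c) v"
  have "?v \<in> tuples T (A # \<Gamma>) Q" unfolding tuples_Cons using Q(2) tuples_push[OF P(2) Q(3)] by blast
  moreover have "\<exists>u \<in> hm Q X. x = map (\<lambda>c. u \<cdot> c) ?v" if X: "X \<in> Ob T" and x: "x \<in> tuples T (A # \<Gamma>) X" for X x
  proof -
    obtain y ys where y: "x = y # ys" "y \<in> hm A X" "ys \<in> tuples T \<Gamma> X" using x unfolding tuples_Cons by blast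
    obtain u where u: "u \<in> hm P X" "ys = map (\<lambda>c. u \<cdot> c) v" using P(3) X y(3) by blast
    define w where "w = y \<cdot> p \<boxplus> u \<cdot> q"
    have w: "w \<in> hm Q X" unfolding w_def using y(2) u(1) Q(4,5) by (auto simp: Hom_iff)
    have wi: "w \<cdot> i = y" "w \<cdot> j = u" unfolding w_def using y(2) u(1) Q(2-9) Ob X by (auto simp: Hom_iff)
    have "x = map (\<lambda>c. w \<cdot> c) ?v" using map_comp_tuple[OF P(2) Q(3) w] wi y(1) u(2) by simp
    then show ?thesis using w by blast
  qed
  ultimately show ?case using Qc by blast
qed

text \<open>Terms commute with maps of objects. Hence an equation holds for the image of a tuple
  under u exactly when u equalizes the two values of its sides at that tuple.\<close>

lemma tm_val_natural:
  assumes "has_sort T S \<Gamma> t A" "S \<subseteq> Ob T" "v \<in> tuples T \<Gamma> L" "L \<in> Ob T"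
  shows "tm_val T L v t \<in> hm A L \<and> (\<forall>X. \<forall>u \<in> hm L X. tm_val T X (map (\<lambda>c. u \<cdot> c) v) t = u \<cdot> tm_val T L v t)"
  using assms(1)
proof (induction rule: has_sort.induct)
  case (1 i)
  then show ?case using tuples_nth[OF assms(3)] tuples_length[OF assms(3)] by simp
next
  case (2 A)
  then show ?case using assms(2,4) zero_Hom by (auto simp: Hom_iff subset_iff)
next
  case (3 s A t)
  then show ?case using add_Hom by (auto simp: Hom_iff)
next
  case (4 A B f t)
  then show ?case using Comp_Hom by (auto simp: Hom_iff)
qed

text \<open>Start from the generic tuple for the free and the bound variables together and impose
  the equations by a weak coequalizer k : P -> Q. Solutions then correspond to maps that factor
  through k, and the tuple c is the free part pushed to Q. The quantified variables need no further
  attention, since their witnesses are the images of the bound part under the same map.\<close>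

lemma free_realisation:
  assumes S: "S \<subseteq> cob" and \<phi>: "pp_formula T S \<phi>"
  obtains Q c where "Q \<in> cob" "c \<in> tuples T (free_sorts \<phi>) Q"
    "\<And>X. X \<in> Ob T \<Longrightarrow> pp_sol T \<phi> X = (\<lambda>w. map (\<lambda>x. w \<cdot> x) c) ` hm Q X"
proof -
  let ?\<Gamma> = "free_sorts \<phi> @ bound_sorts \<phi>" and ?n = "length (free_sorts \<phi>)"
  have SO: "S \<subseteq> Ob T" using S cob_Ob by blast
  have "set ?\<Gamma> \<subseteq> cob" using \<phi> S unfolding pp_formula_def by auto
  then obtain P v where P: "P \<in> cob" "v \<in> tuples T ?\<Gamma> P"
    "\<And>X x. X \<in> Ob T \<Longrightarrow> x \<in> tuples T ?\<Gamma> X \<Longrightarrow> \<exists>u \<in> hm P X. x = map (\<lambda>c. u \<cdot> c) v"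
    using generic_tuple by blast
  have PO: "P \<in> Ob T" using P(1) cob_Ob by blast
  let ?e = "\<lambda>(s, t). (tm_val T P v s, tm_val T P v t)"
  have sorts: "\<exists>A. has_sort T S ?\<Gamma> s A \<and> has_sort T S ?\<Gamma> t A" if "(s, t) \<in> set (eqns \<phi>)" for s t
    using \<phi> that unfolding pp_formula_def by blast
  have hs: "A \<in> S" if "has_sort T S ?\<Gamma> t A" for t A using that by (induction rule: has_sort.induct) auto
  have val: "tm_val T P v s \<in> hm A P" "\<And>X u. u \<in> hm P X \<Longrightarrow> tm_val T X (map (\<lambda>c. u \<cdot> c) v) s = u \<cdot> tm_val T P v s"
    if "has_sort T S ?\<Gamma> s A" for s A
    using tm_val_natural[OF that SO P(2) PO] by blast+
  have "\<exists>A\<in>cob. \<sigma> \<in> hm A P \<and> \<tau> \<in> hm A P" if mem: "(\<sigma>, \<tau>) \<in> set (map ?e (eqns \<phi>))" for \<sigma> \<tau>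
  proof -
    obtain s t where st: "(s, t) \<in> set (eqns \<phi>)" "\<sigma> = tm_val T P v s" "\<tau> = tm_val T P v t" using mem by auto
    obtain A where A: "has_sort T S ?\<Gamma> s A" "has_sort T S ?\<Gamma> t A" using sorts[OF st(1)] by blast
    show ?thesis using val(1)[OF A(1)] val(1)[OF A(2)] hs[OF A(1)] S st by blast
  qed
  then obtain k where k: "k \<in> cmor" "Dom T k = P"
    "\<And>X. pim k X = {z \<in> hm P X. \<forall>(\<sigma>, \<tau>) \<in> set (map ?e (eqns \<phi>)). z \<cdot> \<sigma> = z \<cdot> \<tau>}"
    using weak_coequalizer[OF P(1), of "map ?e (eqns \<phi>)"] by blast
  define Q where "Q = Cod T k"
  have Q: "Q \<in> cob" "k \<in> hm P Q" using k(1,2) unfolding Q_def cpt_mor_def by (auto simp: Hom_iff)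
  have eqs: "(\<forall>(s, t) \<in> set (eqns \<phi>). tm_val T X (map (\<lambda>c. z \<cdot> c) v) s = tm_val T X (map (\<lambda>c. z \<cdot> c) v) t) \<longleftrightarrow> z \<in> pim k X"
    if z: "z \<in> hm P X" for X z
  proof -
    have "tm_val T X (map (\<lambda>c. z \<cdot> c) v) s = tm_val T X (map (\<lambda>c. z \<cdot> c) v) t \<longleftrightarrow> z \<cdot> tm_val T P v s = z \<cdot> tm_val T P v t"
      if "(s, t) \<in> set (eqns \<phi>)" for s t
      using sorts[OF that] val(2)[OF _ z] by metis
    then show ?thesis unfolding k(3) using z by fastforce
  qed
  have lv: "length (take ?n v) = ?n" using tuples_length[OF P(2)] by simp
  have tv: "take ?n v \<in> tuples T (free_sorts \<phi>) P" "drop ?n v \<in> tuples T (bound_sorts \<phi>) P"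
    using tuples_append[OF lv, of "drop ?n v" "bound_sorts \<phi>" P] P(2) by simp_all
  show thesis
  proof (rule that[OF Q(1) tuples_push[OF tv(1) Q(2)]])
    fix X assume X: "X \<in> Ob T"
    show "pp_sol T \<phi> X = (\<lambda>w. map (\<lambda>x. w \<cdot> x) (map (\<lambda>x. k \<cdot> x) (take ?n v))) ` hm Q X"
    proof (intro equalityI subsetI)
      fix xs assume "xs \<in> pp_sol T \<phi> X"
      then obtain ys where ys: "xs \<in> tuples T (free_sorts \<phi>) X" "ys \<in> tuples T (bound_sorts \<phi>) X"
        "\<forall>(s, t) \<in> set (eqns \<phi>). tm_val T X (xs @ ys) s = tm_val T X (xs @ ys) t" unfolding pp_sol_def by blast
      have lx: "length xs = ?n" using tuples_length[OF ys(1)] .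
      then have "xs @ ys \<in> tuples T ?\<Gamma> X" using tuples_append[OF lx] ys(1,2) by blast
      then obtain z where z: "z \<in> hm P X" "xs @ ys = map (\<lambda>c. z \<cdot> c) v" using P(3)[OF X] by blast
      have "z \<in> pim k X" using eqs[OF z(1)] ys(3) unfolding z(2) by blast
      then obtain w where w: "w \<in> hm Q X" "z = w \<cdot> k" using Q(2) unfolding pim_iff by (auto simp: Hom_iff)
      have "xs = take ?n (xs @ ys)" using lx by simp
      also have "\<dots> = map (\<lambda>c. z \<cdot> c) (take ?n v)" unfolding z(2) by (simp add: take_map)
      also have "\<dots> = map (\<lambda>x. w \<cdot> x) (map (\<lambda>x. k \<cdot> x) (take ?n v))" unfolding map_comp_tuple[OF tv(1) Q(2) w(1)] w(2) ..
      finally show "xs \<in> (\<lambda>w. map (\<lambda>x. w \<cdot> x) (map (\<lambda>x. k \<cdot> x) (take ?n v))) ` hm Q X" using w(1) by blast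
    next
      fix xs assume "xs \<in> (\<lambda>w. map (\<lambda>x. w \<cdot> x) (map (\<lambda>x. k \<cdot> x) (take ?n v))) ` hm Q X"
      then obtain w where w: "w \<in> hm Q X" "xs = map (\<lambda>x. w \<cdot> x) (map (\<lambda>x. k \<cdot> x) (take ?n v))" by blast
      let ?z = "w \<cdot> k"
      have z: "?z \<in> hm P X" using Comp_Hom[OF Q(2) w(1)] .
      have "?z \<in> pim k X" using pimI[of w k X] w(1) Q(2) by (simp add: Hom_iff)
      then have e: "\<forall>(s, t) \<in> set (eqns \<phi>). tm_val T X (map (\<lambda>c. ?z \<cdot> c) v) s = tm_val T X (map (\<lambda>c. ?z \<cdot> c) v) t" using eqs[OF z] by blast
      have x: "xs = map (\<lambda>c. ?z \<cdot> c) (take ?n v)" unfolding w(2) map_comp_tuple[OF tv(1) Q(2) w(1)] ..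
      have "xs @ map (\<lambda>c. ?z \<cdot> c) (drop ?n v) = map (\<lambda>c. ?z \<cdot> c) v" unfolding x by (simp flip: map_append)
      then show "xs \<in> pp_sol T \<phi> X" unfolding pp_sol_def
        using e tuples_push[OF tv(1) z] tuples_push[OF tv(2) z] x by (auto intro!: bexI[of _ "map (\<lambda>c. ?z \<cdot> c) (drop ?n v)"])
    qed
  qed
qed

section \<open>Pp-pairs and divisibility conditions\<close>

lemma map2_add_tuple: assumes "c \<in> tuples T \<Gamma> Q" "w \<in> hm Q X" "w' \<in> hm Q X"
  shows "map2 (AddMor T) (map (\<lambda>x. w \<cdot> x) c) (map (\<lambda>x. w' \<cdot> x) c) = map (\<lambda>x. (w \<boxplus> w') \<cdot> x) c"
proof -
  have "w \<cdot> x \<boxplus> w' \<cdot> x = (w \<boxplus> w') \<cdot> x" if "x \<in> set c" for x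
    using tuples_mem[OF assms(1) that] assms(2,3) by (auto simp: Hom_iff)
  then show ?thesis by (auto simp: zip_map_map zip_same_conv_map)
qed

lemma zero_tuple: assumes "c \<in> tuples T \<Gamma> Q" "Q \<in> Ob T" "X \<in> Ob T"
  shows "map (\<lambda>x. zm Q X \<cdot> x) c = map (\<lambda>A. zm A X) \<Gamma>"
proof (rule nth_equalityI)
  show "length (map (\<lambda>x. zm Q X \<cdot> x) c) = length (map (\<lambda>A. zm A X) \<Gamma>)" using tuples_length[OF assms(1)] by simp
  fix i assume "i < length (map (\<lambda>x. zm Q X \<cdot> x) c)"
  then show "map (\<lambda>x. zm Q X \<cdot> x) c ! i = map (\<lambda>A. zm A X) \<Gamma> ! i"
    using tuples_nth[OF assms(1), of i] tuples_length[OF assms(1)] assms(2,3) by (simp add: Hom_iff)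
qed

text \<open>The free realisation of \<psi> shows that its solution set contains zero and is closed
  under sums and differences, and that of \<phi> makes zero neutral on its solutions. This
  determines the relevant cosets, and a quotient with a single coset is seen directly to be a
  group.\<close>

lemma pp_pair_trivial:
  assumes S: "S \<subseteq> cob" and p: "pp_pair T S \<phi> \<psi>" and X: "X \<in> Ob T"
  shows "trivial_group (pp_group T \<phi> X Mod pp_sol T \<psi> X) \<longleftrightarrow> pp_sol T \<phi> X \<subseteq> pp_sol T \<psi> X"
proof -
  have \<phi>: "pp_formula T S \<phi>" and \<psi>: "pp_formula T S \<psi>" and fs: "free_sorts \<phi> = free_sorts \<psi>"
    and sub: "pp_sol T \<psi> X \<subseteq> pp_sol T \<phi> X" using p X unfolding pp_pair_def by blast+
  let ?\<Gamma> = "free_sorts \<psi>" and ?M = "pp_sol T \<psi> X" and ?G = "pp_group T \<phi> X"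
  let ?add = "map2 (AddMor T)" and ?zz = "map (\<lambda>A. zm A X) ?\<Gamma>"
  obtain Q c where Q: "Q \<in> cob" "c \<in> tuples T ?\<Gamma> Q" "\<And>X. X \<in> Ob T \<Longrightarrow> pp_sol T \<psi> X = (\<lambda>w. map (\<lambda>x. w \<cdot> x) c) ` hm Q X"
    using free_realisation[OF S \<psi>] by metis
  have QO: "Q \<in> Ob T" using Q(1) cob_Ob by blast
  obtain R d where R: "R \<in> cob" "d \<in> tuples T ?\<Gamma> R" "\<And>X. X \<in> Ob T \<Longrightarrow> pp_sol T \<phi> X = (\<lambda>w. map (\<lambda>x. w \<cdot> x) d) ` hm R X"
    using free_realisation[OF S \<phi>] unfolding fs by metis
  have RO: "R \<in> Ob T" using R(1) cob_Ob by blast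
  have z: "?zz \<in> ?M" unfolding Q(3)[OF X] using zero_tuple[OF Q(2) QO X] zero_Hom[OF QO X] by (metis imageI)
  have add: "?add x y \<in> ?M" if xy: "x \<in> ?M" "y \<in> ?M" for x y
  proof -
    obtain w w' where w: "w \<in> hm Q X" "x = map (\<lambda>x. w \<cdot> x) c" "w' \<in> hm Q X" "y = map (\<lambda>x. w' \<cdot> x) c"
      using xy unfolding Q(3)[OF X] by blast
    show ?thesis unfolding Q(3)[OF X] w(2,4) map2_add_tuple[OF Q(2) w(1,3)] using add_Hom[OF w(1,3)] by blast
  qed
  have zl: "?add ?zz x = x" if x: "x \<in> pp_sol T \<phi> X" for x
  proof -
    obtain w where w: "w \<in> hm R X" "x = map (\<lambda>x. w \<cdot> x) d" using x unfolding R(3)[OF X] by blast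
    have "zm R X \<boxplus> w = w" using w(1) by (simp add: Hom_iff)
    then show ?thesis unfolding w(2) zero_tuple[OF R(2) RO X, symmetric] map2_add_tuple[OF R(2) zero_Hom[OF RO X] w(1)] by simp
  qed
  have sb: "\<exists>y' \<in> ?M. y = ?add y' x" if xy: "x \<in> ?M" "y \<in> ?M" for x y
  proof -
    obtain w w' where w: "w \<in> hm Q X" "x = map (\<lambda>x. w \<cdot> x) c" "w' \<in> hm Q X" "y = map (\<lambda>x. w' \<cdot> x) c"
      using xy unfolding Q(3)[OF X] by blast
    have d: "w' \<boxminus> w \<in> hm Q X" "w' \<boxminus> w \<boxplus> w = w'" using w by (auto simp: Hom_iff)
    have "y = ?add (map (\<lambda>x. (w' \<boxminus> w) \<cdot> x) c) x" unfolding w(2,4) map2_add_tuple[OF Q(2) d(1) w(1)] d(2) ..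
    then show ?thesis unfolding Q(3)[OF X] using d(1) by blast
  qed
  have coset: "?M #>\<^bsub>?G\<^esub> x = (\<lambda>y. ?add y x) ` ?M" for x unfolding r_coset_def by (auto simp: pp_group_def)
  have cM: "?M #>\<^bsub>?G\<^esub> x = ?M" if x: "x \<in> ?M" for x unfolding coset using add x sb[OF x] by blast
  have car: "carrier (?G Mod ?M) = (\<lambda>x. ?M #>\<^bsub>?G\<^esub> x) ` pp_sol T \<phi> X"
    unfolding FactGroup_def RCOSETS_def by (auto simp: pp_group_def)
  have one: "\<one>\<^bsub>?G Mod ?M\<^esub> = ?M" unfolding FactGroup_def by simp
  show ?thesis
  proof
    assume t: "trivial_group (?G Mod ?M)"
    show "pp_sol T \<phi> X \<subseteq> ?M"
    proof
      fix x assume x: "x \<in> pp_sol T \<phi> X"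
      then have "?M #>\<^bsub>?G\<^esub> x = ?M" using t one car unfolding trivial_group_def by auto
      moreover have "?add ?zz x \<in> ?M #>\<^bsub>?G\<^esub> x" unfolding coset using z by blast
      ultimately show "x \<in> ?M" using zl[OF x] by simp
    qed
  next
    assume le: "pp_sol T \<phi> X \<subseteq> ?M"
    then have c1: "carrier (?G Mod ?M) = {?M}" unfolding car using cM z sub by auto
    have "?M \<otimes>\<^bsub>?G Mod ?M\<^esub> ?M = (\<Union>x\<in>?M. ?M #>\<^bsub>?G\<^esub> x)" unfolding FactGroup_def set_mult_def r_coset_def by auto
    also have "\<dots> = ?M" using cM z by auto
    finally have m: "?M \<otimes>\<^bsub>?G Mod ?M\<^esub> ?M = ?M" .
    have "?M <#>\<^bsub>?G\<^esub> ?M = ?M" using m by simp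
    then have "group (?G Mod ?M)" by (intro groupI) (simp_all add: c1 m one)
    then show "trivial_group (?G Mod ?M)" unfolding trivial_group_def using c1 one by blast
  qed
qed

text \<open>Let d in R and c in Q freely realise \<phi> and \<psi>, and let k out of the biproduct
  of R and Q weakly identify d with c. For w : R -> X the tuple w d solves \<psi> iff it equals w' c
  for some w', that is, iff w factors through k i. So the pair is closed on X exactly when k i
  divides X.\<close>

lemma pp_pair_divides:
  assumes S: "S \<subseteq> cob" and p: "pp_pair T S \<phi> \<psi>"
  obtains e where "e \<in> cmor"
    "\<And>X. X \<in> Ob T \<Longrightarrow> trivial_group (pp_group T \<phi> X Mod pp_sol T \<psi> X) \<longleftrightarrow> divides T e X"
proof -
  have \<phi>: "pp_formula T S \<phi>" and \<psi>: "pp_formula T S \<psi>" and fs: "free_sorts \<phi> = free_sorts \<psi>"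
    using p unfolding pp_pair_def by blast+
  let ?\<Gamma> = "free_sorts \<psi>"
  obtain Q c where Q: "Q \<in> cob" "c \<in> tuples T ?\<Gamma> Q" "\<And>X. X \<in> Ob T \<Longrightarrow> pp_sol T \<psi> X = (\<lambda>w. map (\<lambda>x. w \<cdot> x) c) ` hm Q X"
    using free_realisation[OF S \<psi>] by metis
  obtain R d where R: "R \<in> cob" "d \<in> tuples T ?\<Gamma> R" "\<And>X. X \<in> Ob T \<Longrightarrow> pp_sol T \<phi> X = (\<lambda>w. map (\<lambda>x. w \<cdot> x) d) ` hm R X"
    using free_realisation[OF S \<phi>] unfolding fs by metis
  have Ob: "R \<in> Ob T" "Q \<in> Ob T" using Q(1) R(1) cob_Ob by blast+
  have Gc: "set ?\<Gamma> \<subseteq> cob" using \<psi> S unfolding pp_formula_def by blast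
  have len: "length d = length c" using tuples_length[OF Q(2)] tuples_length[OF R(2)] by simp
  obtain L i j p q where L: "L \<in> Ob T" "i \<in> hm R L" "j \<in> hm Q L" "p \<in> hm L R" "q \<in> hm L Q"
    "p \<cdot> i = ID R" "q \<cdot> j = ID Q" "p \<cdot> j = zm Q R" "q \<cdot> i = zm R Q" "i \<cdot> p \<boxplus> j \<cdot> q = ID L"
    using obtain_biproduct[OF Ob] by blast
  have Lc: "L \<in> cob" using cob_biproduct[OF R(1) Q(1) L(2-5,10)] .
  let ?ps = "zip (map (\<lambda>x. i \<cdot> x) d) (map (\<lambda>x. j \<cdot> x) c)"
  have "\<exists>A\<in>cob. \<sigma> \<in> hm A L \<and> \<tau> \<in> hm A L" if st: "(\<sigma>, \<tau>) \<in> set ?ps" for \<sigma> \<tau>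
  proof -
    obtain n where n: "n < length d" "\<sigma> = i \<cdot> d ! n" "\<tau> = j \<cdot> c ! n" using st len by (auto simp: set_zip)
    have n': "n < length ?\<Gamma>" using n(1) tuples_length[OF R(2)] by simp
    show ?thesis using n Comp_Hom[OF tuples_nth[OF R(2) n'] L(2)] Comp_Hom[OF tuples_nth[OF Q(2) n'] L(3)] Gc n' nth_mem by blast
  qed
  then obtain k where k: "k \<in> cmor" "Dom T k = L" "\<And>X. pim k X = {z \<in> hm L X. \<forall>(\<sigma>, \<tau>) \<in> set ?ps. z \<cdot> \<sigma> = z \<cdot> \<tau>}"
    using weak_coequalizer[OF Lc, of ?ps] by blast
  define N where "N = Cod T k"
  have N: "N \<in> cob" "k \<in> hm L N" using k(1,2) unfolding N_def cpt_mor_def by (auto simp: Hom_iff)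
  have ki: "k \<cdot> i \<in> hm R N" using Comp_Hom[OF L(2) N(2)] .
  have pk: "z \<in> pim k X \<longleftrightarrow> map (\<lambda>x. z \<cdot> i \<cdot> x) d = map (\<lambda>x. z \<cdot> j \<cdot> x) c" if z: "z \<in> hm L X" for z X
  proof -
    have "(\<forall>(\<sigma>, \<tau>) \<in> set ?ps. z \<cdot> \<sigma> = z \<cdot> \<tau>) \<longleftrightarrow> (\<forall>n<length d. z \<cdot> (i \<cdot> d ! n) = z \<cdot> (j \<cdot> c ! n))"
      using list_all2_iff[of "\<lambda>\<sigma> \<tau>. z \<cdot> \<sigma> = z \<cdot> \<tau>" "map (\<lambda>x. i \<cdot> x) d" "map (\<lambda>x. j \<cdot> x) c"]
        list_all2_conv_all_nth[of "\<lambda>\<sigma> \<tau>. z \<cdot> \<sigma> = z \<cdot> \<tau>" "map (\<lambda>x. i \<cdot> x) d" "map (\<lambda>x. j \<cdot> x) c"] len by simp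
    also have "\<dots> \<longleftrightarrow> map (\<lambda>x. z \<cdot> x) (map (\<lambda>x. i \<cdot> x) d) = map (\<lambda>x. z \<cdot> x) (map (\<lambda>x. j \<cdot> x) c)"
      using len by (auto simp: list_eq_iff_nth_eq)
    finally show ?thesis unfolding k(3) map_comp_tuple[OF R(2) L(2) z] map_comp_tuple[OF Q(2) L(3) z] using z by blast
  qed
  have "pp_sol T \<phi> X \<subseteq> pp_sol T \<psi> X \<longleftrightarrow> divides T (k \<cdot> i) X" if X: "X \<in> Ob T" for X
  proof -
    have "(\<exists>w' \<in> hm Q X. map (\<lambda>x. w \<cdot> x) d = map (\<lambda>x. w' \<cdot> x) c) \<longleftrightarrow> w \<in> pim (k \<cdot> i) X" if w: "w \<in> hm R X" for w
    proof
      assume "\<exists>w' \<in> hm Q X. map (\<lambda>x. w \<cdot> x) d = map (\<lambda>x. w' \<cdot> x) c"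
      then obtain w' where w': "w' \<in> hm Q X" "map (\<lambda>x. w \<cdot> x) d = map (\<lambda>x. w' \<cdot> x) c" by blast
      define z where "z = w \<cdot> p \<boxplus> w' \<cdot> q"
      have z: "z \<in> hm L X" unfolding z_def using w w'(1) L(4,5) by (auto simp: Hom_iff)
      have zi: "z \<cdot> i = w" "z \<cdot> j = w'" unfolding z_def using w w'(1) L(2-9) Ob X by (auto simp: Hom_iff)
      have "z \<in> pim k X" unfolding pk[OF z] zi using w'(2) .
      then obtain y where y: "y \<in> hm N X" "z = y \<cdot> k" using N(2) unfolding pim_iff by (auto simp: Hom_iff)
      have "w = y \<cdot> (k \<cdot> i)" using zi(1) y N(2) L(2) by (simp add: Hom_iff)
      then show "w \<in> pim (k \<cdot> i) X" using pimI[of y "k \<cdot> i" X] y(1) ki by (simp add: Hom_iff)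
    next
      assume "w \<in> pim (k \<cdot> i) X"
      then obtain y where y: "y \<in> hm N X" "w = y \<cdot> (k \<cdot> i)" using ki unfolding pim_iff by (auto simp: Hom_iff)
      let ?z = "y \<cdot> k"
      have z: "?z \<in> hm L X" using Comp_Hom[OF N(2) y(1)] .
      have zi: "?z \<cdot> i = w" using y N(2) L(2) by (simp add: Hom_iff)
      have "?z \<in> pim k X" using pimI[of y k X] y(1) N(2) by (simp add: Hom_iff)
      then show "\<exists>w' \<in> hm Q X. map (\<lambda>x. w \<cdot> x) d = map (\<lambda>x. w' \<cdot> x) c"
        unfolding pk[OF z] zi using Comp_Hom[OF L(3) z] by blast
    qed
    moreover have "pp_sol T \<phi> X \<subseteq> pp_sol T \<psi> X \<longleftrightarrow> (\<forall>w \<in> hm R X. \<exists>w' \<in> hm Q X. map (\<lambda>x. w \<cdot> x) d = map (\<lambda>x. w' \<cdot> x) c)"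
      unfolding R(3)[OF X] Q(3)[OF X] by blast
    moreover have "Dom T (k \<cdot> i) = R" using ki by (simp add: Hom_iff)
    ultimately show ?thesis unfolding divides_iff subset_eq by simp
  qed
  then show thesis using that[of "k \<cdot> i"] cmor_iff[OF ki] R(1) N(1) pp_pair_trivial[OF S p] by blast
qed

lemma divides_iso:
  assumes f: "f \<in> hm A B" and a: "iso_mor T A A' a" and b: "iso_mor T B B' b"
  obtains f' where "f' \<in> hm A' B'" "\<And>X. divides T f X \<longleftrightarrow> divides T f' X"
proof -
  obtain a' where a': "a \<in> hm A A'" "a' \<in> hm A' A" "a' \<cdot> a = ID A" "a \<cdot> a' = ID A'" using iso_mor_inverse[OF a] by metis
  obtain b' where b': "b \<in> hm B B'" "b' \<in> hm B' B" "b' \<cdot> b = ID B" "b \<cdot> b' = ID B'" using iso_mor_inverse[OF b] by metis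
  define f' where "f' = b \<cdot> (f \<cdot> a')"
  have f': "f' \<in> hm A' B'" unfolding f'_def using f a'(2) b'(1) Comp_Hom by blast
  have bf: "b' \<cdot> f' \<cdot> a = f"
  proof -
    have "b' \<cdot> f' \<cdot> a = b' \<cdot> b \<cdot> (f \<cdot> (a' \<cdot> a))" unfolding f'_def using f a'(1,2) b'(1,2) by (simp add: Hom_iff)
    then show ?thesis unfolding a'(3) b'(3) using f by (simp add: Hom_iff)
  qed
  have "divides T f X \<longleftrightarrow> divides T f' X" for X
  proof
    assume d: "divides T f X"
    show "divides T f' X" unfolding divides_def
    proof
      fix x assume "x \<in> hm (Dom T f') X"
      then have x: "x \<in> hm A' X" using f' by (simp add: Hom_iff)
      have "x \<cdot> a \<in> hm (Dom T f) X" using Comp_Hom[OF a'(1) x] f by (simp add: Hom_iff)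
      then obtain y where "y \<in> hm (Cod T f) X" "x \<cdot> a = y \<cdot> f" using d unfolding divides_def by blast
      then have y: "y \<in> hm B X" "x \<cdot> a = y \<cdot> f" using f by (simp_all add: Hom_iff)
      have "x = x \<cdot> a \<cdot> a'" using x a' by (simp add: Hom_iff)
      also have "\<dots> = y \<cdot> (b' \<cdot> b) \<cdot> (f \<cdot> a')" unfolding y(2) b'(3) using y(1) f a'(2) by (simp add: Hom_iff)
      also have "\<dots> = y \<cdot> b' \<cdot> f'" unfolding f'_def using y(1) f a'(2) b'(1,2) by (simp add: Hom_iff)
      finally show "\<exists>c\<in>hm (Cod T f') X. x = c \<cdot> f'" using Comp_Hom[OF b'(2) y(1)] f' by (auto simp: Hom_iff)
    qed
  next
    assume d: "divides T f' X"
    show "divides T f X" unfolding divides_def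
    proof
      fix x assume "x \<in> hm (Dom T f) X"
      then have x: "x \<in> hm A X" using f by (simp add: Hom_iff)
      have "x \<cdot> a' \<in> hm (Dom T f') X" using Comp_Hom[OF a'(2) x] f' by (simp add: Hom_iff)
      then obtain y where "y \<in> hm (Cod T f') X" "x \<cdot> a' = y \<cdot> f'" using d unfolding divides_def by blast
      then have y: "y \<in> hm B' X" "x \<cdot> a' = y \<cdot> f'" using f' by (simp_all add: Hom_iff)
      have "x = x \<cdot> a' \<cdot> a" using x a' by (simp add: Hom_iff)
      also have "\<dots> = y \<cdot> (b \<cdot> b') \<cdot> (f' \<cdot> a)" unfolding y(2) b'(4) using y(1) f' a'(1) by (simp add: Hom_iff)
      also have "\<dots> = y \<cdot> b \<cdot> (b' \<cdot> f' \<cdot> a)" using y(1) f' a'(1) b'(1,2) by (simp add: Hom_iff)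
      finally show "\<exists>c\<in>hm (Cod T f) X. x = c \<cdot> f" unfolding bf using Comp_Hom[OF b'(1) y(1)] f by (auto simp: Hom_iff)
    qed
  qed
  then show thesis using that f' by blast
qed

lemma divides_small_version:
  assumes "small_version \<kappa> T S" "f \<in> cmor"
  obtains f' A' B' where "A' \<in> S" "B' \<in> S" "f' \<in> hm A' B'" "\<And>X. divides T f X \<longleftrightarrow> divides T f' X"
proof -
  have f: "f \<in> hm (Dom T f) (Cod T f)" "Dom T f \<in> cob" "Cod T f \<in> cob" using cmorE[OF assms(2)] by metis+
  obtain A' a where a: "A' \<in> S" "iso_mor T (Dom T f) A' a" using assms(1) f(2) unfolding small_version_def isomorphic_def by blast
  obtain B' b where b: "B' \<in> S" "iso_mor T (Cod T f) B' b" using assms(1) f(3) unfolding small_version_def isomorphic_def by blast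
  show thesis using divides_iso[OF f(1) a(2) b(2)] that a(1) b(1) by metis
qed

text \<open>The pair is (x = x) over (there is y with x = y f).\<close>

lemma divides_pp_pair:
  assumes S: "S \<subseteq> cob" and f: "f \<in> hm A B" and AB: "A \<in> S" "B \<in> S"
  obtains \<phi> \<psi> where "pp_pair T S \<phi> \<psi>"
    "\<And>X. X \<in> Ob T \<Longrightarrow> trivial_group (pp_group T \<phi> X Mod pp_sol T \<psi> X) \<longleftrightarrow> divides T f X"
proof -
  let ?\<phi> = "PP [A] [] [] :: ('o, 'm) pp" and ?\<psi> = "PP [A] [B] [(TVar 0, TApp f (TVar 1))] :: ('o, 'm) pp"
  have sol: "pp_sol T ?\<phi> X = (\<lambda>x. [x]) ` hm A X" "pp_sol T ?\<psi> X = (\<lambda>x. [x]) ` pim f X" for X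
  proof -
    have tup: "tuples T [D] X = (\<lambda>x. [x]) ` hm D X" for D by (auto simp: tuples_Cons)
    have tup0: "tuples T [] X = {[]}" by auto
    show "pp_sol T ?\<phi> X = (\<lambda>x. [x]) ` hm A X" unfolding pp_sol_def by (simp add: tup tup0)
    have "pim f X = {x \<in> hm A X. \<exists>y \<in> hm B X. x = y \<cdot> f}" unfolding precomp_image_def using f Comp_Hom[OF f] by (auto simp: Hom_iff)
    then show "pp_sol T ?\<psi> X = (\<lambda>x. [x]) ` pim f X" unfolding pp_sol_def by (auto simp: tup)
  qed
  have v0: "has_sort T S [A, B] (TVar 0) A" using has_sort.intros(1)[of 0 "[A, B]" S T] AB by simp
  have v1: "has_sort T S [A, B] (TVar 1) B" using has_sort.intros(1)[of 1 "[A, B]" S T] AB by simp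
  have "pp_formula T S ?\<phi>" "pp_formula T S ?\<psi>" unfolding pp_formula_def
    using AB v0 has_sort.intros(4)[OF AB f v1] by auto
  moreover have "pp_sol T ?\<psi> X \<subseteq> pp_sol T ?\<phi> X" if "X \<in> Ob T" for X
    unfolding sol using pim_Hom[of f] f by (auto simp: Hom_iff)
  ultimately have p: "pp_pair T S ?\<phi> ?\<psi>" unfolding pp_pair_def by simp
  have "pp_sol T ?\<phi> X \<subseteq> pp_sol T ?\<psi> X \<longleftrightarrow> divides T f X" for X
    unfolding sol divides_iff using f by (auto simp: Hom_iff)
  then show thesis using that[OF p] pp_pair_trivial[OF S p] by blast
qed

end

section \<open>Definable subcategories\<close>

context compactly_generated
begin

lemma definable_iff_Div: "definable \<kappa> T \<D> \<longleftrightarrow> (\<exists>\<Psi> \<subseteq> cmor. \<D> = Div_class T \<Psi>)"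
proof
  assume "definable \<kappa> T \<D>"
  then obtain \<A> where A: "\<A> \<subseteq> Coh \<kappa> T" "\<D> = Ann_Ob T \<A>" unfolding definable_def by blast
  let ?\<Psi> = "{f \<in> cmor. \<exists>F \<in> \<A>. \<exists>\<eta>. nat_iso T (coker_functor T f) F \<eta>}"
  have "Ann_Ob T \<A> = Div_class T ?\<Psi>"
  proof (intro equalityI subsetI)
    fix X assume "X \<in> Ann_Ob T \<A>"
    then have X: "X \<in> Ob T" "\<And>F. F \<in> \<A> \<Longrightarrow> trivial_group (FOb F X)" unfolding Ann_Ob_def by blast+
    have "divides T f X" if f: "f \<in> ?\<Psi>" for f
    proof -
      obtain F \<eta> where F: "f \<in> cmor" "F \<in> \<A>" "nat_iso T (coker_functor T f) F \<eta>" using f by blast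
      then show ?thesis using Coh_divides[OF _ F(1,3) X(1)] A(1) X(2)[OF F(2)] by blast
    qed
    then show "X \<in> Div_class T ?\<Psi>" unfolding Div_class_def using X(1) by blast
  next
    fix X assume "X \<in> Div_class T ?\<Psi>"
    then have X: "X \<in> Ob T" "\<And>f. f \<in> ?\<Psi> \<Longrightarrow> divides T f X" unfolding Div_class_def by blast+
    have "trivial_group (FOb F X)" if F: "F \<in> \<A>" for F
    proof -
      have FC: "F \<in> Coh \<kappa> T" using F A(1) by blast
      then obtain f \<eta> where f: "f \<in> cmor" "nat_iso T (coker_functor T f) F \<eta>" unfolding Coh_def by blast
      have "divides T f X" using X(2) f F by blast
      then show ?thesis using Coh_divides[OF FC f X(1)] by blast
    qed
    then show "X \<in> Ann_Ob T \<A>" unfolding Ann_Ob_def using X(1) by blast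
  qed
  then show "\<exists>\<Psi> \<subseteq> cmor. \<D> = Div_class T \<Psi>" using A(2) by (intro exI[of _ ?\<Psi>]) blast
next
  assume "\<exists>\<Psi> \<subseteq> cmor. \<D> = Div_class T \<Psi>"
  then obtain \<Psi> where P: "\<Psi> \<subseteq> cmor" "\<D> = Div_class T \<Psi>" by blast
  have "coker_functor T ` \<Psi> \<subseteq> Coh \<kappa> T" using P(1) coker_functor_Coh by blast
  moreover have "\<D> = Ann_Ob T (coker_functor T ` \<Psi>)"
    unfolding P(2) Div_class_def Ann_Ob_def using coker_trivial P(1) by auto
  ultimately show "definable \<kappa> T \<D>" unfolding definable_def by blast
qed

section \<open>Annihilation, divisibility and torsionfreeness along a triangle\<close>

lemma kills_divides:
  assumes "tri A B D f g h" shows "kills T X f \<longleftrightarrow> divides T g X"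
proof -
  note t = tri_Hom[OF assms]
  show ?thesis unfolding divides_iff tri_pim[OF assms] kills_def using t by (auto simp: Hom_iff)
qed

text \<open>For k the desuspension of \<open>h\<close>, the annihilator of k in X is exactly (B,X)f,
  so one vanishes iff the other does.\<close>

lemma kills_ann_zero:
  assumes t: "tri A B D f g h" and X: "X \<in> Ob T" shows "kills T X f \<longleftrightarrow> ann_zero T X (ShInvMor T h)"
proof -
  have f: "f \<in> hm A B" "A \<in> Ob T" using tri_Hom[OF t] by blast+
  obtain D' k where k: "D = ShOb T D'" "h = ShMor T k" "k \<in> hm D' A" "tri D' A B (\<boxminus> k) f g" using tri_unrotate[OF t] .
  have D': "D' \<in> Ob T" using k(3) Hom_Ob by blast
  have inv: "ShInvMor T h = k"
    unfolding ShInvMor_def k(2) using the_inv_into_f_f[of "ShMor T" "Mor T" k] ShMor_bij k(3)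
    unfolding bij_betw_def by (simp add: Hom_iff)
  have "ann T X k = pim f X" unfolding ann_def tri_pim_neg[OF k(4,3)] using k(3) by (auto simp: Hom_iff)
  moreover have "zm A X \<in> pim f X" using subfunctorD(3)[OF subfunctor_pim[OF f(1)] X] .
  ultimately show ?thesis unfolding inv ann_zero_def kills_iff using f(1) k(3) by (auto simp: Hom_iff)
qed

lemma divides_kills: assumes "g \<in> cmor" obtains k where "k \<in> cmor" "\<And>X. divides T g X \<longleftrightarrow> kills T X k"
  using obtain_fibre[OF assms] tri_kills by metis

lemma kills_to_divides: assumes "f \<in> cmor" obtains g where "g \<in> cmor" "\<And>X. kills T X f \<longleftrightarrow> divides T g X"
proof -
  have f: "f \<in> hm (Dom T f) (Cod T f)" "Dom T f \<in> cob" "Cod T f \<in> cob" using cmorE[OF assms] by metis+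
  obtain D g h where t: "tri (Dom T f) (Cod T f) D f g h" using obtain_cone[OF f(1)] .
  have "g \<in> hm (Cod T f) D" using tri_Hom[OF t] by blast
  then have "g \<in> cmor" using cmor_iff[of g "Cod T f" D] cob_cone[OF t f(2,3)] f(3) by blast
  then show thesis using that kills_divides[OF t] by blast
qed

lemma kills_to_ann_zero: assumes "f \<in> cmor"
  obtains l where "l \<in> cmor" "\<And>X. X \<in> Ob T \<Longrightarrow> kills T X f \<longleftrightarrow> ann_zero T X l"
proof -
  have f: "f \<in> hm (Dom T f) (Cod T f)" "Dom T f \<in> cob" "Cod T f \<in> cob" using cmorE[OF assms] by metis+
  obtain D g h where t: "tri (Dom T f) (Cod T f) D f g h" using obtain_cone[OF f(1)] .
  obtain D' k where k: "D = ShOb T D'" "h = ShMor T k" "k \<in> hm D' (Dom T f)" using tri_unrotate[OF t] by metis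
  have "D' \<in> cob" using cob_cone[OF t f(2,3)] k(1) cob_Sh Hom_Ob[OF k(3)] by blast
  then have "k \<in> cmor" using cmor_iff[OF k(3)] f(2) by blast
  moreover have "ShInvMor T h = k"
    unfolding ShInvMor_def k(2) using the_inv_into_f_f[of "ShMor T" "Mor T" k] ShMor_bij k(3)
    unfolding bij_betw_def by (simp add: Hom_iff)
  ultimately show thesis using that kills_ann_zero[OF t] by metis
qed

lemma ann_zero_to_kills: assumes "l \<in> cmor"
  obtains f where "f \<in> cmor" "\<And>X. X \<in> Ob T \<Longrightarrow> kills T X f \<longleftrightarrow> ann_zero T X l"
proof -
  have l: "l \<in> hm (Dom T l) (Cod T l)" "Dom T l \<in> cob" "Cod T l \<in> cob" "l \<in> Mor T" using cmorE[OF assms] by metis+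
  \<comment> \<open>The triangle is completed on -l, because rotation turns a first map -l into the
    third map \<Sigma>l; its desuspension is then l itself.\<close>
  have nl: "\<boxminus> l \<in> hm (Dom T l) (Cod T l)" using l(1) neg_Hom by blast
  obtain B f g where t: "tri (Dom T l) (Cod T l) B (\<boxminus> l) f g" using obtain_cone[OF nl] .
  have B: "B \<in> cob" using cob_cone[OF t l(2,3)] .
  have t': "tri (Cod T l) B (ShOb T (Dom T l)) f g (ShMor T l)"
    using tri_rotate[OF t] l(4) by simp
  have "f \<in> cmor" using cmor_iff[of f "Cod T l" B] tri_Hom[OF t] l(3) B by blast
  moreover have "ShInvMor T (ShMor T l) = l"
    unfolding ShInvMor_def using the_inv_into_f_f[of "ShMor T" "Mor T" l] ShMor_bij l(4)
    unfolding bij_betw_def by simp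
  ultimately show thesis using that kills_ann_zero[OF t'] by metis
qed

section \<open>Replacing classes of conditions by sets\<close>

lemma small_translate:
  assumes "\<Psi> \<subseteq> cmor" "small \<kappa> \<Psi>" and tr: "\<And>f. f \<in> cmor \<Longrightarrow> \<exists>g \<in> cmor. \<forall>X \<in> Ob T. P f X \<longleftrightarrow> Q g X"
  obtains \<Phi> where "\<Phi> \<subseteq> cmor" "small \<kappa> \<Phi>" "\<forall>X \<in> Ob T. (\<forall>f \<in> \<Psi>. P f X) \<longleftrightarrow> (\<forall>g \<in> \<Phi>. Q g X)"
proof -
  obtain t where t: "\<And>f. f \<in> cmor \<Longrightarrow> t f \<in> cmor \<and> (\<forall>X \<in> Ob T. P f X \<longleftrightarrow> Q (t f) X)" using tr by metis
  show thesis
  proof (rule that[of "t ` \<Psi>"])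
    show "t ` \<Psi> \<subseteq> cmor" using t assms(1) by blast
    show "small \<kappa> (t ` \<Psi>)" using assms(2) by (rule small_image)
    show "\<forall>X \<in> Ob T. (\<forall>f \<in> \<Psi>. P f X) \<longleftrightarrow> (\<forall>g \<in> t ` \<Psi>. Q g X)" using t assms(1) by blast
  qed
qed

text \<open>A definable subcategory may be cut out by an arbitrarily large class. Divisibility by a
  morphism depends only on its isomorphism class, so every condition is equivalent to one between
  objects of a small version S, and the morphisms between these form a small set.\<close>

lemma Div_small:
  assumes "\<Psi> \<subseteq> cmor"
  obtains \<Phi> where "\<Phi> \<subseteq> cmor" "small \<kappa> \<Phi>" "Div_class T \<Psi> = Div_class T \<Phi>"
proof -
  obtain S where S: "small_version \<kappa> T S" using ex_small_version .
  then have Sc: "S \<subseteq> cob" "small \<kappa> S" unfolding small_version_def by blast+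
  let ?M = "\<Union>A\<in>S. \<Union>B\<in>S. hm A B"
  have sm: "small \<kappa> ?M"
  proof (intro small_UN Sc(2))
    fix A B assume "A \<in> S" "B \<in> S"
    then show "small \<kappa> (hm A B)" using hom_small Sc(1) cob_Ob by blast
  qed
  have Mc: "?M \<subseteq> cmor" using Sc(1) cmor_iff by blast
  let ?\<Phi> = "{f \<in> ?M. \<exists>g \<in> \<Psi>. \<forall>X \<in> Ob T. divides T g X \<longleftrightarrow> divides T f X}"
  have ex: "\<exists>f \<in> ?\<Phi>. \<forall>X \<in> Ob T. divides T g X \<longleftrightarrow> divides T f X" if g: "g \<in> \<Psi>" for g
  proof -
    obtain f A B where f: "A \<in> S" "B \<in> S" "f \<in> hm A B" "\<forall>X \<in> Ob T. divides T g X \<longleftrightarrow> divides T f X"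
      by (rule divides_small_version[OF S subsetD[OF assms g]]) blast
    have "f \<in> ?M" using f(1-3) by blast
    then have "f \<in> ?\<Phi>" using f(4) g by (intro CollectI conjI bexI[of _ g])
    then show ?thesis using f(4) by (intro bexI[of _ f])
  qed
  show thesis
  proof (rule that[of ?\<Phi>])
    show "?\<Phi> \<subseteq> cmor" using Mc by blast
    show "small \<kappa> ?\<Phi>" by (rule small_subset[OF sm]) (rule Collect_subset)
    have "(\<forall>g \<in> \<Psi>. divides T g X) \<longleftrightarrow> (\<forall>f \<in> ?\<Phi>. divides T f X)" if X: "X \<in> Ob T" for X
    proof
      assume 1: "\<forall>g \<in> \<Psi>. divides T g X"
      show "\<forall>f \<in> ?\<Phi>. divides T f X"
      proof
        fix f assume "f \<in> ?\<Phi>"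
        then obtain g where "g \<in> \<Psi>" "\<forall>X \<in> Ob T. divides T g X \<longleftrightarrow> divides T f X" by blast
        then show "divides T f X" using 1 X by blast
      qed
    next
      assume 1: "\<forall>f \<in> ?\<Phi>. divides T f X"
      show "\<forall>g \<in> \<Psi>. divides T g X"
      proof
        fix g assume "g \<in> \<Psi>"
        from ex[OF this] obtain f where f: "f \<in> ?\<Phi>" and e: "\<forall>X \<in> Ob T. divides T g X \<longleftrightarrow> divides T f X" by (rule bexE)
        from 1 f have "divides T f X" by (rule bspec)
        then show "divides T g X" using e X by simp
      qed
    qed
    then show "Div_class T \<Psi> = Div_class T ?\<Phi>" unfolding Div_class_def by auto
  qed
qed

lemma definable_iff_small_Div:
  "definable \<kappa> T \<D> \<longleftrightarrow> (\<exists>\<Psi> \<subseteq> cmor. small \<kappa> \<Psi> \<and> \<D> = Div_class T \<Psi>)"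
  unfolding definable_iff_Div using Div_small by metis

lemma definable_iff_small_Ann:
  "definable \<kappa> T \<D> \<longleftrightarrow> (\<exists>\<Phi> \<subseteq> cmor. small \<kappa> \<Phi> \<and> \<D> = Ann_class T \<Phi>)"
proof
  assume "definable \<kappa> T \<D>"
  then obtain \<Psi> where \<Psi>: "\<Psi> \<subseteq> cmor" "small \<kappa> \<Psi>" "\<D> = Div_class T \<Psi>" unfolding definable_iff_small_Div by blast
  have tr: "\<exists>k \<in> cmor. \<forall>X \<in> Ob T. divides T f X \<longleftrightarrow> kills T X k" if "f \<in> cmor" for f using divides_kills[OF that] by metis
  obtain \<Phi> where "\<Phi> \<subseteq> cmor" "small \<kappa> \<Phi>" "\<forall>X \<in> Ob T. (\<forall>f \<in> \<Psi>. divides T f X) \<longleftrightarrow> (\<forall>g \<in> \<Phi>. kills T X g)"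
    by (rule small_translate[OF \<Psi>(1,2) tr]) blast
  then show "\<exists>\<Phi> \<subseteq> cmor. small \<kappa> \<Phi> \<and> \<D> = Ann_class T \<Phi>" unfolding \<Psi>(3) Div_class_def Ann_class_def by blast
next
  assume "\<exists>\<Phi> \<subseteq> cmor. small \<kappa> \<Phi> \<and> \<D> = Ann_class T \<Phi>"
  then obtain \<Phi> where \<Phi>: "\<Phi> \<subseteq> cmor" "small \<kappa> \<Phi>" "\<D> = Ann_class T \<Phi>" by blast
  have tr: "\<exists>k \<in> cmor. \<forall>X \<in> Ob T. kills T X f \<longleftrightarrow> divides T k X" if "f \<in> cmor" for f using kills_to_divides[OF that] by metis
  obtain \<Psi> where "\<Psi> \<subseteq> cmor" "small \<kappa> \<Psi>" "\<forall>X \<in> Ob T. (\<forall>f \<in> \<Phi>. kills T X f) \<longleftrightarrow> (\<forall>g \<in> \<Psi>. divides T g X)"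
    by (rule small_translate[OF \<Phi>(1,2) tr]) blast
  then show "definable \<kappa> T \<D>" unfolding definable_iff_small_Div \<Phi>(3) Div_class_def Ann_class_def by blast
qed

lemma definable_iff_small_TF:
  "definable \<kappa> T \<D> \<longleftrightarrow> (\<exists>\<Xi> \<subseteq> cmor. small \<kappa> \<Xi> \<and> \<D> = TF_class T \<Xi>)"
proof
  assume "definable \<kappa> T \<D>"
  then obtain \<Psi> where \<Psi>: "\<Psi> \<subseteq> cmor" "small \<kappa> \<Psi>" "\<D> = Ann_class T \<Psi>" unfolding definable_iff_small_Ann by blast
  have tr: "\<exists>k \<in> cmor. \<forall>X \<in> Ob T. kills T X f \<longleftrightarrow> ann_zero T X k" if "f \<in> cmor" for f using kills_to_ann_zero[OF that] by metis
  obtain \<Phi> where "\<Phi> \<subseteq> cmor" "small \<kappa> \<Phi>" "\<forall>X \<in> Ob T. (\<forall>f \<in> \<Psi>. kills T X f) \<longleftrightarrow> (\<forall>g \<in> \<Phi>. ann_zero T X g)"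
    by (rule small_translate[OF \<Psi>(1,2) tr]) blast
  then show "\<exists>\<Xi> \<subseteq> cmor. small \<kappa> \<Xi> \<and> \<D> = TF_class T \<Xi>" unfolding \<Psi>(3) TF_class_def Ann_class_def by blast
next
  assume "\<exists>\<Phi> \<subseteq> cmor. small \<kappa> \<Phi> \<and> \<D> = TF_class T \<Phi>"
  then obtain \<Phi> where \<Phi>: "\<Phi> \<subseteq> cmor" "small \<kappa> \<Phi>" "\<D> = TF_class T \<Phi>" by blast
  have tr: "\<exists>k \<in> cmor. \<forall>X \<in> Ob T. ann_zero T X f \<longleftrightarrow> kills T X k" if "f \<in> cmor" for f using ann_zero_to_kills[OF that] by metis
  obtain \<Psi> where "\<Psi> \<subseteq> cmor" "small \<kappa> \<Psi>" "\<forall>X \<in> Ob T. (\<forall>f \<in> \<Phi>. ann_zero T X f) \<longleftrightarrow> (\<forall>g \<in> \<Psi>. kills T X g)"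
    by (rule small_translate[OF \<Phi>(1,2) tr]) blast
  then show "definable \<kappa> T \<D>" unfolding definable_iff_small_Ann \<Phi>(3) TF_class_def Ann_class_def by blast
qed

lemma definable_iff_pp:
  assumes S: "small_version \<kappa> T S"
  shows "definable \<kappa> T \<D> \<longleftrightarrow> (\<exists>\<Phi>. (\<forall>(\<phi>, \<psi>) \<in> \<Phi>. pp_pair T S \<phi> \<psi>) \<and> \<D> = pp_closed_class T \<Phi>)"
proof
  have Sc: "S \<subseteq> cob" using S unfolding small_version_def by blast
  let ?triv = "\<lambda>X \<phi> \<psi>. trivial_group (pp_group T \<phi> X Mod pp_sol T \<psi> X)"
  {
    assume "definable \<kappa> T \<D>"
    then obtain \<Psi> where \<Psi>: "\<Psi> \<subseteq> cmor" "\<D> = Div_class T \<Psi>" unfolding definable_iff_Div by blast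
    have "\<exists>p. pp_pair T S (fst p) (snd p) \<and> (\<forall>X \<in> Ob T. ?triv X (fst p) (snd p) \<longleftrightarrow> divides T g X)" if g: "g \<in> \<Psi>" for g
    proof -
      obtain f A B where f: "A \<in> S" "B \<in> S" "f \<in> hm A B" "\<And>X. divides T g X \<longleftrightarrow> divides T f X"
        by (rule divides_small_version[OF S subsetD[OF \<Psi>(1) g]]) blast
      obtain \<phi> \<psi> where "pp_pair T S \<phi> \<psi>" "\<And>X. X \<in> Ob T \<Longrightarrow> ?triv X \<phi> \<psi> \<longleftrightarrow> divides T f X"
        using divides_pp_pair[OF Sc f(3,1,2)] by metis
      then show ?thesis using f(4) by (intro exI[of _ "(\<phi>, \<psi>)"]) simp
    qed
    then obtain p where p: "\<And>g. g \<in> \<Psi> \<Longrightarrow> pp_pair T S (fst (p g)) (snd (p g)) \<and>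
        (\<forall>X \<in> Ob T. ?triv X (fst (p g)) (snd (p g)) \<longleftrightarrow> divides T g X)" by metis
    have "\<forall>(\<phi>, \<psi>) \<in> p ` \<Psi>. pp_pair T S \<phi> \<psi>" using p by (auto simp: case_prod_beta)
    moreover have "\<D> = pp_closed_class T (p ` \<Psi>)"
      unfolding \<Psi>(2) Div_class_def pp_closed_class_def case_prod_beta using p by blast
    ultimately show "\<exists>\<Phi>. (\<forall>(\<phi>, \<psi>) \<in> \<Phi>. pp_pair T S \<phi> \<psi>) \<and> \<D> = pp_closed_class T \<Phi>" by blast
  next
    assume "\<exists>\<Phi>. (\<forall>(\<phi>, \<psi>) \<in> \<Phi>. pp_pair T S \<phi> \<psi>) \<and> \<D> = pp_closed_class T \<Phi>"
    then obtain \<Phi> where \<Phi>: "\<And>p. p \<in> \<Phi> \<Longrightarrow> pp_pair T S (fst p) (snd p)" "\<D> = pp_closed_class T \<Phi>"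
      by (auto simp: case_prod_beta)
    have "\<exists>e \<in> cmor. \<forall>X \<in> Ob T. ?triv X (fst p) (snd p) \<longleftrightarrow> divides T e X" if "p \<in> \<Phi>" for p
      using pp_pair_divides[OF Sc \<Phi>(1)[OF that]] by metis
    then obtain e where e: "\<And>p. p \<in> \<Phi> \<Longrightarrow> e p \<in> cmor \<and> (\<forall>X \<in> Ob T. ?triv X (fst p) (snd p) \<longleftrightarrow> divides T (e p) X)" by metis
    have "\<D> = Div_class T (e ` \<Phi>)"
      unfolding \<Phi>(2) Div_class_def pp_closed_class_def case_prod_beta using e by blast
    then show "definable \<kappa> T \<D>" unfolding definable_iff_Div using e by blast
  }
qed

lemma serre_iff_annihilator: "{Ann_Coh \<kappa> T \<D> | \<D>. definable \<kappa> T \<D>} = {\<S>. serre_subcategory \<kappa> T \<S>}"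
proof (intro equalityI subsetI)
  fix \<S> assume "\<S> \<in> {Ann_Coh \<kappa> T \<D> | \<D>. definable \<kappa> T \<D>}"
  then obtain \<D> where D: "\<S> = Ann_Coh \<kappa> T \<D>" "definable \<kappa> T \<D>" by blast
  have "\<D> \<subseteq> Ob T" using D(2) unfolding definable_def Ann_Ob_def by blast
  then show "\<S> \<in> {\<S>. serre_subcategory \<kappa> T \<S>}" using Ann_Coh_serre D(1) by blast
next
  fix \<S> assume "\<S> \<in> {\<S>. serre_subcategory \<kappa> T \<S>}"
  then have S: "serre_subcategory \<kappa> T \<S>" by blast
  then have "definable \<kappa> T (Ann_Ob T \<S>)" unfolding definable_def serre_subcategory_def by blast
  then show "\<S> \<in> {Ann_Coh \<kappa> T \<D> | \<D>. definable \<kappa> T \<D>}" using serre_closed[OF S] by blast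
qed

text \<open>The Galois connection between morphisms and objects gives J = Ann(Ann J). The class Ann
  J is definable for every J of this kind, since each annihilation condition is also a divisibility
  condition.\<close>

lemma ideal_iff_annihilator: "{Ann_Mor \<kappa> T \<D> | \<D>. definable \<kappa> T \<D>} = {J. annihilator_ideal \<kappa> T J}"
proof (intro equalityI subsetI)
  fix J assume "J \<in> {Ann_Mor \<kappa> T \<D> | \<D>. definable \<kappa> T \<D>}"
  then obtain \<D> where D: "J = Ann_Mor \<kappa> T \<D>" "definable \<kappa> T \<D>" by blast
  have "\<D> \<subseteq> Ob T" using D(2) unfolding definable_def Ann_Ob_def by blast
  then show "J \<in> {J. annihilator_ideal \<kappa> T J}" unfolding annihilator_ideal_def using D(1) by blast
next
  fix J assume "J \<in> {J. annihilator_ideal \<kappa> T J}"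
  then obtain \<X> where X: "\<X> \<subseteq> Ob T" "J = Ann_Mor \<kappa> T \<X>" unfolding annihilator_ideal_def by blast
  have Jc: "J \<subseteq> cmor" unfolding X(2) Ann_Mor_def by blast
  have J: "J = Ann_Mor \<kappa> T (Ann_class T J)" using X unfolding Ann_Mor_def Ann_class_def by blast
  have "\<exists>g. g \<in> cmor \<and> (\<forall>X. kills T X f \<longleftrightarrow> divides T g X)" if "f \<in> J" for f
    by (rule kills_to_divides[OF subsetD[OF Jc that]]) blast
  then obtain t where t: "\<And>f. f \<in> J \<Longrightarrow> t f \<in> cmor \<and> (\<forall>X. kills T X f \<longleftrightarrow> divides T (t f) X)"
    by metis
  have "Ann_class T J = Div_class T (t ` J)" unfolding Ann_class_def Div_class_def using t by blast
  then have "definable \<kappa> T (Ann_class T J)" unfolding definable_iff_Div using t by blast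
  then show "J \<in> {Ann_Mor \<kappa> T \<D> | \<D>. definable \<kappa> T \<D>}" using J by blast
qed

end

theorem theorem3p5:
  fixes \<kappa> :: "'u rel" and T :: "('o, 'm) tricat"
  assumes "compactly_generated \<kappa> T"
  shows
    "(\<forall>\<D> \<subseteq> Ob T.
        (\<forall>S. small_version \<kappa> T S \<longrightarrow>
          (definable \<kappa> T \<D> \<longleftrightarrow>
            (\<exists>\<Phi>. (\<forall>(\<phi>, \<psi>) \<in> \<Phi>. pp_pair T S \<phi> \<psi>) \<and> \<D> = pp_closed_class T \<Phi>))) \<and>
        (definable \<kappa> T \<D> \<longleftrightarrow> (\<exists>\<A> \<subseteq> Coh \<kappa> T. \<D> = Ann_Ob T \<A>)) \<and>
        (definable \<kappa> T \<D> \<longleftrightarrow> (\<exists>\<Phi> \<subseteq> cpt_mor \<kappa> T. small \<kappa> \<Phi> \<and> \<D> = Ann_class T \<Phi>)) \<and>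
        (definable \<kappa> T \<D> \<longleftrightarrow> (\<exists>\<Psi> \<subseteq> cpt_mor \<kappa> T. small \<kappa> \<Psi> \<and> \<D> = Div_class T \<Psi>)) \<and>
        (definable \<kappa> T \<D> \<longleftrightarrow> (\<exists>\<Xi> \<subseteq> cpt_mor \<kappa> T. small \<kappa> \<Xi> \<and> \<D> = TF_class T \<Xi>))) \<and>
     {Ann_Coh \<kappa> T \<D> | \<D>. definable \<kappa> T \<D>} = {\<S>. serre_subcategory \<kappa> T \<S>} \<and>
     {Ann_Mor \<kappa> T \<D> | \<D>. definable \<kappa> T \<D>} = {J. annihilator_ideal \<kappa> T J} \<and>
     (\<forall>A \<in> cpt \<kappa> T. \<forall>B \<in> cpt \<kappa> T. \<forall>C \<in> cpt \<kappa> T. \<forall>f g h.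
        dist_triangle T A B C f g h \<longrightarrow>
        (\<forall>X \<in> Ob T.
          (kills T X f \<longleftrightarrow> divides T g X) \<and>
          (divides T g X \<longleftrightarrow> ann_zero T X (ShInvMor T h))))"
proof -
  interpret compactly_generated \<kappa> T by fact
  show ?thesis
  proof (intro conjI allI impI ballI)
    fix \<D> S assume "small_version \<kappa> T S"
    then show "definable \<kappa> T \<D> \<longleftrightarrow> (\<exists>\<Phi>. (\<forall>(\<phi>, \<psi>) \<in> \<Phi>. pp_pair T S \<phi> \<psi>) \<and> \<D> = pp_closed_class T \<Phi>)"
      by (rule definable_iff_pp)
  next
    fix \<D>
    show "definable \<kappa> T \<D> \<longleftrightarrow> (\<exists>\<A> \<subseteq> Coh \<kappa> T. \<D> = Ann_Ob T \<A>)" by (rule definable_def)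
    show "definable \<kappa> T \<D> \<longleftrightarrow> (\<exists>\<Phi> \<subseteq> cpt_mor \<kappa> T. small \<kappa> \<Phi> \<and> \<D> = Ann_class T \<Phi>)" by (rule definable_iff_small_Ann)
    show "definable \<kappa> T \<D> \<longleftrightarrow> (\<exists>\<Psi> \<subseteq> cpt_mor \<kappa> T. small \<kappa> \<Psi> \<and> \<D> = Div_class T \<Psi>)" by (rule definable_iff_small_Div)
    show "definable \<kappa> T \<D> \<longleftrightarrow> (\<exists>\<Xi> \<subseteq> cpt_mor \<kappa> T. small \<kappa> \<Xi> \<and> \<D> = TF_class T \<Xi>)" by (rule definable_iff_small_TF)
  next
    show "{Ann_Coh \<kappa> T \<D> | \<D>. definable \<kappa> T \<D>} = {\<S>. serre_subcategory \<kappa> T \<S>}" by (rule serre_iff_annihilator)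
    show "{Ann_Mor \<kappa> T \<D> | \<D>. definable \<kappa> T \<D>} = {J. annihilator_ideal \<kappa> T J}" by (rule ideal_iff_annihilator)
  next
    fix A B C f g h X assume t: "dist_triangle T A B C f g h" and X: "X \<in> Ob T"
    show "kills T X f \<longleftrightarrow> divides T g X" by (rule kills_divides[OF t])
    then show "divides T g X \<longleftrightarrow> ann_zero T X (ShInvMor T h)" using kills_ann_zero[OF t X] by blast
  qed
qed

end
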